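(* Let $m\ge2$, and set $\tilde q_1=q_1q_1^{\frac1{m-1}}$, $\tilde q_3=q_3q_1^{-\frac1{m-1}}$. The map sending $F\in Sh^0_{m,N}$ to $\sum_{L=0}^N\tilde F_{N,L}$ (with $\tilde F_{N,L}$ as defined in the context) gives a homomorphism of $\mathbb Z_{\ge0}$-graded algebras $$\pi_m^{m-1}:\ Sh^0_m(q_1,q_2,q_3)\longrightarrow Sh^0_{m-1}(\tilde q_1,q_2,\tilde q_3)\otimes Sh_1(q_1q_3^{-m+1},q_2,q_3^m).$$
   Context: **Parameters.** Fix $q,d\in\mathbb C^\times$ and set $q_1=q^{-1}d$, $q_2=q^2$, $q_3=q^{-1}d^{-1}$, so $q_1q_2q_3=1$. Assume $q_1^{n_1}q_2^{n_2}q_3^{n_3}=1$ with $n_i\in\mathbb Z$ holds only if $n_1=n_2=n_3$. Fix $\log q_i$ and set $q_i^r=e^{r\log q_i}$ for $r\in\mathbb Q$. Algebras with parameters $(\tilde q_1,q_2,\tilde q_3)$ are defined by the same formulas with the same $q$ and with $q_1,q_3,d$ replaced by $\tilde q_1,\tilde q_3,\tilde d=q\tilde q_1$. $Sh_1(p_1,p_2,p_3)$ depends only on the triple. **Shuffle algebra $Sh_m=Sh_m(q_1,q_2,q_3)$.** For $m\ge2$, $Sh_m=\bigoplus_{\mathbf N\in\mathbb Z_{\ge0}^m}Sh_{m,\mathbf N}$, where $Sh_{m,\mathbf N}$ is the space of rational functions $F(x_1;\cdots;x_m)$, $x_i=(x_{i,1},\dots,x_{i,N_i})$ (index $i$ mod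 $m$), such that: (1) $F=f/\prod_{i=1}^m\prod_{1\le a\le N_i,1\le b\le N_{i+1}}(x_{i,a}-x_{i+1,b})$ with $f$ a Laurent polynomial; (2) $F$ is symmetric in $x_i$ for each $i$; (3) $F$ vanishes if for some $a,b,c$: (a) $x_{i,b}=q_3x_{i-1,a}$ and $x_{i,c}=q_2x_{i,b}$, $1\le i\le m$, or (b) $x_{i,b}=q_2x_{i,a}$ and $x_{i+1,c}=q_3x_{i,b}$, $0\le i\le m-1$. For $m=1$ condition (1) is replaced by $F=f(x)/\prod_{a<b}(x_a-x_b)^2$ with $f$ a symmetric Laurent polynomial in $x=(x_1,\dots,x_N)$, and (3) applies with all colors equal. The product is $$(F*G)(x_1;\cdots;x_m)=\sum F(x_{1,I_1};\cdots;x_{m,I_m})G(x_{1,J_1};\cdots;x_{m,J_m})\prod_{i,j=1}^m\prod_{a\in I_i,b\in J_j}\omega_{i,j}(x_{i,a},x_{j,b}),$$ summed over $I_i\sqcup J_i=\{1,\dots,M_i+N_i\}$, $|I_i|=M_i$, $|J_i|=N_i$ for $F\in Sh_{m,\mathbf M}$, $G\in Sh_{m,\mathbf N}$, where $x_{i,I}=(x_{i,a})_{a\in I}$ and: for $m\ge3$, $\omega_{i,i}(x,y)=\frac{x-q_2y}{x-y}$, $\omega_{i-1,i}(x,y)=\frac{x-q_1y}{x-y}$, $\omega_{i,i-1}(x,y)=d\frac{x-q_3y}{x-y}$, $\omega_{i,j}=1$ otherwise; for $m=2$, $\omega_{i,i}=\frac{x-q_2y}{x-y}$, $\omega_{i,i-1}=\frac{(x-q_1y)(x-q_3y)}{(x-y)^2}$;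 for $m=1$, $\omega_{1,1}=\frac{(x-q_1y)(x-q_2y)(x-q_3y)}{(x-y)^3}$. Put $Sh^0_{m,N}=Sh_{m,(N,\dots,N)}$, $Sh^0_m=\bigoplus_NSh^0_{m,N}$. **Definition of $\tilde F_{N,L}$ ($m\ge2$).** For $F\in Sh^0_{m,N}$, $0\le L\le N$, $\tilde F_{N,L}(y_1;\cdots;y_{m-1}|z)$ (first tensor factor: variables $y_i=(y_{i,a})_{1\le a\le L}$, degree $L$; second: $z=(z_b)_{L+1\le b\le N}$, degree $N-L$) is defined by $\tilde\rho_{N,L}(F)=\tilde F_{N,L}\cdot ABC$. Here $\tilde\rho_{N,L}$ is the substitution, for $1\le i\le m$, $x_{i,a}=q_1^{-\frac{m-i}{m-1}}y_{i,a}$ ($1\le a\le L$; $y_{m,a}=y_{1,a}$), $x_{i,b}=q_3^{i-1}z_b$ ($L+1\le b\le N$). With $a,b\in\{1..L\}$ in $A$, $a,b\in\{L+1..N\}$ in $B$, $1\le a\le L<b\le N$ in $C$: $$A=\prod_{a<b}d\,\tfrac{(y_{1,a}-q_2y_{1,b})(y_{1,a}-q_2^{-1}y_{1,b})}{(y_{1,a}-q_1y_{1,b})(y_{1,a}-q_1^{-1}y_{1,b})}\prod_{a,b}\prod_{i=1}^{m-1}\tfrac{y_{i,a}-y_{i+1,b}}{y_{i,a}-q_1^{1/(m-1)}y_{i+1,b}},$$ $$B=\prod_{a<b}\Bigl(d\tfrac{(z_a-q_2z_b)(z_a-q_2^{-1}z_b)}{(z_a-q_3z_b)(z_a-q_3^{-1}z_b)}\Bigr)^{m-1}\prod_{a<b}\tfrac{d(z_a-z_b)^2}{(z_a-q_3^{m-1}z_b)(z_a-q_3^{-m+1}z_b)},$$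 $$C=\prod_{a,b}\Bigl[\prod_{i=2}^{m-1}d\tfrac{(Y_{i,a}-q_1q_3^iz_b)(Y_{i,a}-q_1^{-1}q_3^{i-2}z_b)}{(Y_{i,a}-q_3^iz_b)(Y_{i,a}-q_3^{i-2}z_b)}\cdot d^2\tfrac{(y_{1,a}-q_1^2q_3z_b)(y_{1,a}-q_3^{-1}z_b)}{(y_{1,a}-q_1q_3z_b)(y_{1,a}-z_b)}\tfrac{(y_{1,a}-q_1^{-1}q_3^{m-2}z_b)(y_{1,a}-q_1q_3^mz_b)}{(y_{1,a}-q_3^{m-2}z_b)(y_{1,a}-q_1q_3^{m-1}z_b)}\Bigr],$$ where $Y_{i,a}=q_1^{-(m-i)/(m-1)}y_{i,a}$. The product on the tensor product is $(F\otimes G)(F'\otimes G')=(F*F')\otimes(G*G')$, graded by total degree.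
   Formalization: For m=2 the zero factors a=b in A are omitted, and for m=2,3 F̃_{N,L} is divided by an explicit scalar (powers of q, d for m=2; of d·q_1^{1/2} for m=3), since the literal F̃ is undefined (m=2) or not multiplicative (m=2,3); m≥4 is unchanged. *)

theory Defs
  imports
    "HOL-Library.Poly_Mapping"
    "HOL-Library.Nat_Bijection"
    "HOL-Library.FuncSet"
    "HOL-Computational_Algebra.Fraction_Field"
    "HOL-Combinatorics.Permutations"
    "HOL-Algebra.Ring"
    Complex_Main
begin

section \<open>Rational functions in the variables \<open>x\<^sub>i\<^sub>,\<^sub>a\<close>\<close>

text \<open>
  \<open>ratfun\<close> is the field of fractions of the ring of polynomials over the complex numbers in
  countably many variables. The variables are coded by natural numbers: \<open>xvar i a\<close>, the variable
  of colour \<open>i\<close> and label \<open>a\<close>, has the code \<open>prod_encode (i, a)\<close>.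
\<close>

type_synonym cpoly = "(nat \<Rightarrow>\<^sub>0 nat) \<Rightarrow>\<^sub>0 complex"
type_synonym ratfun = "cpoly fract"

definition cst :: "complex \<Rightarrow> ratfun" where
  "cst c = Fraction_Field.Fract (Poly_Mapping.single 0 c) 1"

definition xvar :: "nat \<Rightarrow> nat \<Rightarrow> ratfun" where
  "xvar i a =
     Fraction_Field.Fract (Poly_Mapping.single (Poly_Mapping.single (prod_encode (i, a)) 1) 1) 1"

definition poly_subst :: "(nat \<Rightarrow> nat \<Rightarrow> ratfun) \<Rightarrow> cpoly \<Rightarrow> ratfun" where
  "poly_subst s p =
     (\<Sum>e\<in>Poly_Mapping.keys p. cst (Poly_Mapping.lookup p e) *
        (\<Prod>v\<in>Poly_Mapping.keys e. case_prod s (prod_decode v) ^ Poly_Mapping.lookup e v))"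

text \<open>
  \<open>subst s F\<close> replaces every \<open>x\<^sub>i\<^sub>,\<^sub>a\<close> in \<open>F\<close> by \<open>s i a\<close>. It is defined when \<open>F\<close> is a fraction whose
  denominator does not become zero; the value does not depend on the choice of that fraction.
\<close>

definition subst :: "(nat \<Rightarrow> nat \<Rightarrow> ratfun) \<Rightarrow> ratfun \<Rightarrow> ratfun" where
  "subst s F = (THE G. \<exists>p r. r \<noteq> 0 \<and> poly_subst s r \<noteq> 0 \<and> F = Fraction_Field.Fract p r \<and>
                             G = poly_subst s p / poly_subst s r)"

definition laurent_polys :: "(nat \<times> nat) set \<Rightarrow> ratfun set" where
  "laurent_polys V = {Fraction_Field.Fract p (Poly_Mapping.single e 1) |p e.
      (\<forall>k\<in>Poly_Mapping.keys p. Poly_Mapping.keys k \<subseteq> prod_encode ` V) \<and>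
      Poly_Mapping.keys e \<subseteq> prod_encode ` V}"


section \<open>The shuffle algebras\<close>

text \<open>
  Colours are taken modulo \<open>m\<close> with representatives \<open>1, \<dots>, m\<close>. A parameter tuple is
  \<open>(q, q\<^sub>1, q\<^sub>2, q\<^sub>3)\<close>, and \<open>d\<close> stands for \<open>q q\<^sub>1\<close>; for \<open>m = 1\<close> the first entry is irrelevant.
\<close>

type_synonym params = "complex \<times> complex \<times> complex \<times> complex"

definition nxt :: "nat \<Rightarrow> nat \<Rightarrow> nat" where
  "nxt m i = (if i = m then 1 else i + 1)"

definition prv :: "nat \<Rightarrow> nat \<Rightarrow> nat" where
  "prv m i = (if i = 1 then m else i - 1)"

definition degree_vars :: "nat \<Rightarrow> (nat \<Rightarrow> nat) \<Rightarrow> (nat \<times> nat) set" where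
  "degree_vars m N = (SIGMA i:{1..m}. {1..N i})"

definition sym_in :: "nat \<Rightarrow> (nat \<Rightarrow> nat) \<Rightarrow> ratfun \<Rightarrow> bool" where
  "sym_in m N F \<longleftrightarrow>
     (\<forall>i\<in>{1..m}. \<forall>\<sigma>. \<sigma> permutes {1..N i} \<longrightarrow>
        subst (\<lambda>j a. xvar j (if j = i then \<sigma> a else a)) F = F)"

definition poles :: "nat \<Rightarrow> (nat \<Rightarrow> nat) \<Rightarrow> ratfun \<Rightarrow> bool" where
  "poles m N F \<longleftrightarrow>
     (if m = 1
      then \<exists>f\<in>laurent_polys (degree_vars m N). sym_in m N f \<and>
             F = f / (\<Prod>(a, b)\<in>{(a, b). a \<in> {1..N 1} \<and> b \<in> {1..N 1} \<and> a < b}.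
                        (xvar 1 a - xvar 1 b)^2)
      else \<exists>f\<in>laurent_polys (degree_vars m N).
             F = f / (\<Prod>i\<in>{1..m}. \<Prod>a\<in>{1..N i}. \<Prod>b\<in>{1..N (nxt m i)}.
                        (xvar i a - xvar (nxt m i) b)))"

text \<open>\<open>wheel_at q\<^sub>\<alpha> q\<^sub>\<beta> u v w F\<close>: \<open>F\<close> vanishes at \<open>x\<^sub>v = q\<^sub>\<alpha> x\<^sub>u\<close>, \<open>x\<^sub>w = q\<^sub>\<beta> x\<^sub>v\<close>.\<close>

definition wheel_at ::
  "complex \<Rightarrow> complex \<Rightarrow> nat \<times> nat \<Rightarrow> nat \<times> nat \<Rightarrow> nat \<times> nat \<Rightarrow> ratfun \<Rightarrow> bool" where
  "wheel_at qa qb u v w F \<longleftrightarrow>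
     subst (\<lambda>j e. if (j, e) = v then cst qa * case_prod xvar u
                  else if (j, e) = w then cst qb * (cst qa * case_prod xvar u)
                  else xvar j e) F = 0"

fun wheel :: "nat \<Rightarrow> params \<Rightarrow> (nat \<Rightarrow> nat) \<Rightarrow> ratfun \<Rightarrow> bool" where
  "wheel m (q, q1, q2, q3) N F \<longleftrightarrow>
     (\<forall>i\<in>{1..m}. \<forall>a\<in>{1..N (prv m i)}. \<forall>b\<in>{1..N i}. \<forall>c\<in>{1..N i}.
        distinct [(prv m i, a), (i, b), (i, c)] \<longrightarrow>
        wheel_at q3 q2 (prv m i, a) (i, b) (i, c) F) \<and>
     (\<forall>i\<in>{1..m}. \<forall>a\<in>{1..N i}. \<forall>b\<in>{1..N i}. \<forall>c\<in>{1..N (nxt m i)}.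
        distinct [(i, a), (i, b), (nxt m i, c)] \<longrightarrow>
        wheel_at q2 q3 (i, a) (i, b) (nxt m i, c) F)"

definition Sh :: "nat \<Rightarrow> params \<Rightarrow> (nat \<Rightarrow> nat) \<Rightarrow> ratfun set" where
  "Sh m P N = {F. poles m N F \<and> sym_in m N F \<and> wheel m P N F}"

fun omega :: "nat \<Rightarrow> params \<Rightarrow> nat \<Rightarrow> nat \<Rightarrow> ratfun \<Rightarrow> ratfun \<Rightarrow> ratfun" where
  "omega m (q, q1, q2, q3) i j x y =
     (if m = 1 then (x - cst q1 * y) * (x - cst q2 * y) * (x - cst q3 * y) / (x - y)^3
      else if i = j then (x - cst q2 * y) / (x - y)
      else if m = 2 then (x - cst q1 * y) * (x - cst q3 * y) / (x - y)^2
      else if j = nxt m i then (x - cst q1 * y) / (x - y)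
      else if j = prv m i then cst (q * q1) * (x - cst q3 * y) / (x - y)
      else 1)"

text \<open>\<open>select I F\<close> is \<open>F(x\<^sub>1\<^sub>,\<^sub>I\<^sub>1; \<dots>; x\<^sub>m\<^sub>,\<^sub>I\<^sub>m)\<close>, the elements of each \<open>I\<^sub>i\<close> being listed increasingly.\<close>

definition select :: "(nat \<Rightarrow> nat set) \<Rightarrow> ratfun \<Rightarrow> ratfun" where
  "select I F = subst (\<lambda>i a. xvar i (sorted_list_of_set (I i) ! (a - 1))) F"

definition sh_mult ::
  "nat \<Rightarrow> params \<Rightarrow> (nat \<Rightarrow> nat) \<Rightarrow> (nat \<Rightarrow> nat) \<Rightarrow> ratfun \<Rightarrow> ratfun \<Rightarrow> ratfun" where
  "sh_mult m P M N F G =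
     (\<Sum>I\<in>(\<Pi>\<^sub>E i\<in>{1..m}. {A. A \<subseteq> {1..M i + N i} \<and> card A = M i}).
        let J = (\<lambda>i. {1..M i + N i} - I i) in
        select I F * select J G *
        (\<Prod>i\<in>{1..m}. \<Prod>j\<in>{1..m}. \<Prod>a\<in>I i. \<Prod>b\<in>J j. omega m P i j (xvar i a) (xvar j b)))"

text \<open>
  Elements of a direct sum are finitely supported families of homogeneous components. \<open>Sh0 m P\<close> is
  the algebra of all elements of degrees \<open>(N, \<dots>, N)\<close>.
\<close>

definition Sh0 :: "nat \<Rightarrow> params \<Rightarrow> (nat \<Rightarrow> ratfun) ring" where
  "Sh0 m P =
     \<lparr>carrier = {F. finite {N. F N \<noteq> 0} \<and> (\<forall>N. F N \<in> Sh m P (\<lambda>_. N))},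
      mult = (\<lambda>F G N. \<Sum>M\<le>N. sh_mult m P (\<lambda>_. M) (\<lambda>_. N - M) (F M) (G (N - M))),
      one = (\<lambda>N. if N = 0 then 1 else 0),
      zero = (\<lambda>_. 0),
      add = (\<lambda>F G N. F N + G N)\<rparr>"


section \<open>Tensor products\<close>

text \<open>
  \<open>F \<otimes> G\<close> is the function \<open>F(y) G(z)\<close> in two disjoint groups of variables. Since the colours of a
  shuffle algebra are \<open>1, \<dots>, m\<close>, colour \<open>0\<close> is free for the variables \<open>z\<^sub>b = xvar 0 b\<close> of a second
  factor with a single colour.
\<close>

definition tens :: "ratfun \<Rightarrow> ratfun \<Rightarrow> ratfun" where
  "tens F G = F * subst (\<lambda>i b. xvar 0 b) G"

definition tens_sum :: "(ratfun \<times> ratfun) list \<Rightarrow> ratfun" where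
  "tens_sum ps = (\<Sum>(F, G)\<leftarrow>ps. tens F G)"

definition tens_space :: "ratfun set \<Rightarrow> ratfun set \<Rightarrow> ratfun set" where
  "tens_space V W = {tens_sum ps |ps. set ps \<subseteq> V \<times> W}"

text \<open>
  \<open>tens_mult m P P' L K L' K'\<close> is the bilinear extension of
  \<open>(F \<otimes> G) (F' \<otimes> G') = (F * F') \<otimes> (G * G')\<close> to the components of bidegrees \<open>(L, K)\<close> and \<open>(L', K')\<close>.
\<close>

definition tens_mult ::
  "nat \<Rightarrow> params \<Rightarrow> params \<Rightarrow> nat \<Rightarrow> nat \<Rightarrow> nat \<Rightarrow> nat \<Rightarrow> ratfun \<Rightarrow> ratfun \<Rightarrow> ratfun" where
  "tens_mult m P P' L K L' K' f g =
     (THE h. \<forall>ps qs. set ps \<subseteq> Sh m P (\<lambda>_. L) \<times> Sh 1 P' (\<lambda>_. K) \<longrightarrow>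
        set qs \<subseteq> Sh m P (\<lambda>_. L') \<times> Sh 1 P' (\<lambda>_. K') \<longrightarrow>
        f = tens_sum ps \<longrightarrow> g = tens_sum qs \<longrightarrow>
        h = tens_sum [(sh_mult m P (\<lambda>_. L) (\<lambda>_. L') F F', sh_mult 1 P' (\<lambda>_. K) (\<lambda>_. K') G G').
                        (F, G) \<leftarrow> ps, (F', G') \<leftarrow> qs])"

definition Sh0_tensor_Sh1 :: "nat \<Rightarrow> params \<Rightarrow> params \<Rightarrow> (nat \<times> nat \<Rightarrow> ratfun) ring" where
  "Sh0_tensor_Sh1 m P P' =
     \<lparr>carrier = {f. finite {k. f k \<noteq> 0} \<and>
                    (\<forall>L K. f (L, K) \<in> tens_space (Sh m P (\<lambda>_. L)) (Sh 1 P' (\<lambda>_. K)))},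
      mult = (\<lambda>f g. \<lambda>(L, K). \<Sum>L'\<le>L. \<Sum>K'\<le>K.
                tens_mult m P P' L' K' (L - L') (K - K') (f (L', K')) (g (L - L', K - K'))),
      one = (\<lambda>k. if k = (0, 0) then 1 else 0),
      zero = (\<lambda>_. 0),
      add = (\<lambda>f g k. f k + g k)\<rparr>"

definition graded_algebra_hom ::
  "('g \<Rightarrow> ratfun) ring \<Rightarrow> ('g \<Rightarrow> nat) \<Rightarrow> ('h \<Rightarrow> ratfun) ring \<Rightarrow> ('h \<Rightarrow> nat) \<Rightarrow>
     (('g \<Rightarrow> ratfun) \<Rightarrow> ('h \<Rightarrow> ratfun)) \<Rightarrow> bool" where
  "graded_algebra_hom A degA B degB \<phi> \<longleftrightarrow>
     \<phi> \<in> ring_hom A B \<and>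
     (\<forall>c. \<forall>F\<in>carrier A. \<phi> (\<lambda>g. cst c * F g) = (\<lambda>h. cst c * \<phi> F h)) \<and>
     (\<forall>N. \<forall>F\<in>carrier A. (\<forall>g. F g \<noteq> 0 \<longrightarrow> degA g = N) \<longrightarrow> (\<forall>h. \<phi> F h \<noteq> 0 \<longrightarrow> degB h = N))"


section \<open>The map\<close>

text \<open>\<open>frac_pow l r\<close> is \<open>p\<^sup>r\<close> for the branch \<open>l\<close> of \<open>log p\<close>.\<close>

definition frac_pow :: "complex \<Rightarrow> rat \<Rightarrow> complex" where
  "frac_pow l r = exp (of_rat r * l)"

definition yvar :: "nat \<Rightarrow> nat \<Rightarrow> nat \<Rightarrow> ratfun" where
  "yvar m i a = xvar (if i = m then 1 else i) a"

text \<open>The variables \<open>z\<^sub>L\<^sub>+\<^sub>1, \<dots>, z\<^sub>N\<close>, renumbered from \<open>1\<close> as variables of the second tensor factor.\<close>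

definition zvar :: "nat \<Rightarrow> nat \<Rightarrow> ratfun" where
  "zvar L b = xvar 0 (b - L)"

text \<open>\<open>Yvar m l1 i a\<close> is \<open>q\<^sub>1\<close> to the power \<open>-(m-i)/(m-1)\<close>, times \<open>y\<^sub>i\<^sub>,\<^sub>a\<close>.\<close>

definition Yvar :: "nat \<Rightarrow> complex \<Rightarrow> nat \<Rightarrow> nat \<Rightarrow> ratfun" where
  "Yvar m l1 i a = cst (frac_pow l1 (- (of_nat (m - i) / of_nat (m - 1)))) * yvar m i a"

fun rho :: "nat \<Rightarrow> params \<Rightarrow> complex \<Rightarrow> nat \<Rightarrow> ratfun \<Rightarrow> ratfun" where
  "rho m (q, q1, q2, q3) l1 L F =
     subst (\<lambda>i a. if a \<le> L then Yvar m l1 i a else cst (q3 ^ (i - 1)) * zvar L a) F"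

text \<open>
  For \<open>m = 2\<close> one has \<open>y\<^sub>i = y\<^sub>i\<^sub>+\<^sub>1\<close> in the second product of \<open>A\<close>, and the factors with \<open>a = b\<close> would be
  zero; they are omitted.
\<close>

fun factorA :: "nat \<Rightarrow> params \<Rightarrow> complex \<Rightarrow> nat \<Rightarrow> ratfun" where
  "factorA m (q, q1, q2, q3) l1 L =
     (\<Prod>(a, b)\<in>{(a, b). a \<in> {1..L} \<and> b \<in> {1..L} \<and> a < b}.
        let u = yvar m 1 a; v = yvar m 1 b in
        cst (q * q1) * ((u - cst q2 * v) * (u - cst (inverse q2) * v))
          / ((u - cst q1 * v) * (u - cst (inverse q1) * v))) *
     (\<Prod>(a, b)\<in>{(a, b). a \<in> {1..L} \<and> b \<in> {1..L} \<and> (m = 2 \<longrightarrow> a \<noteq> b)}. \<Prod>i\<in>{1..m - 1}.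
        (yvar m i a - yvar m (i + 1) b)
          / (yvar m i a - cst (frac_pow l1 (1 / of_nat (m - 1))) * yvar m (i + 1) b))"

fun factorB :: "nat \<Rightarrow> params \<Rightarrow> nat \<Rightarrow> nat \<Rightarrow> ratfun" where
  "factorB m (q, q1, q2, q3) N L =
     (\<Prod>(a, b)\<in>{(a, b). a \<in> {L + 1..N} \<and> b \<in> {L + 1..N} \<and> a < b}.
        let u = zvar L a; v = zvar L b in
        (cst (q * q1) * ((u - cst q2 * v) * (u - cst (inverse q2) * v))
          / ((u - cst q3 * v) * (u - cst (inverse q3) * v))) ^ (m - 1)) *
     (\<Prod>(a, b)\<in>{(a, b). a \<in> {L + 1..N} \<and> b \<in> {L + 1..N} \<and> a < b}.
        let u = zvar L a; v = zvar L b in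
        cst (q * q1) * (u - v)^2
          / ((u - cst (q3 ^ (m - 1)) * v) * (u - cst (inverse (q3 ^ (m - 1))) * v)))"

fun factorC :: "nat \<Rightarrow> params \<Rightarrow> complex \<Rightarrow> nat \<Rightarrow> nat \<Rightarrow> ratfun" where
  "factorC m (q, q1, q2, q3) l1 N L =
     (\<Prod>a\<in>{1..L}. \<Prod>b\<in>{L + 1..N}.
        let z = zvar L b; y = yvar m 1 a; d = q * q1 in
        (\<Prod>i\<in>{2..m - 1}. let Y = Yvar m l1 i a in
           cst d * ((Y - cst (q1 * q3 ^ i) * z) * (Y - cst (inverse q1 * q3 ^ (i - 2)) * z))
             / ((Y - cst (q3 ^ i) * z) * (Y - cst (q3 ^ (i - 2)) * z))) *
        (cst (d^2) * ((y - cst (q1^2 * q3) * z) * (y - cst (inverse q3) * z))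
           / ((y - cst (q1 * q3) * z) * (y - z))) *
        (((y - cst (inverse q1 * q3 ^ (m - 2)) * z) * (y - cst (q1 * q3 ^ m) * z))
           / ((y - cst (q3 ^ (m - 2)) * z) * (y - cst (q1 * q3 ^ (m - 1)) * z))))"

text \<open>
  The scalars \<open>d\<close> in \<open>A\<close>, \<open>B\<close>, \<open>C\<close> match the scalars \<open>d\<close> in \<open>\<omega>\<^sub>i\<^sub>,\<^sub>i\<^sub>-\<^sub>1\<close> for \<open>m \<ge> 3\<close>, which are absent for
  one and two colours. So when \<open>m\<close> or \<open>m - 1\<close> equals \<open>2\<close>, multiplicativity needs \<open>ABC\<close> to be rescaled:
  per pair \<open>y\<^sub>a, y\<^sub>b\<close> by \<open>q\<^sup>-\<^sup>1\<close> if \<open>m = 2\<close> and by \<open>(q q\<^sub>1 q\<^sub>1\<^sup>1\<^sup>/\<^sup>2)\<^sup>2\<close> if \<open>m = 3\<close>, and per pair \<open>z\<^sub>a, z\<^sub>b\<close> or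
  \<open>y\<^sub>a, z\<^sub>b\<close> by \<open>d\<^sup>-\<^sup>2\<close> if \<open>m = 2\<close>. For \<open>m \<ge> 4\<close> there is no correction.
\<close>

fun norm_const :: "nat \<Rightarrow> params \<Rightarrow> complex \<Rightarrow> nat \<Rightarrow> nat \<Rightarrow> complex" where
  "norm_const m (q, q1, q2, q3) l1 N L =
     (if m = 2 then inverse (q ^ (L choose 2) *
                             ((q * q1)^2) ^ (((N - L) choose 2) + L * (N - L)))
      else if m = 3 then ((q * q1 * frac_pow l1 (1 / 2))^2) ^ (L choose 2)
      else 1)"

definition tildeF :: "nat \<Rightarrow> params \<Rightarrow> complex \<Rightarrow> nat \<Rightarrow> nat \<Rightarrow> ratfun \<Rightarrow> ratfun" where
  "tildeF m P l1 N L F =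
     rho m P l1 L F /
       (cst (norm_const m P l1 N L) * (factorA m P l1 L * factorB m P N L * factorC m P l1 N L))"

definition pi_map ::
  "nat \<Rightarrow> params \<Rightarrow> complex \<Rightarrow> (nat \<Rightarrow> ratfun) \<Rightarrow> (nat \<times> nat \<Rightarrow> ratfun)" where
  "pi_map m P l1 F = (\<lambda>(L, K). tildeF m P l1 (L + K) L (F (L + K)))"

end

theory Submission
  imports Defs
begin

text \<open>
  Write \<open>F = f / \<Delta>\<close> with a Laurent polynomial \<open>f\<close>. The specialisation \<open>\<rho>\<close> replaces each \<open>x\<^sub>i\<^sub>,\<^sub>a\<close> by a constant
  times a single variable \<open>y\<close> or \<open>z\<close>. The component in bidegree \<open>(L, N - L)\<close> of the image of \<open>F\<close> is
  \<open>\<rho>(f)\<close> divided by \<open>\<rho>(\<Delta>)\<close> and by the normalised factor \<open>A B C\<close>. It has to be seen that this lies in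
  the tensor product, and that products are respected.

  \<^bold>\<open>Membership.\<close> Up to a constant and a monomial, \<open>\<rho>(\<Delta>) A B C\<close> equals \<open>D\<^sub>y D\<^sub>z E\<close>, where \<open>D\<^sub>y\<close> and \<open>D\<^sub>z\<close> are the
  denominators that the two target algebras allow and \<open>E\<close> is a product of linear forms (\<open>Den_asc\<close>).
  Where one of these forms is zero, the specialised variables contain a wheel, so \<open>\<rho>(f)\<close> vanishes.
  The forms \<open>z\<^sub>a - q\<^sub>2 z\<^sub>b\<close> and \<open>z\<^sub>a - q\<^sub>2\<^sup>-\<^sup>1 z\<^sub>b\<close> occur with multiplicity \<open>m - 1\<close>; this order of vanishing is
  found by letting the \<open>m\<close> variables of one label vary independently, since then each of \<open>m - 1\<close>
  colours gives a zero of its own (\<open>lp_multiple_root\<close>). So \<open>h = \<rho>(f) / E\<close> is a Laurent polynomial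
  (\<open>Eprod_dvd_specialisation\<close>). It inherits the symmetry of \<open>f\<close>. On a wheel of the target \<open>\<rho>(f)\<close>
  vanishes because of wheels of the source; if a form in \<open>E\<close> also vanishes there, then \<open>\<rho>(f)\<close>
  vanishes to one order more than \<open>E\<close> (\<open>wheel_multiple\<close>), so \<open>h\<close> vanishes in any case. Finally, \<open>h\<close> is a
  finite sum of products \<open>p\<^sub>k(y) r\<^sub>k(z)\<close>, and in a shortest such sum the \<open>p\<^sub>k\<close> and the \<open>r\<^sub>k\<close> are linearly
  independent. Hence a linear condition on \<open>h\<close> that concerns only the \<open>y\<close> variables holds for every \<open>p\<^sub>k\<close>,
  and likewise for \<open>z\<close> and \<open>r\<^sub>k\<close> (\<open>tensor_rep_conditions\<close>). This gives \<open>tildeF_in_tens_space\<close>.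

  \<^bold>\<open>Products.\<close> The product \<open>F * G\<close> is a sum over ways to distribute the variables of each colour. After
  the specialisation \<open>x\<^sub>i\<^sub>+\<^sub>1\<^sub>,\<^sub>b = q\<^sub>3 x\<^sub>i\<^sub>,\<^sub>b\<close> for the labels of \<open>z\<close> and \<open>x\<^sub>m\<^sub>,\<^sub>a = q\<^sub>1 x\<^sub>1\<^sub>,\<^sub>a\<close> for those of \<open>y\<close>, and
  \<open>\<omega>\<^sub>i\<^sub>+\<^sub>1\<^sub>,\<^sub>i\<close> is zero at the first relation and \<open>\<omega>\<^sub>m\<^sub>,\<^sub>1\<close> at the second one. Together with the equal numbers of
  variables in all colours this leaves only those distributions that put all \<open>z\<^sub>b\<close> with the same label on
  the same side, and the two copies of \<open>y\<^sub>1\<^sub>,\<^sub>a\<close> as well (\<open>OmX_not_aligned\<close>). They are the pairs of a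
  distribution of the \<open>y\<close> and one of the \<open>z\<close>, that is, the index set of the product in the tensor
  product. For such a pair the product of all \<open>\<omega>\<close> is the product of the \<open>\<omega>\<close> of the two target algebras
  times the mixed part of \<open>A B C\<close> (\<open>OmX_DenX\<close>), and the mixed part is exactly what relates \<open>A B C\<close> for two
  disjoint sets of labels to \<open>A B C\<close> for their union (\<open>DenS_union\<close>). So the summands agree.
\<close>

section \<open>Substitution in rational functions\<close>

abbreviation X :: "nat \<times> nat \<Rightarrow> ratfun" where "X v \<equiv> case_prod xvar v"

lemma sum_singles:
  fixes p :: "'a \<Rightarrow>\<^sub>0 'b::comm_monoid_add"
  shows "(\<Sum>e\<in>Poly_Mapping.keys p. Poly_Mapping.single e (Poly_Mapping.lookup p e)) = p"
  by (rule poly_mapping_eqI)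
     (auto simp: lookup_sum lookup_single when_def in_keys_iff sum.If_cases
           simp flip: sum.inter_filter)

lemma poly_mapping_additive_induct [case_names single zero add]:
  fixes p :: "'a \<Rightarrow>\<^sub>0 'b::comm_monoid_add"
  assumes single: "\<And>e c. e \<in> Poly_Mapping.keys p \<Longrightarrow> P (Poly_Mapping.single e c)" and zero: "P 0"
    and add: "\<And>f g. P f \<Longrightarrow> P g \<Longrightarrow> P (f + g)"
  shows "P p"
proof -
  have "P (\<Sum>e\<in>A. Poly_Mapping.single e (Poly_Mapping.lookup p e))"
    if "finite A" "A \<subseteq> Poly_Mapping.keys p" for A
    using that by (induction A) (auto intro: single zero add)
  from this[of "Poly_Mapping.keys p"] show ?thesis
    by (simp add: sum_singles)
qed

subsection \<open>Constants\<close>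

lemma cst_0 [simp]: "cst 0 = 0" and cst_1 [simp]: "cst 1 = 1"
  by (simp_all add: cst_def Zero_fract_def One_fract_def)

lemma cst_add: "cst (a + b) = cst a + cst b"
  by (simp add: cst_def single_add)

lemma cst_mult: "cst (a * b) = cst a * cst b"
  by (simp add: cst_def mult_single)

lemma cst_uminus: "cst (- a) = - cst a"
  by (simp add: cst_def single_uminus)

lemma cst_diff: "cst (a - b) = cst a - cst b"
  using cst_add[of a "-b"] by (simp add: cst_uminus)

lemma cst_eq_iff [simp]: "cst a = cst b \<longleftrightarrow> a = b"
  using injD[OF inj_single] by (auto simp: cst_def eq_fract)

lemma cst_eq_0_iff [simp]: "cst a = 0 \<longleftrightarrow> a = 0" and cst_eq_1_iff [simp]: "cst a = 1 \<longleftrightarrow> a = 1"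
  using cst_eq_iff[of a 0] cst_eq_iff[of a 1] by simp_all

lemma cst_inverse: "cst (inverse a) = inverse (cst a)"
proof (cases "a = 0")
  case False
  have "cst a * cst (inverse a) = 1"
    using False by (simp flip: cst_mult)
  thus ?thesis
    by (metis inverse_unique)
qed simp

lemma cst_divide: "cst (a / b) = cst a / cst b"
  by (simp add: divide_inverse cst_mult cst_inverse)

lemma cst_power: "cst (a ^ n) = cst a ^ n"
  by (induction n) (simp_all add: cst_mult)

subsection \<open>Substitution is a ring homomorphism where it is defined\<close>

definition monom_subst :: "(nat \<Rightarrow> nat \<Rightarrow> ratfun) \<Rightarrow> (nat \<Rightarrow>\<^sub>0 nat) \<Rightarrow> ratfun" where
  "monom_subst s e =
     (\<Prod>v\<in>Poly_Mapping.keys e. case_prod s (prod_decode v) ^ Poly_Mapping.lookup e v)"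

lemma monom_subst_superset:
  assumes "finite A" "Poly_Mapping.keys e \<subseteq> A"
  shows "monom_subst s e = (\<Prod>v\<in>A. case_prod s (prod_decode v) ^ Poly_Mapping.lookup e v)"
  unfolding monom_subst_def using assms
  by (intro prod.mono_neutral_left) (auto simp: in_keys_iff)

lemma monom_subst_add: "monom_subst s (e + f) = monom_subst s e * monom_subst s f"
proof -
  let ?A = "Poly_Mapping.keys e \<union> Poly_Mapping.keys f"
  have "Poly_Mapping.keys (e + f) \<subseteq> ?A"
    by (rule keys_add)
  thus ?thesis
    by (simp add: monom_subst_superset[of ?A] lookup_add power_add prod.distrib)
qed

lemma monom_subst_0 [simp]: "monom_subst s 0 = 1"
  by (simp add: monom_subst_def)

lemma monom_subst_single: "monom_subst s (Poly_Mapping.single v k) = case_prod s (prod_decode v) ^ k"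
  by (cases "k = 0") (simp_all add: monom_subst_def)

lemma poly_subst_monom_subst:
  "poly_subst s p = (\<Sum>e\<in>Poly_Mapping.keys p. cst (Poly_Mapping.lookup p e) * monom_subst s e)"
  by (simp add: poly_subst_def monom_subst_def)

lemma poly_subst_superset:
  assumes "finite A" "Poly_Mapping.keys p \<subseteq> A"
  shows "poly_subst s p = (\<Sum>e\<in>A. cst (Poly_Mapping.lookup p e) * monom_subst s e)"
  unfolding poly_subst_monom_subst using assms
  by (intro sum.mono_neutral_left) (auto simp: in_keys_iff)

lemma poly_subst_add: "poly_subst s (p + r) = poly_subst s p + poly_subst s r"
proof -
  let ?A = "Poly_Mapping.keys p \<union> Poly_Mapping.keys r"
  have "Poly_Mapping.keys (p + r) \<subseteq> ?A"
    by (rule keys_add)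
  thus ?thesis
    by (simp add: poly_subst_superset[of ?A] lookup_add cst_add distrib_right sum.distrib)
qed

lemma poly_subst_0 [simp]: "poly_subst s 0 = 0"
  by (simp add: poly_subst_def)

lemma poly_subst_single: "poly_subst s (Poly_Mapping.single e c) = cst c * monom_subst s e"
  by (cases "c = 0") (simp_all add: poly_subst_monom_subst)

lemma poly_subst_mult: "poly_subst s (p * r) = poly_subst s p * poly_subst s r"
proof (induction p rule: poly_mapping_additive_induct)
  case (single e c)
  show ?case
    by (induction r rule: poly_mapping_additive_induct)
       (simp_all add: poly_subst_single mult_single monom_subst_add cst_mult poly_subst_add
          distrib_left)
qed (simp_all add: poly_subst_add distrib_right)

lemma poly_subst_1 [simp]: "poly_subst s 1 = 1"
  using poly_subst_single[of s 0 1] by simp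

text \<open>
  The relation form of \<^const>\<open>subst\<close>: a rational function has a value under a substitution only if
  some denominator survives it. Side conditions and values are then derived by the same rules.
\<close>

definition has_subst :: "(nat \<Rightarrow> nat \<Rightarrow> ratfun) \<Rightarrow> ratfun \<Rightarrow> ratfun \<Rightarrow> bool" where
  "has_subst s F G \<longleftrightarrow> (\<exists>p r. r \<noteq> 0 \<and> poly_subst s r \<noteq> 0 \<and> F = Fraction_Field.Fract p r \<and>
                              G = poly_subst s p / poly_subst s r)"

lemma has_subst_unique:
  assumes "has_subst s F G" "has_subst s F G'"
  shows "G = G'"
proof -
  obtain p r p' r' where *: "r \<noteq> 0" "r' \<noteq> 0" "poly_subst s r \<noteq> 0" "poly_subst s r' \<noteq> 0"
    "F = Fraction_Field.Fract p r" "F = Fraction_Field.Fract p' r'"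
    "G = poly_subst s p / poly_subst s r" "G' = poly_subst s p' / poly_subst s r'"
    using assms unfolding has_subst_def by blast
  hence "p * r' = p' * r"
    by (metis eq_fract(1))
  hence "poly_subst s p * poly_subst s r' = poly_subst s p' * poly_subst s r"
    by (metis poly_subst_mult)
  thus ?thesis
    using * by (simp add: frac_eq_eq)
qed

lemma has_subst_imp_subst: "has_subst s F G \<Longrightarrow> subst s F = G"
  unfolding subst_def using has_subst_unique[of s F] unfolding has_subst_def
  by (intro the_equality) metis+

lemma has_subst_subst: "has_subst s F G \<Longrightarrow> has_subst s F (subst s F)"
  using has_subst_imp_subst by simp

lemma has_subst_poly: "has_subst s (Fraction_Field.Fract p 1) (poly_subst s p)"
  unfolding has_subst_def by (intro exI[of _ p] exI[of _ 1]) auto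

lemma has_subst_cst: "has_subst s (cst c) (cst c)"
  using has_subst_poly[of s "Poly_Mapping.single 0 c"] by (simp add: cst_def[symmetric] poly_subst_single)

lemma has_subst_xvar: "has_subst s (xvar i a) (s i a)"
  using has_subst_poly[of s "Poly_Mapping.single (Poly_Mapping.single (prod_encode (i, a)) 1) 1"]
  by (simp add: xvar_def[symmetric] poly_subst_single monom_subst_single flip: One_nat_def)

lemma has_subst_X: "has_subst s (X v) (case_prod s v)"
  by (cases v) (simp add: has_subst_xvar)

lemma has_subst_0: "has_subst s 0 0" and has_subst_1: "has_subst s 1 1"
  using has_subst_cst[of s 0] has_subst_cst[of s 1] by simp_all

lemma has_subst_add:
  assumes "has_subst s F G" "has_subst s F' G'"
  shows "has_subst s (F + F') (G + G')"
proof -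
  obtain p r p' r' where *: "r \<noteq> 0" "r' \<noteq> 0" "poly_subst s r \<noteq> 0" "poly_subst s r' \<noteq> 0"
    "F = Fraction_Field.Fract p r" "F' = Fraction_Field.Fract p' r'"
    "G = poly_subst s p / poly_subst s r" "G' = poly_subst s p' / poly_subst s r'"
    using assms unfolding has_subst_def by blast
  thus ?thesis unfolding has_subst_def
    by (intro exI[of _ "p * r' + p' * r"] exI[of _ "r * r'"])
       (simp add: poly_subst_add poly_subst_mult field_simps)
qed

lemma has_subst_mult:
  assumes "has_subst s F G" "has_subst s F' G'"
  shows "has_subst s (F * F') (G * G')"
proof -
  obtain p r p' r' where *: "r \<noteq> 0" "r' \<noteq> 0" "poly_subst s r \<noteq> 0" "poly_subst s r' \<noteq> 0"
    "F = Fraction_Field.Fract p r" "F' = Fraction_Field.Fract p' r'"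
    "G = poly_subst s p / poly_subst s r" "G' = poly_subst s p' / poly_subst s r'"
    using assms unfolding has_subst_def by blast
  thus ?thesis unfolding has_subst_def
    by (intro exI[of _ "p * p'"] exI[of _ "r * r'"]) (simp add: poly_subst_mult)
qed

lemma has_subst_inverse:
  assumes "has_subst s F G" "G \<noteq> 0"
  shows "has_subst s (inverse F) (inverse G)"
proof -
  obtain p r where *: "r \<noteq> 0" "poly_subst s r \<noteq> 0" "F = Fraction_Field.Fract p r"
    "G = poly_subst s p / poly_subst s r"
    using assms unfolding has_subst_def by blast
  moreover have "p \<noteq> 0" "poly_subst s p \<noteq> 0"
    using assms(2) * by auto
  ultimately show ?thesis unfolding has_subst_def
    by (intro exI[of _ r] exI[of _ p]) simp
qed

lemma has_subst_uminus: "has_subst s F G \<Longrightarrow> has_subst s (- F) (- G)"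
  using has_subst_mult[OF has_subst_cst[of s "-1"], of F G] by (simp add: cst_uminus)

lemma has_subst_diff: "has_subst s F G \<Longrightarrow> has_subst s F' G' \<Longrightarrow> has_subst s (F - F') (G - G')"
  using has_subst_add[OF _ has_subst_uminus] by fastforce

lemma has_subst_divide:
  "has_subst s F G \<Longrightarrow> has_subst s F' G' \<Longrightarrow> G' \<noteq> 0 \<Longrightarrow> has_subst s (F / F') (G / G')"
  unfolding divide_inverse by (intro has_subst_mult has_subst_inverse)

lemma has_subst_power: "has_subst s F G \<Longrightarrow> has_subst s (F ^ n) (G ^ n)"
  by (induction n) (auto intro: has_subst_1 has_subst_mult)

lemma has_subst_prod:
  "(\<And>i. i \<in> A \<Longrightarrow> has_subst s (F i) (G i)) \<Longrightarrow> has_subst s (\<Prod>i\<in>A. F i) (\<Prod>i\<in>A. G i)"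
  by (induction A rule: infinite_finite_induct) (auto intro: has_subst_1 has_subst_mult)

lemma has_subst_sum:
  "(\<And>i. i \<in> A \<Longrightarrow> has_subst s (F i) (G i)) \<Longrightarrow> has_subst s (\<Sum>i\<in>A. F i) (\<Sum>i\<in>A. G i)"
  by (induction A rule: infinite_finite_induct) (auto intro: has_subst_0 has_subst_add)

lemmas has_subst_intros =
  has_subst_cst has_subst_X has_subst_xvar has_subst_0 has_subst_1 has_subst_add has_subst_diff
  has_subst_uminus has_subst_mult has_subst_power has_subst_prod has_subst_sum has_subst_divide
  has_subst_inverse

lemma subst_0 [simp]: "subst s 0 = 0" and subst_1 [simp]: "subst s 1 = 1"
  and subst_cst [simp]: "subst s (cst c) = cst c" and subst_xvar [simp]: "subst s (xvar i a) = s i a"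
  by (intro has_subst_imp_subst has_subst_intros)+

lemma xvar_eq_iff [simp]: "xvar i a = xvar j b \<longleftrightarrow> i = j \<and> a = b"
proof
  assume eq: "xvar i a = xvar j b"
  let ?s = "\<lambda>k c. if k = i \<and> c = a then 0 else (1::ratfun)"
  have "subst ?s (xvar i a) = subst ?s (xvar j b)"
    using eq by simp
  thus "i = j \<and> a = b"
    by (simp split: if_splits)
qed simp

lemma xvar_neq_0 [simp]: "xvar i a \<noteq> 0"
  using subst_xvar[of "\<lambda>_ _. 1" i a] by fastforce

text \<open>The denominators of the elements of a shuffle algebra, specialised or not, are products of such binomials.\<close>

lemma linear_form_eq_0:
  assumes "cst a * X u = cst b * X w" "a \<noteq> 0 \<or> b \<noteq> 0"
  shows "u = w \<and> a = b"
proof -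
  obtain i k where u: "u = (i, k)" by (cases u)
  obtain j l where w: "w = (j, l)" by (cases w)
  have eq: "cst a * s i k = cst b * s j l" for s
  proof -
    have "subst s (cst a * X u) = cst a * s i k" "subst s (cst b * X w) = cst b * s j l"
      unfolding u w by (auto intro!: has_subst_imp_subst has_subst_intros)
    thus ?thesis
      using assms(1) by simp
  qed
  from eq[of "\<lambda>_ _. 1"] have ab: "a = b"
    by simp
  from eq[of "\<lambda>k' c. if k' = i \<and> c = k then 0 else 1"] ab assms(2) have "u = w"
    unfolding u w by (auto split: if_splits)
  with ab show ?thesis
    by simp
qed

section \<open>Laurent polynomials\<close>

text \<open>
  Generation by variables and inverses of variables makes the substitution lemmas plain rule inductions.
\<close>

inductive_set lp :: "(nat \<times> nat) set \<Rightarrow> ratfun set" for V where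
  cst: "cst c \<in> lp V"
| var: "v \<in> V \<Longrightarrow> X v \<in> lp V"
| inv: "v \<in> V \<Longrightarrow> inverse (X v) \<in> lp V"
| add: "F \<in> lp V \<Longrightarrow> G \<in> lp V \<Longrightarrow> F + G \<in> lp V"
| mult: "F \<in> lp V \<Longrightarrow> G \<in> lp V \<Longrightarrow> F * G \<in> lp V"

lemma lp_xvar: "(i, a) \<in> V \<Longrightarrow> xvar i a \<in> lp V"
  using lp.var[of "(i, a)" V] by simp

lemma lp_inverse_xvar: "(i, a) \<in> V \<Longrightarrow> inverse (xvar i a) \<in> lp V"
  using lp.inv[of "(i, a)" V] by simp

lemma lp_0: "0 \<in> lp V" and lp_1: "1 \<in> lp V"
  using lp.cst[of 0] lp.cst[of 1] by simp_all

lemma lp_uminus: "F \<in> lp V \<Longrightarrow> - F \<in> lp V"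
  using lp.mult[OF lp.cst[of "-1"]] by (force simp: cst_uminus)

lemma lp_diff: "F \<in> lp V \<Longrightarrow> G \<in> lp V \<Longrightarrow> F - G \<in> lp V"
  using lp.add[OF _ lp_uminus] by fastforce

lemma lp_power: "F \<in> lp V \<Longrightarrow> F ^ n \<in> lp V"
  by (induction n) (auto intro: lp_1 lp.mult)

lemma lp_prod: "(\<And>i. i \<in> A \<Longrightarrow> F i \<in> lp V) \<Longrightarrow> (\<Prod>i\<in>A. F i) \<in> lp V"
  by (induction A rule: infinite_finite_induct) (auto intro: lp_1 lp.mult)

lemma lp_sum: "(\<And>i. i \<in> A \<Longrightarrow> F i \<in> lp V) \<Longrightarrow> (\<Sum>i\<in>A. F i) \<in> lp V"
  by (induction A rule: infinite_finite_induct) (auto intro: lp_0 lp.add)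

lemma lp_mono: "F \<in> lp V \<Longrightarrow> V \<subseteq> W \<Longrightarrow> F \<in> lp W"
  by (induction rule: lp.induct) (auto intro: lp.intros lp_xvar lp_inverse_xvar)

subsection \<open>The two descriptions of Laurent polynomials agree\<close>

lemma monom_subst_xvar: "monom_subst xvar e = Fraction_Field.Fract (Poly_Mapping.single e 1) 1"
proof (induction e rule: poly_mapping_additive_induct)
  case (single v k)
  obtain i a where v: "v = prod_encode (i, a)"
    by (metis prod_decode_inverse surj_pair)
  have "xvar i a ^ k = Fraction_Field.Fract (Poly_Mapping.single (Poly_Mapping.single v k) 1) 1"
  proof (induction k)
    case (Suc k)
    thus ?case
      by (simp add: xvar_def v mult_single flip: single_add)
  qed (simp add: One_fract_def)
  thus ?case
    by (simp add: v monom_subst_single)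
qed (simp_all add: monom_subst_add mult_single One_fract_def)

lemma poly_subst_xvar: "poly_subst xvar p = Fraction_Field.Fract p 1"
  by (induction p rule: poly_mapping_additive_induct)
     (simp_all add: poly_subst_add poly_subst_single monom_subst_xvar cst_def mult_single Zero_fract_def)

definition poly_in :: "nat set \<Rightarrow> cpoly \<Rightarrow> bool" where
  "poly_in W p \<longleftrightarrow> (\<forall>k\<in>Poly_Mapping.keys p. Poly_Mapping.keys k \<subseteq> W)"

lemma poly_in_single: "Poly_Mapping.keys e \<subseteq> W \<Longrightarrow> poly_in W (Poly_Mapping.single e c)"
  by (simp add: poly_in_def)

lemma poly_in_add: "poly_in W p \<Longrightarrow> poly_in W r \<Longrightarrow> poly_in W (p + r)"
  using keys_add[of p r] unfolding poly_in_def by blast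

lemma poly_in_mult: "poly_in W p \<Longrightarrow> poly_in W r \<Longrightarrow> poly_in W (p * r)"
proof -
  assume p: "poly_in W p" "poly_in W r"
  have "Poly_Mapping.keys k \<subseteq> W" if k: "k \<in> Poly_Mapping.keys (p * r)" for k
  proof -
    obtain a b where "k = a + b" "a \<in> Poly_Mapping.keys p" "b \<in> Poly_Mapping.keys r"
      using k keys_mult[of p r] by blast
    thus ?thesis
      using p keys_add[of a b] unfolding poly_in_def by blast
  qed
  thus ?thesis
    by (simp add: poly_in_def)
qed

lemma single_neq_0: "c \<noteq> 0 \<Longrightarrow> Poly_Mapping.single e c \<noteq> 0"
  by (metis lookup_single_eq lookup_zero)

lemma lp_eq_laurent_polys: "lp V = laurent_polys V"
proof (intro equalityI subsetI)
  let ?W = "prod_encode ` V"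
  have laurent: "F \<in> laurent_polys V \<longleftrightarrow> (\<exists>p e. F = Fraction_Field.Fract p (Poly_Mapping.single e 1) \<and>
     poly_in ?W p \<and> Poly_Mapping.keys e \<subseteq> ?W)" for F
    unfolding laurent_polys_def poly_in_def by blast
  have keys_W: "Poly_Mapping.keys (e + f) \<subseteq> ?W"
    if "Poly_Mapping.keys e \<subseteq> ?W" "Poly_Mapping.keys f \<subseteq> ?W" for e f :: "nat \<Rightarrow>\<^sub>0 nat"
    using keys_add[of e f] that by blast
  fix F
  {
    assume "F \<in> lp V"
    thus "F \<in> laurent_polys V"
    proof (induction rule: lp.induct)
      case (cst c)
      show ?case unfolding laurent
        by (intro exI[of _ "Poly_Mapping.single 0 c"] exI[of _ 0]) (simp add: cst_def poly_in_single)
    next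
      case (var v)
      thus ?case unfolding laurent
        by (intro exI[of _ "Poly_Mapping.single (Poly_Mapping.single (prod_encode v) 1) 1"] exI[of _ 0])
           (auto simp: xvar_def split: prod.split intro!: poly_in_single)
    next
      case (inv v)
      thus ?case unfolding laurent
        by (intro exI[of _ 1] exI[of _ "Poly_Mapping.single (prod_encode v) 1"])
           (auto simp: xvar_def poly_in_def split: prod.split)
    next
      case (add F G)
      then obtain p e r f where *: "F = Fraction_Field.Fract p (Poly_Mapping.single e 1)"
        "G = Fraction_Field.Fract r (Poly_Mapping.single f 1)" "poly_in ?W p" "poly_in ?W r"
        "Poly_Mapping.keys e \<subseteq> ?W" "Poly_Mapping.keys f \<subseteq> ?W"
        unfolding laurent by blast
      show ?case unfolding laurent
        by (rule exI[of _ "p * Poly_Mapping.single f 1 + r * Poly_Mapping.single e 1"],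
            rule exI[of _ "e + f"])
           (use * keys_W in \<open>auto simp: mult_single single_neq_0 intro!: poly_in_add poly_in_mult poly_in_single\<close>)
    next
      case (mult F G)
      then obtain p e r f where *: "F = Fraction_Field.Fract p (Poly_Mapping.single e 1)"
        "G = Fraction_Field.Fract r (Poly_Mapping.single f 1)" "poly_in ?W p" "poly_in ?W r"
        "Poly_Mapping.keys e \<subseteq> ?W" "Poly_Mapping.keys f \<subseteq> ?W"
        unfolding laurent by blast
      show ?case unfolding laurent
        by (rule exI[of _ "p * r"], rule exI[of _ "e + f"])
           (use * keys_W in \<open>auto simp: mult_single intro!: poly_in_mult\<close>)
    qed
  next
    assume "F \<in> laurent_polys V"
    then obtain p e where F: "F = Fraction_Field.Fract p (Poly_Mapping.single e 1)"
      and p: "poly_in ?W p" and e: "Poly_Mapping.keys e \<subseteq> ?W"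
      unfolding laurent by blast
    have dec: "prod_decode v \<in> V" if "v \<in> ?W" for v
      using that by auto
    have monom: "monom_subst xvar k \<in> lp V" if "Poly_Mapping.keys k \<subseteq> ?W" for k
      unfolding monom_subst_def using that by (intro lp_prod lp_power lp.var dec) auto
    have "inverse (monom_subst xvar e) = (\<Prod>v\<in>Poly_Mapping.keys e.
            inverse (case_prod xvar (prod_decode v)) ^ Poly_Mapping.lookup e v)"
      by (simp add: monom_subst_def power_inverse flip: prod_inversef)
    also have "\<dots> \<in> lp V"
      using e by (intro lp_prod lp_power lp.inv dec) auto
    finally have "inverse (monom_subst xvar e) \<in> lp V" .
    moreover have "poly_subst xvar p \<in> lp V"
      unfolding poly_subst_monom_subst using p
      by (intro lp_sum lp.mult lp.cst monom) (auto simp: poly_in_def)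
    moreover have "F = poly_subst xvar p * inverse (monom_subst xvar e)"
      by (simp add: F poly_subst_xvar monom_subst_xvar)
    ultimately show "F \<in> lp V"
      by (simp add: lp.mult)
  }
qed

subsection \<open>Units and substitutions\<close>

definition lunit :: "(nat \<times> nat) set \<Rightarrow> ratfun set" where
  "lunit V = {g. g \<noteq> 0 \<and> g \<in> lp V \<and> inverse g \<in> lp V}"

lemma lunit_cst: "c \<noteq> 0 \<Longrightarrow> cst c \<in> lunit V"
  by (simp add: lunit_def lp.cst flip: cst_inverse)

lemma X_neq_0 [simp]: "X v \<noteq> 0"
  by (cases v) simp

lemma lunit_X: "v \<in> V \<Longrightarrow> X v \<in> lunit V"
  by (simp add: lunit_def lp.intros)

lemma lunit_xvar: "(i, a) \<in> V \<Longrightarrow> xvar i a \<in> lunit V"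
  using lunit_X[of "(i, a)"] by simp

lemma lunit_mult: "g \<in> lunit V \<Longrightarrow> h \<in> lunit V \<Longrightarrow> g * h \<in> lunit V"
  by (simp add: lunit_def lp.mult)

lemma lunit_inverse: "g \<in> lunit V \<Longrightarrow> inverse g \<in> lunit V"
  by (simp add: lunit_def)

lemma lunit_divide: "g \<in> lunit V \<Longrightarrow> h \<in> lunit V \<Longrightarrow> g / h \<in> lunit V"
  by (simp add: divide_inverse lunit_mult lunit_inverse)

lemma lunit_1: "1 \<in> lunit V"
  using lunit_cst[of 1] by simp

lemma lunit_uminus: "g \<in> lunit V \<Longrightarrow> - g \<in> lunit V"
  using lunit_mult[OF lunit_cst[of "-1"], of g V] by (simp add: cst_uminus)

lemma lunit_power: "g \<in> lunit V \<Longrightarrow> g ^ n \<in> lunit V"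
  by (induction n) (auto intro: lunit_1 lunit_mult)

lemma lunit_prod: "(\<And>i. i \<in> A \<Longrightarrow> F i \<in> lunit V) \<Longrightarrow> (\<Prod>i\<in>A. F i) \<in> lunit V"
  by (induction A rule: infinite_finite_induct) (auto intro: lunit_1 lunit_mult)

lemma lunit_lp: "g \<in> lunit V \<Longrightarrow> g \<in> lp V" and lunit_neq_0: "g \<in> lunit V \<Longrightarrow> g \<noteq> 0"
  by (simp_all add: lunit_def)

lemma lunit_mono: "g \<in> lunit V \<Longrightarrow> V \<subseteq> W \<Longrightarrow> g \<in> lunit W"
  unfolding lunit_def using lp_mono by blast

lemmas lunit_intros = lunit_cst lunit_X lunit_xvar lunit_mult lunit_divide lunit_inverse lunit_1
  lunit_uminus lunit_power lunit_prod

lemma lp_has_subst: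
  assumes "F \<in> lp V" "\<And>i a. (i, a) \<in> V \<Longrightarrow> s i a \<noteq> 0"
  shows "has_subst s F (subst s F)"
proof -
  have "\<exists>G. has_subst s F G"
    using assms(1)
  proof induction
    case (inv v)
    hence "case_prod s v \<noteq> 0"
      using assms(2) by (cases v) auto
    thus ?case
      using has_subst_inverse[OF has_subst_X] by blast
  qed (blast intro: has_subst_cst has_subst_X has_subst_add has_subst_mult)+
  thus ?thesis
    using has_subst_subst by blast
qed

lemma lp_subst:
  assumes "F \<in> lp V" "\<And>i a. (i, a) \<in> V \<Longrightarrow> s i a \<in> lunit W"
  shows "subst s F \<in> lp W"
proof -
  have "\<exists>G. has_subst s F G \<and> G \<in> lp W"
    using assms(1)
  proof induction
    case (var v)
    thus ?case
      using assms(2) by (cases v) (auto intro: has_subst_xvar lunit_lp)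
  next
    case (inv v)
    obtain i a where v: "v = (i, a)" by (cases v)
    have "has_subst s (inverse (X v)) (inverse (s i a))" "inverse (s i a) \<in> lp W"
      using assms(2) inv by (auto simp: v lunit_def intro: has_subst_intros)
    thus ?case by blast
  qed (blast intro: lp.cst lp.add lp.mult has_subst_cst has_subst_add has_subst_mult)+
  thus ?thesis
    using has_subst_imp_subst by blast
qed

lemma lp_subst_comp:
  assumes "F \<in> lp V"
    and "\<And>i a. (i, a) \<in> V \<Longrightarrow> t i a \<noteq> 0 \<and> u i a \<noteq> 0 \<and> has_subst s (t i a) (u i a)"
  shows "has_subst s (subst t F) (subst u F)" "subst s (subst t F) = subst u F"
proof -
  have "\<exists>F' G. has_subst t F F' \<and> has_subst s F' G \<and> has_subst u F G"
    using assms(1)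
  proof induction
    case (var v)
    thus ?case
      using assms(2) by (cases v) (auto intro: has_subst_xvar)
  next
    case (inv v)
    obtain i a where v: "v = (i, a)" by (cases v)
    have "has_subst t (inverse (X v)) (inverse (t i a))" "has_subst u (inverse (X v)) (inverse (u i a))"
      "has_subst s (inverse (t i a)) (inverse (u i a))"
      using assms(2) inv by (auto simp: v intro!: has_subst_intros)
    thus ?case by blast
  qed (blast intro: has_subst_cst has_subst_add has_subst_mult)+
  thus "has_subst s (subst t F) (subst u F)"
    using has_subst_imp_subst by metis
  thus "subst s (subst t F) = subst u F"
    by (rule has_subst_imp_subst)
qed

lemma lp_subst_cong:
  assumes "F \<in> lp V" "\<And>i a. (i, a) \<in> V \<Longrightarrow> s i a \<noteq> 0 \<and> s i a = t i a"
  shows "subst s F = subst t F"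
proof -
  have "\<exists>G. has_subst s F G \<and> has_subst t F G"
    using assms(1)
  proof induction
    case (var v)
    hence "case_prod s v = case_prod t v"
      using assms(2) by (cases v) auto
    thus ?case
      using has_subst_X[of s v] has_subst_X[of t v] by auto
  next
    case (inv v)
    hence "case_prod s v = case_prod t v \<and> case_prod t v \<noteq> 0"
      using assms(2)[of "fst v" "snd v"] by (cases v) auto
    thus ?case
      using has_subst_inverse[OF has_subst_X, of s v] has_subst_inverse[OF has_subst_X, of t v] by auto
  qed (blast intro: has_subst_cst has_subst_add has_subst_mult)+
  thus ?thesis
    using has_subst_imp_subst by metis
qed

lemma lp_subst_id:
  assumes "F \<in> lp V" "\<And>i a. (i, a) \<in> V \<Longrightarrow> s i a = xvar i a"
  shows "subst s F = F"
proof -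
  have X: "case_prod s v = X v" if "v \<in> V" for v
    using that assms(2) by (cases v) auto
  have "has_subst s F F"
    using assms(1)
  proof induction
    case (var v)
    thus ?case
      using has_subst_X[of s v] X by simp
  next
    case (inv v)
    thus ?case
      using has_subst_inverse[OF has_subst_X, of s v] X by simp
  qed (auto intro: has_subst_cst has_subst_add has_subst_mult)
  thus ?thesis
    by (rule has_subst_imp_subst)
qed

section \<open>Divisibility by linear forms\<close>

definition sub1 :: "nat \<times> nat \<Rightarrow> ratfun \<Rightarrow> nat \<Rightarrow> nat \<Rightarrow> ratfun" where
  "sub1 u E = (\<lambda>i a. if (i, a) = u then E else xvar i a)"

lemma sub1_unit:
  assumes "E \<in> lunit V" "(i, a) \<in> insert u V"
  shows "sub1 u E i a \<in> lunit V"
  using assms by (auto simp: sub1_def intro: lunit_intros)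

lemma sub1_neq_0: "E \<noteq> 0 \<Longrightarrow> sub1 u E i a \<noteq> 0"
  by (auto simp: sub1_def)

text \<open>
  The remainder theorem. It passes from \<open>F\<close> and \<open>G\<close> to \<open>F G\<close> because
  \<open>F G - F' G' = F (G - G') + (F - F') G'\<close>.
\<close>

lemma lp_minus_value_dvd:
  assumes F: "F \<in> lp V" and E: "E \<in> lunit V" "X u \<noteq> E"
  shows "(F - subst (sub1 u E) F) / (X u - E) \<in> lp V"
proof -
  let ?s = "sub1 u E"
  have ok: "has_subst ?s G (subst ?s G)" "subst ?s G \<in> lp V" if "G \<in> lp V" for G
    using lp_has_subst[OF that lunit_neq_0[OF sub1_unit[OF E(1)]]] lp_subst[OF that sub1_unit[OF E(1)]]
    by auto
  show ?thesis using F
  proof induction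
    case (cst c)
    thus ?case by (simp add: lp_0)
  next
    case (var v)
    thus ?case
      using E by (cases v; cases "v = u") (auto simp: sub1_def lp_0 lp_1)
  next
    case (inv v)
    obtain i a where v: "v = (i, a)" by (cases v)
    have s: "subst ?s (inverse (X v)) = inverse (?s i a)"
      unfolding v by (auto intro!: has_subst_imp_subst has_subst_inverse has_subst_xvar sub1_neq_0 lunit_neq_0[OF E(1)])
    show ?case
    proof (cases "v = u")
      case True
      have "(inverse (X u) - inverse E) / (X u - E) = - (inverse (X u) * inverse E)"
        using E lunit_neq_0[OF E(1)] by (simp add: field_simps)
      thus ?thesis
        using E inv s by (auto simp: True v[symmetric] sub1_def lunit_def v intro!: lp_uminus lp.mult lp.inv)
    next
      case False
      thus ?thesis
        using s by (simp add: v sub1_def lp_0)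
    qed
  next
    case (add F G)
    have "subst ?s (F + G) = subst ?s F + subst ?s G"
      using add by (intro has_subst_imp_subst has_subst_add ok)
    hence "(F + G - subst ?s (F + G)) / (X u - E) =
           (F - subst ?s F) / (X u - E) + (G - subst ?s G) / (X u - E)"
      by (simp add: diff_divide_distrib add_divide_distrib)
    thus ?case
      using add by (simp add: lp.add)
  next
    case (mult F G)
    have "subst ?s (F * G) = subst ?s F * subst ?s G"
      using mult by (intro has_subst_imp_subst has_subst_mult ok)
    hence "(F * G - subst ?s (F * G)) / (X u - E) =
           F * ((G - subst ?s G) / (X u - E)) + (F - subst ?s F) / (X u - E) * subst ?s G"
      by (simp add: field_simps diff_divide_distrib add_divide_distrib)
    moreover have "F * ((G - subst ?s G) / (X u - E)) + (F - subst ?s F) / (X u - E) * subst ?s G \<in> lp V"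
      by (intro lp.add lp.mult mult ok)
    ultimately show ?case
      by simp
  qed
qed

text \<open>
  The form \<open>x\<^sub>u - c x\<^sub>w\<close> is coded as a triple, so that finite sets of forms can be named and the variable
  \<open>x\<^sub>u\<close> to be eliminated is marked.
\<close>

definition lin :: "(nat \<times> nat) \<times> complex \<times> (nat \<times> nat) \<Rightarrow> ratfun" where
  "lin k = (case k of (u, c, w) \<Rightarrow> X u - cst c * X w)"

definition root_sub :: "(nat \<times> nat) \<times> complex \<times> (nat \<times> nat) \<Rightarrow> nat \<Rightarrow> nat \<Rightarrow> ratfun" where
  "root_sub k = (case k of (u, c, w) \<Rightarrow> sub1 u (cst c * X w))"

definition lin_in :: "(nat \<times> nat) set \<Rightarrow> (nat \<times> nat) \<times> complex \<times> (nat \<times> nat) \<Rightarrow> bool" where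
  "lin_in V k = (case k of (u, c, w) \<Rightarrow> u \<in> V \<and> w \<in> V \<and> u \<noteq> w \<and> c \<noteq> 0)"

lemma lin_neq_0: "lin_in V k \<Longrightarrow> lin k \<noteq> 0"
  using linear_form_eq_0[of 1 "fst k" "fst (snd k)" "snd (snd k)"]
  by (auto simp: lin_def lin_in_def split: prod.splits)

lemma lin_lp: "lin_in V k \<Longrightarrow> lin k \<in> lp V"
  unfolding lin_def lin_in_def by (auto split: prod.splits intro!: lp_diff lp.intros intro: lp.var[of "(_, _)", simplified])

lemma root_neq_0: "lin_in V k \<Longrightarrow> root_sub k i a \<noteq> 0"
  unfolding root_sub_def lin_in_def by (auto split: prod.splits simp: sub1_def)

lemma lp_root:
  assumes "F \<in> lp V" "lin_in V k" "subst (root_sub k) F = 0"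
  shows "F / lin k \<in> lp V"
proof -
  obtain u c w where k: "k = (u, c, w)" by (cases k)
  have "X u \<noteq> cst c * X w"
    using lin_neq_0[OF assms(2)] by (simp add: k lin_def)
  thus ?thesis
    using lp_minus_value_dvd[OF assms(1), of "cst c * X w" u] assms(2,3)
    by (auto simp: k lin_def root_sub_def lin_in_def intro!: lunit_intros)
qed

lemma root_lin_eq_0:
  assumes "lin_in V k"
  shows "has_subst (root_sub k) (lin k) 0"
proof -
  obtain u c w where k: "k = (u, c, w)" by (cases k)
  have "has_subst (root_sub k) (lin k) (case_prod (root_sub k) u - cst c * case_prod (root_sub k) w)"
    unfolding k lin_def prod.case by (intro has_subst_intros)
  thus ?thesis
    using assms by (cases u; cases w) (auto simp: k lin_in_def root_sub_def sub1_def)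
qed

lemma root_lin_neq_0:
  assumes "lin_in V (u, c, w)" "lin_in W (u', c', w')"
    and "(u', c', w') \<noteq> (u, c, w)" "\<not> (u' = w \<and> w' = u)"
  shows "subst (root_sub (u, c, w)) (lin (u', c', w')) \<noteq> 0"
proof -
  let ?s = "root_sub (u, c, w)"
  have s: "case_prod ?s v = (if v = u then cst c * X w else X v)" for v
    by (cases v) (simp add: root_sub_def sub1_def)
  have eq: "subst ?s (lin (u', c', w')) = case_prod ?s u' - cst c' * case_prod ?s w'"
    unfolding lin_def prod.case by (intro has_subst_imp_subst has_subst_intros)
  show ?thesis
  proof
    assume "subst ?s (lin (u', c', w')) = 0"
    hence *: "case_prod ?s u' = cst c' * case_prod ?s w'"
      by (simp add: eq)
    consider "u' = u" | "u' \<noteq> u" "w' = u" | "u' \<noteq> u" "w' \<noteq> u" by blast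
    thus False
    proof cases
      case 1
      with * assms show False
        using linear_form_eq_0[of c w c' w'] by (auto simp: s lin_in_def split: if_splits)
    next
      case 2
      with * assms show False
        using linear_form_eq_0[of 1 u' "c' * c" w] by (auto simp: s lin_in_def cst_mult mult.assoc)
    next
      case 3
      with * assms show False
        using linear_form_eq_0[of 1 u' c' w'] by (auto simp: s lin_in_def)
    qed
  qed
qed

text \<open>
  Linear forms are prime: where \<open>lin k\<close> is zero and \<open>D\<close> is not, the zeros of \<open>D g\<close> are those of \<open>g\<close>, and
  this is repeated order by order.
\<close>

lemma lp_cancel_factor:
  assumes k: "lin_in V k" and D: "D \<in> lp V" "subst (root_sub k) D \<noteq> 0" and g: "g \<in> lp V"
    and dvd: "D * g / lin k ^ e \<in> lp V"
  shows "g / lin k ^ e \<in> lp V"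
  using dvd
proof (induction e)
  case (Suc e)
  let ?l = "lin k"
  have l0: "?l \<noteq> 0"
    using lin_neq_0[OF k] .
  have ok: "has_subst (root_sub k) G (subst (root_sub k) G)" if "G \<in> lp V" for G
    using that root_neq_0[OF k] by (intro lp_has_subst)
  have eq: "D * g / ?l ^ e = ?l * (D * g / ?l ^ Suc e)"
    using l0 by (simp add: field_simps)
  have "D * g / ?l ^ e \<in> lp V"
    unfolding eq by (intro lp.mult lin_lp[OF k] Suc.prems)
  hence IH: "g / ?l ^ e \<in> lp V"
    using Suc.IH by blast
  have "has_subst (root_sub k) (?l * (D * g / ?l ^ Suc e)) (0 * subst (root_sub k) (D * g / ?l ^ Suc e))"
    by (intro has_subst_mult root_lin_eq_0[OF k] ok Suc.prems)
  moreover have "has_subst (root_sub k) (D * (g / ?l ^ e)) (subst (root_sub k) D * subst (root_sub k) (g / ?l ^ e))"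
    by (intro has_subst_mult ok IH D)
  ultimately have "subst (root_sub k) D * subst (root_sub k) (g / ?l ^ e) = 0"
    using has_subst_unique eq by (metis mult_zero_left times_divide_eq_right)
  hence "g / ?l ^ e / ?l \<in> lp V"
    using D(2) by (intro lp_root IH k) simp
  thus ?case
    by (simp add: field_simps)
qed (simp add: g)

text \<open>
  The forms are split off one at a time; a quotient by the forms already treated stays divisible by the
  next one, because no other form vanishes on its zero locus.
\<close>

lemma lp_prod_dvd:
  assumes "finite K" "\<And>k. k \<in> K \<Longrightarrow> lin_in V k"
    and coprime: "\<And>k k'. k \<in> K \<Longrightarrow> k' \<in> K \<Longrightarrow> k \<noteq> k' \<Longrightarrow> subst (root_sub k) (lin k') \<noteq> 0"
    and p: "p \<in> lp V" "\<And>k. k \<in> K \<Longrightarrow> p / lin k ^ e k \<in> lp V"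
  shows "p / (\<Prod>k\<in>K. lin k ^ e k) \<in> lp V"
  using assms
proof (induction K)
  case (insert k K)
  let ?D = "\<Prod>k\<in>K. lin k ^ e k"
  have K: "lin_in V k'" if "k' \<in> K" for k'
    using insert.prems(1) that by auto
  have k: "lin_in V k"
    using insert.prems(1) by auto
  have D0: "?D \<noteq> 0"
    using lin_neq_0[OF K] insert.hyps(1) by simp
  have ok: "has_subst (root_sub k) (lin k') (subst (root_sub k) (lin k'))" if "k' \<in> K" for k'
    by (rule lp_has_subst[OF lin_lp[OF K[OF that]] root_neq_0[OF k]])
  have "subst (root_sub k) ?D = (\<Prod>k'\<in>K. subst (root_sub k) (lin k') ^ e k')"
    using ok by (intro has_subst_imp_subst has_subst_prod has_subst_power)
  also have "\<dots> \<noteq> 0"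
  proof -
    have "subst (root_sub k) (lin k') \<noteq> 0" if "k' \<in> K" for k'
      using insert.prems(2)[of k k'] insert.hyps(2) that by auto
    thus ?thesis
      using insert.hyps(1) by simp
  qed
  finally have D: "subst (root_sub k) ?D \<noteq> 0" .
  have g: "p / ?D \<in> lp V"
    by (rule insert.IH) (use insert.prems in blast)+
  have "?D * (p / ?D) / lin k ^ e k \<in> lp V"
    using insert.prems(4)[of k] D0 by simp
  moreover have "?D \<in> lp V"
    by (intro lp_prod lp_power lin_lp K)
  ultimately have "p / ?D / lin k ^ e k \<in> lp V"
    using lp_cancel_factor[OF k _ D g] by blast
  thus ?case
    using insert.hyps by (simp add: mult.commute)
qed simp

text \<open>
  Zeros of higher order: if \<open>F\<close> depends on several variables \<open>\<xi>\<^sub>k\<close> and vanishes on each hyperplane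
  \<open>\<xi>\<^sub>k = \<kappa>\<^sub>k c w\<close>, then it is divisible by the product of the corresponding linear forms, and all of them
  become multiples of \<open>v - c w\<close> when the \<open>\<xi>\<^sub>k\<close> are identified with multiples of \<open>v\<close>.
\<close>

lemma lp_multiple_root:
  assumes F: "F \<in> lp (V \<union> \<xi> ` T)" and T: "finite T" "inj_on \<xi> T" "\<xi> ` T \<inter> V = {}"
    and lin: "lin_in V (v, c, w)" and \<kappa>: "\<And>k. k \<in> T \<Longrightarrow> \<kappa> k \<noteq> 0"
    and zero: "\<And>k. k \<in> T \<Longrightarrow> subst (sub1 (\<xi> k) (cst (\<kappa> k * c) * X w)) F = 0"
    and \<tau>: "\<And>k. k \<in> T \<Longrightarrow> case_prod \<tau> (\<xi> k) = cst (\<kappa> k) * X v"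
      "\<And>i a. (i, a) \<in> V \<Longrightarrow> \<tau> i a = xvar i a"
  shows "subst \<tau> F / lin (v, c, w) ^ card T \<in> lp V"
proof -
  let ?V = "V \<union> \<xi> ` T" and ?K = "(\<lambda>k. (\<xi> k, \<kappa> k * c, w)) ` T"
  have vw: "v \<in> V" "w \<in> V" "v \<noteq> w" "c \<noteq> 0"
    using lin by (auto simp: lin_in_def)
  have lin': "lin_in ?V (\<xi> k, \<kappa> k * c, w)" if "k \<in> T" for k
    using that T vw \<kappa> by (auto simp: lin_in_def)
  have "F / (\<Prod>k\<in>?K. lin k ^ 1) \<in> lp ?V"
  proof (rule lp_prod_dvd)
    show "subst (root_sub k) (lin k') \<noteq> 0" if kk: "k \<in> ?K" "k' \<in> ?K" "k \<noteq> k'" for k k'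
    proof -
      obtain a b where ab: "a \<in> T" "b \<in> T" "k = (\<xi> a, \<kappa> a * c, w)" "k' = (\<xi> b, \<kappa> b * c, w)"
        using kk(1,2) by blast
      have "\<xi> b \<noteq> w"
        using ab T(3) vw by auto
      thus ?thesis
        unfolding ab(3,4) using kk(3) ab by (intro root_lin_neq_0[OF lin' lin']) auto
    qed
    show "F / lin k ^ 1 \<in> lp ?V" if "k \<in> ?K" for k
      using that F lin' zero by (auto intro!: lp_root simp: root_sub_def)
  qed (use T F lin' in auto)
  also have "(\<Prod>k\<in>?K. lin k ^ 1) = (\<Prod>k\<in>T. lin (\<xi> k, \<kappa> k * c, w))"
    using T(2) by (subst prod.reindex) (auto simp: inj_on_def)
  finally have "F / (\<Prod>k\<in>T. lin (\<xi> k, \<kappa> k * c, w)) \<in> lp ?V" .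
  moreover define h where "h = F / (\<Prod>k\<in>T. lin (\<xi> k, \<kappa> k * c, w))"
  ultimately have h: "h \<in> lp ?V"
    by simp
  have F_eq: "F = h * (\<Prod>k\<in>T. lin (\<xi> k, \<kappa> k * c, w))"
    using lin_neq_0[OF lin'] T(1) by (simp add: h_def)
  have \<tau>_unit: "\<tau> i a \<in> lunit V" if ia: "(i, a) \<in> ?V" for i a
  proof (cases "(i, a) \<in> V")
    case False
    then obtain k where "k \<in> T" "\<xi> k = (i, a)"
      using ia by auto
    thus ?thesis
      using \<tau>(1)[of k] \<kappa>[of k] vw by (auto intro: lunit_intros)
  qed (use \<tau> in \<open>auto intro: lunit_intros\<close>)
  have h': "has_subst \<tau> h (subst \<tau> h)"
    using \<tau>_unit by (intro lp_has_subst[OF h] lunit_neq_0)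
  have lin_\<tau>: "has_subst \<tau> (lin (\<xi> k, \<kappa> k * c, w)) (cst (\<kappa> k) * lin (v, c, w))" if "k \<in> T" for k
  proof -
    have "has_subst \<tau> (lin (\<xi> k, \<kappa> k * c, w)) (cst (\<kappa> k) * X v - cst (\<kappa> k * c) * X w)"
      unfolding lin_def prod.case
      using has_subst_X[of \<tau> "\<xi> k"] \<tau>(1)[OF that] has_subst_X[of \<tau> w] \<tau>(2) vw
      by (intro has_subst_intros) (auto split: prod.splits)
    thus ?thesis
      by (simp add: lin_def cst_mult algebra_simps)
  qed
  have "subst \<tau> F = subst \<tau> h * (\<Prod>k\<in>T. cst (\<kappa> k) * lin (v, c, w))"
    unfolding F_eq by (intro has_subst_imp_subst has_subst_mult h' has_subst_prod lin_\<tau>)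
  hence "subst \<tau> F / lin (v, c, w) ^ card T = subst \<tau> h * (\<Prod>k\<in>T. cst (\<kappa> k))"
    using lin_neq_0[OF lin] by (simp add: prod.distrib)
  thus ?thesis
    using lp_subst[OF h \<tau>_unit] by (simp add: lp.mult lp_prod lp.cst)
qed

section \<open>Separating two groups of variables\<close>

lemma poly_mapping_add_split:
  fixes e e' f f' :: "nat \<Rightarrow>\<^sub>0 nat"
  assumes "Poly_Mapping.keys e \<subseteq> A" "Poly_Mapping.keys e' \<subseteq> A"
    and "Poly_Mapping.keys f \<subseteq> B" "Poly_Mapping.keys f' \<subseteq> B" and "A \<inter> B = {}"
  shows "e + f = e' + f' \<longleftrightarrow> e = e' \<and> f = f'"
proof
  assume eq: "e + f = e' + f'"
  have look: "Poly_Mapping.lookup e v + Poly_Mapping.lookup f v =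
              Poly_Mapping.lookup e' v + Poly_Mapping.lookup f' v" for v
    using eq by (metis lookup_add)
  have zero: "Poly_Mapping.lookup g v = 0" if "Poly_Mapping.keys g \<subseteq> C" "v \<notin> C"
    for g :: "nat \<Rightarrow>\<^sub>0 nat" and C v
    using that by (auto simp: in_keys_iff)
  have "Poly_Mapping.lookup e v = Poly_Mapping.lookup e' v \<and>
        Poly_Mapping.lookup f v = Poly_Mapping.lookup f' v" for v
  proof (cases "v \<in> A")
    case True
    hence "v \<notin> B" using assms(5) by blast
    thus ?thesis using look[of v] zero assms(3,4) by simp
  next
    case False
    thus ?thesis using look[of v] zero assms(1,2) by simp
  qed
  thus "e = e' \<and> f = f'"
    by (simp add: poly_mapping_eqI)
qed simp

text \<open>
  A monomial of a product in two disjoint groups of variables determines its two factors, so there is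
  no cancellation.
\<close>

lemma lookup_mult_separate:
  assumes "poly_in A p" "poly_in B a" "A \<inter> B = {}"
    and "Poly_Mapping.keys e \<subseteq> A" "Poly_Mapping.keys f \<subseteq> B"
  shows "Poly_Mapping.lookup (p * a) (e + f) = Poly_Mapping.lookup p e * Poly_Mapping.lookup a f"
proof (induction p rule: poly_mapping_additive_induct)
  case (single e' c)
  show ?case
  proof (induction a rule: poly_mapping_additive_induct)
    case (single f' c')
    have "e' + f' = e + f \<longleftrightarrow> e' = e \<and> f' = f"
      by (rule poly_mapping_add_split[of _ A _ _ B])
         (use assms \<open>e' \<in> Poly_Mapping.keys p\<close> single in \<open>auto simp: poly_in_def\<close>)
    thus ?case
      by (auto simp: mult_single lookup_single when_def)
  qed (simp_all add: distrib_left lookup_add)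
qed (simp_all add: distrib_right lookup_add)

text \<open>
  A linear relation with coefficients in other variables can be read off at one monomial of those
  variables, where it becomes a relation with complex coefficients.
\<close>

lemma poly_relation_imp_constant_relation:
  assumes "finite I" "\<And>i. i \<in> I \<Longrightarrow> poly_in A (p i) \<and> poly_in B (a i)" "A \<inter> B = {}"
    and sum: "(\<Sum>i\<in>I. p i * a i) = 0" and j: "j \<in> I" "a j \<noteq> 0"
  shows "\<exists>c. (\<exists>i\<in>I. c i \<noteq> 0) \<and> (\<Sum>i\<in>I. Poly_Mapping.single 0 (c i) * p i) = 0"
proof -
  obtain f where f: "f \<in> Poly_Mapping.keys (a j)"
    using j(2) by (metis all_not_in_conv keys_eq_empty)
  define c where "c i = Poly_Mapping.lookup (a i) f" for i
  have fB: "Poly_Mapping.keys f \<subseteq> B"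
    using assms(2)[OF j(1)] f by (auto simp: poly_in_def)
  have "Poly_Mapping.lookup (\<Sum>i\<in>I. Poly_Mapping.single 0 (c i) * p i) e = 0" for e
  proof -
    have single: "Poly_Mapping.lookup (Poly_Mapping.single 0 k * r) e = k * Poly_Mapping.lookup r e"
      for k and r :: cpoly
      by (induction r rule: poly_mapping_additive_induct)
         (auto simp: mult_single lookup_single when_def distrib_left lookup_add)
    have eq: "Poly_Mapping.lookup (\<Sum>i\<in>I. Poly_Mapping.single 0 (c i) * p i) e =
          (\<Sum>i\<in>I. Poly_Mapping.lookup (p i) e * c i)"
      unfolding lookup_sum single by (simp add: mult.commute)
    show ?thesis
    proof (cases "Poly_Mapping.keys e \<subseteq> A")
      case True
      have "(\<Sum>i\<in>I. Poly_Mapping.lookup (p i) e * c i) =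
            Poly_Mapping.lookup (\<Sum>i\<in>I. p i * a i) (e + f)"
        unfolding lookup_sum c_def using assms(2,3) True fB
        by (intro sum.cong refl lookup_mult_separate[symmetric, of A _ B]) auto
      thus ?thesis
        using sum eq by simp
    next
      case False
      have "Poly_Mapping.lookup (p i) e = 0" if "i \<in> I" for i
        using assms(2)[OF that] False by (auto simp: poly_in_def in_keys_iff)
      thus ?thesis
        using eq by simp
    qed
  qed
  hence "(\<Sum>i\<in>I. Poly_Mapping.single 0 (c i) * p i) = 0"
    by (simp add: poly_mapping_eqI)
  moreover have "c j \<noteq> 0"
    using f by (simp add: c_def in_keys_iff)
  ultimately show ?thesis
    using j(1) by blast
qed

lemma lp_common_denominator:
  assumes "finite I" "\<And>i. i \<in> I \<Longrightarrow> F i \<in> lp V"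
  shows "\<exists>Q P. Q \<noteq> 0 \<and> poly_in (prod_encode ` V) Q \<and>
           (\<forall>i\<in>I. poly_in (prod_encode ` V) (P i) \<and>
                  F i * Fraction_Field.Fract Q 1 = Fraction_Field.Fract (P i) 1)"
  using assms
proof (induction I)
  case empty
  show ?case by (intro exI[of _ 1]) (auto simp: poly_in_def)
next
  case (insert k I)
  let ?W = "prod_encode ` V" and ?emb = "\<lambda>p::cpoly. Fraction_Field.Fract p 1"
  obtain Q P where Q: "Q \<noteq> 0" "poly_in ?W Q"
      and P: "\<And>i. i \<in> I \<Longrightarrow> poly_in ?W (P i) \<and> F i * ?emb Q = ?emb (P i)"
    using insert by blast
  obtain p e where p: "F k = Fraction_Field.Fract p (Poly_Mapping.single e 1)" "poly_in ?W p"
      "Poly_Mapping.keys e \<subseteq> ?W"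
    using insert.prems[of k] unfolding lp_eq_laurent_polys laurent_polys_def poly_in_def by blast
  let ?m = "Poly_Mapping.single e 1 :: cpoly"
  have m: "?m \<noteq> 0" "poly_in ?W ?m"
    using p(3) by (auto simp: single_neq_0 poly_in_single)
  define P' where "P' i = (if i = k then p * Q else P i * ?m)" for i
  have "poly_in ?W (P' i) \<and> F i * ?emb (Q * ?m) = ?emb (P' i)" if "i \<in> insert k I" for i
  proof (cases "i = k")
    case True
    thus ?thesis
      using p m Q by (simp add: P'_def poly_in_mult eq_fract mult_ac)
  next
    case False
    hence i: "i \<in> I" using that by simp
    have "F i * ?emb (Q * ?m) = F i * ?emb Q * ?emb ?m"
      by simp
    also have "\<dots> = ?emb (P i * ?m)"
      using P[OF i] by simp
    finally show ?thesis
      using P[OF i] m False by (simp add: P'_def poly_in_mult)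
  qed
  thus ?case
    using Q m by (intro exI[of _ "Q * ?m"] exI[of _ P']) (simp add: poly_in_mult)
qed

lemma sum_Fract_1: "(\<Sum>i\<in>I. Fraction_Field.Fract (p i) 1) = Fraction_Field.Fract (\<Sum>i\<in>I. p i :: cpoly) 1"
  by (induction I rule: infinite_finite_induct) (simp_all add: Zero_fract_def)

lemma lp_relation_imp_constant_relation:
  assumes I: "finite I" and F: "\<And>i. i \<in> I \<Longrightarrow> F i \<in> lp V" and a: "\<And>i. i \<in> I \<Longrightarrow> a i \<in> lp W"
    and VW: "V \<inter> W = {}" and sum: "(\<Sum>i\<in>I. F i * a i) = 0" and j: "j \<in> I" "a j \<noteq> 0"
  shows "\<exists>c. (\<exists>i\<in>I. c i \<noteq> 0) \<and> (\<Sum>i\<in>I. cst (c i) * F i) = 0"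
proof -
  let ?emb = "\<lambda>p::cpoly. Fraction_Field.Fract p 1"
  obtain Q P where Q: "Q \<noteq> 0" and "\<forall>i\<in>I. poly_in (prod_encode ` V) (P i) \<and>
      F i * ?emb Q = ?emb (P i)"
    using lp_common_denominator[of I F V] I F by meson
  hence P: "\<And>i. i \<in> I \<Longrightarrow> poly_in (prod_encode ` V) (P i) \<and> F i * ?emb Q = ?emb (P i)"
    by simp
  obtain R A where R: "R \<noteq> 0" and "\<forall>i\<in>I. poly_in (prod_encode ` W) (A i) \<and>
      a i * ?emb R = ?emb (A i)"
    using lp_common_denominator[of I a W] I a by meson
  hence A: "\<And>i. i \<in> I \<Longrightarrow> poly_in (prod_encode ` W) (A i) \<and> a i * ?emb R = ?emb (A i)"
    by simp
  have emb0: "?emb p = 0 \<longleftrightarrow> p = 0" for p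
    using eq_fract(1)[of 1 1 p 0] by (simp flip: Zero_fract_def)
  have "?emb (\<Sum>i\<in>I. P i * A i) = (\<Sum>i\<in>I. ?emb (P i) * ?emb (A i))"
    unfolding sum_Fract_1[symmetric] by simp
  also have "\<dots> = (\<Sum>i\<in>I. (F i * a i) * (?emb Q * ?emb R))"
  proof (intro sum.cong refl)
    fix i assume "i \<in> I"
    hence eqs: "?emb (P i) = F i * ?emb Q" "?emb (A i) = a i * ?emb R"
      using P A by auto
    show "?emb (P i) * ?emb (A i) = (F i * a i) * (?emb Q * ?emb R)"
      unfolding eqs by (simp only: mult_ac)
  qed
  also have "\<dots> = 0"
    unfolding sum_distrib_right[symmetric] sum by simp
  finally have "(\<Sum>i\<in>I. P i * A i) = 0"
    by (simp add: emb0)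
  moreover have "A j \<noteq> 0"
  proof
    assume "A j = 0"
    hence "a j * ?emb R = 0"
      using A[OF j(1)] emb0[of 0] by simp
    thus False
      using j(2) R emb0[of R] by simp
  qed
  moreover have "prod_encode ` V \<inter> prod_encode ` W = {}"
    using VW by (simp flip: image_Int[OF inj_prod_encode])
  ultimately obtain c where c: "\<exists>i\<in>I. c i \<noteq> 0" "(\<Sum>i\<in>I. Poly_Mapping.single 0 (c i) * P i) = 0"
    using poly_relation_imp_constant_relation[OF I, of "prod_encode ` V" P "prod_encode ` W" A j] P A j
    by blast
  have "(\<Sum>i\<in>I. cst (c i) * F i) * ?emb Q = (\<Sum>i\<in>I. cst (c i) * ?emb (P i))"
    unfolding sum_distrib_right using P by (intro sum.cong refl) (auto simp: mult.assoc)
  also have "\<dots> = 0"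
    using c(2) by (simp add: cst_def emb0 sum_Fract_1)
  finally have "(\<Sum>i\<in>I. cst (c i) * F i) = 0"
    using Q emb0[of Q] by simp
  thus ?thesis
    using c(1) by blast
qed

definition tensor_rep :: "(nat \<times> nat) set \<Rightarrow> (nat \<times> nat) set \<Rightarrow> ratfun \<Rightarrow> nat set \<Rightarrow>
    (nat \<Rightarrow> ratfun) \<Rightarrow> (nat \<Rightarrow> ratfun) \<Rightarrow> bool" where
  "tensor_rep V W h I p r \<longleftrightarrow> finite I \<and> (\<forall>i\<in>I. p i \<in> lp V \<and> r i \<in> lp W) \<and> h = (\<Sum>i\<in>I. p i * r i)"

lemma tensor_rep_swap: "tensor_rep V W h I p r \<longleftrightarrow> tensor_rep W V h I r p"
  by (auto simp: tensor_rep_def mult.commute)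

lemma tensor_rep_exists:
  assumes "h \<in> lp (V \<union> W)"
  shows "\<exists>I p r. tensor_rep V W h I p r"
proof -
  have "\<exists>ps. set ps \<subseteq> lp V \<times> lp W \<and> h = (\<Sum>(p, r)\<leftarrow>ps. p * r)"
    using assms
  proof induction
    case (cst c)
    thus ?case by (intro exI[of _ "[(cst c, 1)]"]) (auto intro: lp.cst lp_1)
  next
    case (var v)
    thus ?case
    proof
      assume "v \<in> V"
      thus ?thesis by (intro exI[of _ "[(X v, 1)]"]) (simp add: lp.var lp_1)
    next
      assume "v \<in> W"
      thus ?thesis by (intro exI[of _ "[(1, X v)]"]) (simp add: lp.var lp_1)
    qed
  next
    case (inv v)
    thus ?case
    proof
      assume "v \<in> V"
      thus ?thesis by (intro exI[of _ "[(inverse (X v), 1)]"]) (simp add: lp.inv lp_1)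
    next
      assume "v \<in> W"
      thus ?thesis by (intro exI[of _ "[(1, inverse (X v))]"]) (simp add: lp.inv lp_1)
    qed
  next
    case (add F G)
    then obtain ps qs where "set ps \<subseteq> lp V \<times> lp W" "F = (\<Sum>(p, r)\<leftarrow>ps. p * r)"
      "set qs \<subseteq> lp V \<times> lp W" "G = (\<Sum>(p, r)\<leftarrow>qs. p * r)" by blast
    thus ?case by (intro exI[of _ "ps @ qs"]) auto
  next
    case (mult F G)
    then obtain ps qs where *: "set ps \<subseteq> lp V \<times> lp W" "F = (\<Sum>(p, r)\<leftarrow>ps. p * r)"
      "set qs \<subseteq> lp V \<times> lp W" "G = (\<Sum>(p, r)\<leftarrow>qs. p * r)" by blast
    have row: "(\<Sum>(p', r')\<leftarrow>map (\<lambda>(p', r'). (p * p', r * r')) qs. p' * r') = p * r * G" for p r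
      unfolding *(4) by (induction qs) (auto simp: algebra_simps)
    have "F * G = (\<Sum>(p, r)\<leftarrow>concat (map (\<lambda>(p, r). map (\<lambda>(p', r'). (p * p', r * r')) qs) ps). p * r)"
      unfolding *(2)
    proof (induction ps)
      case (Cons x ps)
      obtain p r where "x = (p, r)" by (cases x)
      thus ?case using Cons row[of p r] by (simp add: distrib_right)
    qed simp
    moreover have "set (concat (map (\<lambda>(p, r). map (\<lambda>(p', r'). (p * p', r * r')) qs) ps)) \<subseteq> lp V \<times> lp W"
      using *(1,3) by (force intro: lp.mult)
    ultimately show ?case by blast
  qed
  then obtain ps where ps: "set ps \<subseteq> lp V \<times> lp W" "h = (\<Sum>(p, r)\<leftarrow>ps. p * r)" by blast
  have "tensor_rep V W h {..<length ps} (\<lambda>i. fst (ps ! i)) (\<lambda>i. snd (ps ! i))"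
    unfolding tensor_rep_def
  proof (intro conjI ballI)
    fix i assume "i \<in> {..<length ps}"
    hence "ps ! i \<in> lp V \<times> lp W"
      using ps(1) nth_mem by blast
    thus "fst (ps ! i) \<in> lp V" "snd (ps ! i) \<in> lp W" by auto
  qed (auto simp: ps(2) sum_list_sum_nth case_prod_beta atLeast0LessThan)
  thus ?thesis by blast
qed

text \<open>A shortest representation has independent left factors: a relation would shorten it.\<close>

lemma tensor_rep_shorten:
  assumes rep: "tensor_rep V W h I p r" and j: "j \<in> I" "c j \<noteq> 0"
    and rel: "(\<Sum>i\<in>I. cst (c i) * p i) = 0"
  shows "\<exists>r'. tensor_rep V W h (I - {j}) p r'"
proof -
  define r' where "r' i = r i - cst (c i / c j) * r j" for i
  have I: "finite I" and p: "\<And>i. i \<in> I \<Longrightarrow> p i \<in> lp V \<and> r i \<in> lp W" and h: "h = (\<Sum>i\<in>I. p i * r i)"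
    using rep by (auto simp: tensor_rep_def)
  have "(\<Sum>i\<in>I. p i * r' i) = h - (\<Sum>i\<in>I. cst (c i) * p i) * (r j / cst (c j))"
    unfolding h r'_def sum_distrib_right
    by (simp add: algebra_simps sum_subtractf cst_divide)
  also have "\<dots> = h"
    using rel by simp
  also have "(\<Sum>i\<in>I. p i * r' i) = (\<Sum>i\<in>I - {j}. p i * r' i)"
    using j I by (intro sum.mono_neutral_right) (auto simp: r'_def)
  finally have "h = (\<Sum>i\<in>I - {j}. p i * r' i)" ..
  moreover have "r' i \<in> lp W" if "i \<in> I" for i
    unfolding r'_def using p j that by (intro lp_diff lp.mult lp.cst) auto
  ultimately have "tensor_rep V W h (I - {j}) p r'"
    using I p by (auto simp: tensor_rep_def)
  thus ?thesis by blast
qed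

lemma tensor_rep_independent:
  assumes h: "h \<in> lp (V \<union> W)" and VW: "V \<inter> W = {}"
  obtains I p r where "tensor_rep V W h I p r"
    and "\<And>a i. (\<And>i. i \<in> I \<Longrightarrow> a i \<in> lp W) \<Longrightarrow> (\<Sum>i\<in>I. p i * a i) = 0 \<Longrightarrow> i \<in> I \<Longrightarrow> a i = 0"
    and "\<And>b i. (\<And>i. i \<in> I \<Longrightarrow> b i \<in> lp V) \<Longrightarrow> (\<Sum>i\<in>I. b i * r i) = 0 \<Longrightarrow> i \<in> I \<Longrightarrow> b i = 0"
proof -
  \<comment> \<open>One shortest representation serves for both sides, since shortening is symmetric in \<open>V\<close> and \<open>W\<close>.\<close>
  define P where "P n \<longleftrightarrow> (\<exists>I p r. tensor_rep V W h I p r \<and> card I = n)" for n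
  have "\<exists>n. P n"
    using tensor_rep_exists[OF h] by (auto simp: P_def)
  hence "P (LEAST n. P n)"
    by (rule LeastI_ex)
  then obtain I p r where rep: "tensor_rep V W h I p r" and card: "card I = (LEAST n. P n)"
    by (auto simp: P_def)
  have I: "finite I" and pr: "\<And>i. i \<in> I \<Longrightarrow> p i \<in> lp V \<and> r i \<in> lp W"
    using rep by (auto simp: tensor_rep_def)
  have no_shorter: False if "j \<in> I" "tensor_rep V W h (I - {j}) p' r'" for j p' r'
  proof -
    have "P (card (I - {j}))"
      using that(2) by (auto simp: P_def)
    moreover have "card (I - {j}) < card I"
      using I that(1) by (intro psubset_card_mono) auto
    ultimately show False
      by (metis card not_less_Least)
  qed
  have "a i = 0" if a: "\<And>i. i \<in> I \<Longrightarrow> a i \<in> lp W" "(\<Sum>i\<in>I. p i * a i) = 0" "i \<in> I" for a i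
  proof (rule ccontr)
    assume "a i \<noteq> 0"
    then obtain c where "\<exists>i\<in>I. c i \<noteq> 0" "(\<Sum>i\<in>I. cst (c i) * p i) = 0"
      using lp_relation_imp_constant_relation[OF I, of p V a W i] pr a VW by blast
    thus False
      using tensor_rep_shorten[OF rep] no_shorter by blast
  qed
  moreover have "b i = 0" if b: "\<And>i. i \<in> I \<Longrightarrow> b i \<in> lp V" "(\<Sum>i\<in>I. b i * r i) = 0" "i \<in> I" for b i
  proof (rule ccontr)
    assume "b i \<noteq> 0"
    moreover have "(\<Sum>i\<in>I. r i * b i) = 0" "W \<inter> V = {}"
      using b(2) VW by (auto simp: mult.commute)
    ultimately obtain c where "\<exists>i\<in>I. c i \<noteq> 0" "(\<Sum>i\<in>I. cst (c i) * r i) = 0"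
      using lp_relation_imp_constant_relation[OF I, of r W b V i] pr b by blast
    thus False
      using tensor_rep_shorten[OF rep[unfolded tensor_rep_swap[of V]]] no_shorter
      unfolding tensor_rep_swap[of V] by blast
  qed
  ultimately show thesis
    using that[OF rep] by blast
qed

text \<open>
  For an independent representation, conditions that involve only one group of variables can be
  checked on the factors: this applies to the vanishing of, and to the invariance under, a
  substitution that leaves the other group alone.
\<close>

lemma tensor_rep_subst:
  assumes rep: "tensor_rep V W h I p r" and VW: "V \<inter> W = {}"
    and s: "\<And>i a. (i, a) \<in> V \<Longrightarrow> s i a \<in> lunit V" "\<And>i a. (i, a) \<in> W \<Longrightarrow> s i a = xvar i a"
  shows "subst s h = (\<Sum>i\<in>I. subst s (p i) * r i)"
proof -
  have "has_subst s h (\<Sum>i\<in>I. subst s (p i) * r i)"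
  proof -
    have *: "has_subst s (p i) (subst s (p i))" "has_subst s (r i) (r i)" if "i \<in> I" for i
    proof -
      have pr: "p i \<in> lp V" "r i \<in> lp W"
        using rep that by (auto simp: tensor_rep_def)
      show "has_subst s (p i) (subst s (p i))"
        by (rule lp_has_subst[OF pr(1) lunit_neq_0[OF s(1)]])
      show "has_subst s (r i) (r i)"
        using lp_has_subst[OF pr(2), of s] lp_subst_id[OF pr(2) s(2)] s(2) by auto
    qed
    have h: "h = (\<Sum>i\<in>I. p i * r i)"
      using rep by (auto simp: tensor_rep_def)
    show ?thesis
      unfolding h by (intro has_subst_sum has_subst_mult *)
  qed
  thus ?thesis
    by (rule has_subst_imp_subst)
qed

lemma tensor_rep_conditions:
  assumes rep: "tensor_rep V W h I p r" and VW: "V \<inter> W = {}"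
    and indep: "\<And>b i. (\<And>i. i \<in> I \<Longrightarrow> b i \<in> lp V) \<Longrightarrow> (\<Sum>i\<in>I. b i * r i) = 0 \<Longrightarrow> i \<in> I \<Longrightarrow> b i = 0"
    and s: "\<And>i a. (i, a) \<in> V \<Longrightarrow> s i a \<in> lunit V" "\<And>i a. (i, a) \<in> W \<Longrightarrow> s i a = xvar i a"
    and i: "i \<in> I"
  shows "subst s h = 0 \<Longrightarrow> subst s (p i) = 0" "subst s h = h \<Longrightarrow> subst s (p i) = p i"
proof -
  note eq = tensor_rep_subst[OF rep VW s]
  have p: "p k \<in> lp V" if "k \<in> I" for k
    using rep that by (auto simp: tensor_rep_def)
  have sp: "subst s (p k) \<in> lp V" if "k \<in> I" for k
    by (rule lp_subst[OF p[OF that] s(1)])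
  show "subst s (p i) = 0" if "subst s h = 0"
    by (rule indep[of "\<lambda>k. subst s (p k)"]) (use that eq sp i in auto)
  have "subst s (p i) - p i = 0" if "subst s h = h"
  proof (rule indep[of "\<lambda>k. subst s (p k) - p k"])
    show "(\<Sum>k\<in>I. (subst s (p k) - p k) * r k) = 0"
      using that eq rep by (simp add: tensor_rep_def left_diff_distrib sum_subtractf)
  qed (use sp p i in \<open>auto intro: lp_diff\<close>)
  thus "subst s h = h \<Longrightarrow> subst s (p i) = p i"
    by simp
qed

section \<open>Wheel conditions and the specialisation\<close>

lemma frac_pow_nat_mult: "frac_pow l (of_nat n * r) = frac_pow l r ^ n"
  by (simp add: frac_pow_def of_rat_mult mult.assoc exp_of_nat_mult)

lemma frac_pow_minus: "frac_pow l (- r) = inverse (frac_pow l r)"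
  by (simp add: frac_pow_def of_rat_minus exp_minus)

lemma subst_monom: "subst s (cst c * X v) = cst c * case_prod s v"
  by (intro has_subst_imp_subst has_subst_intros)

lemma has_subst_monom: "has_subst s (cst c * X v) (cst c * case_prod s v)"
  by (intro has_subst_intros)

lemma linear_form_eq_iff:
  "a \<noteq> 0 \<or> b \<noteq> 0 \<Longrightarrow> cst a * X u = cst b * X w \<longleftrightarrow> u = w \<and> a = b"
  using linear_form_eq_0 by blast

text \<open>
  A wheel condition concerns the generic point of the wheel. Every substitution through the wheel
  factors through this point.
\<close>

lemma wheel_at_imp_subst_eq_0:
  assumes f: "f \<in> lp V" and wh: "wheel_at qa qb u v w f" and distinct: "distinct [u, v, w]"
    and q: "qa \<noteq> 0" "qb \<noteq> 0" and s: "\<And>i a. (i, a) \<in> V \<Longrightarrow> s i a \<noteq> 0" "u \<in> V"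
    and v: "case_prod s v = cst qa * case_prod s u" and w: "case_prod s w = cst qb * case_prod s v"
  shows "subst s f = 0"
proof -
  let ?t = "\<lambda>j e. if (j, e) = v then cst qa * case_prod xvar u
                  else if (j, e) = w then cst qb * (cst qa * case_prod xvar u)
                  else xvar j e"
  have "has_subst s (?t i a) (s i a)" for i a
  proof -
    consider "(i, a) = v" | "(i, a) \<noteq> v" "(i, a) = w" | "(i, a) \<noteq> v" "(i, a) \<noteq> w" by blast
    thus ?thesis
    proof cases
      case 1
      hence "s i a = cst qa * case_prod s u" using v by auto
      thus ?thesis using 1 has_subst_monom[of s qa u] by simp
    next
      case 2
      hence "s i a = cst qb * (cst qa * case_prod s u)" using v w by auto
      thus ?thesis using 2 has_subst_mult[OF has_subst_cst has_subst_monom, of s qb qa u] by simp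
    next
      case 3
      thus ?thesis by (auto intro: has_subst_xvar)
    qed
  qed
  moreover have "?t i a \<noteq> 0" for i a
    using q by simp
  ultimately have "subst s (subst ?t f) = subst s f"
    using s by (intro lp_subst_comp(2)[OF f]) blast
  moreover have "subst ?t f = 0"
    using wh unfolding wheel_at_def .
  ultimately show ?thesis
    by simp
qed

text \<open>The form in which \<open>lp_multiple_root\<close> is applied to a substitution instance of \<open>f\<close>.\<close>

lemma subst_multiple_root:
  assumes f: "f \<in> lp D" and s: "\<And>i a. (i, a) \<in> D \<Longrightarrow> s i a \<in> lunit (V \<union> \<xi> ` T)"
    and T: "finite T" "inj_on \<xi> T" "\<xi> ` T \<inter> V = {}"
    and lin: "lin_in V (v, c, w)" and \<kappa>: "\<And>k. k \<in> T \<Longrightarrow> \<kappa> k \<noteq> 0"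
    and zero: "\<And>k. k \<in> T \<Longrightarrow>
       subst (\<lambda>i a. subst (sub1 (\<xi> k) (cst (\<kappa> k * c) * X w)) (s i a)) f = 0"
    and \<tau>: "\<And>k. k \<in> T \<Longrightarrow> case_prod \<tau> (\<xi> k) = cst (\<kappa> k) * X v"
      "\<And>i a. (i, a) \<in> V \<Longrightarrow> \<tau> i a = xvar i a"
  shows "subst (\<lambda>i a. subst \<tau> (s i a)) f / lin (v, c, w) ^ card T \<in> lp V"
proof -
  let ?V = "V \<union> \<xi> ` T"
  have vw: "v \<in> V" "w \<in> V" "c \<noteq> 0"
    using lin by (auto simp: lin_in_def)
  have comp: "subst \<sigma> (subst s f) = subst (\<lambda>i a. subst \<sigma> (s i a)) f"
    if \<sigma>: "\<And>i a. (i, a) \<in> ?V \<Longrightarrow> \<sigma> i a \<noteq> 0" for \<sigma>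
  proof (intro lp_subst_comp(2)[OF f] conjI)
    fix i a assume "(i, a) \<in> D"
    hence si: "s i a \<noteq> 0" "s i a \<in> lp ?V" "inverse (s i a) \<in> lp ?V"
      using s[of i a] by (auto simp: lunit_def)
    show "s i a \<noteq> 0" by fact
    show sub: "has_subst \<sigma> (s i a) (subst \<sigma> (s i a))"
      by (rule lp_has_subst[OF si(2) \<sigma>])
    have "has_subst \<sigma> (inverse (s i a)) (subst \<sigma> (inverse (s i a)))"
      by (rule lp_has_subst[OF si(3) \<sigma>])
    from has_subst_mult[OF sub this] have "subst \<sigma> (s i a) * subst \<sigma> (inverse (s i a)) = 1"
      using has_subst_unique[OF _ has_subst_1] si(1) by simp
    thus "subst \<sigma> (s i a) \<noteq> 0" by auto
  qed
  have "subst s f \<in> lp ?V"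
    by (rule lp_subst[OF f s])
  hence "subst \<tau> (subst s f) / lin (v, c, w) ^ card T \<in> lp V"
  proof (rule lp_multiple_root[OF _ T lin \<kappa>])
    fix k assume k: "k \<in> T"
    have "cst (\<kappa> k * c) * X w \<noteq> 0"
      using \<kappa>[OF k] vw by simp
    note comp[OF sub1_neq_0[OF this]]
    thus "subst (sub1 (\<xi> k) (cst (\<kappa> k * c) * X w)) (subst s f) = 0"
      using zero[OF k] by simp
  qed (use \<tau> in auto)
  moreover have "\<tau> i a \<noteq> 0" if ia: "(i, a) \<in> ?V" for i a
  proof (cases "(i, a) \<in> V")
    case False
    then obtain k where "k \<in> T" "\<xi> k = (i, a)"
      using ia by auto
    thus ?thesis
      using \<tau>(1)[of k] \<kappa>[of k] by auto
  qed (use \<tau> in auto)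
  ultimately show ?thesis
    using comp[of \<tau>] by auto
qed

text \<open>
  Every constant is a monomial \<open>mn a b\<close> in \<open>t = q\<^sub>1\<^sup>1\<^sup>/\<^sup>(\<^sup>m\<^sup>-\<^sup>1\<^sup>)\<close> and \<open>q\<^sub>3\<close>, and by genericity the exponents are
  determined. So \<open>mn\<close> is a normal form, and comparing constants is integer arithmetic.
\<close>

locale shuffle_setup =
  fixes q d q1 q2 q3 l1 t :: complex and m :: nat and mn :: "int \<Rightarrow> int \<Rightarrow> complex"
  assumes nz: "q \<noteq> 0" "d \<noteq> 0"
    and q1_eq: "q1 = inverse q * d" and q2_eq: "q2 = q^2" and q3_eq: "q3 = inverse q * inverse d"
    and generic: "\<And>n1 n2 n3 :: int.
      q1 powi n1 * q2 powi n2 * q3 powi n3 = 1 \<Longrightarrow> n1 = n2 \<and> n2 = n3"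
    and l1: "exp l1 = q1" and m: "m \<ge> 2"
    and t_def: "t = frac_pow l1 (1 / of_nat (m - 1))"
    and mn_def: "mn a b = t powi a * q3 powi b"
begin

subsection \<open>Constants\<close>

definition kap :: "nat \<Rightarrow> complex" where
  "kap i = frac_pow l1 (- (of_nat (m - i) / of_nat (m - 1)))"

lemma qs_neq_0: "q1 \<noteq> 0" "q2 \<noteq> 0" "q3 \<noteq> 0" "t \<noteq> 0"
  using nz by (simp_all add: q1_eq q2_eq q3_eq t_def frac_pow_def)

lemma q1_q2_q3: "q1 * q2 * q3 = 1"
  using nz by (simp add: q1_eq q2_eq q3_eq power2_eq_square field_simps)

lemma t_power: "t ^ (m - 1) = q1"
proof -
  have "t ^ (m - 1) = frac_pow l1 (of_nat (m - 1) * (1 / of_nat (m - 1)))"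
    by (simp only: t_def frac_pow_nat_mult)
  also have "of_nat (m - 1) * (1 / of_nat (m - 1)) = (1 :: rat)"
    using m by simp
  finally show ?thesis
    by (simp add: frac_pow_def l1)
qed

lemma kap_eq_inverse: "kap i = inverse (t ^ (m - i))"
  using frac_pow_nat_mult[of l1 "m - i" "1 / of_nat (m - 1)"]
  by (simp add: kap_def t_def frac_pow_minus)

lemma mn_mult: "mn a b * mn a' b' = mn (a + a') (b + b')"
  using qs_neq_0 by (simp add: mn_def power_int_add)

lemma mn_inverse: "inverse (mn a b) = mn (- a) (- b)"
  by (simp add: mn_def power_int_minus)

lemma mn_divide: "mn a b / mn a' b' = mn (a - a') (b - b')"
  by (simp add: divide_inverse mn_inverse mn_mult)

lemma mn_power: "mn a b ^ n = mn (int n * a) (int n * b)"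
  by (induction n) (simp_all add: mn_mult mn_def[of 0 0] algebra_simps)

lemma mn_neq_0: "mn a b \<noteq> 0"
  using qs_neq_0 by (simp add: mn_def)

lemma mn_q1: "q1 = mn (int m - 1) 0"
  using m t_power by (simp add: mn_def power_int_def of_nat_diff nat_diff_distrib)

lemma mn_q3: "q3 = mn 0 1" and mn_t: "t = mn 1 0" and mn_1: "1 = mn 0 0"
  by (simp_all add: mn_def)

lemma mn_q2: "q2 = mn (1 - int m) (- 1)"
proof -
  have "q2 = inverse (q1 * q3)"
    using q1_q2_q3 qs_neq_0 by (simp add: field_simps)
  also have "\<dots> = mn (1 - int m) (- 1)"
    unfolding mn_q1 mn_q3 by (simp add: mn_mult mn_inverse)
  finally show ?thesis .
qed

lemma mn_kap: "i \<le> m \<Longrightarrow> kap i = mn (int i - int m) 0"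
  by (simp add: kap_eq_inverse mn_t mn_power mn_inverse of_nat_diff)

lemma mn_eq_iff: "mn a b = mn a' b' \<longleftrightarrow> a = a' \<and> b = b'"
proof
  assume "mn a b = mn a' b'"
  hence "mn (a - a') (b - b') = 1"
    by (simp add: mn_neq_0 flip: mn_divide)
  hence "mn (a - a') (b - b') ^ (m - 1) = 1"
    by simp
  hence "mn (int (m - 1) * (a - a')) (int (m - 1) * (b - b')) = 1"
    by (simp add: mn_power)
  moreover have "t powi (int (m - 1) * k) = q1 powi k" for k
    using power_int_mult[of t "int (m - 1)" k] t_power by simp
  ultimately have "q1 powi (a - a') * q2 powi 0 * q3 powi (int (m - 1) * (b - b')) = 1"
    by (simp add: mn_def)
  from generic[OF this] show "a = a' \<and> b = b'"
    using m by auto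
qed simp

lemma mn_eq_1_iff: "mn a b = 1 \<longleftrightarrow> a = 0 \<and> b = 0" "1 = mn a b \<longleftrightarrow> a = 0 \<and> b = 0"
  using mn_eq_iff[of a b 0 0] by (auto simp: mn_1[symmetric])

lemmas mn_consts = mn_q1 mn_q2 mn_q3 mn_t mn_kap

lemmas mn_simps = mn_mult mn_inverse mn_divide mn_power mn_eq_iff mn_eq_1_iff mn_neq_0

lemma kap_neq_0: "kap i \<noteq> 0"
  using qs_neq_0 by (simp add: kap_eq_inverse)

subsection \<open>The specialisation as a monomial substitution\<close>

abbreviation col :: "nat \<Rightarrow> nat" where "col i \<equiv> (if i = m then 1 else i)"

text \<open>
  \<open>\<rho>\<close> sends every variable to a constant times one variable: labels up to \<open>L\<close> go to the \<open>y\<close> variables, where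
  the colours \<open>1\<close> and \<open>m\<close> share \<open>y\<^sub>1\<close>, and the other labels go to the \<open>z\<close> variables, which have colour \<open>0\<close>.
\<close>

definition rco :: "nat \<Rightarrow> nat \<Rightarrow> nat \<Rightarrow> complex" where
  "rco L i a = (if a \<le> L then kap i else q3 ^ (i - 1))"

definition rvar :: "nat \<Rightarrow> nat \<Rightarrow> nat \<Rightarrow> nat \<times> nat" where
  "rvar L i a = (if a \<le> L then (col i, a) else (0, a - L))"

definition sg :: "nat \<Rightarrow> nat \<Rightarrow> nat \<Rightarrow> ratfun" where
  "sg L i a = cst (rco L i a) * X (rvar L i a)"

lemma rco_neq_0: "rco L i a \<noteq> 0"
  using qs_neq_0 kap_neq_0 by (simp add: rco_def)

lemma sg_neq_0: "sg L i a \<noteq> 0"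
  by (simp add: sg_def rco_neq_0)

lemma rho_eq: "rho m (q, q1, q2, q3) l1 L F = subst (sg L) F"
proof -
  have "sg L = (\<lambda>i a. if a \<le> L then Yvar m l1 i a else cst (q3 ^ (i - 1)) * zvar L a)"
    by (intro ext) (simp add: sg_def rco_def rvar_def Yvar_def yvar_def zvar_def kap_def)
  thus ?thesis
    by simp
qed

abbreviation Xv :: "nat \<Rightarrow> (nat \<times> nat) set" where "Xv N \<equiv> degree_vars m (\<lambda>_. N)"

definition Yv :: "nat \<Rightarrow> (nat \<times> nat) set" where "Yv L = degree_vars (m - 1) (\<lambda>_. L)"

definition Zv :: "nat \<Rightarrow> (nat \<times> nat) set" where "Zv K = {0} \<times> {1..K}"

lemma Yv_iff: "(i, a) \<in> Yv L \<longleftrightarrow> 1 \<le> i \<and> i < m \<and> 1 \<le> a \<and> a \<le> L"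
  using m by (auto simp: Yv_def degree_vars_def)

lemma Zv_iff: "(i, a) \<in> Zv K \<longleftrightarrow> i = 0 \<and> 1 \<le> a \<and> a \<le> K"
  by (auto simp: Zv_def)

lemma Xv_iff: "(i, a) \<in> Xv N \<longleftrightarrow> 1 \<le> i \<and> i \<le> m \<and> 1 \<le> a \<and> a \<le> N"
  by (auto simp: degree_vars_def)

lemma Yv_Zv_disjoint: "Yv L \<inter> Zv K = {}"
  by (auto simp: Yv_iff Zv_iff)

abbreviation YZ :: "nat \<Rightarrow> nat \<Rightarrow> (nat \<times> nat) set" where "YZ L K \<equiv> Yv L \<union> Zv K"

lemma rvar_YZ: "(i, a) \<in> Xv (L + K) \<Longrightarrow> rvar L i a \<in> YZ L K"
  using m by (auto simp: rvar_def Yv_iff Zv_iff Xv_iff)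

lemma sg_unit: "(i, a) \<in> Xv (L + K) \<Longrightarrow> sg L i a \<in> lunit (YZ L K)"
  unfolding sg_def by (intro lunit_mult lunit_cst lunit_X rco_neq_0 rvar_YZ)

subsection \<open>Wheels of the source\<close>

text \<open>
  The wheel conditions for arbitrary substitutions through a wheel, in which also variables outside the
  wheel may be specialised.
\<close>

definition wheel_zero :: "nat \<Rightarrow> ratfun \<Rightarrow> bool" where
  "wheel_zero N f \<longleftrightarrow>
     (\<forall>s i a b c. i \<in> {1..m} \<longrightarrow> {a, b, c} \<subseteq> {1..N} \<longrightarrow> b \<noteq> c \<longrightarrow> (\<forall>j e. (j, e) \<in> Xv N \<longrightarrow> s j e \<noteq> 0) \<longrightarrow>
        s i b = cst q3 * s (prv m i) a \<longrightarrow> s i c = cst q2 * s i b \<longrightarrow> subst s f = 0) \<and>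
     (\<forall>s i a b c. i \<in> {1..m} \<longrightarrow> {a, b, c} \<subseteq> {1..N} \<longrightarrow> a \<noteq> b \<longrightarrow> (\<forall>j e. (j, e) \<in> Xv N \<longrightarrow> s j e \<noteq> 0) \<longrightarrow>
        s i b = cst q2 * s i a \<longrightarrow> s (nxt m i) c = cst q3 * s i b \<longrightarrow> subst s f = 0)"

lemma nxt_prv: "i \<in> {1..m} \<Longrightarrow> nxt m i \<in> {1..m} \<and> prv m i \<in> {1..m} \<and> nxt m i \<noteq> i \<and> prv m i \<noteq> i"
  using m by (auto simp: nxt_def prv_def)

lemma wheel_zeroA:
  assumes "wheel_zero N f" "i \<in> {1..m}" "{a, b, c} \<subseteq> {1..N}" "b \<noteq> c"
    "\<And>j e. (j, e) \<in> Xv N \<Longrightarrow> s j e \<noteq> 0" "s i b = cst q3 * s (prv m i) a" "s i c = cst q2 * s i b"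
  shows "subst s f = 0"
  using assms unfolding wheel_zero_def by metis

lemma wheel_zeroB:
  assumes "wheel_zero N f" "i \<in> {1..m}" "{a, b, c} \<subseteq> {1..N}" "a \<noteq> b"
    "\<And>j e. (j, e) \<in> Xv N \<Longrightarrow> s j e \<noteq> 0" "s i b = cst q2 * s i a" "s (nxt m i) c = cst q3 * s i b"
  shows "subst s f = 0"
  using assms unfolding wheel_zero_def by metis

lemma wheel_imp_wheel_zero:
  assumes f: "f \<in> lp (Xv N)" and wh: "wheel m (q, q1, q2, q3) (\<lambda>_. N) f"
  shows "wheel_zero N f"
  unfolding wheel_zero_def
proof (intro conjI allI impI)
  fix s :: "nat \<Rightarrow> nat \<Rightarrow> ratfun" and i a b c
  assume i: "i \<in> {1..m}" and abc: "{a, b, c} \<subseteq> {1..N}"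
    and s: "\<forall>j e. (j, e) \<in> Xv N \<longrightarrow> s j e \<noteq> 0"
  {
    assume "b \<noteq> c" "s i b = cst q3 * s (prv m i) a" "s i c = cst q2 * s i b"
    thus "subst s f = 0"
      using i abc wh s nxt_prv[OF i]
      by (intro wheel_at_imp_subst_eq_0[OF f, of q3 q2 "(prv m i, a)" "(i, b)" "(i, c)"])
         (auto simp: qs_neq_0 Xv_iff)
  next
    assume "a \<noteq> b" "s i b = cst q2 * s i a" "s (nxt m i) c = cst q3 * s i b"
    thus "subst s f = 0"
      using i abc wh s nxt_prv[OF i]
      by (intro wheel_at_imp_subst_eq_0[OF f, of q2 q3 "(i, a)" "(i, b)" "(nxt m i, c)"])
         (auto simp: qs_neq_0 Xv_iff)
  }
qed

subsection \<open>The linear forms that divide the specialisation\<close>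

text \<open>
  \<open>Kset\<close> collects the linear forms on whose zero loci the specialised variables contain a wheel of the
  source: two \<open>y\<^sub>1\<close> in \<open>KA\<close>, two \<open>z\<close> in \<open>KB\<close>, and some \<open>y\<^sub>i\<close> with some \<open>z\<close> in \<open>KC\<close>. In \<open>KC\<close> the colour \<open>i\<close> runs up
  to \<open>m\<close>, so that \<open>y\<^sub>1\<close>, which stands for two colours, gets twice as many forms as the other \<open>y\<^sub>i\<close>.
\<close>

definition prs :: "nat \<Rightarrow> (nat \<times> nat) set" where
  "prs n = {(a, b). a \<in> {1..n} \<and> b \<in> {1..n} \<and> a < b}"

definition KA :: "nat \<Rightarrow> ((nat \<times> nat) \<times> complex \<times> (nat \<times> nat)) set" where
  "KA L = (\<lambda>((a, b), c). ((1, a), c, (1, b))) ` (prs L \<times> {q2, inverse q2})"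

definition KB :: "nat \<Rightarrow> ((nat \<times> nat) \<times> complex \<times> (nat \<times> nat)) set" where
  "KB K = (\<lambda>((a, b), c). ((0, a), c, (0, b))) ` (prs K \<times> {q2, inverse q2})"

text \<open>
  The two values of \<open>y\<^sub>i / z\<close> for which the ratio of the specialised variables of colour \<open>i\<close> is \<open>q\<^sub>2\<^sup>-\<^sup>1\<close> or \<open>q\<^sub>2\<close>.
\<close>

definition Cf :: "nat \<Rightarrow> complex set" where
  "Cf i = {mn (2 * int m - 1 - int i) (int i), mn (1 - int i) (int i - 2)}"

definition KC :: "nat \<Rightarrow> nat \<Rightarrow> ((nat \<times> nat) \<times> complex \<times> (nat \<times> nat)) set" where
  "KC L K = (\<lambda>((i, a, b), c). ((col i, a), c, (0, b))) ` (SIGMA (i, a, b):{1..m} \<times> {1..L} \<times> {1..K}. Cf i)"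

definition Kset :: "nat \<Rightarrow> nat \<Rightarrow> ((nat \<times> nat) \<times> complex \<times> (nat \<times> nat)) set" where
  "Kset L K = KA L \<union> KB K \<union> KC L K"

text \<open>
  Two \<open>z\<close> variables stand for two chains of \<open>m\<close> variables with ratio \<open>q\<^sub>3\<close>, and each of the \<open>m - 1\<close> links
  contributes a zero.
\<close>

definition mlt :: "(nat \<times> nat) \<times> complex \<times> (nat \<times> nat) \<Rightarrow> nat" where
  "mlt k = (if fst (fst k) = 0 then m - 1 else 1)"

lemma finite_prs [simp]: "finite (prs n)"
  by (rule finite_subset[of _ "{1..n} \<times> {1..n}"]) (auto simp: prs_def)

lemma finite_Kset: "finite (Kset L K)"
  unfolding Kset_def KA_def KB_def KC_def Cf_def
  by (intro finite_UnI finite_imageI finite_SigmaI) auto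

lemma Cf_neq_0: "c \<in> Cf i \<Longrightarrow> c \<noteq> 0"
  by (auto simp: Cf_def mn_neq_0)

lemma Kset_cases [consumes 1, case_names A B C]:
  assumes "k \<in> Kset L K"
  obtains a b c where "k = ((1, a), c, (1, b))" "1 \<le> a" "a < b" "b \<le> L" "c = q2 \<or> c = inverse q2"
  | a b c where "k = ((0, a), c, (0, b))" "1 \<le> a" "a < b" "b \<le> K" "c = q2 \<or> c = inverse q2"
  | i a b c where "k = ((col i, a), c, (0, b))" "i \<in> {1..m}" "a \<in> {1..L}" "b \<in> {1..K}" "c \<in> Cf i"
  using assms unfolding Kset_def KA_def KB_def KC_def prs_def by (elim UnE imageE SigmaE) auto

lemma Kset_lin_in: "k \<in> Kset L K \<Longrightarrow> lin_in (YZ L K) k"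
  by (erule Kset_cases) (use m in \<open>auto simp: lin_in_def Yv_iff Zv_iff qs_neq_0 Cf_neq_0\<close>)

lemma Kset_coprime:
  assumes "k \<in> Kset L K" "k' \<in> Kset L K" "k \<noteq> k'"
  shows "subst (root_sub k) (lin k') \<noteq> 0"
proof -
  obtain u c w u' c' w' where k: "k = (u, c, w)" "k' = (u', c', w')"
    by (cases k, cases k')
  \<comment> \<open>The two variables of a form come in a fixed order, so none of the forms is the multiple of another.\<close>
  have ord: "fst w < fst u \<or> fst w = fst u \<and> snd u < snd w" if "(u, c, w) \<in> Kset L K" for u c w
    using that m by (cases rule: Kset_cases) auto
  have "\<not> (u' = w \<and> w' = u)"
    using ord[of u c w] ord[of u' c' w'] assms(1,2) k by auto
  thus ?thesis
    using root_lin_neq_0[OF Kset_lin_in[of "(u, c, w)" L K] Kset_lin_in[of "(u', c', w')" L K]] assms k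
    by auto
qed

lemma subst_sg_comp:
  assumes f: "f \<in> lp (Xv (L + K))" and \<sigma>: "\<And>i a. (i, a) \<in> YZ L K \<Longrightarrow> \<sigma> i a \<noteq> 0"
  shows "subst \<sigma> (subst (sg L) f) =
         subst (\<lambda>i a. cst (rco L i a) * case_prod \<sigma> (rvar L i a)) f"
proof (intro lp_subst_comp(2)[OF f] conjI)
  fix i a assume ia: "(i, a) \<in> Xv (L + K)"
  show "sg L i a \<noteq> 0" by (rule sg_neq_0)
  show "has_subst \<sigma> (sg L i a) (cst (rco L i a) * case_prod \<sigma> (rvar L i a))"
    unfolding sg_def by (rule has_subst_monom)
  have "case_prod \<sigma> (rvar L i a) \<noteq> 0"
    using rvar_YZ[OF ia] \<sigma>[of "fst (rvar L i a)" "snd (rvar L i a)"] by (simp add: case_prod_beta)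
  thus "cst (rco L i a) * case_prod \<sigma> (rvar L i a) \<noteq> 0"
    by (simp add: rco_neq_0)
qed

text \<open>
  The two colours \<open>1\<close> and \<open>m\<close> carry the same variables \<open>y\<^sub>1\<close> up to the factor \<open>q\<^sub>1\<close>, so the ratio
  \<open>q\<^sub>2\<close> of two of them already makes a wheel.
\<close>

lemma zero_yy:
  assumes f: "wheel_zero N f" and s: "\<And>j e. (j, e) \<in> Xv N \<Longrightarrow> s j e \<noteq> 0"
    and ab: "a \<in> {1..N}" "b \<in> {1..N}" "a \<noteq> b"
    and "s 1 a = cst (kap 1) * y a" "s 1 b = cst (kap 1) * y b" "s m a = y a" "y a = cst q2 * y b"
  shows "subst s f = 0"
proof (rule wheel_zeroA[OF f, where i = 1 and a = a and b = b and c = a])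
  have "kap 1 = q3 * q2"
    using m by (simp add: mn_consts mn_simps)
  thus "s 1 b = cst q3 * s (prv m 1) a"
    using assms by (simp add: prv_def cst_mult)
qed (use assms m in auto)

lemma dvd_KA:
  assumes f: "f \<in> lp (Xv (L + K))" "wheel_zero (L + K) f" and k: "k \<in> Kset L K" "k = ((1, a), c, (1, b))"
    and ab: "1 \<le> a" "a < b" "b \<le> L" "c = q2 \<or> c = inverse q2"
  shows "subst (sg L) f / lin k \<in> lp (YZ L K)"
proof (rule lp_root[OF lp_subst[OF f(1) sg_unit] Kset_lin_in[OF k(1)]])
  let ?\<sigma> = "root_sub k" and ?s = "\<lambda>i a. cst (rco L i a) * case_prod (root_sub k) (rvar L i a)"
  have \<sigma>0: "?\<sigma> i e \<noteq> 0" for i e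
    by (rule root_neq_0[OF Kset_lin_in[OF k(1)]])
  have kap_m: "kap m = 1"
    by (simp add: mn_kap mn_simps)
  have s: "?s j e \<noteq> 0" for j e
    using \<sigma>0 by (simp add: rco_neq_0 case_prod_beta)
  have \<sigma>a: "?\<sigma> 1 a = cst c * xvar 1 b" and \<sigma>b: "?\<sigma> 1 b = xvar 1 b"
    using ab(2) by (auto simp: k(2) root_sub_def sub1_def)
  have "subst ?s f = 0"
  proof (cases "c = q2")
    case True
    show ?thesis
      using ab s True \<sigma>a \<sigma>b
      by (intro zero_yy[OF f(2), where a = a and b = b and y = "?\<sigma> 1"])
         (auto simp: rvar_def rco_def kap_m)
  next
    case False
    hence "cst q2 * cst c = 1"
      using ab(4) qs_neq_0 by (simp flip: cst_mult)
    thus ?thesis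
      using ab s \<sigma>a \<sigma>b
      by (intro zero_yy[OF f(2), where a = b and b = a and y = "?\<sigma> 1"])
         (auto simp: rvar_def rco_def kap_m simp flip: mult.assoc)
  qed
  thus "subst ?\<sigma> (subst (sg L) f) = 0"
    by (simp add: subst_sg_comp[OF f(1) \<sigma>0])
qed

text \<open>
  For a label \<open>\<alpha>\<close> specialised along \<open>q\<^sub>3\<close>-strings, each colour contributes one zero; letting the
  variables \<open>x\<^sub>i\<^sub>,\<^sub>\<alpha>\<close> vary independently shows that these zeros add up.
\<close>

lemma multiple_root_z:
  assumes f: "f \<in> lp (Xv N)" and s0: "\<And>i a. (i, a) \<in> Xv N \<Longrightarrow> s0 i a \<in> lunit V"
    and V: "\<And>i a. (i, a) \<in> V \<Longrightarrow> i \<le> m" and T: "T \<subseteq> {1..m}" and lin: "lin_in V (v, c, w)"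
    and s0_T: "\<And>i. i \<in> T \<Longrightarrow> s0 i \<alpha> = cst (q3 ^ (i - 1)) * X v"
    and zero: "\<And>i s. i \<in> T \<Longrightarrow> (\<And>j e. (j, e) \<in> Xv N \<Longrightarrow> s j e \<noteq> 0) \<Longrightarrow>
       (\<And>j e. (j, e) \<in> Xv N \<Longrightarrow> e \<noteq> \<alpha> \<or> j \<notin> T \<Longrightarrow> s j e = s0 j e) \<Longrightarrow>
       s i \<alpha> = cst (q3 ^ (i - 1) * c) * X w \<Longrightarrow> subst s f = 0"
  shows "subst s0 f / lin (v, c, w) ^ card T \<in> lp V"
proof -
  \<comment> \<open>Colours above \<open>m\<close> do not occur in \<open>V\<close>, so these variables are new.\<close>
  define \<xi> where "\<xi> i = (m + i, 0::nat)" for i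
  define s' where "s' j e = (if j \<in> T \<and> e = \<alpha> then X (\<xi> j) else s0 j e)" for j e
  define \<tau> where "\<tau> i a = (if i > m then cst (q3 ^ (i - m - 1)) * X v else xvar i a)" for i a
  have vw: "v \<in> V" "w \<in> V" "c \<noteq> 0"
    using lin by (auto simp: lin_in_def)
  have pos: "i \<ge> 1" if "i \<in> T" for i
    using T that by auto
  have fresh: "\<xi> i \<notin> V" if "i \<in> T" for i
    using V[of "m + i" 0] pos[OF that] by (auto simp: \<xi>_def)
  have s'_unit: "s' i a \<in> lunit (V \<union> \<xi> ` T)" if "(i, a) \<in> Xv N" for i a
    using s0[OF that] by (auto simp: s'_def intro: lunit_X lunit_mono)
  have sub_T: "subst \<sigma> (s' j e) = (if j \<in> T \<and> e = \<alpha> then case_prod \<sigma> (\<xi> j) else s0 j e)"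
    if "(j, e) \<in> Xv N" "\<And>i a. (i, a) \<in> V \<Longrightarrow> \<sigma> i a = xvar i a" for \<sigma> j e
    using lp_subst_id[OF lunit_lp[OF s0[OF that(1)]] that(2)] by (auto simp: s'_def \<xi>_def)
  have "subst (\<lambda>i a. subst \<tau> (s' i a)) f / lin (v, c, w) ^ card T \<in> lp V"
  proof (rule subst_multiple_root[where D = "Xv N" and \<xi> = \<xi> and \<kappa> = "\<lambda>i. q3 ^ (i - 1)" and w = w])
    show "finite T"
      using T by (rule finite_subset) simp
    show "inj_on \<xi> T"
      by (auto simp: inj_on_def \<xi>_def)
    show "\<xi> ` T \<inter> V = {}"
      using fresh by auto
    show "case_prod \<tau> (\<xi> k) = cst (q3 ^ (k - 1)) * X v" if "k \<in> T" for k
      using pos[OF that] by (simp add: \<tau>_def \<xi>_def)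
    show "\<tau> i a = xvar i a" if "(i, a) \<in> V" for i a
      using V[OF that] by (simp add: \<tau>_def)
    fix k assume k: "k \<in> T"
    let ?E = "cst (q3 ^ (k - 1) * c) * X w"
    let ?\<sigma> = "sub1 (\<xi> k) ?E"
    have \<sigma>_id: "?\<sigma> i a = xvar i a" if "(i, a) \<in> V" for i a
      using fresh[OF k] that by (auto simp: sub1_def)
    have E0: "?E \<noteq> 0"
      using vw qs_neq_0 by simp
    show "subst (\<lambda>i a. subst ?\<sigma> (s' i a)) f = 0"
    proof (rule zero[OF k])
      show "subst ?\<sigma> (s' j e) \<noteq> 0" if "(j, e) \<in> Xv N" for j e
        using sub_T[OF that \<sigma>_id] lunit_neq_0[OF s0[OF that]] sub1_neq_0[OF E0]
        by (simp add: \<xi>_def)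
      show "subst ?\<sigma> (s' j e) = s0 j e" if "(j, e) \<in> Xv N" "e \<noteq> \<alpha> \<or> j \<notin> T" for j e
        using sub_T[OF that(1) \<sigma>_id] that(2) by auto
      show "subst ?\<sigma> (s' k \<alpha>) = ?E"
        using k by (simp add: s'_def \<xi>_def sub1_def)
    qed
  qed (use f s'_unit lin qs_neq_0 in auto)
  also have "subst (\<lambda>i a. subst \<tau> (s' i a)) f = subst s0 f"
  proof (rule lp_subst_cong[OF f])
    fix i a assume ia: "(i, a) \<in> Xv N"
    have "subst \<tau> (s' i a) = (if i \<in> T \<and> a = \<alpha> then case_prod \<tau> (\<xi> i) else s0 i a)"
      by (rule sub_T[OF ia]) (use V in \<open>simp add: \<tau>_def leD\<close>)
    hence "subst \<tau> (s' i a) = s0 i a"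
      using s0_T[of i] pos[of i] by (auto simp: \<tau>_def \<xi>_def)
    thus "subst \<tau> (s' i a) \<noteq> 0 \<and> subst \<tau> (s' i a) = s0 i a"
      using lunit_neq_0[OF s0[OF ia]] by simp
  qed
  finally show ?thesis .
qed

lemma YZ_col_le: "(i, a) \<in> YZ L K \<Longrightarrow> i \<le> m"
  by (auto simp: Yv_iff Zv_iff)

lemma dvd_KB:
  assumes f: "f \<in> lp (Xv (L + K))" "wheel_zero (L + K) f" and k: "k \<in> Kset L K" "k = ((0, a), c, (0, b))"
    and ab: "1 \<le> a" "a < b" "b \<le> K" "c = q2 \<or> c = inverse q2"
  shows "subst (sg L) f / lin k ^ (m - 1) \<in> lp (YZ L K)"
proof -
  \<comment> \<open>For \<open>c = q\<^sub>2\<close> the wheel at colour \<open>i\<close> starts from the colour before, otherwise it ends in the colour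
      after; the first or the last colour of the chain drops out.\<close>
  let ?T = "if c = q2 then {2..m} else {1..m - 1}"
  have sgb: "sg L i (b + L) = cst (q3 ^ (i - 1)) * xvar 0 b" for i
    using ab by (simp add: sg_def rco_def rvar_def)
  have q3_Suc: "q3 ^ (i - 1) = q3 * q3 ^ (i - 2)" if "i \<ge> 2" for i
    using that by (metis Suc_diff_Suc Suc_1 diff_Suc_1 less_eq_Suc_le power_Suc One_nat_def)
  have lin: "lin_in (YZ L K) ((0, a), c, (0, b))"
    using Kset_lin_in[OF k(1)] k(2) by simp
  have "subst (sg L) f / lin ((0, a), c, (0, b)) ^ card ?T \<in> lp (YZ L K)"
  proof (rule multiple_root_z[OF f(1) sg_unit YZ_col_le _ lin])
    show "sg L i (a + L) = cst (q3 ^ (i - 1)) * X (0, a)" for i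
      using ab by (simp add: sg_def rco_def rvar_def)
    fix i s assume i: "i \<in> ?T" and s: "\<And>j e. (j, e) \<in> Xv (L + K) \<Longrightarrow> s j e \<noteq> 0"
      and eq: "\<And>j e. (j, e) \<in> Xv (L + K) \<Longrightarrow> e \<noteq> a + L \<or> j \<notin> ?T \<Longrightarrow> s j e = sg L j e"
      and sa: "s i (a + L) = cst (q3 ^ (i - 1) * c) * X (0, b)"
    have sb: "s j (b + L) = cst (q3 ^ (j - 1)) * xvar 0 b" if "j \<in> {1..m}" for j
      using that ab eq[of j "b + L"] by (simp add: sgb Xv_iff)
    show "subst s f = 0"
    proof (cases "c = q2")
      case True
      with i have i2: "2 \<le> i" "i \<le> m" by auto
      hence i1: "i - 1 \<in> {1..m}" by auto
      show ?thesis
      proof (rule wheel_zeroA[OF f(2), where i = i and a = "b + L" and b = "b + L" and c = "a + L"])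
        show "s i (b + L) = cst q3 * s (prv m i) (b + L)"
          using i2 sb[of i] sb[OF i1] q3_Suc[of i]
          by (simp add: prv_def cst_mult numeral_2_eq_2)
        show "s i (a + L) = cst q2 * s i (b + L)"
          using i2 sa sb[of i] True by (simp add: cst_mult)
      qed (use i2 ab s in auto)
    next
      case False
      hence c: "c = inverse q2" using ab(4) by simp
      from False i have i2: "1 \<le> i" "i < m" by (auto split: if_splits)
      have "cst q2 * cst c = 1"
        using c qs_neq_0 by (simp flip: cst_mult)
      show ?thesis
      proof (rule wheel_zeroB[OF f(2), where i = i and a = "a + L" and b = "b + L" and c = "b + L"])
        show "s i (b + L) = cst q2 * s i (a + L)"
          using i2 sa sb[of i] \<open>cst q2 * cst c = 1\<close> by (simp add: cst_mult mult_ac)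
        show "s (nxt m i) (b + L) = cst q3 * s i (b + L)"
          using i2 sb[of i] sb[of "i + 1"] power_Suc[of q3 "i - 1"] by (simp add: nxt_def flip: cst_mult mult.assoc)
      qed (use i2 ab s in auto)
    qed
  qed auto
  moreover have "card ?T = m - 1"
    using m by auto
  ultimately show ?thesis
    unfolding k(2) by simp
qed

text \<open>
  The wheel consists of \<open>x\<^sub>i\<^sub>,\<^sub>a\<close>, of \<open>x\<^sub>i\<^sub>,\<^sub>b\<close> in the chain of \<open>z\<^sub>b\<close>, and of a neighbour of the latter in that
  chain. At the end of the chain the other copy of \<open>y\<^sub>1\<^sub>,\<^sub>a\<close> takes the place of the missing neighbour.
\<close>

lemma dvd_KC:
  assumes f: "f \<in> lp (Xv (L + K))" "wheel_zero (L + K) f" and k: "k \<in> Kset L K" "k = ((col i, a), c, (0, b))"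
    and ab: "i \<in> {1..m}" "a \<in> {1..L}" "b \<in> {1..K}" "c \<in> Cf i"
  shows "subst (sg L) f / lin k \<in> lp (YZ L K)"
proof (rule lp_root[OF lp_subst[OF f(1) sg_unit] Kset_lin_in[OF k(1)]])
  let ?\<sigma> = "root_sub k" and ?s = "\<lambda>i a. cst (rco L i a) * case_prod (root_sub k) (rvar L i a)"
  have \<sigma>0: "?\<sigma> i e \<noteq> 0" for i e
    by (rule root_neq_0[OF Kset_lin_in[OF k(1)]])
  have s: "?s j e \<noteq> 0" for j e
    using \<sigma>0 by (simp add: rco_neq_0 case_prod_beta)
  have q3p: "q3 ^ n = mn 0 (int n)" for n
    by (simp add: mn_consts mn_simps)
  have s_a: "?s j a = cst (mn (int j - int m) 0 * c) * xvar 0 b" if "j \<in> {1..m}" "col j = col i" for j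
    using ab that by (auto simp: k(2) root_sub_def sub1_def rco_def rvar_def mn_kap cst_mult)
  have s_b: "?s j (b + L) = cst (mn 0 (int j - 1)) * xvar 0 b" if "j \<in> {1..m}" for j
  proof -
    have "col i \<noteq> 0" using ab m by auto
    thus ?thesis
      using ab that by (auto simp: k(2) root_sub_def sub1_def rco_def rvar_def q3p of_nat_diff)
  qed
  have col1m: "col 1 = col m" by simp
  have lab: "{a, b + L} \<subseteq> {1..L + K}" "a \<noteq> b + L"
    using ab by auto
  have "subst ?s f = 0"
    using ab(4) unfolding Cf_def
  proof (elim insertE emptyE)
    assume c: "c = mn (2 * int m - 1 - int i) (int i)"
    have nxt: "?s (nxt m i) (if i = m then a else b + L) = cst (mn 0 (int i)) * xvar 0 b"
    proof (cases "i = m")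
      case True
      thus ?thesis
        using s_a[of 1] m by (simp add: nxt_def c mn_simps)
    next
      case False
      thus ?thesis
        using s_b[of "i + 1"] ab(1) by (simp add: nxt_def)
    qed
    show ?thesis
    proof (rule wheel_zeroB[OF f(2), where i = i and a = a and b = "b + L"
          and c = "if i = m then a else b + L"])
      show "?s i (b + L) = cst q2 * ?s i a"
        unfolding s_b[OF ab(1)] s_a[OF ab(1) refl] c
        by (simp add: mn_consts mn_simps flip: mult.assoc cst_mult)
      show "?s (nxt m i) (if i = m then a else b + L) = cst q3 * ?s i (b + L)"
        unfolding s_b[OF ab(1)] nxt by (simp add: mn_consts mn_simps flip: mult.assoc cst_mult)
    qed (use lab s ab in auto)
  next
    assume c: "c = mn (1 - int i) (int i - 2)"
    have prv: "?s (prv m i) (if i = 1 then a else b + L) = cst (mn 0 (int i - 2)) * xvar 0 b"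
    proof (cases "i = 1")
      case True
      thus ?thesis
        using s_a[of m] m by (simp add: prv_def c mn_simps)
    next
      case False
      hence i1: "i - 1 \<in> {1..m}"
        using ab(1) by auto
      show ?thesis
        using s_b[OF i1] ab(1) False by (simp add: prv_def of_nat_diff)
    qed
    show ?thesis
    proof (rule wheel_zeroA[OF f(2), where i = i and a = "if i = 1 then a else b + L"
          and b = "b + L" and c = a])
      show "?s i a = cst q2 * ?s i (b + L)"
        unfolding s_b[OF ab(1)] s_a[OF ab(1) refl] c
        by (simp add: mn_consts mn_simps flip: mult.assoc cst_mult)
      show "?s i (b + L) = cst q3 * ?s (prv m i) (if i = 1 then a else b + L)"
        unfolding s_b[OF ab(1)] prv by (simp add: mn_consts mn_simps flip: mult.assoc cst_mult)
    qed (use lab s ab in auto)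
  qed
  thus "subst ?\<sigma> (subst (sg L) f) = 0"
    by (simp add: subst_sg_comp[OF f(1) \<sigma>0])
qed

definition Eprod :: "nat \<Rightarrow> nat \<Rightarrow> ratfun" where
  "Eprod L K = (\<Prod>k\<in>Kset L K. lin k ^ mlt k)"

lemma Eprod_neq_0: "Eprod L K \<noteq> 0"
  using finite_Kset lin_neq_0[OF Kset_lin_in] by (simp add: Eprod_def)

text \<open>
  By coprimality it is enough to count the zeros along each form separately.
\<close>

theorem Eprod_dvd_specialisation:
  assumes f: "f \<in> lp (Xv (L + K))" "wheel_zero (L + K) f"
  shows "subst (sg L) f / Eprod L K \<in> lp (YZ L K)"
  unfolding Eprod_def
proof (rule lp_prod_dvd[OF finite_Kset Kset_lin_in Kset_coprime])
  show "subst (sg L) f \<in> lp (YZ L K)"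
    by (rule lp_subst[OF f(1) sg_unit])
  fix k assume k: "k \<in> Kset L K"
  thus "subst (sg L) f / lin k ^ mlt k \<in> lp (YZ L K)"
  proof (cases rule: Kset_cases)
    case (A a b c)
    thus ?thesis using dvd_KA[OF f k] by (simp add: mlt_def)
  next
    case (B a b c)
    thus ?thesis using dvd_KB[OF f k] by (simp add: mlt_def)
  next
    case (C i a b c)
    hence "mlt k = 1" using m by (auto simp: mlt_def)
    thus ?thesis using dvd_KC[OF f k] C by simp
  qed
qed

end

section \<open>The correction factors\<close>

text \<open>
  Only divisibility in the ring of Laurent polynomials matters for the pole conditions, so constants and
  monomials are dropped.
\<close>

definition asc :: "(nat \<times> nat) set \<Rightarrow> ratfun \<Rightarrow> ratfun \<Rightarrow> bool" where
  "asc V x y \<longleftrightarrow> (\<exists>u\<in>lunit V. x = u * y)"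

lemma asc_refl: "asc V x x"
  unfolding asc_def using lunit_1 by force

lemma asc_trans [trans]: "asc V x y \<Longrightarrow> asc V y z \<Longrightarrow> asc V x z"
  unfolding asc_def by (metis lunit_mult mult.assoc)

lemma asc_mult: "asc V x y \<Longrightarrow> asc V x' y' \<Longrightarrow> asc V (x * x') (y * y')"
proof -
  assume "asc V x y" "asc V x' y'"
  then obtain u u' where "u \<in> lunit V" "u' \<in> lunit V" "x = u * y" "x' = u' * y'"
    unfolding asc_def by blast
  thus "asc V (x * x') (y * y')"
    unfolding asc_def by (intro bexI[of _ "u * u'"] lunit_mult) (simp_all add: mult_ac)
qed

lemma asc_unit: "u \<in> lunit V \<Longrightarrow> asc V (u * x) x"
  unfolding asc_def by blast

lemma asc_cst: "c \<noteq> 0 \<Longrightarrow> asc V (cst c * x) x"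
  by (intro asc_unit lunit_cst)

lemma asc_prod: "(\<And>i. i \<in> A \<Longrightarrow> asc V (f i) (g i)) \<Longrightarrow> asc V (\<Prod>i\<in>A. f i) (\<Prod>i\<in>A. g i)"
  by (induction A rule: infinite_finite_induct) (auto intro: asc_refl asc_mult)

lemma asc_eq_trans [trans]: "x = y \<Longrightarrow> asc V y z \<Longrightarrow> asc V x z" "asc V x y \<Longrightarrow> y = z \<Longrightarrow> asc V x z"
  by auto

lemma asc_linear:
  assumes "a \<noteq> 0"
  shows "asc V (cst a * y - cst b * z) (y - cst (b / a) * z)"
    and "asc V (cst b * z - cst a * y) (y - cst (b / a) * z)"
proof -
  have eq: "cst a * y - cst b * z = cst a * (y - cst (b / a) * z)"
    using assms by (simp add: right_diff_distrib mult.assoc[symmetric] flip: cst_mult)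
  thus "asc V (cst a * y - cst b * z) (y - cst (b / a) * z)"
    using asc_cst[OF assms] by simp
  have "cst b * z - cst a * y = - (cst a * y - cst b * z)"
    by simp
  also have "\<dots> = cst (- a) * (y - cst (b / a) * z)"
    unfolding eq by (simp add: cst_uminus)
  finally have "cst b * z - cst a * y = cst (- a) * (y - cst (b / a) * z)" .
  thus "asc V (cst b * z - cst a * y) (y - cst (b / a) * z)"
    using asc_cst[of "-a"] assms by simp
qed

text \<open>
  For symmetric \<open>g\<close> this is a product over unordered pairs, which does not change under relabelling.
\<close>

definition ppr :: "nat set \<Rightarrow> (nat \<Rightarrow> nat \<Rightarrow> ratfun) \<Rightarrow> ratfun" where
  "ppr S g = (\<Prod>(a, b)\<in>{(a, b). a \<in> S \<and> b \<in> S \<and> a < b}. g a b)"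

lemma finite_ordered_pairs: "finite S \<Longrightarrow> finite {(a, b). a \<in> S \<and> b \<in> S \<and> a < (b::nat)}"
  by (rule finite_subset[of _ "S \<times> S"]) auto

lemma ppr_mult: "ppr S (\<lambda>a b. g a b * h a b) = ppr S g * ppr S h"
  by (simp add: ppr_def prod.distrib case_prod_beta)

lemma ppr_asc: "(\<And>a b. a \<in> S \<Longrightarrow> b \<in> S \<Longrightarrow> a < b \<Longrightarrow> asc V (g a b) (h a b)) \<Longrightarrow> asc V (ppr S g) (ppr S h)"
  unfolding ppr_def by (intro asc_prod) auto

lemma offdiag_eq_ppr:
  assumes "finite S"
  shows "(\<Prod>(a, b)\<in>{(a, b). a \<in> S \<and> b \<in> S \<and> a \<noteq> b}. g a b) = ppr S (\<lambda>a b. g a b * g b a)"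
proof -
  let ?P = "{(a, b). a \<in> S \<and> b \<in> S \<and> a < b}"
  have "{(a, b). a \<in> S \<and> b \<in> S \<and> a \<noteq> b} = ?P \<union> prod.swap ` ?P"
    by (auto simp: image_iff)
  hence "(\<Prod>(a, b)\<in>{(a, b). a \<in> S \<and> b \<in> S \<and> a \<noteq> b}. g a b) =
         (\<Prod>(a, b)\<in>?P. g a b) * (\<Prod>(a, b)\<in>prod.swap ` ?P. g a b)"
    using finite_ordered_pairs[OF assms] by (simp, intro prod.union_disjoint) auto
  also have "(\<Prod>(a, b)\<in>prod.swap ` ?P. g a b) = (\<Prod>(a, b)\<in>?P. g b a)"
    by (subst prod.reindex) (auto simp: inj_on_def case_prod_beta)
  finally show ?thesis
    by (simp add: ppr_mult) (simp add: ppr_def)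
qed

lemma square_eq_ppr:
  assumes "finite S"
  shows "(\<Prod>a\<in>S. \<Prod>b\<in>S. g a b) = (\<Prod>a\<in>S. g a a) * ppr S (\<lambda>a b. g a b * g b a)"
proof -
  have "S \<times> S = (\<lambda>a. (a, a)) ` S \<union> {(a, b). a \<in> S \<and> b \<in> S \<and> a \<noteq> b}"
    by auto
  moreover have "finite {(a, b). a \<in> S \<and> b \<in> S \<and> a \<noteq> b}"
    by (rule finite_subset[of _ "S \<times> S"]) (use assms in auto)
  ultimately have "(\<Prod>(a, b)\<in>S \<times> S. g a b) = (\<Prod>(a, b)\<in>(\<lambda>a. (a, a)) ` S. g a b) *
       (\<Prod>(a, b)\<in>{(a, b). a \<in> S \<and> b \<in> S \<and> a \<noteq> b}. g a b)"
    using assms by (simp, intro prod.union_disjoint) auto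
  also have "(\<Prod>(a, b)\<in>(\<lambda>a. (a, a)) ` S. g a b) = (\<Prod>a\<in>S. g a a)"
    by (subst prod.reindex) (auto simp: inj_on_def)
  finally show ?thesis
    by (simp add: prod.cartesian_product offdiag_eq_ppr[OF assms])
qed

lemma card_ordered_pairs: "card {(a, b). a \<in> {1..n} \<and> b \<in> {1..n} \<and> a < b} = n choose 2"
proof (induction n)
  case (Suc n)
  let ?S = "{(a, b). a \<in> {1..n} \<and> b \<in> {1..n} \<and> a < b}" and ?T = "(\<lambda>a. (a, Suc n)) ` {1..n}"
  have "{(a, b). a \<in> {1..Suc n} \<and> b \<in> {1..Suc n} \<and> a < b} = ?S \<union> ?T"
    by (auto simp: image_iff)
  moreover have "card (?S \<union> ?T) = card ?S + card ?T"
    by (rule card_Un_disjoint) (use finite_ordered_pairs[of "{1..n}"] in auto)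
  moreover have "card ?T = n"
    by (subst card_image) (auto simp: inj_on_def)
  ultimately show ?case
    using Suc by (simp add: numeral_2_eq_2)
qed auto

lemma ppr_const: "ppr {1..n} (\<lambda>_ _. c) = c ^ (n choose 2)"
  unfolding ppr_def using card_ordered_pairs[of n] by (simp add: case_prod_beta)

lemma prod_add_split:
  fixes g :: "nat \<Rightarrow> 'a::comm_monoid_mult"
  shows "(\<Prod>a\<in>{1..L + K}. g a) = (\<Prod>a\<in>{1..L}. g a) * (\<Prod>b\<in>{1..K}. g (b + L))"
  using prod.ub_add_nat[of 1 L g K] prod.shift_bounds_cl_nat_ivl[of g 1 L K]
  by (simp add: add.commute)

context shuffle_setup
begin

lemma q_q1: "q * q1 = d"
  using nz by (simp add: q1_eq)

text \<open>
  \<^const>\<open>norm_const\<close> distributed over pairs of variables: \<open>nA\<close> for each pair of \<open>y\<close> labels, \<open>nB\<close> for each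
  pair of \<open>z\<close> labels and each mixed pair.
\<close>

definition nA :: complex where
  "nA = (if m = 2 then inverse q else if m = 3 then (d * t)^2 else 1)"

definition nB :: complex where
  "nB = (if m = 2 then inverse (d^2) else 1)"

lemma nA_neq_0: "nA \<noteq> 0" and nB_neq_0: "nB \<noteq> 0"
  using nz qs_neq_0 by (auto simp: nA_def nB_def)

lemma norm_const_eq:
  "norm_const m (q, q1, q2, q3) l1 (L + K) L = nA ^ (L choose 2) * nB ^ ((K choose 2) + L * K)"
proof -
  consider "m = 2" | "m = 3" | "m \<noteq> 2" "m \<noteq> 3" by blast
  thus ?thesis
  proof cases
    case 1
    hence eq: "nA = inverse q" "nB = inverse (d^2)"
      unfolding nA_def nB_def by simp_all
    show ?thesis unfolding eq using 1 by (simp add: q_q1 power_inverse)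
  next
    case 2
    hence eq: "nA = (d * frac_pow l1 (1 / 2))^2" "nB = 1"
      unfolding nA_def nB_def using 2 by (simp_all add: t_def)
    show ?thesis unfolding eq using 2 by (simp add: q_q1)
  next
    case 3
    hence eq: "nA = 1" "nB = 1"
      unfolding nA_def nB_def by simp_all
    show ?thesis unfolding eq using 3 by simp
  qed
qed

text \<open>
  The contribution of one pair of variables to the normalised factor \<open>A B C\<close>: \<open>al\<close> for two \<open>y\<^sub>1\<close>, \<open>be\<close> for
  \<open>y\<^sub>i\<close> and \<open>y\<^sub>i\<^sub>+\<^sub>1\<close>, \<open>ga\<close> for two \<open>z\<close>, and \<open>de i\<close> for \<open>y\<^sub>i\<close> and \<open>z\<close>. For \<open>i = 1\<close> the latter contains the two
  copies of \<open>y\<^sub>1\<close>.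
\<close>

definition al :: "ratfun \<Rightarrow> ratfun \<Rightarrow> ratfun" where
  "al u v = cst nA * (cst d * ((u - cst q2 * v) * (u - cst (inverse q2) * v))
              / ((u - cst q1 * v) * (u - cst (inverse q1) * v)))"

definition be :: "ratfun \<Rightarrow> ratfun \<Rightarrow> ratfun" where
  "be u v = (u - v) / (u - cst t * v)"

definition ga :: "ratfun \<Rightarrow> ratfun \<Rightarrow> ratfun" where
  "ga u v = cst nB *
     ((cst d * ((u - cst q2 * v) * (u - cst (inverse q2) * v))
          / ((u - cst q3 * v) * (u - cst (inverse q3) * v))) ^ (m - 1) *
      (cst d * (u - v)^2 / ((u - cst (q3 ^ (m - 1)) * v) * (u - cst (inverse (q3 ^ (m - 1))) * v))))"

definition de :: "nat \<Rightarrow> ratfun \<Rightarrow> ratfun \<Rightarrow> ratfun" where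
  "de i u v = (if i = 1 then
       cst nB * ((cst (d^2) * ((u - cst (q1^2 * q3) * v) * (u - cst (inverse q3) * v))
           / ((u - cst (q1 * q3) * v) * (u - v))) *
        (((u - cst (inverse q1 * q3 ^ (m - 2)) * v) * (u - cst (q1 * q3 ^ m) * v))
           / ((u - cst (q3 ^ (m - 2)) * v) * (u - cst (q1 * q3 ^ (m - 1)) * v))))
     else cst d * ((cst (kap i) * u - cst (q1 * q3 ^ i) * v) *
                   (cst (kap i) * u - cst (inverse q1 * q3 ^ (i - 2)) * v))
             / ((cst (kap i) * u - cst (q3 ^ i) * v) * (cst (kap i) * u - cst (q3 ^ (i - 2)) * v)))"

definition yy_pairs :: "(nat \<Rightarrow> nat set) \<Rightarrow> nat \<Rightarrow> (nat \<times> nat) set" where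
  "yy_pairs I i = {(a, b). a \<in> I i \<and> b \<in> I (col (i + 1)) \<and> (m = 2 \<longrightarrow> a \<noteq> b)}"

text \<open>
  The normalised factor \<open>A B C\<close> for arbitrary sets of labels, as needed when the labels are distributed
  between two factors of a product.
\<close>

definition DenS :: "(nat \<Rightarrow> nat set) \<Rightarrow> nat set \<Rightarrow> ratfun" where
  "DenS I J = ppr (I 1) (\<lambda>a b. al (xvar 1 a) (xvar 1 b)) *
     (\<Prod>i\<in>{1..m - 1}. \<Prod>(a, b)\<in>yy_pairs I i. be (xvar i a) (xvar (col (i + 1)) b)) *
     ppr J (\<lambda>a b. ga (xvar 0 a) (xvar 0 b)) *
     (\<Prod>i\<in>{1..m - 1}. \<Prod>a\<in>I i. \<Prod>b\<in>J. de i (xvar i a) (xvar 0 b))"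

definition Den :: "nat \<Rightarrow> nat \<Rightarrow> ratfun" where
  "Den L K = DenS (\<lambda>_. {1..L}) {1..K}"

lemma upto_m1: "{1..m - 1} = insert 1 {2..m - 1}"
  using m by auto

lemma factorA_eq:
  "cst nA ^ (L choose 2) * factorA m (q, q1, q2, q3) l1 L =
     ppr {1..L} (\<lambda>a b. al (xvar 1 a) (xvar 1 b)) *
     (\<Prod>i\<in>{1..m - 1}. \<Prod>(a, b)\<in>yy_pairs (\<lambda>_. {1..L}) i. be (xvar i a) (xvar (col (i + 1)) b))"
proof -
  let ?S = "{(a, b). a \<in> {1..L} \<and> b \<in> {1..L} \<and> (m = 2 \<longrightarrow> a \<noteq> b)}"
  have 1: "ppr {1..L} (\<lambda>a b. al (xvar 1 a) (xvar 1 b)) = cst nA ^ (L choose 2) *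
    (\<Prod>(a, b)\<in>{(a, b). a \<in> {1..L} \<and> b \<in> {1..L} \<and> a < b}.
      let u = yvar m 1 a; v = yvar m 1 b in
      cst (q * q1) * ((u - cst q2 * v) * (u - cst (inverse q2) * v))
        / ((u - cst q1 * v) * (u - cst (inverse q1) * v)))"
    unfolding al_def ppr_mult ppr_const q_q1 using m by (simp add: ppr_def yvar_def Let_def)
  have "(\<Prod>i\<in>{1..m - 1}. \<Prod>(a, b)\<in>yy_pairs (\<lambda>_. {1..L}) i. be (xvar i a) (xvar (col (i + 1)) b)) =
    (\<Prod>i\<in>{1..m - 1}. \<Prod>x\<in>?S. (yvar m i (fst x) - yvar m (i + 1) (snd x))
        / (yvar m i (fst x) - cst t * yvar m (i + 1) (snd x)))"
    by (intro prod.cong refl) (auto simp: yy_pairs_def case_prod_beta be_def yvar_def)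
  also have "\<dots> = (\<Prod>x\<in>?S. \<Prod>i\<in>{1..m - 1}. (yvar m i (fst x) - yvar m (i + 1) (snd x))
        / (yvar m i (fst x) - cst t * yvar m (i + 1) (snd x)))"
    by (rule prod.swap)
  finally show ?thesis
    unfolding 1 by (simp add: case_prod_beta t_def mult.assoc)
qed

lemma factorB_eq:
  "cst nB ^ (K choose 2) * factorB m (q, q1, q2, q3) (L + K) L =
     ppr {1..K} (\<lambda>a b. ga (xvar 0 a) (xvar 0 b))"
proof -
  have shift: "(\<Prod>(a, b)\<in>{(a, b). a \<in> {L + 1..L + K} \<and> b \<in> {L + 1..L + K} \<and> a < b}. g (zvar L a) (zvar L b)) =
      ppr {1..K} (\<lambda>a b. g (xvar 0 a) (xvar 0 b))" for g :: "ratfun \<Rightarrow> ratfun \<Rightarrow> ratfun"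
    unfolding ppr_def
    by (rule prod.reindex_bij_witness[of _ "\<lambda>(a, b). (a + L, b + L)" "\<lambda>(a, b). (a - L, b - L)"])
       (auto simp: zvar_def)
  show ?thesis
    unfolding factorB.simps Let_def shift[of "\<lambda>u v. (cst (q * q1) * ((u - cst q2 * v) * (u - cst (inverse q2) * v))
          / ((u - cst q3 * v) * (u - cst (inverse q3) * v))) ^ (m - 1)"]
      shift[of "\<lambda>u v. cst (q * q1) * (u - v)^2
          / ((u - cst (q3 ^ (m - 1)) * v) * (u - cst (inverse (q3 ^ (m - 1))) * v))"]
    unfolding ga_def ppr_mult ppr_const q_q1 by simp
qed

lemma factorC_eq:
  "cst nB ^ (L * K) * factorC m (q, q1, q2, q3) l1 (L + K) L =
     (\<Prod>i\<in>{1..m - 1}. \<Prod>a\<in>{1..L}. \<Prod>b\<in>{1..K}. de i (xvar i a) (xvar 0 b))"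
proof -
  define g where "g a z = (let y = yvar m 1 a in
        (\<Prod>i\<in>{2..m - 1}. let Y = Yvar m l1 i a in
           cst d * ((Y - cst (q1 * q3 ^ i) * z) * (Y - cst (inverse q1 * q3 ^ (i - 2)) * z))
             / ((Y - cst (q3 ^ i) * z) * (Y - cst (q3 ^ (i - 2)) * z))) *
        (cst (d^2) * ((y - cst (q1^2 * q3) * z) * (y - cst (inverse q3) * z))
           / ((y - cst (q1 * q3) * z) * (y - z))) *
        (((y - cst (inverse q1 * q3 ^ (m - 2)) * z) * (y - cst (q1 * q3 ^ m) * z))
           / ((y - cst (q3 ^ (m - 2)) * z) * (y - cst (q1 * q3 ^ (m - 1)) * z))))" for a z
  have "factorC m (q, q1, q2, q3) l1 (L + K) L = (\<Prod>a\<in>{1..L}. \<Prod>b\<in>{L + 1..L + K}. g a (zvar L b))"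
    unfolding factorC.simps g_def Let_def q_q1 by simp
  also have "\<dots> = (\<Prod>a\<in>{1..L}. \<Prod>b\<in>{1..K}. g a (xvar 0 b))"
    by (intro prod.cong refl prod.reindex_bij_witness[of _ "\<lambda>b. b + L" "\<lambda>b. b - L"])
       (auto simp: zvar_def)
  also have "cst nB ^ (L * K) * \<dots> = (\<Prod>a\<in>{1..L}. \<Prod>b\<in>{1..K}. cst nB * g a (xvar 0 b))"
    by (simp add: prod.distrib power_mult mult.commute)
  also have "\<dots> = (\<Prod>a\<in>{1..L}. \<Prod>b\<in>{1..K}. \<Prod>i\<in>{1..m - 1}. de i (xvar i a) (xvar 0 b))"
  proof (intro prod.cong refl)
    fix a b
    have "(\<Prod>i\<in>{2..m - 1}. let Y = Yvar m l1 i a in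
           cst d * ((Y - cst (q1 * q3 ^ i) * xvar 0 b) * (Y - cst (inverse q1 * q3 ^ (i - 2)) * xvar 0 b))
             / ((Y - cst (q3 ^ i) * xvar 0 b) * (Y - cst (q3 ^ (i - 2)) * xvar 0 b))) =
          (\<Prod>i\<in>{2..m - 1}. de i (xvar i a) (xvar 0 b))"
      by (intro prod.cong refl) (auto simp: de_def Yvar_def yvar_def Let_def kap_def)
    thus "cst nB * g a (xvar 0 b) = (\<Prod>i\<in>{1..m - 1}. de i (xvar i a) (xvar 0 b))"
      using m unfolding g_def upto_m1 by (simp add: Let_def de_def yvar_def mult_ac)
  qed
  also have "\<dots> = (\<Prod>i\<in>{1..m - 1}. \<Prod>a\<in>{1..L}. \<Prod>b\<in>{1..K}. de i (xvar i a) (xvar 0 b))"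
    by (simp only: prod.swap[of _ "{1..m - 1}"])
  finally show ?thesis .
qed

lemma Den_eq:
  "cst (norm_const m (q, q1, q2, q3) l1 (L + K) L) * (factorA m (q, q1, q2, q3) l1 L *
     factorB m (q, q1, q2, q3) (L + K) L * factorC m (q, q1, q2, q3) l1 (L + K) L) = Den L K"
  unfolding Den_def DenS_def norm_const_eq factorA_eq[symmetric] factorB_eq[of K L, symmetric]
    factorC_eq[symmetric]
  by (simp only: cst_mult cst_power power_add mult_ac)

lemma lf_neq_0:
  "a \<noteq> 0 \<or> b \<noteq> 0 \<Longrightarrow> (i, x) \<noteq> (j, y) \<or> a \<noteq> b \<Longrightarrow> cst a * xvar i x - cst b * xvar j y \<noteq> 0"
  "(i, x) \<noteq> (j, y) \<or> b \<noteq> 1 \<Longrightarrow> xvar i x - cst b * xvar j y \<noteq> 0"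
  "(i, x) \<noteq> (j, y) \<Longrightarrow> xvar i x - xvar j y \<noteq> 0"
  using linear_form_eq_iff[of a b "(i, x)" "(j, y)"] linear_form_eq_iff[of 1 b "(i, x)" "(j, y)"]
  by auto

lemma asc_square:
  assumes V: "\<And>a. a \<in> {1..n} \<Longrightarrow> (i, a) \<in> V" and c: "c \<noteq> 0" "c \<noteq> 1"
  shows "asc V (\<Prod>a\<in>{1..n}. \<Prod>b\<in>{1..n}. (xvar i a - cst c * xvar i b))
     (ppr {1..n} (\<lambda>a b. (xvar i a - cst c * xvar i b) * (xvar i a - cst (inverse c) * xvar i b)))"
proof -
  have 1: "xvar i a - cst c * xvar i a \<in> lunit V" if "a \<in> {1..n}" for a
  proof -
    have "xvar i a - cst c * xvar i a = cst (1 - c) * xvar i a"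
      by (simp add: cst_diff left_diff_distrib)
    thus ?thesis
      using c V[OF that] by (auto intro!: lunit_mult lunit_cst lunit_xvar)
  qed
  have A: "asc V (ppr {1..n} (\<lambda>a b. (xvar i a - cst c * xvar i b) * (xvar i b - cst c * xvar i a)))
     (ppr {1..n} (\<lambda>a b. (xvar i a - cst c * xvar i b) * (xvar i a - cst (inverse c) * xvar i b)))"
    using asc_linear(2)[OF c(1), where b = 1 and V = V] by (intro ppr_asc asc_mult asc_refl) (simp add: divide_inverse)
  have eq: "(\<Prod>a\<in>{1..n}. \<Prod>b\<in>{1..n}. (xvar i a - cst c * xvar i b)) =
      (\<Prod>a\<in>{1..n}. (xvar i a - cst c * xvar i a)) *
       ppr {1..n} (\<lambda>a b. (xvar i a - cst c * xvar i b) * (xvar i b - cst c * xvar i a))"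
    by (rule square_eq_ppr) simp
  show ?thesis
    unfolding eq by (rule asc_trans[OF asc_unit[OF lunit_prod[OF 1]] A])
qed

subsection \<open>Denominators\<close>

definition Dy :: "nat \<Rightarrow> ratfun" where
  "Dy L = (if m - 1 = 1 then ppr {1..L} (\<lambda>a b. (xvar 1 a - xvar 1 b)^2)
           else (\<Prod>i\<in>{1..m - 1}. \<Prod>a\<in>{1..L}. \<Prod>b\<in>{1..L}. (xvar i a - xvar (nxt (m - 1) i) b)))"

definition Dz :: "nat \<Rightarrow> ratfun" where
  "Dz K = ppr {1..K} (\<lambda>a b. (xvar 0 a - xvar 0 b)^2)"

definition rD :: "nat \<Rightarrow> nat \<Rightarrow> ratfun" where
  "rD L K = (\<Prod>i\<in>{1..m}. \<Prod>a\<in>{1..L + K}. \<Prod>b\<in>{1..L + K}. (sg L i a - sg L (nxt m i) b))"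

lemma sg_y: "a \<le> L \<Longrightarrow> sg L i a = cst (kap i) * xvar (col i) a"
  by (simp add: sg_def rco_def rvar_def)

lemma sg_z: "1 \<le> b \<Longrightarrow> sg L i (b + L) = cst (q3 ^ (i - 1)) * xvar 0 b"
  by (simp add: sg_def rco_def rvar_def)

lemma upto_m: "{1..m} = insert m {1..m - 1}"
  using m by auto

lemma kap_m: "kap m = 1" and kap_1: "kap 1 = inverse q1"
  using m by (simp_all add: mn_consts mn_simps)

lemma kap_Suc: "i \<in> {1..m - 1} \<Longrightarrow> kap (i + 1) / kap i = t"
proof -
  assume "i \<in> {1..m - 1}"
  hence "i \<le> m" "i + 1 \<le> m"
    using m by auto
  thus ?thesis
    by (simp add: mn_kap mn_t mn_simps)
qed

lemma q3_pow: "q3 ^ n = mn 0 (int n)"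
  by (simp add: mn_consts mn_simps)

lemma consts_neq_1: "q1 \<noteq> 1" "q3 \<noteq> 1" "t \<noteq> 1" "inverse q1 \<noteq> 1" "inverse (q3 ^ (m - 1)) \<noteq> 1" "q3 ^ (m - 1) \<noteq> 1"
  using m by (simp_all only: mn_consts mn_simps q3_pow) auto

text \<open>
  For \<open>m = 2\<close> the variables \<open>y\<^sub>i\<close> and \<open>y\<^sub>i\<^sub>+\<^sub>1\<close> coincide, which produces the squares in the denominator of a
  shuffle algebra with one colour.
\<close>

lemma prod_be_2:
  assumes "m = 2"
  shows "asc (YZ L K) ((\<Prod>a\<in>{1..L}. \<Prod>b\<in>{1..L}. (xvar 1 a - cst t * xvar 1 b)) *
     (\<Prod>(a, b)\<in>{(a, b). a \<in> {1..L} \<and> b \<in> {1..L} \<and> a \<noteq> b}. be (xvar 1 a) (xvar 1 b)))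
     (ppr {1..L} (\<lambda>a b. (xvar 1 a - xvar 1 b)^2))"
proof -
  let ?l = "\<lambda>a b. xvar 1 a - cst t * xvar 1 b"
  have be: "asc (YZ L K) (?l a b * (xvar 1 a - cst (inverse t) * xvar 1 b) *
       (be (xvar 1 a) (xvar 1 b) * be (xvar 1 b) (xvar 1 a))) ((xvar 1 a - xvar 1 b)^2)"
    if "a < b" for a b
  proof -
    have nz: "?l a b \<noteq> 0" "?l b a \<noteq> 0"
      using that by (intro lf_neq_0; simp)+
    have "cst (inverse (- t)) * ?l b a = cst (inverse (- t)) * xvar 1 b - cst (inverse (- t) * t) * xvar 1 a"
      by (simp only: right_diff_distrib cst_mult mult.assoc)
    also have "\<dots> = xvar 1 a - cst (inverse t) * xvar 1 b"
      using qs_neq_0 by (simp add: cst_uminus)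
    finally have flip: "xvar 1 a - cst (inverse t) * xvar 1 b = cst (inverse (- t)) * ?l b a" ..
    have cancel: "x * (k * y) * (n / x * (p / y)) = k * (n * p)" if "x \<noteq> 0" "y \<noteq> 0" for x y k n p :: ratfun
      using that by simp
    have "?l a b * (xvar 1 a - cst (inverse t) * xvar 1 b) *
       (be (xvar 1 a) (xvar 1 b) * be (xvar 1 b) (xvar 1 a)) =
       cst (inverse (- t)) * ((xvar 1 a - xvar 1 b) * (xvar 1 b - xvar 1 a))"
      unfolding flip be_def by (rule cancel[OF nz])
    also have "\<dots> = cst (inverse t) * (xvar 1 a - xvar 1 b)^2"
      by (simp add: cst_uminus power2_eq_square algebra_simps)
    finally show ?thesis
      using asc_cst[of "inverse t"] qs_neq_0 by simp
  qed
  have "asc (YZ L K) ((\<Prod>a\<in>{1..L}. \<Prod>b\<in>{1..L}. ?l a b) *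
     (\<Prod>(a, b)\<in>{(a, b). a \<in> {1..L} \<and> b \<in> {1..L} \<and> a \<noteq> b}. be (xvar 1 a) (xvar 1 b)))
     (ppr {1..L} (\<lambda>a b. ?l a b * (xvar 1 a - cst (inverse t) * xvar 1 b)) *
      ppr {1..L} (\<lambda>a b. be (xvar 1 a) (xvar 1 b) * be (xvar 1 b) (xvar 1 a)))"
    unfolding offdiag_eq_ppr[OF finite_atLeastAtMost]
    using m consts_neq_1 qs_neq_0 by (intro asc_mult asc_square asc_refl) (auto simp: Yv_iff)
  also have "asc (YZ L K) \<dots> (ppr {1..L} (\<lambda>a b. (xvar 1 a - xvar 1 b)^2))"
    unfolding ppr_mult[symmetric] by (intro ppr_asc be)
  finally show ?thesis .
qed

lemma asc_yy:
  "asc (YZ L K) ((\<Prod>i\<in>{1..m}. \<Prod>a\<in>{1..L}. \<Prod>b\<in>{1..L}. (sg L i a - sg L (nxt m i) b)) *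
     (ppr {1..L} (\<lambda>a b. al (xvar 1 a) (xvar 1 b)) *
     (\<Prod>i\<in>{1..m - 1}. \<Prod>(a, b)\<in>yy_pairs (\<lambda>_. {1..L}) i. be (xvar i a) (xvar (col (i + 1)) b))))
     (Dy L * ppr {1..L} (\<lambda>a b. (xvar 1 a - cst q2 * xvar 1 b) * (xvar 1 a - cst (inverse q2) * xvar 1 b)))"
proof -
  let ?V = "YZ L K"
  let ?P = "\<lambda>i. \<Prod>a\<in>{1..L}. \<Prod>b\<in>{1..L}. (sg L i a - sg L (nxt m i) b)"
  let ?BE = "\<Prod>i\<in>{1..m - 1}. \<Prod>(a, b)\<in>yy_pairs (\<lambda>_. {1..L}) i. be (xvar i a) (xvar (col (i + 1)) b)"
  let ?AL = "ppr {1..L} (\<lambda>a b. al (xvar 1 a) (xvar 1 b))"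
  let ?EA = "ppr {1..L} (\<lambda>a b. (xvar 1 a - cst q2 * xvar 1 b) * (xvar 1 a - cst (inverse q2) * xvar 1 b))"
  have "?P m = (\<Prod>a\<in>{1..L}. \<Prod>b\<in>{1..L}. (xvar 1 a - cst (inverse q1) * xvar 1 b))"
    using m by (intro prod.cong refl) (simp add: nxt_def sg_y kap_m kap_1[unfolded One_nat_def])
  moreover have "asc ?V \<dots> (ppr {1..L} (\<lambda>a b. (xvar 1 a - cst (inverse q1) * xvar 1 b) *
      (xvar 1 a - cst (inverse (inverse q1)) * xvar 1 b)))"
    using m qs_neq_0 consts_neq_1 by (intro asc_square) (auto simp: Yv_iff)
  ultimately have "asc ?V (?P m * ?AL) (ppr {1..L} (\<lambda>a b. (xvar 1 a - cst (inverse q1) * xvar 1 b) *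
      (xvar 1 a - cst (inverse (inverse q1)) * xvar 1 b)) * ?AL)"
    by (intro asc_mult asc_refl) simp
  also have "asc ?V \<dots> ?EA"
    unfolding ppr_mult[symmetric]
  proof (rule ppr_asc)
    fix a b :: nat assume "a < b"
    hence nl: "xvar 1 a - cst (inverse q1) * xvar 1 b \<noteq> 0" "xvar 1 a - cst q1 * xvar 1 b \<noteq> 0"
      by (intro lf_neq_0; simp)+
    let ?N = "(xvar 1 a - cst q2 * xvar 1 b) * (xvar 1 a - cst (inverse q2) * xvar 1 b)"
    have "(xvar 1 a - cst (inverse q1) * xvar 1 b) * (xvar 1 a - cst (inverse (inverse q1)) * xvar 1 b) *
          al (xvar 1 a) (xvar 1 b) = cst (nA * d) * ?N"
      unfolding al_def cst_mult using nl by (simp add: mult_ac)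
    thus "asc ?V ((xvar 1 a - cst (inverse q1) * xvar 1 b) *
        (xvar 1 a - cst (inverse (inverse q1)) * xvar 1 b) * al (xvar 1 a) (xvar 1 b)) ?N"
      using asc_cst[of "nA * d"] nA_neq_0 nz by simp
  qed
  finally have top: "asc ?V (?P m * ?AL) ?EA" .
  have step: "asc ?V (?P i) (\<Prod>a\<in>{1..L}. \<Prod>b\<in>{1..L}. (xvar i a - cst t * xvar (col (i + 1)) b))"
    if i: "i \<in> {1..m - 1}" for i
  proof (intro asc_prod)
    fix a b assume "a \<in> {1..L}" "b \<in> {1..L}"
    have "nxt m i = i + 1" "col i = i"
      using i by (auto simp: nxt_def)
    hence eqs: "sg L i a = cst (kap i) * xvar i a"
      "sg L (nxt m i) b = cst (kap (i + 1)) * xvar (col (i + 1)) b"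
      using \<open>a \<in> {1..L}\<close> \<open>b \<in> {1..L}\<close> sg_y[of a L i] sg_y[of b L "i + 1"] by auto
    show "asc ?V (sg L i a - sg L (nxt m i) b) (xvar i a - cst t * xvar (col (i + 1)) b)"
      using asc_linear(1)[OF kap_neq_0, of ?V i "xvar i a" "kap (i + 1)" "xvar (col (i + 1)) b"]
      unfolding eqs kap_Suc[OF i] .
  qed
  have rest: "asc ?V ((\<Prod>i\<in>{1..m - 1}. ?P i) * ?BE) (Dy L)"
  proof (cases "m = 2")
    case True
    have P: "(\<Prod>i\<in>{1..m - 1}. ?P i) = ?P 1" and
      BE: "?BE = (\<Prod>(a, b)\<in>{(a, b). a \<in> {1..L} \<and> b \<in> {1..L} \<and> a \<noteq> b}. be (xvar 1 a) (xvar 1 b))"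
      unfolding yy_pairs_def using True by simp_all
    have Dy: "Dy L = ppr {1..L} (\<lambda>a b. (xvar 1 a - xvar 1 b)^2)"
      unfolding Dy_def using True by simp
    have "asc ?V (?P 1) (\<Prod>a\<in>{1..L}. \<Prod>b\<in>{1..L}. (xvar 1 a - cst t * xvar 1 b))"
      using step[of 1] True by simp
    from asc_trans[OF asc_mult[OF this asc_refl] prod_be_2[OF True]] show ?thesis
      unfolding P BE Dy .
  next
    case False
    have Dy: "Dy L = (\<Prod>i\<in>{1..m - 1}. \<Prod>a\<in>{1..L}. \<Prod>b\<in>{1..L}. (xvar i a - xvar (nxt (m - 1) i) b))"
    proof -
      have "m - 1 \<noteq> 1"
        using False m by auto
      thus ?thesis
        unfolding Dy_def by (rule if_not_P)
    qed
    have BE: "?BE = (\<Prod>i\<in>{1..m - 1}. \<Prod>a\<in>{1..L}. \<Prod>b\<in>{1..L}. be (xvar i a) (xvar (col (i + 1)) b))"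
    proof (intro prod.cong refl)
      fix i
      have "yy_pairs (\<lambda>_. {1..L}) i = {1..L} \<times> {1..L}"
        using False by (auto simp: yy_pairs_def)
      thus "(\<Prod>(a, b)\<in>yy_pairs (\<lambda>_. {1..L}) i. be (xvar i a) (xvar (col (i + 1)) b)) =
            (\<Prod>a\<in>{1..L}. \<Prod>b\<in>{1..L}. be (xvar i a) (xvar (col (i + 1)) b))"
        by (simp add: prod.cartesian_product)
    qed
    show ?thesis
      unfolding Dy BE prod.distrib[of ?P "\<lambda>i. \<Prod>a\<in>{1..L}. \<Prod>b\<in>{1..L}. be (xvar i a) (xvar (col (i + 1)) b)"
        "{1..m - 1}", symmetric]
    proof (rule asc_prod)
      fix i assume i: "i \<in> {1..m - 1}"
      have ne: "i \<noteq> col (i + 1)" and nx: "nxt (m - 1) i = col (i + 1)"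
        using i m False by (auto simp: nxt_def)
      have "asc ?V (?P i * (\<Prod>a\<in>{1..L}. \<Prod>b\<in>{1..L}. be (xvar i a) (xvar (col (i + 1)) b)))
         ((\<Prod>a\<in>{1..L}. \<Prod>b\<in>{1..L}. (xvar i a - cst t * xvar (col (i + 1)) b)) *
          (\<Prod>a\<in>{1..L}. \<Prod>b\<in>{1..L}. be (xvar i a) (xvar (col (i + 1)) b)))"
        by (intro asc_mult step i asc_refl)
      also have "\<dots> = (\<Prod>a\<in>{1..L}. \<Prod>b\<in>{1..L}. (xvar i a - xvar (nxt (m - 1) i) b))"
        unfolding prod.distrib[symmetric]
      proof (intro prod.cong refl)
        fix a b
        have "xvar i a - cst t * xvar (col (i + 1)) b \<noteq> 0"
          using ne by (intro lf_neq_0) auto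
        thus "(xvar i a - cst t * xvar (col (i + 1)) b) * be (xvar i a) (xvar (col (i + 1)) b) =
          xvar i a - xvar (nxt (m - 1) i) b"
          unfolding be_def nx by simp
      qed
      finally show "asc ?V (?P i * (\<Prod>a\<in>{1..L}. \<Prod>b\<in>{1..L}. be (xvar i a) (xvar (col (i + 1)) b)))
          (\<Prod>a\<in>{1..L}. \<Prod>b\<in>{1..L}. (xvar i a - xvar (nxt (m - 1) i) b))" .
    qed
  qed
  have "(\<Prod>i\<in>{1..m}. ?P i) = ?P m * (\<Prod>i\<in>{1..m - 1}. ?P i)"
    unfolding upto_m using m by (subst prod.insert) auto
  hence eq: "(\<Prod>i\<in>{1..m}. ?P i) * (?AL * ?BE) = (\<Prod>i\<in>{1..m - 1}. ?P i) * ?BE * (?P m * ?AL)"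
    by (simp only: mult_ac)
  show ?thesis
    unfolding eq by (rule asc_mult[OF rest top])
qed

lemma asc_zz:
  "asc (YZ L K) ((\<Prod>i\<in>{1..m}. \<Prod>a\<in>{1..K}. \<Prod>b\<in>{1..K}. (sg L i (a + L) - sg L (nxt m i) (b + L))) *
     ppr {1..K} (\<lambda>a b. ga (xvar 0 a) (xvar 0 b)))
     (Dz K * ppr {1..K} (\<lambda>a b. ((xvar 0 a - cst q2 * xvar 0 b) *
                                 (xvar 0 a - cst (inverse q2) * xvar 0 b)) ^ (m - 1)))"
proof -
  let ?V = "YZ L K"
  let ?P = "\<lambda>i. \<Prod>a\<in>{1..K}. \<Prod>b\<in>{1..K}. (sg L i (a + L) - sg L (nxt m i) (b + L))"
  let ?D1 = "\<lambda>a b. (xvar 0 a - cst q3 * xvar 0 b) * (xvar 0 a - cst (inverse q3) * xvar 0 b)"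
  let ?Q = "q3 ^ (m - 1)"
  let ?D2 = "\<lambda>a b. (xvar 0 a - cst ?Q * xvar 0 b) * (xvar 0 a - cst (inverse ?Q) * xvar 0 b)"
  let ?N = "\<lambda>a b. (xvar 0 a - cst q2 * xvar 0 b) * (xvar 0 a - cst (inverse q2) * xvar 0 b)"
  have V: "(0, a) \<in> ?V" if "a \<in> {1..K}" for a
    using that by (simp add: Zv_iff)
  have low: "asc ?V (?P i) (ppr {1..K} ?D1)" if i: "i \<in> {1..m - 1}" for i
  proof -
    have "asc ?V (?P i) (\<Prod>a\<in>{1..K}. \<Prod>b\<in>{1..K}. (xvar 0 a - cst q3 * xvar 0 b))"
    proof (intro asc_prod)
      fix a b assume "a \<in> {1..K}" "b \<in> {1..K}"
      moreover have "nxt m i = i + 1" "q3 ^ i / q3 ^ (i - 1) = q3"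
        using i qs_neq_0 by (auto simp: nxt_def power_diff)
      moreover have "q3 ^ (i - 1) \<noteq> 0"
        using qs_neq_0 by simp
      note asc_linear(1)[OF this, of ?V "xvar 0 a" "q3 ^ i" "xvar 0 b"]
      ultimately show "asc ?V (sg L i (a + L) - sg L (nxt m i) (b + L)) (xvar 0 a - cst q3 * xvar 0 b)"
        by (simp add: sg_z)
    qed
    also have "asc ?V \<dots> (ppr {1..K} ?D1)"
      using V qs_neq_0 consts_neq_1 by (intro asc_square)
    finally show ?thesis .
  qed
  have top: "asc ?V (?P m) (ppr {1..K} ?D2)"
  proof -
    have "asc ?V (?P m) (\<Prod>a\<in>{1..K}. \<Prod>b\<in>{1..K}. (xvar 0 a - cst (inverse ?Q) * xvar 0 b))"
    proof (intro asc_prod)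
      fix a b assume "a \<in> {1..K}" "b \<in> {1..K}"
      moreover have "nxt m m = 1"
        by (simp add: nxt_def)
      moreover have "?Q \<noteq> 0"
        using qs_neq_0 by simp
      note asc_linear(1)[OF this, of ?V "xvar 0 a" 1 "xvar 0 b"]
      ultimately show "asc ?V (sg L m (a + L) - sg L (nxt m m) (b + L)) (xvar 0 a - cst (inverse ?Q) * xvar 0 b)"
        by (simp add: sg_z divide_inverse)
    qed
    also have "asc ?V \<dots> (ppr {1..K} (\<lambda>a b. (xvar 0 a - cst (inverse ?Q) * xvar 0 b) *
        (xvar 0 a - cst (inverse (inverse ?Q)) * xvar 0 b)))"
      using V qs_neq_0 consts_neq_1 by (intro asc_square) simp_all
    finally show ?thesis
      by (simp add: mult.commute)
  qed
  have "(\<Prod>i\<in>{1..m}. ?P i) = (\<Prod>i\<in>{1..m - 1}. ?P i) * ?P m"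
    unfolding upto_m using m by (subst prod.insert) (auto simp: mult.commute)
  moreover have "asc ?V ((\<Prod>i\<in>{1..m - 1}. ?P i) * ?P m) ((\<Prod>i\<in>{1..m - 1}. ppr {1..K} ?D1) * ppr {1..K} ?D2)"
    by (intro asc_mult asc_prod low top)
  moreover have "(\<Prod>i\<in>{1..m - 1}. ppr {1..K} ?D1) = ppr {1..K} (\<lambda>a b. ?D1 a b ^ (m - 1))"
    by (simp add: ppr_def case_prod_beta flip: prod_power_distrib)
  ultimately have "asc ?V ((\<Prod>i\<in>{1..m}. ?P i) * ppr {1..K} (\<lambda>a b. ga (xvar 0 a) (xvar 0 b)))
     (ppr {1..K} (\<lambda>a b. ?D1 a b ^ (m - 1)) * ppr {1..K} ?D2 * ppr {1..K} (\<lambda>a b. ga (xvar 0 a) (xvar 0 b)))"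
    by (intro asc_mult asc_refl) simp
  also have "asc ?V \<dots> (Dz K * ppr {1..K} (\<lambda>a b. ?N a b ^ (m - 1)))"
    unfolding Dz_def ppr_mult[symmetric]
  proof (rule ppr_asc)
    fix a b :: nat assume "a < b"
    hence "xvar 0 a - cst c * xvar 0 b \<noteq> 0" for c
      by (intro lf_neq_0) simp
    hence D: "?D1 a b \<noteq> 0" "?D2 a b \<noteq> 0"
      by simp_all
    have cancel: "D ^ n * D' * (cn * ((cd * M / D) ^ n * (cd * s / D'))) = (cn * cd ^ n * cd) * (s * M ^ n)"
      if "D \<noteq> 0" "D' \<noteq> 0" for D D' cn cd M s :: ratfun and n
      using that by (simp add: power_divide power_mult_distrib mult_ac)
    have "?D1 a b ^ (m - 1) * ?D2 a b * ga (xvar 0 a) (xvar 0 b) =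
        (cst nB * cst d ^ (m - 1) * cst d) * ((xvar 0 a - xvar 0 b)^2 * ?N a b ^ (m - 1))"
      unfolding ga_def by (rule cancel[OF D])
    moreover have "cst nB * cst d ^ (m - 1) * cst d \<in> lunit ?V"
      using nz nB_neq_0 by (intro lunit_mult lunit_power lunit_cst)
    ultimately show "asc ?V (?D1 a b ^ (m - 1) * ?D2 a b * ga (xvar 0 a) (xvar 0 b))
       ((xvar 0 a - xvar 0 b)^2 * ?N a b ^ (m - 1))"
      using asc_unit by simp
  qed
  finally show ?thesis .
qed

lemma split_upto_m:
  fixes g :: "nat \<Rightarrow> 'a::comm_monoid_mult"
  shows "(\<Prod>i\<in>{1..m}. g i) = g 1 * g m * (\<Prod>i\<in>{2..m - 1}. g i)"
proof -
  have "{1..m} = insert 1 (insert m {2..m - 1})"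
    using m by auto
  thus ?thesis
    using m by (simp add: mult.assoc)
qed

lemma bij_nxt: "bij_betw (nxt m) {1..m} {1..m}"
  by (rule bij_betw_byWitness[where f' = "prv m"]) (use m in \<open>auto simp: nxt_def prv_def\<close>)

lemma prv_nxt: "i \<in> {1..m} \<Longrightarrow> prv m (nxt m i) = i"
  using m by (auto simp: nxt_def prv_def)

lemma prod_nxt: "(\<Prod>i\<in>{1..m}. g (nxt m i) i) = (\<Prod>i\<in>{1..m}. g i (prv m i))"
proof -
  have "(\<Prod>i\<in>{1..m}. g i (prv m i)) = (\<Prod>i\<in>{1..m}. g (nxt m i) (prv m (nxt m i)))"
    by (rule prod.reindex_bij_betw[OF bij_nxt, symmetric])
  also have "\<dots> = (\<Prod>i\<in>{1..m}. g (nxt m i) i)"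
    by (intro prod.cong refl) (simp only: prv_nxt)
  finally show ?thesis ..
qed

lemma Cf_prod:
  "(\<Prod>c\<in>Cf i. g c) = g (mn (2 * int m - 1 - int i) (int i)) * g (mn (1 - int i) (int i - 2))"
proof -
  have "mn (2 * int m - 1 - int i) (int i) \<noteq> mn (1 - int i) (int i - 2)"
    by (simp add: mn_eq_iff)
  thus ?thesis
    by (simp add: Cf_def)
qed

lemma asc_mid:
  assumes i: "i \<in> {2..m - 1}" and ab: "a \<in> {1..L}" "b \<in> {1..K}"
  shows "asc (YZ L K) ((sg L i a - sg L (nxt m i) (b + L)) * (sg L (prv m i) (b + L) - sg L i a) *
      de i (xvar i a) (xvar 0 b)) (\<Prod>c\<in>Cf i. (xvar (col i) a - cst c * xvar 0 b))"
proof -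
  let ?Y = "cst (kap i) * xvar i a" and ?z = "xvar 0 b" and ?V = "YZ L K"
  have i': "nxt m i = i + 1" "prv m i = i - 1" "col i = i" "i \<noteq> 1" "i - 1 - 1 = i - 2"
    using i by (auto simp: nxt_def prv_def)
  have "i \<le> m"
    using i by auto
  have nl: "?Y - cst c * ?z \<noteq> 0" for c
    using i by (intro lf_neq_0) (auto simp: kap_neq_0)
  have cancel: "D1 * (- D2) * (k * (N1 * N2) / (D1 * D2)) = (- k) * (N1 * N2)"
    if "D1 \<noteq> 0" "D2 \<noteq> 0" for D1 D2 k N1 N2 :: ratfun
    using that by simp
  have "(sg L i a - sg L (nxt m i) (b + L)) * (sg L (prv m i) (b + L) - sg L i a) * de i (xvar i a) ?z =
     (?Y - cst (q3 ^ i) * ?z) * (- (?Y - cst (q3 ^ (i - 2)) * ?z)) * de i (xvar i a) ?z"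
    using ab by (simp add: i' sg_y sg_z numeral_2_eq_2)
  also have "\<dots> = (- cst d) * ((?Y - cst (q1 * q3 ^ i) * ?z) * (?Y - cst (inverse q1 * q3 ^ (i - 2)) * ?z))"
    unfolding de_def using i' by (simp only: if_False) (rule cancel[OF nl nl])
  also have "asc ?V \<dots> ((?Y - cst (q1 * q3 ^ i) * ?z) * (?Y - cst (inverse q1 * q3 ^ (i - 2)) * ?z))"
    using nz by (intro asc_unit lunit_uminus lunit_cst)
  also have "asc ?V \<dots> ((xvar i a - cst (q1 * q3 ^ i / kap i) * ?z) *
       (xvar i a - cst (inverse q1 * q3 ^ (i - 2) / kap i) * ?z))"
    by (intro asc_mult asc_linear kap_neq_0)
  also have "\<dots> = (\<Prod>c\<in>Cf i. (xvar (col i) a - cst c * ?z))"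
  proof -
    have "q1 * q3 ^ i / kap i = mn (2 * int m - 1 - int i) (int i)"
      "inverse q1 * q3 ^ (i - 2) / kap i = mn (1 - int i) (int i - 2)"
      using i \<open>i \<le> m\<close> by (simp_all add: mn_q1 mn_kap q3_pow mn_simps)
    thus ?thesis
      unfolding Cf_prod by (simp add: i')
  qed
  finally show ?thesis .
qed

lemma asc_ends:
  assumes ab: "a \<in> {1..L}" "b \<in> {1..K}"
  shows "asc (YZ L K) ((sg L 1 a - sg L (nxt m 1) (b + L)) * (sg L (prv m 1) (b + L) - sg L 1 a) *
      ((sg L m a - sg L (nxt m m) (b + L)) * (sg L (prv m m) (b + L) - sg L m a)) *
      de 1 (xvar 1 a) (xvar 0 b))
     ((\<Prod>c\<in>Cf 1. (xvar (col 1) a - cst c * xvar 0 b)) * (\<Prod>c\<in>Cf m. (xvar (col m) a - cst c * xvar 0 b)))"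
proof -
  let ?y = "xvar 1 a" and ?z = "xvar 0 b" and ?V = "YZ L K"
  let ?f = "\<lambda>c. ?y - cst c * ?z"
  have nl: "?f c \<noteq> 0" for c
    by (intro lf_neq_0) simp
  have nl1: "?y - ?z \<noteq> 0"
    by (intro lf_neq_0) simp
  have i': "nxt m 1 = 2" "prv m 1 = m" "nxt m m = 1" "prv m m = m - 1" "m - 1 - 1 = m - 2"
    using m by (auto simp: nxt_def prv_def)
  have q1': "inverse q1 \<noteq> 0"
    using qs_neq_0 by simp
  have s1: "sg L 1 a = cst (inverse q1) * ?y"
    using ab sg_y[of a L 1] m kap_1 by simp
  have s2: "sg L (nxt m 1) (b + L) = cst q3 * ?z"
    unfolding i' using sg_z[of b L 2] ab by simp
  have s3: "sg L (prv m 1) (b + L) = cst (q3 ^ (m - 1)) * ?z"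
    unfolding i' using sg_z[of b L m] ab by simp
  have s4: "sg L m a = ?y"
    using ab sg_y[of a L m] kap_m by simp
  have s5: "sg L (nxt m m) (b + L) = ?z"
    unfolding i' using sg_z[of b L 1] ab by simp
  have s6: "sg L (prv m m) (b + L) = cst (q3 ^ (m - 2)) * ?z"
    unfolding i' using sg_z[of b L "m - 1"] ab by (simp add: numeral_2_eq_2)
  have e: "q3 / inverse q1 = q1 * q3" "q3 ^ (m - 1) / inverse q1 = q1 * q3 ^ (m - 1)"
    by (simp_all add: divide_inverse mult.commute)
  have 1: "asc ?V (sg L 1 a - sg L (nxt m 1) (b + L)) (?f (q1 * q3))"
    using asc_linear(1)[OF q1', of ?V ?y q3 ?z] unfolding s1 s2 e .
  have 2: "asc ?V (sg L (prv m 1) (b + L) - sg L 1 a) (?f (q1 * q3 ^ (m - 1)))"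
    using asc_linear(2)[OF q1', of ?V "q3 ^ (m - 1)" ?z ?y] unfolding s1 s3 e .
  have 3: "asc ?V (sg L m a - sg L (nxt m m) (b + L)) (?y - ?z)"
    unfolding s4 s5 by (rule asc_refl)
  have 4: "asc ?V (sg L (prv m m) (b + L) - sg L m a) (?f (q3 ^ (m - 2)))"
    using asc_linear(2)[of 1 ?V "q3 ^ (m - 2)" ?z ?y] unfolding s4 s6 by simp
  have cancel: "D1 * D4 * (D2 * D3) * (k * ((k' * (N1 * N2) / (D1 * D2)) * ((N3 * N4) / (D3 * D4)))) =
       (k * k') * (N1 * N2 * (N4 * N3))"
    if "D1 \<noteq> 0" "D2 \<noteq> 0" "D3 \<noteq> 0" "D4 \<noteq> 0" for D1 D2 D3 D4 k k' N1 N2 N3 N4 :: ratfun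
    using that by (simp add: mult_ac)
  have "asc ?V ((sg L 1 a - sg L (nxt m 1) (b + L)) * (sg L (prv m 1) (b + L) - sg L 1 a) *
      ((sg L m a - sg L (nxt m m) (b + L)) * (sg L (prv m m) (b + L) - sg L m a)) *
      de 1 ?y ?z) (?f (q1 * q3) * ?f (q1 * q3 ^ (m - 1)) * ((?y - ?z) * ?f (q3 ^ (m - 2))) * de 1 ?y ?z)"
    by (intro asc_mult 1 2 3 4 asc_refl)
  also have "\<dots> = (cst nB * cst (d^2)) * (?f (q1^2 * q3) * ?f (inverse q3) *
       (?f (q1 * q3 ^ m) * ?f (inverse q1 * q3 ^ (m - 2))))"
    unfolding de_def if_P[OF refl] by (rule cancel[OF nl nl1 nl nl])
  also have "asc ?V \<dots> (?f (q1^2 * q3) * ?f (inverse q3) * (?f (q1 * q3 ^ m) * ?f (inverse q1 * q3 ^ (m - 2))))"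
    using nz nB_neq_0 by (intro asc_unit lunit_mult lunit_cst) auto
  also have "\<dots> = ((\<Prod>c\<in>Cf 1. (xvar (col 1) a - cst c * ?z)) * (\<Prod>c\<in>Cf m. (xvar (col m) a - cst c * ?z)))"
  proof -
    have "mn (2 * int m - 1 - int 1) (int 1) = q1^2 * q3" "mn (1 - int 1) (int 1 - 2) = inverse q3"
      "mn (2 * int m - 1 - int m) (int m) = q1 * q3 ^ m"
      "mn (1 - int m) (int m - 2) = inverse q1 * q3 ^ (m - 2)"
      using m by (simp_all add: mn_q1 mn_q3 mn_simps)
    thus ?thesis
      unfolding Cf_prod using m by (simp only:) simp
  qed
  finally show ?thesis .
qed

lemma asc_yz:
  "asc (YZ L K) ((\<Prod>i\<in>{1..m}. \<Prod>a\<in>{1..L}. \<Prod>b\<in>{1..K}. (sg L i a - sg L (nxt m i) (b + L))) *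
     (\<Prod>i\<in>{1..m}. \<Prod>b\<in>{1..K}. \<Prod>a\<in>{1..L}. (sg L i (b + L) - sg L (nxt m i) a)) *
     (\<Prod>i\<in>{1..m - 1}. \<Prod>a\<in>{1..L}. \<Prod>b\<in>{1..K}. de i (xvar i a) (xvar 0 b)))
     (\<Prod>i\<in>{1..m}. \<Prod>a\<in>{1..L}. \<Prod>b\<in>{1..K}. \<Prod>c\<in>Cf i. (xvar (col i) a - cst c * xvar 0 b))"
proof -
  let ?V = "YZ L K"
  let ?f = "\<lambda>i a b. sg L i a - sg L (nxt m i) (b + L)"
  let ?g = "\<lambda>i a b. sg L (prv m i) (b + L) - sg L i a"
  let ?h = "\<lambda>i a b. de i (xvar i a) (xvar 0 b)"
  let ?c = "\<lambda>i a b. \<Prod>c\<in>Cf i. (xvar (col i) a - cst c * xvar 0 b)"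
  let ?PP = "\<lambda>g :: nat \<Rightarrow> nat \<Rightarrow> ratfun. \<Prod>a\<in>{1..L}. \<Prod>b\<in>{1..K}. g a b"
  have "(\<Prod>i\<in>{1..m}. \<Prod>b\<in>{1..K}. \<Prod>a\<in>{1..L}. (sg L i (b + L) - sg L (nxt m i) a)) =
        (\<Prod>i\<in>{1..m}. \<Prod>b\<in>{1..K}. \<Prod>a\<in>{1..L}. ?g i a b)"
    by (rule prod_nxt[of "\<lambda>j i. \<Prod>b\<in>{1..K}. \<Prod>a\<in>{1..L}. (sg L i (b + L) - sg L j a)"])
  also have "\<dots> = (\<Prod>i\<in>{1..m}. ?PP (?g i))"
    by (intro prod.cong refl prod.swap)
  finally have zy: "(\<Prod>i\<in>{1..m}. \<Prod>b\<in>{1..K}. \<Prod>a\<in>{1..L}. (sg L i (b + L) - sg L (nxt m i) a)) =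
     (\<Prod>i\<in>{1..m}. ?PP (?g i))" .
  have h: "(\<Prod>i\<in>{1..m - 1}. ?PP (?h i)) = ?PP (?h 1) * (\<Prod>i\<in>{2..m - 1}. ?PP (?h i))"
    unfolding upto_m1 by simp
  have PP_mult: "?PP u * ?PP v = ?PP (\<lambda>a b. u a b * v a b)" for u v
    by (simp only: prod.distrib)
  have "(\<Prod>i\<in>{1..m}. ?PP (?f i)) * (\<Prod>i\<in>{1..m}. ?PP (?g i)) * (\<Prod>i\<in>{1..m - 1}. ?PP (?h i)) =
     (?PP (?f 1) * ?PP (?g 1) * (?PP (?f m) * ?PP (?g m)) * ?PP (?h 1)) *
     (\<Prod>i\<in>{2..m - 1}. ?PP (?f i) * ?PP (?g i) * ?PP (?h i))"
    unfolding h split_upto_m[of "\<lambda>i. ?PP (?f i)"] split_upto_m[of "\<lambda>i. ?PP (?g i)"]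
    by (simp only: prod.distrib mult_ac)
  also have "asc ?V \<dots> (?PP (?c 1) * ?PP (?c m) * (\<Prod>i\<in>{2..m - 1}. ?PP (?c i)))"
    unfolding PP_mult by (intro asc_mult asc_prod asc_ends asc_mid)
  also have "\<dots> = (\<Prod>i\<in>{1..m}. ?PP (?c i))"
    by (rule split_upto_m[of "\<lambda>i. ?PP (?c i)", symmetric])
  finally show ?thesis
    unfolding zy .
qed

lemma lin_1: "lin ((i, a), c, (j, b)) = xvar i a - cst c * xvar j b"
  by (simp add: lin_def)

lemma q2_neq_inverse: "q2 \<noteq> inverse q2"
  using m by (simp add: mn_q2 mn_simps)

lemma prod_KA:
  "(\<Prod>k\<in>KA L. lin k ^ mlt k) =
     ppr {1..L} (\<lambda>a b. (xvar 1 a - cst q2 * xvar 1 b) * (xvar 1 a - cst (inverse q2) * xvar 1 b))"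
proof -
  have "(\<Prod>k\<in>KA L. lin k ^ mlt k) =
        (\<Prod>x\<in>prs L \<times> {q2, inverse q2}. xvar 1 (fst (fst x)) - cst (snd x) * xvar 1 (snd (fst x)))"
    unfolding KA_def by (subst prod.reindex) (auto simp: inj_on_def lin_1 mlt_def case_prod_beta)
  also have "\<dots> = (\<Prod>p\<in>prs L. \<Prod>c\<in>{q2, inverse q2}. xvar 1 (fst p) - cst c * xvar 1 (snd p))"
    by (simp only: prod.cartesian_product case_prod_unfold)
  also have "\<dots> = ppr {1..L} (\<lambda>a b. (xvar 1 a - cst q2 * xvar 1 b) * (xvar 1 a - cst (inverse q2) * xvar 1 b))"
    unfolding ppr_def prs_def using q2_neq_inverse by (simp add: case_prod_beta)
  finally show ?thesis .
qed

lemma prod_KB: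
  "(\<Prod>k\<in>KB K. lin k ^ mlt k) =
     ppr {1..K} (\<lambda>a b. ((xvar 0 a - cst q2 * xvar 0 b) * (xvar 0 a - cst (inverse q2) * xvar 0 b)) ^ (m - 1))"
proof -
  have "(\<Prod>k\<in>KB K. lin k ^ mlt k) =
        (\<Prod>x\<in>prs K \<times> {q2, inverse q2}. (xvar 0 (fst (fst x)) - cst (snd x) * xvar 0 (snd (fst x))) ^ (m - 1))"
    unfolding KB_def by (subst prod.reindex) (auto simp: inj_on_def lin_1 mlt_def case_prod_beta)
  also have "\<dots> = (\<Prod>p\<in>prs K. \<Prod>c\<in>{q2, inverse q2}. (xvar 0 (fst p) - cst c * xvar 0 (snd p)) ^ (m - 1))"
    by (simp only: prod.cartesian_product case_prod_unfold)
  also have "\<dots> = ppr {1..K} (\<lambda>a b. ((xvar 0 a - cst q2 * xvar 0 b) *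
       (xvar 0 a - cst (inverse q2) * xvar 0 b)) ^ (m - 1))"
    unfolding ppr_def prs_def using q2_neq_inverse by (simp add: case_prod_beta power_mult_distrib)
  finally show ?thesis .
qed

lemma Cf_disjoint: "Cf 1 \<inter> Cf m = {}"
  using m by (auto simp: Cf_def mn_eq_iff)

lemma prod_times: "(\<Prod>x\<in>A \<times> B. g x) = (\<Prod>a\<in>A. \<Prod>b\<in>B. (g (a, b) :: ratfun))"
  by (simp add: prod.cartesian_product)

lemma prod_KC:
  "(\<Prod>k\<in>KC L K. lin k ^ mlt k) =
     (\<Prod>i\<in>{1..m}. \<Prod>a\<in>{1..L}. \<Prod>b\<in>{1..K}. \<Prod>c\<in>Cf i. (xvar (col i) a - cst c * xvar 0 b))"
proof -
  let ?S = "{1..m} \<times> {1..L} \<times> {1..K}"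
  have fin: "finite (Cf i)" for i
    by (simp add: Cf_def)
  let ?\<phi> = "\<lambda>((i, a, b), c). ((col i, a), c, (0::nat, b))"
  have "inj_on ?\<phi> (SIGMA (i, a, b):?S. Cf i)"
  proof (rule inj_onI)
    fix x y
    assume x: "x \<in> (SIGMA (i, a, b):?S. Cf i)" and y: "y \<in> (SIGMA (i, a, b):?S. Cf i)"
      and eq: "?\<phi> x = ?\<phi> y"
    obtain i a b c i' a' b' c' where xy: "x = ((i, a, b), c)" "y = ((i', a', b'), c')"
      by (metis prod.collapse)
    have c: "c \<in> Cf i" "c' \<in> Cf i'"
      using x y by (simp_all add: xy)
    have eqs: "col i = col i'" "a = a'" "c = c'" "b = b'"
      using eq by (simp_all add: xy)
    have "i = i'"
    proof (rule ccontr)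
      assume ne: "i \<noteq> i'"
      have "c \<in> Cf 1 \<inter> Cf m"
      proof (cases "i = m")
        case True
        hence "i' = 1" using eqs(1) ne by simp
        thus ?thesis using c eqs(3) True by simp
      next
        case False
        hence "i' = m \<and> i = 1" using eqs(1) ne by (cases "i' = m") simp_all
        thus ?thesis using c eqs(3) by simp
      qed
      thus False using Cf_disjoint by blast
    qed
    thus "x = y"
      using eqs by (simp add: xy)
  qed
  hence "(\<Prod>k\<in>KC L K. lin k ^ mlt k) =
      (\<Prod>x\<in>(SIGMA (i, a, b):?S. Cf i).
          lin (?\<phi> x) ^ mlt (?\<phi> x))"
    unfolding KC_def by (simp only: prod.reindex o_def)
  also have "\<dots> = (\<Prod>(x, c)\<in>(SIGMA x:?S. Cf (fst x)). xvar (col (fst x)) (fst (snd x)) - cst c * xvar 0 (snd (snd x)))"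
    by (rule prod.cong) (use m in \<open>auto simp: lin_1 mlt_def\<close>)
  also have "\<dots> = (\<Prod>x\<in>?S. \<Prod>c\<in>Cf (fst x). xvar (col (fst x)) (fst (snd x)) - cst c * xvar 0 (snd (snd x)))"
    by (rule prod.Sigma[symmetric]) (auto simp: fin)
  also have "\<dots> = (\<Prod>i\<in>{1..m}. \<Prod>a\<in>{1..L}. \<Prod>b\<in>{1..K}. \<Prod>c\<in>Cf i. (xvar (col i) a - cst c * xvar 0 b))"
    by (simp only: prod_times fst_conv snd_conv)
  finally show ?thesis .
qed

lemma Eprod_eq:
  "Eprod L K =
     ppr {1..L} (\<lambda>a b. (xvar 1 a - cst q2 * xvar 1 b) * (xvar 1 a - cst (inverse q2) * xvar 1 b)) *
     ppr {1..K} (\<lambda>a b. ((xvar 0 a - cst q2 * xvar 0 b) * (xvar 0 a - cst (inverse q2) * xvar 0 b)) ^ (m - 1)) *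
     (\<Prod>i\<in>{1..m}. \<Prod>a\<in>{1..L}. \<Prod>b\<in>{1..K}. \<Prod>c\<in>Cf i. (xvar (col i) a - cst c * xvar 0 b))"
proof -
  have fin: "finite (KA L)" "finite (KB K)" "finite (KC L K)"
    using finite_Kset[of L K] by (auto simp: Kset_def)
  have "KA L \<inter> KB K = {}" "(KA L \<union> KB K) \<inter> KC L K = {}"
    using m by (auto simp: KA_def KB_def KC_def split: if_splits)
  hence "Eprod L K = (\<Prod>k\<in>KA L. lin k ^ mlt k) * (\<Prod>k\<in>KB K. lin k ^ mlt k) * (\<Prod>k\<in>KC L K. lin k ^ mlt k)"
    unfolding Eprod_def Kset_def using fin by (simp add: prod.union_disjoint)
  thus ?thesis
    unfolding prod_KA prod_KB prod_KC .
qed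

lemma rD_split:
  "rD L K = (\<Prod>i\<in>{1..m}. \<Prod>a\<in>{1..L}. \<Prod>b\<in>{1..L}. (sg L i a - sg L (nxt m i) b)) *
     (\<Prod>i\<in>{1..m}. \<Prod>a\<in>{1..K}. \<Prod>b\<in>{1..K}. (sg L i (a + L) - sg L (nxt m i) (b + L))) *
     ((\<Prod>i\<in>{1..m}. \<Prod>a\<in>{1..L}. \<Prod>b\<in>{1..K}. (sg L i a - sg L (nxt m i) (b + L))) *
      (\<Prod>i\<in>{1..m}. \<Prod>b\<in>{1..K}. \<Prod>a\<in>{1..L}. (sg L i (b + L) - sg L (nxt m i) a)))"
  unfolding rD_def prod_add_split prod.distrib by (simp only: mult_ac)

text \<open>
  The denominators of \<open>A B C\<close> cancel against the specialised poles of the source. What remains is the poles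
  allowed in the target and the zeros that are known for \<open>\<rho>(f)\<close>.
\<close>

lemma Den_asc: "asc (YZ L K) (rD L K * Den L K) (Dy L * Dz K * Eprod L K)"
proof -
  let ?yy = "\<Prod>i\<in>{1..m}. \<Prod>a\<in>{1..L}. \<Prod>b\<in>{1..L}. (sg L i a - sg L (nxt m i) b)"
  let ?zz = "\<Prod>i\<in>{1..m}. \<Prod>a\<in>{1..K}. \<Prod>b\<in>{1..K}. (sg L i (a + L) - sg L (nxt m i) (b + L))"
  let ?yz = "(\<Prod>i\<in>{1..m}. \<Prod>a\<in>{1..L}. \<Prod>b\<in>{1..K}. (sg L i a - sg L (nxt m i) (b + L))) *
      (\<Prod>i\<in>{1..m}. \<Prod>b\<in>{1..K}. \<Prod>a\<in>{1..L}. (sg L i (b + L) - sg L (nxt m i) a))"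
  let ?AL = "ppr {1..L} (\<lambda>a b. al (xvar 1 a) (xvar 1 b)) *
     (\<Prod>i\<in>{1..m - 1}. \<Prod>(a, b)\<in>yy_pairs (\<lambda>_. {1..L}) i. be (xvar i a) (xvar (col (i + 1)) b))"
  let ?GA = "ppr {1..K} (\<lambda>a b. ga (xvar 0 a) (xvar 0 b))"
  let ?DE = "\<Prod>i\<in>{1..m - 1}. \<Prod>a\<in>{1..L}. \<Prod>b\<in>{1..K}. de i (xvar i a) (xvar 0 b)"
  let ?EA = "ppr {1..L} (\<lambda>a b. (xvar 1 a - cst q2 * xvar 1 b) * (xvar 1 a - cst (inverse q2) * xvar 1 b))"
  let ?EB = "ppr {1..K} (\<lambda>a b. ((xvar 0 a - cst q2 * xvar 0 b) * (xvar 0 a - cst (inverse q2) * xvar 0 b)) ^ (m - 1))"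
  let ?EC = "\<Prod>i\<in>{1..m}. \<Prod>a\<in>{1..L}. \<Prod>b\<in>{1..K}. \<Prod>c\<in>Cf i. (xvar (col i) a - cst c * xvar 0 b)"
  have "rD L K * Den L K = (?yy * ?AL) * (?zz * ?GA) * (?yz * ?DE)"
    unfolding rD_split Den_def DenS_def by (simp only: mult_ac)
  moreover have "Dy L * Dz K * Eprod L K = (Dy L * ?EA) * (Dz K * ?EB) * ?EC"
    unfolding Eprod_eq by (simp only: mult_ac)
  moreover have "asc (YZ L K) ((?yy * ?AL) * (?zz * ?GA) * (?yz * ?DE)) ((Dy L * ?EA) * (Dz K * ?EB) * ?EC)"
    by (intro asc_mult[OF asc_mult[OF asc_yy asc_zz] asc_yz])
  ultimately show ?thesis
    by (simp only:)
qed

lemma Dy_neq_0: "Dy L \<noteq> 0"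
proof -
  have "i \<noteq> nxt (m - 1) i" if "m - 1 \<noteq> 1" "i \<in> {1..m - 1}" for i
    using that m by (auto simp: nxt_def)
  thus ?thesis
    using finite_ordered_pairs[of "{1..L}"] by (auto simp: Dy_def ppr_def)
qed

lemma Dz_neq_0: "Dz K \<noteq> 0"
  using finite_ordered_pairs[of "{1..K}"] by (auto simp: Dz_def ppr_def)

lemma rD_Den_neq_0: "rD L K \<noteq> 0" "Den L K \<noteq> 0"
  using Den_asc[of L K] Dy_neq_0 Dz_neq_0 Eprod_neq_0 lunit_neq_0 by (auto simp: asc_def)

end

subsection \<open>Renaming variables\<close>

definition ren :: "(nat \<Rightarrow> nat \<Rightarrow> nat) \<Rightarrow> nat \<Rightarrow> nat \<Rightarrow> ratfun" where
  "ren r i a = xvar i (r i a)"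

lemma has_subst_ren: "has_subst (ren r) (xvar i a) (xvar i (r i a))"
  using has_subst_xvar[of "ren r" i a] by (simp add: ren_def)

lemma ppr_reindex:
  assumes sym: "\<And>a b. g a b = g b a" and inj: "inj_on r S"
  shows "ppr S (\<lambda>a b. g (r a) (r b)) = ppr (r ` S) g"
  unfolding ppr_def
proof (rule prod.reindex_bij_witness[
      of _ "\<lambda>(a, b). let a' = inv_into S r a; b' = inv_into S r b in if a' < b' then (a', b') else (b', a')"
        "\<lambda>(a, b). if r a < r b then (r a, r b) else (r b, r a)"])
  fix x assume x: "x \<in> {(a, b). a \<in> S \<and> b \<in> S \<and> a < b}"
  then obtain a b where [simp]: "x = (a, b)" and ab: "a \<in> S" "b \<in> S" "a < b" by auto
  have ne: "r a \<noteq> r b"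
    using inj ab by (auto simp: inj_on_def)
  show "(case case x of (a, b) \<Rightarrow> if r a < r b then (r a, r b) else (r b, r a) of
       (a, b) \<Rightarrow> let a' = inv_into S r a; b' = inv_into S r b in if a' < b' then (a', b') else (b', a')) = x"
    using inj ab ne by (auto simp: Let_def)
  show "(case x of (a, b) \<Rightarrow> if r a < r b then (r a, r b) else (r b, r a)) \<in> {(a, b). a \<in> r ` S \<and> b \<in> r ` S \<and> a < b}"
    using ab ne by auto
  show "(case case x of (a, b) \<Rightarrow> if r a < r b then (r a, r b) else (r b, r a) of (a, b) \<Rightarrow> g a b) =
        (case x of (a, b) \<Rightarrow> g (r a) (r b))"
    using sym by auto
next
  fix y assume y: "y \<in> {(a, b). a \<in> r ` S \<and> b \<in> r ` S \<and> a < b}"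
  then obtain a b where [simp]: "y = (r a, r b)" and ab: "a \<in> S" "b \<in> S" "r a < r b" by auto
  have ne: "a \<noteq> b" using ab by auto
  show "(case case y of (a, b) \<Rightarrow> let a' = inv_into S r a; b' = inv_into S r b in if a' < b' then (a', b') else (b', a') of
       (a, b) \<Rightarrow> if r a < r b then (r a, r b) else (r b, r a)) = y"
    using inj ab ne by (auto simp: Let_def)
  show "(case y of (a, b) \<Rightarrow> let a' = inv_into S r a; b' = inv_into S r b in if a' < b' then (a', b') else (b', a'))
      \<in> {(a, b). a \<in> S \<and> b \<in> S \<and> a < b}"
    using inj ab ne by (auto simp: Let_def)
qed

context shuffle_setup
begin

lemma quadratic_sym:
  "c \<noteq> 0 \<Longrightarrow> (u - cst c * v) * (u - cst (inverse c) * v) = (v - cst c * u) * (v - cst (inverse c) * u)"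
proof -
  assume "c \<noteq> 0"
  hence "cst c * cst (inverse c) = 1"
    by (simp flip: cst_mult)
  hence "(u - cst c * v) * (u - cst (inverse c) * v) = u * u - (cst c + cst (inverse c)) * (u * v) + v * v" for u v
    by (simp add: algebra_simps mult.left_commute[of "cst c" "cst (inverse c)"])
  thus ?thesis
    by (simp only:) (simp add: algebra_simps)
qed

lemma al_sym: "al u v = al v u"
  unfolding al_def using quadratic_sym[of q2 u v] quadratic_sym[of q1 u v] qs_neq_0 by simp

lemma ga_sym: "ga u v = ga v u"
  unfolding ga_def
  using quadratic_sym[of q2 u v] quadratic_sym[of q3 u v] quadratic_sym[of "q3 ^ (m - 1)" u v] qs_neq_0
  by (simp add: power2_commute)

lemma has_subst_al:
  assumes "r 1 a \<noteq> r 1 b"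
  shows "has_subst (ren r) (al (xvar 1 a) (xvar 1 b)) (al (xvar 1 (r 1 a)) (xvar 1 (r 1 b)))"
proof -
  have "xvar 1 (r 1 a) - cst c * xvar 1 (r 1 b) \<noteq> 0" for c
    using assms by (intro lf_neq_0) simp
  thus ?thesis
    unfolding al_def by (intro has_subst_mult has_subst_divide has_subst_cst has_subst_diff has_subst_ren) simp
qed

lemma has_subst_ga:
  assumes "r 0 a \<noteq> r 0 b"
  shows "has_subst (ren r) (ga (xvar 0 a) (xvar 0 b)) (ga (xvar 0 (r 0 a)) (xvar 0 (r 0 b)))"
proof -
  have "xvar 0 (r 0 a) - cst c * xvar 0 (r 0 b) \<noteq> 0" for c
    using assms by (intro lf_neq_0) simp
  thus ?thesis
    unfolding ga_def
    by (intro has_subst_mult has_subst_divide has_subst_cst has_subst_diff has_subst_power has_subst_ren) simp_all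
qed

lemma has_subst_be:
  assumes "(i, r i a) \<noteq> (j, r j b)"
  shows "has_subst (ren r) (be (xvar i a) (xvar j b)) (be (xvar i (r i a)) (xvar j (r j b)))"
proof -
  have "xvar i (r i a) - cst t * xvar j (r j b) \<noteq> 0"
    using assms by (intro lf_neq_0) simp
  thus ?thesis
    unfolding be_def by (intro has_subst_mult has_subst_divide has_subst_cst has_subst_diff has_subst_ren)
qed

lemma has_subst_de:
  assumes "i \<noteq> 0"
  shows "has_subst (ren r) (de i (xvar i a) (xvar 0 b)) (de i (xvar i (r i a)) (xvar 0 (r 0 b)))"
proof -
  have "xvar i (r i a) - cst c * xvar 0 (r 0 b) \<noteq> 0" "xvar i (r i a) - xvar 0 (r 0 b) \<noteq> 0"
    "cst (kap i) * xvar i (r i a) - cst c * xvar 0 (r 0 b) \<noteq> 0" for c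
    using assms kap_neq_0 by (intro lf_neq_0; simp)+
  note nl = this
  show ?thesis
  proof (cases "i = 1")
    case True
    show ?thesis
      unfolding de_def if_P[OF True]
      by (intro has_subst_mult has_subst_divide has_subst_cst has_subst_diff has_subst_ren no_zero_divisors nl)
  next
    case False
    show ?thesis
      unfolding de_def if_not_P[OF False]
      by (intro has_subst_mult has_subst_divide has_subst_cst has_subst_diff has_subst_ren no_zero_divisors nl)
  qed
qed

lemma has_subst_Den:
  assumes inj: "\<And>i. i < m \<Longrightarrow> i \<noteq> 0 \<Longrightarrow> inj_on (r i) {1..L}" "inj_on (r 0) {1..K}"
  shows "has_subst (ren r) (Den L K) (DenS (\<lambda>i. r i ` {1..L}) (r 0 ` {1..K}))"
proof -
  let ?I = "\<lambda>i. r i ` {1..L}"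
  have col: "col (i + 1) < m" "col (i + 1) \<noteq> 0" "i < m" "i \<noteq> 0" if "i \<in> {1..m - 1}" for i
    using that m by auto
  have be_ok: "(i, r i a) \<noteq> (col (i + 1), r (col (i + 1)) b)"
    if "i \<in> {1..m - 1}" "(a, b) \<in> yy_pairs (\<lambda>_. {1..L}) i" for i a b
  proof (cases "m = 2")
    case True
    hence "i = 1" using that(1) by simp
    thus ?thesis
      using True that(2) inj(1)[of 1] unfolding yy_pairs_def by (auto simp: inj_on_eq_iff)
  next
    case False
    hence "i \<noteq> col (i + 1)" using that(1) m by auto
    thus ?thesis by simp
  qed
  have reindex_be: "(\<Prod>(a, b)\<in>yy_pairs (\<lambda>_. {1..L}) i. be (xvar i (r i a)) (xvar (col (i + 1)) (r (col (i + 1)) b))) =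
      (\<Prod>(a, b)\<in>yy_pairs ?I i. be (xvar i a) (xvar (col (i + 1)) b))" if i: "i \<in> {1..m - 1}" for i
  proof -
    let ?j = "col (i + 1)"
    have inj': "inj_on (r i) {1..L}" "inj_on (r ?j) {1..L}"
      using inj(1) col[OF i] by blast+
    have eq_i: "i = 1 \<and> ?j = 1" if "m = 2"
      using that i by auto
    have "yy_pairs ?I i = map_prod (r i) (r ?j) ` yy_pairs (\<lambda>_. {1..L}) i"
    proof (cases "m = 2")
      case True
      hence [simp]: "i = 1" and m2: "m = 2" using i by auto
      show ?thesis
        unfolding yy_pairs_def using inj'(1) m2 by (auto simp: inj_on_eq_iff image_iff)
    next
      case False
      thus ?thesis by (auto simp: yy_pairs_def image_iff)
    qed
    moreover have "inj_on (map_prod (r i) (r ?j)) (yy_pairs (\<lambda>_. {1..L}) i)"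
      by (rule inj_on_subset[OF map_prod_inj_on[OF inj']]) (auto simp: yy_pairs_def)
    ultimately show ?thesis
      by (simp add: prod.reindex case_prod_beta)
  qed
  have "has_subst (ren r) (Den L K)
     (ppr {1..L} (\<lambda>a b. al (xvar 1 (r 1 a)) (xvar 1 (r 1 b))) *
     (\<Prod>i\<in>{1..m - 1}. \<Prod>(a, b)\<in>yy_pairs (\<lambda>_. {1..L}) i. be (xvar i (r i a)) (xvar (col (i + 1)) (r (col (i + 1)) b))) *
     ppr {1..K} (\<lambda>a b. ga (xvar 0 (r 0 a)) (xvar 0 (r 0 b))) *
     (\<Prod>i\<in>{1..m - 1}. \<Prod>a\<in>{1..L}. \<Prod>b\<in>{1..K}. de i (xvar i (r i a)) (xvar 0 (r 0 b))))"
  proof -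
    have A: "has_subst (ren r) (ppr {1..L} (\<lambda>a b. al (xvar 1 a) (xvar 1 b)))
       (ppr {1..L} (\<lambda>a b. al (xvar 1 (r 1 a)) (xvar 1 (r 1 b))))"
      unfolding ppr_def case_prod_beta
      using inj(1)[of 1] m by (intro has_subst_prod has_subst_al) (auto simp: inj_on_eq_iff)
    have G: "has_subst (ren r) (ppr {1..K} (\<lambda>a b. ga (xvar 0 a) (xvar 0 b)))
       (ppr {1..K} (\<lambda>a b. ga (xvar 0 (r 0 a)) (xvar 0 (r 0 b))))"
      unfolding ppr_def case_prod_beta
      using inj(2) by (intro has_subst_prod has_subst_ga) (auto simp: inj_on_eq_iff)
    have B: "has_subst (ren r) (\<Prod>(a, b)\<in>yy_pairs (\<lambda>_. {1..L}) i. be (xvar i a) (xvar (col (i + 1)) b))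
      (\<Prod>(a, b)\<in>yy_pairs (\<lambda>_. {1..L}) i. be (xvar i (r i a)) (xvar (col (i + 1)) (r (col (i + 1)) b)))"
      if "i \<in> {1..m - 1}" for i
      unfolding case_prod_beta using be_ok[OF that] by (intro has_subst_prod has_subst_be) auto
    have D: "has_subst (ren r) (\<Prod>i\<in>{1..m - 1}. \<Prod>a\<in>{1..L}. \<Prod>b\<in>{1..K}. de i (xvar i a) (xvar 0 b))
       (\<Prod>i\<in>{1..m - 1}. \<Prod>a\<in>{1..L}. \<Prod>b\<in>{1..K}. de i (xvar i (r i a)) (xvar 0 (r 0 b)))"
      by (intro has_subst_prod has_subst_de) auto
    show ?thesis
      unfolding Den_def DenS_def
      by (rule has_subst_mult[OF has_subst_mult[OF has_subst_mult[OF A has_subst_prod[OF B]] G] D])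
  qed
  moreover have "ppr {1..L} (\<lambda>a b. al (xvar 1 (r 1 a)) (xvar 1 (r 1 b))) =
     ppr (?I 1) (\<lambda>a b. al (xvar 1 a) (xvar 1 b))"
    using inj(1)[of 1] m by (intro ppr_reindex[of "\<lambda>a b. al (xvar 1 a) (xvar 1 b)"] al_sym) auto
  moreover have "ppr {1..K} (\<lambda>a b. ga (xvar 0 (r 0 a)) (xvar 0 (r 0 b))) =
     ppr (r 0 ` {1..K}) (\<lambda>a b. ga (xvar 0 a) (xvar 0 b))"
    using inj(2) by (intro ppr_reindex[of "\<lambda>a b. ga (xvar 0 a) (xvar 0 b)"] ga_sym)
  moreover have "(\<Prod>i\<in>{1..m - 1}. \<Prod>a\<in>{1..L}. \<Prod>b\<in>{1..K}. de i (xvar i (r i a)) (xvar 0 (r 0 b))) =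
     (\<Prod>i\<in>{1..m - 1}. \<Prod>a\<in>?I i. \<Prod>b\<in>r 0 ` {1..K}. de i (xvar i a) (xvar 0 b))"
  proof (rule prod.cong[OF refl])
    fix i assume "i \<in> {1..m - 1}"
    hence "inj_on (r i) {1..L}"
      using inj(1) col by blast
    thus "(\<Prod>a\<in>{1..L}. \<Prod>b\<in>{1..K}. de i (xvar i (r i a)) (xvar 0 (r 0 b))) =
          (\<Prod>a\<in>?I i. \<Prod>b\<in>r 0 ` {1..K}. de i (xvar i a) (xvar 0 b))"
      using inj(2) by (simp add: prod.reindex)
  qed
  ultimately show ?thesis
    unfolding DenS_def using reindex_be by simp
qed

end

section \<open>The conditions on the image\<close>

definition wsub :: "complex \<Rightarrow> complex \<Rightarrow> nat \<times> nat \<Rightarrow> nat \<times> nat \<Rightarrow> nat \<times> nat \<Rightarrow> nat \<Rightarrow> nat \<Rightarrow> ratfun" where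
  "wsub qa qb u v w = (\<lambda>j e. if (j, e) = v then cst qa * case_prod xvar u
                  else if (j, e) = w then cst qb * (cst qa * case_prod xvar u)
                  else xvar j e)"

lemma wheel_at_wsub: "wheel_at qa qb u v w F \<longleftrightarrow> subst (wsub qa qb u v w) F = 0"
  by (simp add: wheel_at_def wsub_def)

text \<open>
  A wheel substitution sends \<open>x\<close> to \<open>wco x\<close> times the variable \<open>wvar x\<close>, so whether a linear form vanishes on
  the wheel is a comparison of constants.
\<close>

definition wco :: "complex \<Rightarrow> complex \<Rightarrow> nat \<times> nat \<Rightarrow> nat \<times> nat \<Rightarrow> nat \<times> nat \<Rightarrow> complex" where
  "wco qa qb v w x = (if x = v then qa else if x = w then qb * qa else 1)"

definition wvar :: "nat \<times> nat \<Rightarrow> nat \<times> nat \<Rightarrow> nat \<times> nat \<Rightarrow> nat \<times> nat \<Rightarrow> nat \<times> nat" where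
  "wvar u v w x = (if x = v \<or> x = w then u else x)"

lemma wsub_eq: "case_prod (wsub qa qb u v w) x = cst (wco qa qb v w x) * X (wvar u v w x)"
  by (cases x) (auto simp: wsub_def wco_def wvar_def cst_mult mult.assoc)

lemma wsub_eq': "wsub qa qb u v w i a = cst (wco qa qb v w (i, a)) * X (wvar u v w (i, a))"
  using wsub_eq[of qa qb u v w "(i, a)"] by simp

lemma wco_neq_0: "qa \<noteq> 0 \<Longrightarrow> qb \<noteq> 0 \<Longrightarrow> wco qa qb v w x \<noteq> 0"
  by (simp add: wco_def)

lemma wsub_unit:
  assumes "qa \<noteq> 0" "qb \<noteq> 0" "u \<in> V" "(i, a) \<in> V"
  shows "wsub qa qb u v w i a \<in> lunit V"
  unfolding wsub_eq' using assms by (intro lunit_mult lunit_cst lunit_X wco_neq_0) (auto simp: wvar_def)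

lemma wsub_neq_0: "qa \<noteq> 0 \<Longrightarrow> qb \<noteq> 0 \<Longrightarrow> wsub qa qb u v w i a \<noteq> 0"
  unfolding wsub_eq' by (simp add: wco_neq_0)

lemma wsub_lin:
  assumes "qa \<noteq> 0" "qb \<noteq> 0"
  shows "subst (wsub qa qb u v w) (lin (x, c, y)) = 0 \<longleftrightarrow>
           wvar u v w x = wvar u v w y \<and> wco qa qb v w x = c * wco qa qb v w y"
proof -
  have "subst (wsub qa qb u v w) (lin (x, c, y)) =
        case_prod (wsub qa qb u v w) x - cst c * case_prod (wsub qa qb u v w) y"
    unfolding lin_def prod.case by (intro has_subst_imp_subst has_subst_intros)
  also have "\<dots> = cst (wco qa qb v w x) * X (wvar u v w x) - cst (c * wco qa qb v w y) * X (wvar u v w y)"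
    unfolding wsub_eq by (simp add: cst_mult mult.assoc)
  finally show ?thesis
    using linear_form_eq_iff[of "wco qa qb v w x" "c * wco qa qb v w y"] wco_neq_0[OF assms] by simp
qed

text \<open>The poles stay away from the wheels, so \<open>f / D\<close> and \<open>f\<close> satisfy the same wheel conditions.\<close>

lemma wsub_inj:
  assumes "distinct [u, v, w]" "qa \<noteq> 0" "qb \<noteq> 0" "qa \<noteq> 1" "qb \<noteq> 1" "qb * qa \<noteq> 1" "x \<noteq> y"
  shows "case_prod (wsub qa qb u v w) x \<noteq> case_prod (wsub qa qb u v w) y"
proof
  assume "case_prod (wsub qa qb u v w) x = case_prod (wsub qa qb u v w) y"
  hence "wvar u v w x = wvar u v w y" "wco qa qb v w x = wco qa qb v w y"
    using linear_form_eq_iff[of "wco qa qb v w x" "wco qa qb v w y"] wco_neq_0[OF assms(2,3)]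
    by (simp_all add: wsub_eq)
  thus False
    using assms by (auto simp: wvar_def wco_def split: if_splits)
qed

lemma wheel_at_divide:
  assumes f: "f \<in> lp V" and D: "has_subst (wsub qa qb u v w) D D'" "D' \<noteq> 0" and q: "qa \<noteq> 0" "qb \<noteq> 0"
  shows "wheel_at qa qb u v w (f / D) \<longleftrightarrow> wheel_at qa qb u v w f"
proof -
  have "has_subst (wsub qa qb u v w) (f / D) (subst (wsub qa qb u v w) f / D')"
    using wsub_neq_0[OF q] by (intro has_subst_divide lp_has_subst[OF f] D)
  thus ?thesis
    using D(2) by (simp add: wheel_at_wsub has_subst_imp_subst)
qed

definition cyc_den :: "nat \<Rightarrow> nat \<Rightarrow> ratfun" where
  "cyc_den n N = (\<Prod>i\<in>{1..n}. \<Prod>a\<in>{1..N}. \<Prod>b\<in>{1..N}. (xvar i a - xvar (nxt n i) b))"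

lemma nxt_neq: "n \<ge> 2 \<Longrightarrow> i \<in> {1..n} \<Longrightarrow> nxt n i \<noteq> i"
  by (auto simp: nxt_def)

lemma nxt_range: "i \<in> {1..n} \<Longrightarrow> nxt n i \<in> {1..n}"
  by (auto simp: nxt_def)

lemma cyc_den_lp: "cyc_den n N \<in> lp (degree_vars n (\<lambda>_. N))"
  unfolding cyc_den_def
  by (intro lp_prod lp_diff lp_xvar) (auto simp: degree_vars_def nxt_def)

lemma has_subst_cyc_den:
  "has_subst s (cyc_den n N) (\<Prod>i\<in>{1..n}. \<Prod>a\<in>{1..N}. \<Prod>b\<in>{1..N}. (s i a - s (nxt n i) b))"
  unfolding cyc_den_def by (intro has_subst_prod has_subst_diff has_subst_xvar)

lemma cyc_den_subst_neq_0:
  fixes s :: "nat \<Rightarrow> nat \<Rightarrow> ratfun"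
  assumes "n \<ge> 2" "\<And>x y. x \<in> degree_vars n (\<lambda>_. N) \<Longrightarrow> y \<in> degree_vars n (\<lambda>_. N) \<Longrightarrow> x \<noteq> y \<Longrightarrow>
     case_prod s x \<noteq> case_prod s y"
  shows "(\<Prod>i\<in>{1..n}. \<Prod>a\<in>{1..N}. \<Prod>b\<in>{1..N}. (s i a - s (nxt n i) b)) \<noteq> 0"
proof -
  have "s i a - s (nxt n i) b \<noteq> 0" if "i \<in> {1..n}" "a \<in> {1..N}" "b \<in> {1..N}" for i a b
    using assms(2)[of "(i, a)" "(nxt n i, b)"] that nxt_neq[OF assms(1) that(1)] nxt_range[OF that(1)]
    by (auto simp: degree_vars_def)
  thus ?thesis
    by simp
qed

lemma cyc_den_neq_0: "n \<ge> 2 \<Longrightarrow> cyc_den n N \<noteq> 0"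
  using cyc_den_subst_neq_0[of n N xvar] by (auto simp: cyc_den_def)

lemma ren_cyc_den:
  assumes "\<And>i. i \<in> {1..n} \<Longrightarrow> r i permutes {1..N}"
  shows "subst (ren r) (cyc_den n N) = cyc_den n N"
proof -
  have "subst (ren r) (cyc_den n N) =
      (\<Prod>i\<in>{1..n}. \<Prod>a\<in>{1..N}. \<Prod>b\<in>{1..N}. (xvar i (r i a) - xvar (nxt n i) (r (nxt n i) b)))"
    using has_subst_imp_subst[OF has_subst_cyc_den] by (simp add: ren_def)
  also have "\<dots> = cyc_den n N"
    unfolding cyc_den_def
  proof (rule prod.cong[OF refl])
    fix i assume i: "i \<in> {1..n}"
    have "(\<Prod>a\<in>{1..N}. \<Prod>b\<in>{1..N}. (xvar i (r i a) - xvar (nxt n i) (r (nxt n i) b))) =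
          (\<Prod>a\<in>{1..N}. \<Prod>b\<in>{1..N}. (xvar i (r i a) - xvar (nxt n i) b))"
    proof (rule prod.cong[OF refl])
      fix a
      show "(\<Prod>b\<in>{1..N}. (xvar i (r i a) - xvar (nxt n i) (r (nxt n i) b))) =
            (\<Prod>b\<in>{1..N}. (xvar i (r i a) - xvar (nxt n i) b))"
        using prod.permute[OF assms[OF nxt_range[OF i]], of "\<lambda>b. xvar i (r i a) - xvar (nxt n i) b"]
        by (simp add: o_def)
    qed
    also have "\<dots> = (\<Prod>a\<in>{1..N}. \<Prod>b\<in>{1..N}. (xvar i a - xvar (nxt n i) b))"
      using prod.permute[OF assms[OF i], of "\<lambda>a. \<Prod>b\<in>{1..N}. (xvar i a - xvar (nxt n i) b)"]
      by (simp add: o_def)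
    finally show "(\<Prod>a\<in>{1..N}. \<Prod>b\<in>{1..N}. (xvar i (r i a) - xvar (nxt n i) (r (nxt n i) b))) =
       (\<Prod>a\<in>{1..N}. \<Prod>b\<in>{1..N}. (xvar i a - xvar (nxt n i) b))" .
  qed
  finally show ?thesis .
qed

definition ren1 :: "nat \<Rightarrow> (nat \<Rightarrow> nat) \<Rightarrow> nat \<Rightarrow> nat \<Rightarrow> nat" where
  "ren1 i \<sigma> = (\<lambda>j a. if j = i then \<sigma> a else a)"

lemma sym_in_ren1: "sym_in n N F \<longleftrightarrow> (\<forall>i\<in>{1..n}. \<forall>\<sigma>. \<sigma> permutes {1..N i} \<longrightarrow> subst (ren (ren1 i \<sigma>)) F = F)"
proof -
  have "(\<lambda>j a. xvar j (if j = i then \<sigma> a else a)) = ren (ren1 i \<sigma>)" for i \<sigma>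
    by (simp add: fun_eq_iff ren_def ren1_def)
  thus ?thesis
    by (simp add: sym_in_def)
qed

lemma ren_neq_0: "ren r i a \<noteq> 0"
  by (simp add: ren_def)

lemma sym_in_divide:
  assumes f: "f \<in> lp V" and D: "D \<in> lp V" "D \<noteq> 0"
    and D_inv: "\<And>i \<sigma>. i \<in> {1..n} \<Longrightarrow> \<sigma> permutes {1..N i} \<Longrightarrow> subst (ren (ren1 i \<sigma>)) D = D"
  shows "sym_in n N (f / D) \<longleftrightarrow> sym_in n N f"
proof -
  have "subst (ren (ren1 i \<sigma>)) (f / D) = f / D \<longleftrightarrow> subst (ren (ren1 i \<sigma>)) f = f"
    if "i \<in> {1..n}" "\<sigma> permutes {1..N i}" for i \<sigma>
  proof -
    have "has_subst (ren (ren1 i \<sigma>)) (f / D) (subst (ren (ren1 i \<sigma>)) f / subst (ren (ren1 i \<sigma>)) D)"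
      using D_inv[OF that] D(2) by (intro has_subst_divide lp_has_subst[OF f] lp_has_subst[OF D(1)] ren_neq_0) simp
    thus ?thesis
      using D_inv[OF that] D(2) by (simp add: has_subst_imp_subst)
  qed
  thus ?thesis
    unfolding sym_in_ren1 by blast
qed

lemma ren1_permutes:
  "\<sigma> permutes S i \<Longrightarrow> ren1 i \<sigma> j permutes S j"
  using permutes_id[of "S j"] by (cases "j = i") (simp_all add: ren1_def id_def)

text \<open>Symmetry in each colour separately gives symmetry under all colourwise permutations at once.\<close>

lemma sym_in_imp_ren:
  assumes f: "f \<in> lp (degree_vars n N)" and sym: "sym_in n N f"
    and r: "\<And>i. i \<in> {1..n} \<Longrightarrow> r i permutes {1..N i}"
  shows "subst (ren r) f = f"
proof -
  define r' where "r' k i = (if i \<in> {1..k} then r i else (\<lambda>a. a))" for k i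
  have "subst (ren (r' k)) f = f" if "k \<le> n" for k
    using that
  proof (induction k)
    case 0
    show ?case
      by (rule lp_subst_id[OF f]) (simp add: r'_def ren_def)
  next
    case (Suc k)
    have "subst (ren (r' k)) (subst (ren (ren1 (Suc k) (r (Suc k)))) f) = subst (ren (r' (Suc k))) f"
    proof (rule lp_subst_comp(2)[OF f], intro conjI ren_neq_0)
      fix i a
      show "has_subst (ren (r' k)) (ren (ren1 (Suc k) (r (Suc k))) i a) (ren (r' (Suc k)) i a)"
        unfolding ren_def[of "ren1 _ _"] ren_def[of "r' (Suc k)"]
        using has_subst_ren[of "r' k" i "ren1 (Suc k) (r (Suc k)) i a"]
        by (cases "i = Suc k") (auto simp: r'_def ren1_def le_Suc_eq)
    qed
    moreover have "subst (ren (ren1 (Suc k) (r (Suc k)))) f = f"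
      using sym r[of "Suc k"] Suc.prems unfolding sym_in_ren1 by auto
    ultimately show ?case
      using Suc by simp
  qed
  hence "subst (ren (r' n)) f = f"
    by simp
  moreover have "subst (ren r) f = subst (ren (r' n)) f"
    by (rule lp_subst_cong[OF f]) (auto simp: ren_def r'_def degree_vars_def)
  ultimately show ?thesis
    by simp
qed

context shuffle_setup
begin

lemma Sh_numerator:
  assumes F: "F \<in> Sh m (q, q1, q2, q3) (\<lambda>_. N)"
  obtains f where "f \<in> lp (Xv N)" "F = f / cyc_den m N" "wheel_zero N f" "sym_in m (\<lambda>_. N) f"
proof -
  have m1: "m \<noteq> 1"
    using m by simp
  obtain f where f: "f \<in> lp (Xv N)" "F = f / cyc_den m N"
    using F m1 by (auto simp: Sh_def poles_def cyc_den_def lp_eq_laurent_polys)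
  have wh: "wheel_at qa qb u v w f" if "wheel_at qa qb u v w F" "distinct [u, v, w]"
    "qa = q3 \<and> qb = q2 \<or> qa = q2 \<and> qb = q3" for qa qb u v w
  proof -
    have "q3 \<noteq> 1" "q2 \<noteq> 1" "q2 * q3 \<noteq> 1" "q3 * q2 \<noteq> 1"
      using m by (simp_all add: mn_consts mn_simps)
    hence q: "qa \<noteq> 0" "qb \<noteq> 0" "qa \<noteq> 1" "qb \<noteq> 1" "qb * qa \<noteq> 1"
      using that(3) qs_neq_0 by auto
    have "(\<Prod>i\<in>{1..m}. \<Prod>a\<in>{1..N}. \<Prod>b\<in>{1..N}. (wsub qa qb u v w i a - wsub qa qb u v w (nxt m i) b)) \<noteq> 0"
      using wsub_inj[OF that(2) q] m by (intro cyc_den_subst_neq_0)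
    from wheel_at_divide[OF f(1) has_subst_cyc_den this q(1,2)] show ?thesis
      using that(1) f(2) by simp
  qed
  have "wheel m (q, q1, q2, q3) (\<lambda>_. N) f"
    using F wh unfolding Sh_def by auto
  hence "wheel_zero N f"
    by (rule wheel_imp_wheel_zero[OF f(1)])
  moreover have "sym_in m (\<lambda>_. N) f"
  proof -
    have "subst (ren (ren1 i \<sigma>)) (cyc_den m N) = cyc_den m N" if "\<sigma> permutes {1..N}" for i \<sigma>
      using ren1_permutes[of \<sigma> "\<lambda>_. {1..N}" i] that by (intro ren_cyc_den) auto
    thus ?thesis
      using sym_in_divide[OF f(1) cyc_den_lp cyc_den_neq_0[OF m], of m "\<lambda>_. N"] F f(2)
      by (auto simp: Sh_def)
  qed
  ultimately show thesis
    using that f by blast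
qed

lemma rD_eq: "has_subst (sg L) (cyc_den m (L + K)) (rD L K)"
  unfolding rD_def by (rule has_subst_cyc_den)

lemma tildeF_eq:
  assumes f: "f \<in> lp (Xv (L + K))" "F = f / cyc_den m (L + K)"
  shows "tildeF m (q, q1, q2, q3) l1 (L + K) L F = subst (sg L) f / (rD L K * Den L K)"
    and "has_subst (sg L) F (subst (sg L) f / rD L K)"
proof -
  show "has_subst (sg L) F (subst (sg L) f / rD L K)"
    unfolding f(2) by (intro has_subst_divide rD_eq lp_has_subst[OF f(1)] sg_neq_0 rD_Den_neq_0)
  hence "subst (sg L) F = subst (sg L) f / rD L K"
    by (rule has_subst_imp_subst)
  thus "tildeF m (q, q1, q2, q3) l1 (L + K) L F = subst (sg L) f / (rD L K * Den L K)"
    by (simp only: tildeF_def rho_eq Den_eq divide_divide_eq_left)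
qed

text \<open>
  The image of \<open>f / \<Delta>\<close>, multiplied by the denominators of the two target algebras. By \<open>Den_asc\<close> it is
  \<open>\<rho>(f) / E\<close> up to a unit.
\<close>

definition hnum :: "nat \<Rightarrow> nat \<Rightarrow> ratfun \<Rightarrow> ratfun" where
  "hnum L K f = subst (sg L) f * (Dy L * Dz K) / (rD L K * Den L K)"

lemma hnum_factor:
  obtains g where "g \<in> lunit (YZ L K)" "\<And>f. g * (Eprod L K * hnum L K f) = subst (sg L) f"
proof -
  obtain g where g: "g \<in> lunit (YZ L K)" "rD L K * Den L K = g * (Dy L * Dz K * Eprod L K)"
    using Den_asc[of L K] unfolding asc_def by blast
  have "g * (E * (p * (y * z) / (g * (y * z * E)))) = p"
    if "g \<noteq> 0" "E \<noteq> 0" "y \<noteq> 0" "z \<noteq> 0" for g E p y z :: ratfun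
    using that by simp
  hence "g * (Eprod L K * hnum L K f) = subst (sg L) f" for f
    unfolding hnum_def g(2) using lunit_neq_0[OF g(1)] Eprod_neq_0 Dy_neq_0 Dz_neq_0 by blast
  thus thesis
    using that g(1) by blast
qed

lemma hnum_lp:
  assumes "f \<in> lp (Xv (L + K))" "wheel_zero (L + K) f"
  shows "hnum L K f \<in> lp (YZ L K)"
proof -
  obtain g where g: "g \<in> lunit (YZ L K)" "g * (Eprod L K * hnum L K f) = subst (sg L) f"
    using hnum_factor by metis
  have eq: "hnum L K f = inverse g * (subst (sg L) f / Eprod L K)"
    using g(2)[symmetric] lunit_neq_0[OF g(1)] Eprod_neq_0[of L K] by simp
  show ?thesis
    unfolding eq by (rule lp.mult[OF lunit_lp[OF lunit_inverse[OF g(1)]] Eprod_dvd_specialisation[OF assms]])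
qed

subsection \<open>Symmetry\<close>

text \<open>
  A permutation of the \<open>y\<close> and \<open>z\<close> variables comes from one of the \<open>x\<close> variables, which uses the same
  permutation in the colours \<open>1\<close> and \<open>m\<close>.
\<close>

definition lift_ren :: "nat \<Rightarrow> nat \<Rightarrow> (nat \<Rightarrow> nat \<Rightarrow> nat) \<Rightarrow> nat \<Rightarrow> nat \<Rightarrow> nat" where
  "lift_ren L K r i a = (if a \<in> {1..L} then r (col i) a
                         else if a \<in> {L + 1..L + K} then r 0 (a - L) + L else a)"

lemma lift_ren_permutes:
  assumes "r (col i) permutes {1..L}" "r 0 permutes {1..K}"
  shows "lift_ren L K r i permutes {1..L + K}"
proof (rule bij_imp_permutes)
  have "bij_betw (lift_ren L K r i) {1..L} {1..L}"
    using permutes_imp_bij[OF assms(1)] by (rule bij_betw_cong[THEN iffD1, rotated]) (simp add: lift_ren_def)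
  moreover have "bij_betw (lift_ren L K r i) {L + 1..L + K} {L + 1..L + K}"
  proof -
    have "bij_betw (\<lambda>a. a + L) {1..K} {L + 1..L + K}" "bij_betw (\<lambda>a. a - L) {L + 1..L + K} {1..K}"
      by (rule bij_betw_byWitness[where f' = "\<lambda>a. a - L"]; auto)
         (rule bij_betw_byWitness[where f' = "\<lambda>a. a + L"]; auto)
    hence "bij_betw ((\<lambda>a. a + L) \<circ> (r 0 \<circ> (\<lambda>a. a - L))) {L + 1..L + K} {L + 1..L + K}"
      using permutes_imp_bij[OF assms(2)] by (blast intro: bij_betw_trans)
    thus ?thesis
      by (rule bij_betw_cong[THEN iffD1, rotated]) (simp add: lift_ren_def)
  qed
  ultimately have "bij_betw (lift_ren L K r i) ({1..L} \<union> {L + 1..L + K}) ({1..L} \<union> {L + 1..L + K})"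
    by (rule bij_betw_combine) auto
  moreover have "{1..L} \<union> {L + 1..L + K} = {1..L + K}"
    by auto
  ultimately show "bij_betw (lift_ren L K r i) {1..L + K} {1..L + K}"
    by simp
qed (auto simp: lift_ren_def)

lemma specialisation_sym:
  assumes f: "f \<in> lp (Xv (L + K))" and inv: "\<And>r. (\<And>i. i \<in> {1..m} \<Longrightarrow> r i permutes {1..L + K}) \<Longrightarrow> subst (ren r) f = f"
    and r: "\<And>i. i \<in> {1..m - 1} \<Longrightarrow> r i permutes {1..L}" "r 0 permutes {1..K}"
  shows "subst (ren r) (subst (sg L) f) = subst (sg L) f"
proof -
  let ?r = "lift_ren L K r"
  have rcol: "r (col i) permutes {1..L}" if "i \<in> {1..m}" for i
    using r(1)[of "col i"] that m by auto
  have "subst (sg L) (subst (ren ?r) f) = subst (\<lambda>i a. cst (rco L i a) * case_prod (ren r) (rvar L i a)) f"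
  proof (rule lp_subst_comp(2)[OF f], intro conjI ren_neq_0)
    fix i a assume ia: "(i, a) \<in> Xv (L + K)"
    have perm: "r (col i) permutes {1..L}"
      using ia rcol by (simp add: Xv_iff)
    have "sg L i (?r i a) = cst (rco L i a) * case_prod (ren r) (rvar L i a)"
    proof (cases "a \<le> L")
      case True
      hence "r (col i) a \<in> {1..L}"
        using ia permutes_in_image[OF perm, of a] by (simp add: Xv_iff)
      thus ?thesis
        using True ia by (simp add: lift_ren_def sg_def rco_def rvar_def ren_def Xv_iff)
    next
      case False
      hence "r 0 (a - L) \<in> {1..K}"
        using ia permutes_in_image[OF r(2), of "a - L"] by (auto simp: Xv_iff)
      thus ?thesis
        using False ia by (auto simp: lift_ren_def sg_def rco_def rvar_def ren_def Xv_iff)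
    qed
    thus "has_subst (sg L) (ren ?r i a) (cst (rco L i a) * case_prod (ren r) (rvar L i a))"
      using has_subst_xvar[of "sg L" i "?r i a"] by (simp add: ren_def)
    show "cst (rco L i a) * case_prod (ren r) (rvar L i a) \<noteq> 0"
      by (simp add: rco_neq_0 ren_def case_prod_beta)
  qed
  moreover have "subst (ren ?r) f = f"
    by (rule inv) (rule lift_ren_permutes[OF rcol r(2)])
  moreover have "subst (ren r) (subst (sg L) f) =
     subst (\<lambda>i a. cst (rco L i a) * case_prod (ren r) (rvar L i a)) f"
    by (rule subst_sg_comp[OF f ren_neq_0])
  ultimately show ?thesis
    by simp
qed

lemma ren_ppr:
  assumes "\<And>a b. g a b = g b a" "r i permutes {1..n}"
    "\<And>a b. has_subst (ren r) (g a b) (g (r i a) (r i b))"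
  shows "has_subst (ren r) (ppr {1..n} g) (ppr {1..n} g)"
proof -
  have "has_subst (ren r) (ppr {1..n} g) (ppr {1..n} (\<lambda>a b. g (r i a) (r i b)))"
    unfolding ppr_def case_prod_beta by (intro has_subst_prod assms(3))
  moreover have "ppr {1..n} (\<lambda>a b. g (r i a) (r i b)) = ppr {1..n} g"
    using ppr_reindex[of g "r i" "{1..n}"] assms(1) permutes_inj_on[OF assms(2)] permutes_image[OF assms(2)]
    by simp
  ultimately show ?thesis
    by simp
qed

lemma Dz_sym: "r 0 permutes {1..K} \<Longrightarrow> has_subst (ren r) (Dz K) (Dz K)"
  unfolding Dz_def
  by (rule ren_ppr[where i = 0]) (auto simp: power2_commute intro!: has_subst_power has_subst_diff has_subst_ren)

lemma Dy_sym:
  assumes "\<And>i. i \<in> {1..m - 1} \<Longrightarrow> r i permutes {1..L}"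
  shows "has_subst (ren r) (Dy L) (Dy L)"
proof (cases "m - 1 = 1")
  case True
  have "r 1 permutes {1..L}"
    using assms[of 1] m by simp
  thus ?thesis
    unfolding Dy_def if_P[OF True]
    by (rule ren_ppr[where i = 1, rotated]) (auto simp: power2_commute intro!: has_subst_power has_subst_diff has_subst_ren)
next
  case False
  have eq: "Dy L = cyc_den (m - 1) L"
    unfolding Dy_def if_not_P[OF False] cyc_den_def by (rule refl)
  show ?thesis
  proof -
    have "has_subst (ren r) (cyc_den (m - 1) L) (subst (ren r) (cyc_den (m - 1) L))"
      by (rule lp_has_subst[OF cyc_den_lp]) (rule ren_neq_0)
    thus "has_subst (ren r) (Dy L) (Dy L)"
      unfolding eq using ren_cyc_den[of "m - 1" r L] assms by simp
  qed
qed

lemma DenS_cong: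
  assumes I: "\<And>i. i \<in> {1..m - 1} \<Longrightarrow> I i = I' i"
  shows "DenS I J = DenS I' J"
proof -
  have yy: "yy_pairs I i = yy_pairs I' i" if "i \<in> {1..m - 1}" for i
  proof -
    have "col (i + 1) \<in> {1..m - 1}"
      using that m by auto
    from I[OF that] I[OF this] show ?thesis
      unfolding yy_pairs_def by simp
  qed
  have I1: "I 1 = I' 1"
    using I[of 1] m by simp
  have "(\<Prod>i\<in>{1..m - 1}. \<Prod>(a, b)\<in>yy_pairs I i. be (xvar i a) (xvar (col (i + 1)) b)) =
        (\<Prod>i\<in>{1..m - 1}. \<Prod>(a, b)\<in>yy_pairs I' i. be (xvar i a) (xvar (col (i + 1)) b))"
    by (rule prod.cong[OF refl]) (simp only: yy)
  moreover have "(\<Prod>i\<in>{1..m - 1}. \<Prod>a\<in>I i. \<Prod>b\<in>J. de i (xvar i a) (xvar 0 b)) =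
        (\<Prod>i\<in>{1..m - 1}. \<Prod>a\<in>I' i. \<Prod>b\<in>J. de i (xvar i a) (xvar 0 b))"
    by (rule prod.cong[OF refl]) (simp only: I)
  ultimately show ?thesis
    unfolding DenS_def I1 by (simp only:)
qed

lemma hnum_sym:
  assumes f: "f \<in> lp (Xv (L + K))" "sym_in m (\<lambda>_. L + K) f"
    and r: "\<And>i. i \<in> {1..m - 1} \<Longrightarrow> r i permutes {1..L}" "r 0 permutes {1..K}"
  shows "subst (ren r) (hnum L K f) = hnum L K f"
proof -
  have inv: "has_subst (ren r) (subst (sg L) g) (subst (sg L) g)"
    if "g \<in> lp (Xv (L + K))" "sym_in m (\<lambda>_. L + K) g" for g
  proof -
    have "subst (ren r) (subst (sg L) g) = subst (sg L) g"
      by (rule specialisation_sym; (rule that(1) r sym_in_imp_ren[OF that])?) assumption+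
    moreover have "has_subst (ren r) (subst (sg L) g) (subst (ren r) (subst (sg L) g))"
      by (rule lp_has_subst[where V = "YZ L K"], rule lp_subst[OF that(1)], rule sg_unit, assumption)
         (rule ren_neq_0)
    ultimately show ?thesis
      by simp
  qed
  have "subst (ren (ren1 i \<sigma>)) (cyc_den m N) = cyc_den m N" if "\<sigma> permutes {1..N}" for i \<sigma> N
    using ren1_permutes[of \<sigma> "\<lambda>_. {1..N}" i] that by (intro ren_cyc_den) auto
  hence "has_subst (ren r) (rD L K) (rD L K)"
    using inv[OF cyc_den_lp] has_subst_imp_subst[OF rD_eq] by (simp add: sym_in_ren1)
  moreover have "has_subst (ren r) (Den L K) (Den L K)"
  proof -
    have "has_subst (ren r) (Den L K) (DenS (\<lambda>i. r i ` {1..L}) (r 0 ` {1..K}))"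
      using r by (intro has_subst_Den permutes_inj_on[of "r _" "{1..L}"] permutes_inj_on[OF r(2)]) auto
    moreover have "DenS (\<lambda>i. r i ` {1..L}) (r 0 ` {1..K}) = Den L K"
      unfolding Den_def permutes_image[OF r(2)] by (rule DenS_cong) (rule permutes_image[OF r(1)])
    ultimately show ?thesis by simp
  qed
  ultimately show ?thesis
    unfolding hnum_def using r
    by (intro has_subst_imp_subst has_subst_divide has_subst_mult inv f Dy_sym Dz_sym)
       (auto simp: rD_Den_neq_0)
qed

subsection \<open>Wheels of the image\<close>

lemma lp_subst_prod:
  assumes "f \<in> lp V" "g \<in> lp V" "\<And>i a. (i, a) \<in> V \<Longrightarrow> s i a \<noteq> 0"
  shows "subst s (f * g) = subst s f * subst s g"
  using assms by (intro has_subst_imp_subst has_subst_mult lp_has_subst)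

lemma Eprod_lp: "Eprod L K \<in> lp (YZ L K)"
  unfolding Eprod_def by (intro lp_prod lp_power lin_lp Kset_lin_in)

lemma subst_unit_neq_0:
  assumes g: "g \<in> lunit V" and s: "\<And>i a. (i, a) \<in> V \<Longrightarrow> s i a \<noteq> 0"
  shows "subst s g \<noteq> 0"
proof -
  have "subst s (g * inverse g) = subst s g * subst s (inverse g)"
    using g by (intro lp_subst_prod s) (auto simp: lunit_def)
  thus ?thesis
    using lunit_neq_0[OF g] by auto
qed

lemma Kset_has_subst:
  assumes "\<And>i a. (i, a) \<in> YZ L K \<Longrightarrow> s i a \<noteq> 0" "k \<in> Kset L K"
  shows "has_subst s (lin k) (subst s (lin k))"
  by (rule lp_has_subst[OF lin_lp[OF Kset_lin_in[OF assms(2)]] assms(1)])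

lemma subst_Eprod_part_neq_0:
  assumes s: "\<And>i a. (i, a) \<in> YZ L K \<Longrightarrow> s i a \<noteq> 0" and A: "A \<subseteq> Kset L K"
    and nz: "\<And>k. k \<in> A \<Longrightarrow> subst s (lin k) \<noteq> 0"
  shows "subst s (\<Prod>k\<in>A. lin k ^ mlt k) \<noteq> 0"
proof -
  have "subst s (\<Prod>k\<in>A. lin k ^ mlt k) = (\<Prod>k\<in>A. subst s (lin k) ^ mlt k)"
    using A by (intro has_subst_imp_subst has_subst_prod has_subst_power Kset_has_subst[OF s]) auto
  thus ?thesis
    using nz finite_subset[OF A finite_Kset] by simp
qed

text \<open>
  If no form in \<open>E\<close> vanishes on the wheel, then a zero of \<open>\<rho>(f)\<close> is a zero of \<open>\<rho>(f) / E\<close>.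
\<close>

lemma wheel_simple:
  assumes f: "f \<in> lp (Xv (L + K))" "wheel_zero (L + K) f"
    and s: "\<And>i a. (i, a) \<in> YZ L K \<Longrightarrow> s i a \<noteq> 0"
    and nz: "\<And>k. k \<in> Kset L K \<Longrightarrow> subst s (lin k) \<noteq> 0" and zero: "subst s (subst (sg L) f) = 0"
  shows "subst s (hnum L K f) = 0"
proof -
  obtain g where g: "g \<in> lunit (YZ L K)" "g * (Eprod L K * hnum L K f) = subst (sg L) f"
    using hnum_factor by metis
  have ok: "has_subst s F (subst s F)" if "F \<in> lp (YZ L K)" for F
    by (rule lp_has_subst[OF that s])
  have "subst s g * (subst s (Eprod L K) * subst s (hnum L K f)) = subst s (g * (Eprod L K * hnum L K f))"
    by (intro has_subst_imp_subst[symmetric] has_subst_mult ok lunit_lp[OF g(1)] Eprod_lp hnum_lp[OF f])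
  also have "\<dots> = 0"
    using zero g(2) by simp
  finally show ?thesis
    using subst_unit_neq_0[OF g(1) s] subst_Eprod_part_neq_0[OF s subset_refl nz]
    by (simp add: Eprod_def)
qed

text \<open>
  When the wheel meets one of the linear forms that were divided out, the specialisation has to
  vanish there to one order more than the multiplicity of that form.
\<close>

lemma wheel_multiple:
  assumes f: "f \<in> lp (Xv (L + K))" "wheel_zero (L + K) f"
    and s: "\<And>i a. (i, a) \<in> YZ L K \<Longrightarrow> s i a \<in> lunit (YZ L K)"
    and k0: "k0 \<in> Kset L K" and lin: "lin_in (YZ L K) l" and asc: "asc (YZ L K) (subst s (lin k0)) (lin l)"
    and dvd: "subst s (subst (sg L) f) / lin l ^ Suc (mlt k0) \<in> lp (YZ L K)"
    and nz: "\<And>k. k \<in> Kset L K \<Longrightarrow> k \<noteq> k0 \<Longrightarrow> subst (root_sub l) (subst s (lin k)) \<noteq> 0"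
  shows "subst (root_sub l) (subst s (hnum L K f)) = 0"
proof -
  let ?V = "YZ L K" and ?h = "hnum L K f" and ?E = "\<Prod>k\<in>Kset L K - {k0}. lin k ^ mlt k"
  let ?e = "mlt k0"
  have s0: "s i a \<noteq> 0" if "(i, a) \<in> ?V" for i a
    using s[OF that] by (rule lunit_neq_0)
  have r0: "root_sub l i a \<noteq> 0" for i a
    by (rule root_neq_0[OF lin])
  obtain g where g: "g \<in> lunit ?V" "g * (Eprod L K * ?h) = subst (sg L) f"
    using hnum_factor by metis
  have ok: "has_subst s F (subst s F)" if "F \<in> lp ?V" for F
    by (rule lp_has_subst[OF that s0])
  have ok': "has_subst (root_sub l) F (subst (root_sub l) F)" if "F \<in> lp ?V" for F
    by (rule lp_has_subst[OF that r0])
  have h: "?h \<in> lp ?V" and E: "?E \<in> lp ?V"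
    by (rule hnum_lp[OF f]) (intro lp_prod lp_power lin_lp Kset_lin_in, simp)
  have k0_lp: "lin k0 \<in> lp ?V"
    by (rule lin_lp[OF Kset_lin_in[OF k0]])
  obtain u where u: "u \<in> lunit ?V" "subst s (lin k0) = u * lin l"
    using asc unfolding asc_def by blast
  have l0: "lin l \<noteq> 0"
    by (rule lin_neq_0[OF lin])
  \<comment> \<open>\<open>P\<close> is the specialisation after division by the known zeros along \<open>l\<close>. By assumption it still has a
      zero there, and all its factors but the last one are nonzero on that locus.\<close>
  define P where "P = subst s g * u ^ ?e * subst s ?E * subst s ?h"
  have "Eprod L K = lin k0 ^ ?e * ?E"
    unfolding Eprod_def using finite_Kset k0 by (rule prod.remove)
  hence "subst s (subst (sg L) f) = subst s (g * (lin k0 ^ ?e * ?E * ?h))"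
    using g(2) by simp
  also have "\<dots> = subst s g * (subst s (lin k0) ^ ?e * subst s ?E * subst s ?h)"
    by (intro has_subst_imp_subst has_subst_mult has_subst_power ok h E k0_lp lunit_lp[OF g(1)])
  also have "\<dots> = lin l ^ ?e * P"
    unfolding u(2) P_def power_mult_distrib by (simp only: mult_ac)
  finally have eq: "subst s (subst (sg L) f) = lin l ^ ?e * P" .
  have P_dvd: "P / lin l \<in> lp ?V"
    using dvd l0 unfolding eq by simp
  have "has_subst (root_sub l) (lin l * (P / lin l)) (0 * subst (root_sub l) (P / lin l))"
    by (intro has_subst_mult root_lin_eq_0[OF lin] lp_has_subst[OF P_dvd] r0)
  hence "has_subst (root_sub l) P 0"
    using l0 by simp
  hence "subst (root_sub l) P = 0"
    by (rule has_subst_imp_subst)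
  moreover have lp_s: "subst s x \<in> lp ?V" if "x \<in> lp ?V" for x
    by (rule lp_subst[OF that s])
  have "subst (root_sub l) P = subst (root_sub l) (subst s g) * subst (root_sub l) u ^ ?e *
      subst (root_sub l) (subst s ?E) * subst (root_sub l) (subst s ?h)"
    unfolding P_def
    by (intro has_subst_imp_subst has_subst_mult has_subst_power ok' lp_s
        lunit_lp[OF g(1)] lunit_lp[OF u(1)] E h)
  moreover have "subst (root_sub l) (subst s g) \<noteq> 0"
  proof -
    have "subst s g \<in> lunit ?V"
    proof -
      have "has_subst s (inverse g) (inverse (subst s g))"
        by (intro has_subst_inverse lp_has_subst[OF lunit_lp[OF g(1)]] s0 subst_unit_neq_0[OF g(1)])
      hence "inverse (subst s g) = subst s (inverse g)"
        by (rule has_subst_imp_subst[symmetric])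
      thus ?thesis
        using lp_s[OF lunit_lp[OF g(1)]] lp_s[OF lunit_lp[OF lunit_inverse[OF g(1)]]]
          subst_unit_neq_0[OF g(1) s0] by (simp add: lunit_def)
    qed
    thus ?thesis
      by (rule subst_unit_neq_0) (rule r0)
  qed
  moreover have "subst (root_sub l) u \<noteq> 0"
    by (rule subst_unit_neq_0[OF u(1) r0])
  moreover have "subst (root_sub l) (subst s ?E) \<noteq> 0"
  proof -
    have "subst s ?E = (\<Prod>k\<in>Kset L K - {k0}. subst s (lin k) ^ mlt k)"
      by (intro has_subst_imp_subst has_subst_prod has_subst_power ok lin_lp Kset_lin_in) simp
    moreover have "subst (root_sub l) (\<Prod>k\<in>Kset L K - {k0}. subst s (lin k) ^ mlt k) =
        (\<Prod>k\<in>Kset L K - {k0}. subst (root_sub l) (subst s (lin k)) ^ mlt k)"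
      by (intro has_subst_imp_subst has_subst_prod has_subst_power ok' lp_s lin_lp Kset_lin_in) simp
    ultimately show ?thesis
      using nz finite_Kset by simp
  qed
  ultimately show ?thesis
    by simp
qed

text \<open>
  Both wheel types, \<open>x\<^sub>v = q\<^sub>\<alpha> x\<^sub>u, x\<^sub>w = q\<^sub>\<beta> x\<^sub>v\<close>, are reached in two steps: first the relation with ratio
  different from \<open>q\<^sub>2\<close> is imposed, then the one with ratio \<open>q\<^sub>2\<close>.
\<close>

lemma wheel_multiple_A:
  assumes f: "f \<in> lp (Xv (L + K))" "wheel_zero (L + K) f"
    and uvw: "distinct [u, v, w]" "u \<in> YZ L K" "v \<in> YZ L K" "w \<in> YZ L K" and qa: "qa \<noteq> 0"
    and k0: "k0 \<in> Kset L K" "k0 = (w, q2, v) \<or> k0 = (v, inverse q2, w)"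
    and dvd: "subst (sub1 v (cst qa * X u)) (subst (sg L) f) / lin (w, q2 * qa, u) ^ Suc (mlt k0) \<in> lp (YZ L K)"
    and nz: "\<And>k. k \<in> Kset L K \<Longrightarrow> k \<noteq> k0 \<Longrightarrow> subst (wsub qa q2 u v w) (lin k) \<noteq> 0"
  shows "wheel_at qa q2 u v w (hnum L K f)"
proof -
  let ?V = "YZ L K" and ?s = "sub1 v (cst qa * X u)" and ?l = "(w, q2 * qa, u)"
  have lin: "lin_in ?V ?l"
    using uvw qa qs_neq_0 by (auto simp: lin_in_def)
  have s: "?s i a \<in> lunit ?V" if "(i, a) \<in> ?V" for i a
    using that uvw qa by (intro sub1_unit lunit_mult lunit_cst lunit_X) auto
  have comp: "subst (root_sub ?l) (subst ?s F) = subst (wsub qa q2 u v w) F" if "F \<in> lp ?V" for F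
  proof (rule lp_subst_comp(2)[OF that], intro conjI)
    fix i a assume "(i, a) \<in> ?V"
    show "?s i a \<noteq> 0" using s[OF \<open>(i, a) \<in> ?V\<close>] by (rule lunit_neq_0)
    show "wsub qa q2 u v w i a \<noteq> 0" using qa qs_neq_0 by (intro wsub_neq_0)
    have X_u: "case_prod (root_sub ?l) u = X u"
      using uvw by (cases u) (auto simp: root_sub_def sub1_def)
    show "has_subst (root_sub ?l) (?s i a) (wsub qa q2 u v w i a)"
    proof (cases "(i, a) = v")
      case True
      have "has_subst (root_sub ?l) (cst qa * X u) (cst qa * X u)"
        using has_subst_monom[of "root_sub ?l" qa u] X_u by simp
      thus ?thesis using True by (simp add: sub1_def wsub_def)
    next
      case False
      thus ?thesis
        using has_subst_xvar[of "root_sub ?l" i a] 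
        by (auto simp: sub1_def wsub_def root_sub_def cst_mult mult.assoc)
    qed
  qed
  have s_lin: "subst ?s (lin (x, c, y)) = case_prod ?s x - cst c * case_prod ?s y" for x c y
    unfolding lin_def prod.case by (intro has_subst_imp_subst has_subst_intros)
  have s_val: "case_prod ?s x = (if x = v then cst qa * X u else X x)" for x
    by (cases x) (simp add: sub1_def)
  have s_v: "case_prod ?s v = cst qa * X u" and s_w: "case_prod ?s w = X w"
    using uvw(1) by (auto simp: s_val)
  have "asc ?V (subst ?s (lin k0)) (lin ?l)"
    using k0(2)
  proof
    assume "k0 = (w, q2, v)"
    thus ?thesis
      unfolding s_lin[of w q2 v, folded \<open>k0 = (w, q2, v)\<close>] s_v s_w
      by (simp add: lin_def cst_mult mult.assoc asc_refl)
  next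
    assume k: "k0 = (v, inverse q2, w)"
    have "qa / inverse q2 = q2 * qa"
      by (simp add: divide_inverse mult.commute)
    thus ?thesis
      using asc_linear(2)[of "inverse q2" ?V qa "X u" "X w"] qs_neq_0
      unfolding s_lin[of v "inverse q2" w, folded k] s_v s_w by (simp add: lin_def)
  qed
  from wheel_multiple[OF f s k0(1) lin this dvd]
  have "subst (root_sub ?l) (subst ?s (hnum L K f)) = 0"
    using nz comp[OF lin_lp[OF Kset_lin_in]] by simp
  thus ?thesis
    using comp[OF hnum_lp[OF f]] by (simp add: wheel_at_wsub)
qed

lemma wheel_multiple_B:
  assumes f: "f \<in> lp (Xv (L + K))" "wheel_zero (L + K) f"
    and uvw: "distinct [u, v, w]" "u \<in> YZ L K" "v \<in> YZ L K" "w \<in> YZ L K" and qb: "qb \<noteq> 0"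
    and k0: "k0 \<in> Kset L K" "k0 = (u, inverse q2, v) \<or> k0 = (v, q2, u)"
    and dvd: "subst (sub1 w (cst qb * X v)) (subst (sg L) f) / lin (u, inverse q2, v) ^ Suc (mlt k0) \<in> lp (YZ L K)"
    and nz: "\<And>k. k \<in> Kset L K \<Longrightarrow> k \<noteq> k0 \<Longrightarrow> subst (wsub q2 qb u v w) (lin k) \<noteq> 0"
  shows "wheel_at q2 qb u v w (hnum L K f)"
proof -
  let ?V = "YZ L K" and ?s = "sub1 w (cst qb * X v)" and ?l = "(u, inverse q2, v)" and ?W = "wsub q2 qb u v w"
  have lin: "lin_in ?V ?l"
    using uvw qb qs_neq_0 by (auto simp: lin_in_def)
  have s: "?s i a \<in> lunit ?V" if "(i, a) \<in> ?V" for i a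
    using that uvw qb by (intro sub1_unit lunit_mult lunit_cst lunit_X) auto
  have W0: "?W i a \<noteq> 0" for i a
    using qb qs_neq_0 by (intro wsub_neq_0)
  have r0: "root_sub ?l i a \<noteq> 0" for i a
    by (rule root_neq_0[OF lin])
  have W_u: "case_prod ?W u = X u" and W_v: "case_prod ?W v = cst q2 * X u"
    and W_w: "case_prod ?W w = cst (qb * q2) * X u"
    using uvw by (auto simp: wsub_eq wco_def wvar_def)
  have c: "cst (inverse q2) * (cst q2 * x) = x" for x
    using qs_neq_0 by (simp add: cst_inverse)
  have W_root: "has_subst ?W (root_sub ?l i a) (?W i a)" for i a
  proof (cases "(i, a) = u")
    case True
    hence W: "?W i a = X u" using W_u by auto
    show ?thesis
      using has_subst_monom[of ?W "inverse q2" v] True unfolding W W_v c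
      by (simp add: root_sub_def sub1_def)
  next
    case False
    thus ?thesis
      using has_subst_xvar[of ?W i a] by (simp add: root_sub_def sub1_def)
  qed
  have W_s: "has_subst ?W (?s i a) (?W i a)" for i a
  proof (cases "(i, a) = w")
    case True
    hence W: "?W i a = cst qb * (cst q2 * X u)" using W_w by (auto simp: cst_mult mult.assoc)
    show ?thesis
      using has_subst_monom[of ?W qb v] True unfolding W W_v by (simp add: sub1_def)
  next
    case False
    thus ?thesis
      using has_subst_xvar[of ?W i a] by (simp add: sub1_def)
  qed
  have comp: "subst ?W (subst (root_sub ?l) (subst ?s F)) = subst ?W F" if "F \<in> lp ?V" for F
  proof -
    have "subst ?W (subst (root_sub ?l) (subst ?s F)) = subst ?W (subst ?s F)"
      using lp_subst[OF that s] r0 W0 W_root by (intro lp_subst_comp(2)) auto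
    also have "\<dots> = subst ?W F"
      using that lunit_neq_0[OF s] W0 W_s by (intro lp_subst_comp(2)) auto
    finally show ?thesis .
  qed
  have s_lin: "subst ?s (lin (x, c, y)) = case_prod ?s x - cst c * case_prod ?s y" for x c y
    unfolding lin_def prod.case by (intro has_subst_imp_subst has_subst_intros)
  have s_val: "case_prod ?s x = (if x = w then cst qb * X v else X x)" for x
    by (cases x) (simp add: sub1_def)
  have s_v: "case_prod ?s v = X v" and s_u: "case_prod ?s u = X u"
    using uvw(1) by (auto simp: s_val)
  have "asc ?V (subst ?s (lin k0)) (lin ?l)"
    using k0(2)
  proof
    assume k: "k0 = (u, inverse q2, v)"
    thus ?thesis
      unfolding s_lin[of u "inverse q2" v, folded k] s_v s_u by (simp add: lin_def asc_refl)
  next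
    assume k: "k0 = (v, q2, u)"
    thus ?thesis
      using asc_linear(2)[of q2 ?V 1 "X v" "X u"] qs_neq_0
      unfolding s_lin[of v q2 u, folded k] s_v s_u by (simp add: lin_def divide_inverse)
  qed
  moreover have "subst (root_sub ?l) (subst ?s (lin k)) \<noteq> 0" if "k \<in> Kset L K" "k \<noteq> k0" for k
    using nz[OF that] comp[OF lin_lp[OF Kset_lin_in[OF that(1)]]] by auto
  ultimately have "subst (root_sub ?l) (subst ?s (hnum L K f)) = 0"
    by (intro wheel_multiple[OF f s k0(1) lin _ dvd])
  thus ?thesis
    using comp[OF hnum_lp[OF f]] by (simp add: wheel_at_wsub)
qed

lemma Kset_order: "(x, c, y) \<in> Kset L K \<Longrightarrow> (y, c', x) \<notin> Kset L K"
proof -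
  have ord: "fst w < fst u \<or> fst w = fst u \<and> snd u < snd w" if "(u, c, w) \<in> Kset L K" for u c w
    using that m by (cases rule: Kset_cases) auto
  assume "(x, c, y) \<in> Kset L K"
  thus ?thesis
    using ord[of x c y] ord[of y c' x] by auto
qed

lemma wsub_lin_eq_0:
  assumes k: "k \<in> Kset L K" "subst (wsub qa qb u v w) (lin k) = 0" and q: "qa \<noteq> 0" "qb \<noteq> 0"
    and uvw: "{u, v, w} \<subseteq> Yv L \<or> {u, v, w} \<subseteq> Zv K"
  obtains x c y where "k = (x, c, y)" "c = q2 \<or> c = inverse q2" "x \<noteq> y" "x \<in> {u, v, w}" "y \<in> {u, v, w}"
    "wco qa qb v w x = c * wco qa qb v w y"
proof -
  obtain x c y where kk: "k = (x, c, y)" by (cases k)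
  have xy: "x \<noteq> y"
    using Kset_lin_in[OF k(1)] by (simp add: kk lin_in_def)
  have *: "wvar u v w x = wvar u v w y" "wco qa qb v w x = c * wco qa qb v w y"
    using k(2) wsub_lin[OF q] by (simp_all add: kk)
  have mem: "x \<in> {u, v, w}" "y \<in> {u, v, w}"
    using *(1) xy by (auto simp: wvar_def split: if_splits)
  have eq: "fst x = 0 \<longleftrightarrow> fst y = 0"
    using uvw mem by (cases x; cases y) (auto simp: Yv_iff Zv_iff)
  have "c = q2 \<or> c = inverse q2"
    using k(1)[unfolded kk] eq m by (cases rule: Kset_cases) (auto split: if_splits)
  thus thesis
    using that kk xy mem * by blast
qed

text \<open>
  On a wheel the three variables have the ratios \<open>1 : g : g q\<^sub>2\<close>. For generic \<open>g\<close> only the last two of them,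
  with ratio \<open>q\<^sub>2\<close>, can make a form in \<open>E\<close> zero.
\<close>

lemma wsub_Kset_A:
  assumes k: "k \<in> Kset L K" "subst (wsub g q2 u v w) (lin k) = 0"
    and uvw: "{u, v, w} \<subseteq> Yv L \<or> {u, v, w} \<subseteq> Zv K" "distinct [u, v, w]"
    and g: "g \<noteq> 0" "g \<noteq> 1" "g \<noteq> q2" "g * q2 \<noteq> 1" "q2 * q2 * g \<noteq> 1"
  shows "k = (w, q2, v) \<or> k = (v, inverse q2, w)"
proof -
  obtain x c y where xy: "k = (x, c, y)" "c = q2 \<or> c = inverse q2" "x \<noteq> y" "x \<in> {u, v, w}" "y \<in> {u, v, w}"
    "wco g q2 v w x = c * wco g q2 v w y"
    using wsub_lin_eq_0[OF k g(1) qs_neq_0(2) uvw(1)] by blast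
  have co: "wco g q2 v w u = 1" "wco g q2 v w v = g" "wco g q2 v w w = q2 * g"
    using uvw(2) by (auto simp: wco_def)
  have alg: "(1 = c * g \<longrightarrow> False) \<and> (g = c \<longrightarrow> False) \<and> (1 = c * (q2 * g) \<longrightarrow> False) \<and> (q2 * g = c \<longrightarrow> False)
     \<and> (g = c * (q2 * g) \<longrightarrow> c = inverse q2) \<and> (q2 * g = c * g \<longrightarrow> c = q2)"
    using xy(2)
  proof
    assume "c = q2"
    thus ?thesis using g qs_neq_0 by (auto simp: field_simps)
  next
    assume c: "c = inverse q2"
    show ?thesis unfolding c using g qs_neq_0 by (auto simp: field_simps)
  qed
  show ?thesis
    using xy(3,4,5,6) alg unfolding xy(1) by (auto simp: co)
qed

lemma wsub_Kset_B:
  assumes k: "k \<in> Kset L K" "subst (wsub q2 g u v w) (lin k) = 0"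
    and uvw: "{u, v, w} \<subseteq> Yv L \<or> {u, v, w} \<subseteq> Zv K" "distinct [u, v, w]"
    and g: "g \<noteq> 0" "g \<noteq> 1" "g \<noteq> q2" "g * q2 \<noteq> 1" "q2 * q2 * g \<noteq> 1"
  shows "k = (u, inverse q2, v) \<or> k = (v, q2, u)"
proof -
  obtain x c y where xy: "k = (x, c, y)" "c = q2 \<or> c = inverse q2" "x \<noteq> y" "x \<in> {u, v, w}" "y \<in> {u, v, w}"
    "wco q2 g v w x = c * wco q2 g v w y"
    using wsub_lin_eq_0[OF k qs_neq_0(2) g(1) uvw(1)] by blast
  have co: "wco q2 g v w u = 1" "wco q2 g v w v = q2" "wco q2 g v w w = g * q2"
    using uvw(2) by (auto simp: wco_def)
  have alg: "(1 = c * q2 \<longrightarrow> c = inverse q2) \<and> (q2 = c * 1 \<longrightarrow> c = q2) \<and> (1 = c * (g * q2) \<longrightarrow> False) \<and>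
     (g * q2 = c \<longrightarrow> False) \<and> (q2 = c * (g * q2) \<longrightarrow> False) \<and> (g * q2 = c * q2 \<longrightarrow> False)"
    using xy(2)
  proof
    assume "c = q2"
    thus ?thesis using g qs_neq_0 by (auto simp: field_simps)
  next
    assume c: "c = inverse q2"
    show ?thesis unfolding c using g qs_neq_0 by (auto simp: field_simps)
  qed
  show ?thesis
    using xy(3,4,5,6) alg g(4) qs_neq_0 unfolding xy(1) by (auto simp: co)
qed

lemma generic_ratio:
  assumes "g = mn (- 1) 1 \<or> g = q3 ^ m"
  shows "g \<noteq> 0" "g \<noteq> 1" "g \<noteq> q2" "g * q2 \<noteq> 1" "q2 * q2 * g \<noteq> 1" "q2 * g \<noteq> 1"
  using assms m by (auto simp: mn_q2 q3_pow mn_simps)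

lemma q2_neq_1: "q2 \<noteq> 1"
  using m by (simp add: mn_q2 mn_simps)

text \<open>
  A double zero: along the family below \<open>f\<close> vanishes both where \<open>\<xi>\<^sub>1\<close> and where \<open>\<xi>\<^sub>2\<close> takes the critical
  value, and \<open>\<xi>\<^sub>1 = \<xi>\<^sub>2\<close> gives back the original substitution. The quotient \<open>\<xi>\<^sub>1 / \<xi>\<^sub>2\<close> is what lets the
  second zero be reached without moving \<open>\<xi>\<^sub>1\<close>.
\<close>

lemma double_root:
  assumes f: "f \<in> lp (Xv N)" and s0: "\<And>i a. (i, a) \<in> Xv N \<Longrightarrow> s0 i a \<in> lunit V"
    and V: "\<And>i a. (i, a) \<in> V \<Longrightarrow> i \<le> m" and lin: "lin_in V (v, c, w)"
    and x: "distinct [x1, x2, x3]" "{x1, x2, x3} \<subseteq> Xv N"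
    and x1: "case_prod s0 x1 = X v" and x2: "case_prod s0 x2 = cst k2 * X v" and k2: "k2 \<noteq> 0"
    and zero1: "\<And>s. (\<And>j e. (j, e) \<in> Xv N \<Longrightarrow> s j e \<noteq> 0) \<Longrightarrow>
       (\<And>j e. (j, e) \<in> Xv N \<Longrightarrow> (j, e) \<notin> {x1, x2, x3} \<Longrightarrow> s j e = s0 j e) \<Longrightarrow>
       case_prod s x1 = cst c * X w \<Longrightarrow> case_prod s x2 = cst k2 * (cst c * X w) \<Longrightarrow> subst s f = 0"
    and zero2: "\<And>s Y. (\<And>j e. (j, e) \<in> Xv N \<Longrightarrow> s j e \<noteq> 0) \<Longrightarrow>
       (\<And>j e. (j, e) \<in> Xv N \<Longrightarrow> (j, e) \<notin> {x1, x2, x3} \<Longrightarrow> s j e = s0 j e) \<Longrightarrow>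
       case_prod s x1 = Y \<Longrightarrow> case_prod s x2 = cst k2 * Y \<Longrightarrow>
       case_prod s x3 = case_prod s0 x3 * (Y / (cst c * X w)) \<Longrightarrow> subst s f = 0"
  shows "subst s0 f / lin (v, c, w) ^ 2 \<in> lp V"
proof -
  \<comment> \<open>Colours above \<open>m\<close> do not occur in \<open>V\<close>, so these variables are new.\<close>
  define \<xi> where "\<xi> n = (m + n, 0::nat)" for n
  let ?T = "{1, 2::nat}" and ?W = "V \<union> \<xi> ` {1, 2}"
  define s' where "s' j e = (if (j, e) = x1 then X (\<xi> 1) else if (j, e) = x2 then cst k2 * X (\<xi> 1)
     else if (j, e) = x3 then s0 j e * (X (\<xi> 1) / X (\<xi> 2)) else s0 j e)" for j e
  define \<tau> where "\<tau> i a = (if i > m then X v else xvar i a)" for i a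
  have vw: "v \<in> V" "w \<in> V" "c \<noteq> 0" "v \<noteq> w"
    using lin by (auto simp: lin_in_def)
  have fresh: "\<xi> n \<notin> V" if "n \<ge> 1" for n
    using V[of "m + n" 0] that by (auto simp: \<xi>_def)
  have s'_unit: "s' j e \<in> lunit ?W" if "(j, e) \<in> Xv N" for j e
    using lunit_mono[OF s0[OF that], of ?W] k2
    by (auto simp: s'_def intro!: lunit_mult lunit_divide lunit_cst lunit_X)
  have val: "subst \<sigma> (s' j e) = (if (j, e) = x1 then case_prod \<sigma> (\<xi> 1)
     else if (j, e) = x2 then cst k2 * case_prod \<sigma> (\<xi> 1)
     else if (j, e) = x3 then s0 j e * (case_prod \<sigma> (\<xi> 1) / case_prod \<sigma> (\<xi> 2)) else s0 j e)"
    if je: "(j, e) \<in> Xv N" and id: "\<And>i a. (i, a) \<in> V \<Longrightarrow> \<sigma> i a = xvar i a" and nz: "case_prod \<sigma> (\<xi> 2) \<noteq> 0"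
    for \<sigma> j e
  proof -
    have "has_subst \<sigma> (s0 j e) (s0 j e)"
      using lp_has_subst[OF lunit_lp[OF s0[OF je]], of \<sigma>] lp_subst_id[OF lunit_lp[OF s0[OF je]] id] id by auto
    hence "has_subst \<sigma> (s0 j e * (X (\<xi> 1) / X (\<xi> 2))) (s0 j e * (case_prod \<sigma> (\<xi> 1) / case_prod \<sigma> (\<xi> 2)))"
      using nz by (intro has_subst_mult has_subst_divide has_subst_X)
    moreover have "subst \<sigma> (X (\<xi> 1)) = case_prod \<sigma> (\<xi> 1)"
      by (rule has_subst_imp_subst[OF has_subst_X])
    ultimately show ?thesis
      using lp_subst_id[OF lunit_lp[OF s0[OF je]] id] subst_monom[of \<sigma> k2 "\<xi> 1"]
      by (simp add: s'_def has_subst_imp_subst del: case_prod_conv)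
  qed
  have c_E: "cst c * X w \<noteq> 0"
    using vw by simp
  have "subst (\<lambda>i a. subst \<tau> (s' i a)) f / lin (v, c, w) ^ card ?T \<in> lp V"
  proof (rule subst_multiple_root[where D = "Xv N" and \<xi> = \<xi> and \<kappa> = "\<lambda>_. 1" and w = w])
    show "inj_on \<xi> ?T" "\<xi> ` ?T \<inter> V = {}"
      using fresh[of 1] fresh[of 2] by (auto simp: inj_on_def \<xi>_def)
    show "case_prod \<tau> (\<xi> k) = cst 1 * X v" if "k \<in> ?T" for k
      using that by (auto simp: \<tau>_def \<xi>_def)
    show "\<tau> i a = xvar i a" if "(i, a) \<in> V" for i a
      using V[OF that] by (simp add: \<tau>_def)
    fix k assume k: "k \<in> ?T"
    let ?\<sigma> = "sub1 (\<xi> k) (cst (1 * c) * X w)" and ?s = "\<lambda>i a. subst (sub1 (\<xi> k) (cst (1 * c) * X w)) (s' i a)"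
    have id: "?\<sigma> i a = xvar i a" if "(i, a) \<in> V" for i a
      using fresh[of k] k that by (auto simp: sub1_def)
    have \<sigma>_nz: "?\<sigma> i a \<noteq> 0" for i a
      using c_E by (intro sub1_neq_0) simp
    have \<sigma>_\<xi>: "case_prod ?\<sigma> (\<xi> n) = (if n = k then cst c * X w else X (\<xi> n))" for n
      by (simp add: \<xi>_def sub1_def)
    have nz2: "case_prod ?\<sigma> (\<xi> 2) \<noteq> 0"
      unfolding \<sigma>_\<xi> using c_E by simp
    have nz: "?s j e \<noteq> 0" if "(j, e) \<in> Xv N" for j e
      by (rule subst_unit_neq_0[OF s'_unit[OF that] \<sigma>_nz])
    have others: "?s j e = s0 j e" if "(j, e) \<in> Xv N" "(j, e) \<notin> {x1, x2, x3}" for j e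
      using val[OF that(1) id nz2] that(2) by auto
    have s1: "case_prod ?s x1 = case_prod ?\<sigma> (\<xi> 1)" and s2: "case_prod ?s x2 = cst k2 * case_prod ?\<sigma> (\<xi> 1)"
      and s3: "case_prod ?s x3 = case_prod s0 x3 * (case_prod ?\<sigma> (\<xi> 1) / case_prod ?\<sigma> (\<xi> 2))"
      using x val[OF _ id nz2] by (cases x1; cases x2; cases x3; auto)+
    show "subst ?s f = 0"
    proof (cases "k = 1")
      case True
      show ?thesis
        by (rule zero1[OF nz others]) (use s1 s2 \<sigma>_\<xi>[of 1] True in simp_all)
    next
      case False
      hence "k = 2" using k by simp
      show ?thesis
        by (rule zero2[OF nz others s1 s2]) (use s3 \<sigma>_\<xi>[of 2] \<open>k = 2\<close> in simp_all)
    qed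
  qed (use f s'_unit lin in auto)
  moreover have "subst (\<lambda>i a. subst \<tau> (s' i a)) f = subst s0 f"
  proof (rule lp_subst_cong[OF f])
    fix i a assume ia: "(i, a) \<in> Xv N"
    have id: "\<tau> i a = xvar i a" if "(i, a) \<in> V" for i a
      using V[OF that] by (simp add: \<tau>_def)
    have \<tau>_\<xi>: "case_prod \<tau> (\<xi> 1) = X v" "case_prod \<tau> (\<xi> 2) = X v"
      by (simp_all add: \<tau>_def \<xi>_def)
    have "subst \<tau> (s' i a) = s0 i a"
      using val[OF ia id] x1 x2 unfolding \<tau>_\<xi> by auto
    thus "subst \<tau> (s' i a) \<noteq> 0 \<and> subst \<tau> (s' i a) = s0 i a"
      using lunit_neq_0[OF s0[OF ia]] by simp
  qed
  moreover have "card ?T = 2" by simp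
  ultimately show ?thesis
    by (simp add: power2_eq_square)
qed

lemma kap_step: "i \<in> {1..m - 1} \<Longrightarrow> q3 * kap i = kap (i + 1) * mn (- 1) 1"
proof -
  assume "i \<in> {1..m - 1}"
  hence "i \<le> m" "i + 1 \<le> m"
    using m by auto
  thus ?thesis
    by (simp add: mn_kap mn_q3 mn_simps)
qed

lemma not_Kset_y: "i \<noteq> 1 \<Longrightarrow> 0 < i \<Longrightarrow> ((i, a), c, (j, b)) \<in> Kset L K \<Longrightarrow> j = 0"
  by (erule Kset_cases) auto

lemma sgs_y: "a \<le> L \<Longrightarrow> cst (rco L i a) * case_prod \<sigma> (rvar L i a) = cst (kap i) * \<sigma> (col i) a"
  by (simp add: rco_def rvar_def)

lemma sgs_z: "1 \<le> b \<Longrightarrow> cst (rco L i (b + L)) * case_prod \<sigma> (rvar L i (b + L)) = cst (q3 ^ (i - 1)) * \<sigma> 0 b"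
  by (simp add: rco_def rvar_def)

lemma Kset_A_y:
  assumes "b \<in> {1..L}" "c \<in> {1..L}" "b \<noteq> c"
  shows "((1, c), q2, (1, b)) \<in> Kset L K \<or> ((1, b), inverse q2, (1, c)) \<in> Kset L K"
proof (cases "b < c")
  case True
  hence "((1, b), inverse q2, (1, c)) \<in> KA L"
    unfolding KA_def prs_def using assms by (intro image_eqI[of _ _ "((b, c), inverse q2)"]) auto
  thus ?thesis by (simp add: Kset_def)
next
  case False
  hence "((1, c), q2, (1, b)) \<in> KA L"
    unfolding KA_def prs_def using assms by (intro image_eqI[of _ _ "((c, b), q2)"]) auto
  thus ?thesis by (simp add: Kset_def)
qed

lemma Kset_A_z:
  assumes "b \<in> {1..K}" "c \<in> {1..K}" "b \<noteq> c"
  shows "((0, c), q2, (0, b)) \<in> Kset L K \<or> ((0, b), inverse q2, (0, c)) \<in> Kset L K"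
proof (cases "b < c")
  case True
  hence "((0, b), inverse q2, (0, c)) \<in> KB K"
    unfolding KB_def prs_def using assms by (intro image_eqI[of _ _ "((b, c), inverse q2)"]) auto
  thus ?thesis by (simp add: Kset_def)
next
  case False
  hence "((0, c), q2, (0, b)) \<in> KB K"
    unfolding KB_def prs_def using assms by (intro image_eqI[of _ _ "((c, b), q2)"]) auto
  thus ?thesis by (simp add: Kset_def)
qed

lemma mlt_y: "i \<noteq> 0 \<Longrightarrow> mlt ((i, a), c, w) = 1" and mlt_z: "Suc (mlt ((0, a), c, w)) = m"
  using m by (simp_all add: mlt_def)

lemma sgs_unit:
  assumes "\<And>i a. (i, a) \<in> YZ L K \<Longrightarrow> \<sigma> i a \<in> lunit (YZ L K)" "(i, a) \<in> Xv (L + K)"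
  shows "cst (rco L i a) * case_prod \<sigma> (rvar L i a) \<in> lunit (YZ L K)"
  using assms(1)[of "fst (rvar L i a)" "snd (rvar L i a)"] rvar_YZ[OF assms(2)]
  by (intro lunit_mult lunit_cst rco_neq_0) (simp add: case_prod_beta)

text \<open>
  For \<open>i \<noteq> 1\<close> the wheel of the target is a wheel of the source, because of \<open>q\<^sub>3 \<kappa>\<^sub>i\<^sub>-\<^sub>1 = \<kappa>\<^sub>i q\<^sub>3'\<close> for the scaling
  factors \<open>\<kappa>\<^sub>i\<close> of \<open>y\<^sub>i\<close> and the parameter \<open>q\<^sub>3'\<close> of the target. For \<open>i = 1\<close> a form in \<open>E\<close> vanishes as well, and
  a double zero of \<open>\<rho>(f)\<close> is needed. Since \<open>y\<^sub>1\<close> has two copies, there are two wheels: one through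
  \<open>x\<^sub>m\<^sub>-\<^sub>1\<^sub>,\<^sub>a, x\<^sub>m\<^sub>,\<^sub>b, x\<^sub>m\<^sub>,\<^sub>c\<close> and one through \<open>x\<^sub>m\<^sub>,\<^sub>c, x\<^sub>1\<^sub>,\<^sub>b, x\<^sub>1\<^sub>,\<^sub>c\<close>.
\<close>

lemma wheel_y_A:
  assumes f: "f \<in> lp (Xv (L + K))" "wheel_zero (L + K) f"
    and i: "i \<in> {1..m - 1}" and abc: "a \<in> {1..L}" "b \<in> {1..L}" "c \<in> {1..L}"
    and p_def: "p = prv (m - 1) i" and distinct: "distinct [(p, a), (i, b), (i, c)]"
  shows "wheel_at (mn (- 1) 1) q2 (p, a) (i, b) (i, c) (hnum L K f)"
proof -
  let ?g = "mn (- 1) 1" and ?u = "(p, a)" and ?v = "(i, b)" and ?w = "(i, c)" and ?V = "YZ L K"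
  have p: "p \<in> {1..m - 1}" "col p = p"
    using i m by (auto simp: p_def prv_def)
  have uvw: "?u \<in> ?V" "?v \<in> ?V" "?w \<in> ?V"
    using i p abc m by (auto simp: Yv_iff)
  have uvw': "{?u, ?v, ?w} \<subseteq> Yv L"
    using uvw i p by (auto simp: Zv_iff)
  have bc: "b \<noteq> c" using distinct by simp
  note g = generic_ratio[of ?g]
  have near: "k = (?w, q2, ?v) \<or> k = (?v, inverse q2, ?w)"
    if "k \<in> Kset L K" "subst (wsub ?g q2 ?u ?v ?w) (lin k) = 0" for k
    using that uvw' distinct g by (intro wsub_Kset_A) auto
  show ?thesis
  proof (cases "i = 1")
    case False
    let ?W = "wsub ?g q2 ?u ?v ?w"
    have W0: "?W j e \<noteq> 0" for j e
      using mn_neq_0 qs_neq_0 by (intro wsub_neq_0)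
    have pi: "p = i - 1" "prv m i = p" "p + 1 = i" "col i = i"
      using False i m by (auto simp: p_def prv_def)
    let ?s = "\<lambda>j e. cst (rco L j e) * case_prod ?W (rvar L j e)"
    have Wv: "?W p a = xvar p a" "?W i b = cst ?g * xvar p a" "?W i c = cst q2 * (cst ?g * xvar p a)"
      using distinct by (auto simp: wsub_def)
    have sA: "?s i b = cst (kap i) * (cst ?g * xvar p a)"
      and sC: "?s i c = cst (kap i) * (cst q2 * (cst ?g * xvar p a))"
      using sgs_y[of b L i ?W] sgs_y[of c L i ?W] abc Wv by (simp_all only: pi(4) atLeastAtMost_iff)
    have sP: "?s (prv m i) a = cst (kap p) * xvar p a"
      unfolding pi(2) using sgs_y[of a L p ?W] abc Wv by (simp only: p(2) atLeastAtMost_iff)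
    have key: "kap i * ?g = q3 * kap p"
      using kap_step[OF p(1)] unfolding pi(3) by (rule sym)
    have "subst ?s f = 0"
    proof (rule wheel_zeroA[OF f(2), where i = i and a = a and b = b and c = c])
      show "?s i b = cst q3 * ?s (prv m i) a"
        unfolding sA sP by (simp only: mult.assoc[symmetric] cst_mult[symmetric] key)
      show "?s i c = cst q2 * ?s i b"
        unfolding sA sC by (simp only: mult_ac)
      show "?s j e \<noteq> 0" for j e
        using W0 by (simp add: rco_neq_0 case_prod_beta)
    qed (use i abc bc in auto)
    hence "subst ?W (subst (sg L) f) = 0"
      using subst_sg_comp[OF f(1) W0] by simp
    moreover have "subst ?W (lin k) \<noteq> 0" if "k \<in> Kset L K" for k
      using near[OF that] not_Kset_y[of i] that False i by fastforce
    ultimately show ?thesis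
      unfolding wheel_at_wsub by (intro wheel_simple[OF f W0])
  next
    case True
    obtain k0 where k0: "k0 \<in> Kset L K" "k0 = (?w, q2, ?v) \<or> k0 = (?v, inverse q2, ?w)"
      using Kset_A_y[OF abc(2,3) bc, of K] True by auto
    have p_m: "p = m - 1" "prv m m = p" "p + 1 = m"
      using True m by (auto simp: p_def prv_def)
    let ?\<sigma> = "sub1 ?v (cst ?g * X ?u)"
    let ?s = "\<lambda>j e. cst (rco L j e) * case_prod ?\<sigma> (rvar L j e)"
    have \<sigma>_unit: "?\<sigma> j e \<in> lunit ?V" if "(j, e) \<in> ?V" for j e
      using that uvw mn_neq_0 by (intro sub1_unit lunit_mult lunit_cst lunit_X) auto
    have \<sigma>v: "?\<sigma> p a = xvar p a" "?\<sigma> 1 b = cst ?g * xvar p a" "?\<sigma> 1 c = xvar 1 c"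
      using distinct True by (auto simp: sub1_def)
    have s_m: "?s m e = ?\<sigma> 1 e" if "e \<in> {1..L}" for e
      using that by (simp add: sgs_y kap_m)
    have s_1: "?s 1 e = cst (kap 1) * ?\<sigma> 1 e" if "e \<in> {1..L}" for e
      using that by (simp add: sgs_y)
    have s_p: "?s p a = cst (kap p) * xvar p a"
      using abc p \<sigma>v by (simp add: sgs_y)
    have kap1: "kap 1 * ?g = q3 * (q2 * ?g)"
      using m by (simp add: mn_consts mn_simps)
    have ne: "(p, a) \<notin> {(m, c), (1, c), (1, b)}" "(m, b) \<notin> {(m, c), (1, c), (1, b)}"
      using distinct True p m bc by auto
    have X: "(p, a) \<in> Xv (L + K)" "(m, b) \<in> Xv (L + K)"
      using p abc m by (auto simp: Xv_iff)
    have "subst ?s f / lin (?w, q2 * ?g, ?u) ^ 2 \<in> lp ?V"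
    proof (rule double_root[OF f(1) sgs_unit[OF \<sigma>_unit] YZ_col_le,
          where ?x1.0 = "(m, c)" and ?x2.0 = "(1, c)" and ?x3.0 = "(1, b)" and ?k2.0 = "kap 1"])
      show "lin_in ?V (?w, q2 * ?g, ?u)"
        using uvw distinct mn_neq_0 qs_neq_0 by (auto simp: lin_in_def)
      show "distinct [(m, c), (1, c), (1, b)]" "{(m, c), (1, c), (1, b)} \<subseteq> Xv (L + K)"
        using m bc abc by (auto simp: Xv_iff)
      show "case_prod ?s (m, c) = X ?w" "case_prod ?s (1, c) = cst (kap 1) * X ?w"
        using s_m[OF abc(3)] s_1[OF abc(3)] \<sigma>v True by simp_all
      fix s :: "nat \<Rightarrow> nat \<Rightarrow> ratfun"
      assume nz: "\<And>j e. (j, e) \<in> Xv (L + K) \<Longrightarrow> s j e \<noteq> 0"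
        and oth: "\<And>j e. (j, e) \<in> Xv (L + K) \<Longrightarrow> (j, e) \<notin> {(m, c), (1, c), (1, b)} \<Longrightarrow> s j e = ?s j e"
      {
        assume s1: "case_prod s (m, c) = cst (q2 * ?g) * X ?u"
        show "subst s f = 0"
        proof (rule wheel_zeroA[OF f(2) _ _ bc nz, where i = m and a = a])
          have "s m b = cst ?g * xvar p a"
            using oth[OF X(2) ne(2)] s_m[OF abc(2)] \<sigma>v by simp
          moreover have "s p a = cst (kap p) * xvar p a"
            using oth[OF X(1) ne(1)] s_p by simp
          moreover have "q3 * kap p = ?g"
            using kap_step[OF p(1)] p_m kap_m by simp
          ultimately show "s m b = cst q3 * s (prv m m) a" "s m c = cst q2 * s m b"
            using s1 by (simp_all add: p_m mult.assoc[symmetric] flip: cst_mult)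
        qed (use m abc in auto)
      }
      {
        fix Y
        assume s1: "case_prod s (m, c) = Y" and s2: "case_prod s (1, c) = cst (kap 1) * Y"
          and s3: "case_prod s (1, b) = case_prod ?s (1, b) * (Y / (cst (q2 * ?g) * X ?u))"
        show "subst s f = 0"
        proof (rule wheel_zeroA[OF f(2) _ _ bc nz, where i = 1 and a = c])
          have "case_prod ?s (1, b) = cst (q3 * (q2 * ?g)) * X ?u"
            using s_1[OF abc(2)] \<sigma>v kap1 by (simp flip: cst_mult mult.assoc)
          hence sb: "s 1 b = cst q3 * Y"
            using s3 mn_neq_0 qs_neq_0 by (simp add: cst_mult)
          thus "s 1 b = cst q3 * s (prv m 1) c"
            using s1 by (simp add: prv_def)
          have "kap 1 = q2 * q3"
            using m by (simp add: mn_consts mn_simps)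
          thus "s 1 c = cst q2 * s 1 b"
            using s2 sb by (simp add: cst_mult)
        qed (use m abc in auto)
      }
    qed (auto simp: kap_neq_0)
    moreover have "mlt k0 = 1"
      using k0(2) True by (auto simp: mlt_y)
    ultimately have dvd: "subst ?\<sigma> (subst (sg L) f) / lin (?w, q2 * ?g, ?u) ^ Suc (mlt k0) \<in> lp ?V"
      using subst_sg_comp[OF f(1) lunit_neq_0[OF \<sigma>_unit]] by (simp add: numeral_2_eq_2)
    show ?thesis
    proof (rule wheel_multiple_A[OF f distinct uvw mn_neq_0 k0 dvd])
      fix k assume "k \<in> Kset L K" "k \<noteq> k0"
      thus "subst (wsub ?g q2 ?u ?v ?w) (lin k) \<noteq> 0"
        using near[of k] k0 Kset_order by blast
    qed
  qed
qed

text \<open>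
  The mirror image of \<open>wheel_y_A\<close>. For \<open>i = 1\<close> the two wheels of the source start in \<open>x\<^sub>1\<^sub>,\<^sub>a, x\<^sub>1\<^sub>,\<^sub>b\<close> and in
  \<open>x\<^sub>m\<^sub>,\<^sub>a, x\<^sub>m\<^sub>,\<^sub>b\<close>.
\<close>

lemma wheel_y_B:
  assumes f: "f \<in> lp (Xv (L + K))" "wheel_zero (L + K) f"
    and i: "i \<in> {1..m - 1}" and abc: "a \<in> {1..L}" "b \<in> {1..L}" "c \<in> {1..L}"
    and n_def: "n = nxt (m - 1) i" and distinct: "distinct [(i, a), (i, b), (n, c)]"
  shows "wheel_at q2 (mn (- 1) 1) (i, a) (i, b) (n, c) (hnum L K f)"
proof -
  let ?g = "mn (- 1) 1" and ?u = "(i, a)" and ?v = "(i, b)" and ?w = "(n, c)" and ?V = "YZ L K"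
  have n: "n \<in> {1..m - 1}" "n = col (i + 1)" "nxt m i = i + 1" "col i = i"
    using i m by (auto simp: n_def nxt_def)
  have uvw: "?u \<in> ?V" "?v \<in> ?V" "?w \<in> ?V"
    using i n(1) abc m by (auto simp: Yv_iff)
  have uvw': "{?u, ?v, ?w} \<subseteq> Yv L"
    using uvw i n(1) by (auto simp: Zv_iff)
  have ab: "a \<noteq> b" using distinct by simp
  note g = generic_ratio[of ?g]
  have near: "k = (?u, inverse q2, ?v) \<or> k = (?v, q2, ?u)"
    if "k \<in> Kset L K" "subst (wsub q2 ?g ?u ?v ?w) (lin k) = 0" for k
    using that uvw' distinct g by (intro wsub_Kset_B) auto
  show ?thesis
  proof (cases "i = 1")
    case False
    let ?W = "wsub q2 ?g ?u ?v ?w"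
    have W0: "?W j e \<noteq> 0" for j e
      using mn_neq_0 qs_neq_0 by (intro wsub_neq_0)
    let ?s = "\<lambda>j e. cst (rco L j e) * case_prod ?W (rvar L j e)"
    have Wv: "?W i a = xvar i a" "?W i b = cst q2 * xvar i a" "?W n c = cst ?g * (cst q2 * xvar i a)"
      using distinct by (auto simp: wsub_def)
    have sA: "?s i a = cst (kap i) * xvar i a"
      and sB: "?s i b = cst (kap i) * (cst q2 * xvar i a)"
      using sgs_y[of a L i ?W] sgs_y[of b L i ?W] abc Wv by (simp_all only: n(4) atLeastAtMost_iff)
    have sC: "?s (nxt m i) c = cst (kap (i + 1)) * (cst ?g * (cst q2 * xvar i a))"
      unfolding n(3) using sgs_y[of c L "i + 1" ?W] abc Wv by (simp only: n(2)[symmetric] atLeastAtMost_iff)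
    have key: "kap (i + 1) * ?g = q3 * kap i"
      using kap_step[OF i] by (rule sym)
    have "subst ?s f = 0"
    proof (rule wheel_zeroB[OF f(2), where i = i and a = a and b = b and c = c])
      show "?s i b = cst q2 * ?s i a"
        unfolding sA sB by (simp only: mult_ac)
      show "?s (nxt m i) c = cst q3 * ?s i b"
        unfolding sB sC by (simp only: mult.assoc[symmetric] cst_mult[symmetric] key)
      show "?s j e \<noteq> 0" for j e
        using W0 by (simp add: rco_neq_0 case_prod_beta)
    qed (use i abc ab in auto)
    hence "subst ?W (subst (sg L) f) = 0"
      using subst_sg_comp[OF f(1) W0] by simp
    moreover have "subst ?W (lin k) \<noteq> 0" if "k \<in> Kset L K" for k
      using near[OF that] not_Kset_y[of i] that False i by fastforce
    ultimately show ?thesis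
      unfolding wheel_at_wsub by (intro wheel_simple[OF f W0])
  next
    case True
    obtain k0 where k0: "k0 \<in> Kset L K" "k0 = (?u, inverse q2, ?v) \<or> k0 = (?v, q2, ?u)"
      using Kset_A_y[OF abc(1,2) ab, of K] True by auto
    let ?\<sigma> = "sub1 ?w (cst ?g * X ?v)"
    let ?s = "\<lambda>j e. cst (rco L j e) * case_prod ?\<sigma> (rvar L j e)"
    have \<sigma>_unit: "?\<sigma> j e \<in> lunit ?V" if "(j, e) \<in> ?V" for j e
      using that uvw mn_neq_0 by (intro sub1_unit lunit_mult lunit_cst lunit_X) auto
    have \<sigma>v: "?\<sigma> 1 a = xvar 1 a" "?\<sigma> 1 b = xvar 1 b" "?\<sigma> n c = cst ?g * xvar 1 b"
      using distinct True by (auto simp: sub1_def)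
    have s_m: "?s m e = ?\<sigma> 1 e" if "e \<in> {1..L}" for e
      using that by (simp add: sgs_y kap_m)
    have s_1: "?s 1 e = cst (kap 1) * ?\<sigma> 1 e" if "e \<in> {1..L}" for e
      using that by (simp add: sgs_y)
    have s_2: "?s 2 c = cst (kap 2 * ?g) * xvar 1 b"
    proof -
      have "n = col 2"
        using n(2) unfolding True one_add_one .
      thus ?thesis
        using sgs_y[of c L 2 ?\<sigma>] abc \<sigma>v(3) by (simp only: cst_mult mult.assoc atLeastAtMost_iff)
    qed
    have ne: "(2, c) \<notin> {(m, a), (1, a), (m, b)}" "(1, b) \<notin> {(m, a), (1, a), (m, b)}"
      using distinct True n(2) m ab by auto
    have X: "(2, c) \<in> Xv (L + K)" "(1, b) \<in> Xv (L + K)"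
      using abc m by (auto simp: Xv_iff)
    have "subst ?s f / lin (?u, inverse q2, ?v) ^ 2 \<in> lp ?V"
    proof (rule double_root[OF f(1) sgs_unit[OF \<sigma>_unit] YZ_col_le,
          where ?x1.0 = "(m, a)" and ?x2.0 = "(1, a)" and ?x3.0 = "(m, b)" and ?k2.0 = "kap 1"])
      show "lin_in ?V (?u, inverse q2, ?v)"
        using uvw distinct qs_neq_0 by (auto simp: lin_in_def)
      show "distinct [(m, a), (1, a), (m, b)]" "{(m, a), (1, a), (m, b)} \<subseteq> Xv (L + K)"
        using m ab abc by (auto simp: Xv_iff)
      show "case_prod ?s (m, a) = X ?u" "case_prod ?s (1, a) = cst (kap 1) * X ?u"
        using s_m[OF abc(1)] s_1[OF abc(1)] \<sigma>v True by simp_all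
      fix s :: "nat \<Rightarrow> nat \<Rightarrow> ratfun"
      assume nz: "\<And>j e. (j, e) \<in> Xv (L + K) \<Longrightarrow> s j e \<noteq> 0"
        and oth: "\<And>j e. (j, e) \<in> Xv (L + K) \<Longrightarrow> (j, e) \<notin> {(m, a), (1, a), (m, b)} \<Longrightarrow> s j e = ?s j e"
      have q2i: "cst q2 * (x * (cst (inverse q2) * y)) = x * y" for x y
        using qs_neq_0 by (simp add: cst_inverse)
      {
        assume s2: "case_prod s (1, a) = cst (kap 1) * (cst (inverse q2) * X ?v)"
        show "subst s f = 0"
        proof (rule wheel_zeroB[OF f(2) _ _ ab nz, where i = 1 and c = c])
          have sb: "s 1 b = cst (kap 1) * xvar 1 b"
            using oth[OF X(2) ne(2)] s_1[OF abc(2)] \<sigma>v by simp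
          show "s 1 b = cst q2 * s 1 a"
            using s2 sb True by (simp add: q2i)
          have "s 2 c = cst (kap 2 * ?g) * xvar 1 b"
            using oth[OF X(1) ne(1)] s_2 by simp
          moreover have "kap 2 * ?g = q3 * kap 1"
            using kap_step[of 1] i True by (simp add: numeral_2_eq_2)
          ultimately have "s 2 c = cst (q3 * kap 1) * xvar 1 b"
            by (simp only:)
          moreover have "nxt m 1 = 2"
            using m by (simp add: nxt_def)
          ultimately show "s (nxt m 1) c = cst q3 * s 1 b"
            using sb by (simp add: cst_mult mult.assoc)
        qed (use m abc in auto)
      }
      {
        fix Y
        assume s1: "case_prod s (m, a) = Y" and s2: "case_prod s (1, a) = cst (kap 1) * Y"
          and s3: "case_prod s (m, b) = case_prod ?s (m, b) * (Y / (cst (inverse q2) * X ?v))"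
        show "subst s f = 0"
        proof (rule wheel_zeroB[OF f(2) _ _ ab nz, where i = m and c = a])
          have "case_prod ?s (m, b) = X ?v"
            using s_m[OF abc(2)] \<sigma>v True by simp
          hence sb: "s m b = cst q2 * Y"
            using s3 by (simp add: cst_inverse divide_inverse mult.commute)
          thus "s m b = cst q2 * s m a"
            using s1 by simp
          have "kap 1 = q3 * q2"
            using m by (simp add: mn_consts mn_simps)
          thus "s (nxt m m) a = cst q3 * s m b"
            using s2 sb by (simp add: nxt_def cst_mult)
        qed (use m abc in auto)
      }
    qed (auto simp: kap_neq_0)
    moreover have "mlt k0 = 1"
      using k0(2) True by (auto simp: mlt_y)
    ultimately have dvd: "subst ?\<sigma> (subst (sg L) f) / lin (?u, inverse q2, ?v) ^ Suc (mlt k0) \<in> lp ?V"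
      using subst_sg_comp[OF f(1) lunit_neq_0[OF \<sigma>_unit]] by (simp add: numeral_2_eq_2)
    show ?thesis
    proof (rule wheel_multiple_B[OF f distinct uvw mn_neq_0 k0 dvd])
      fix k assume "k \<in> Kset L K" "k \<noteq> k0"
      thus "subst (wsub q2 ?g ?u ?v ?w) (lin k) \<noteq> 0"
        using near[of k] k0 Kset_order by blast
    qed
  qed
qed

text \<open>
  The ratio \<open>q\<^sub>3\<^sup>m\<close> joins the end of the chain of \<open>z\<^sub>a\<close> to the start of the chain of \<open>z\<^sub>b\<close>. So now all \<open>m\<close> colours
  give a zero of \<open>\<rho>(f)\<close> at \<open>z\<^sub>c = q\<^sub>2 z\<^sub>b\<close>, one more than the \<open>m - 1\<close> zeros of \<open>E\<close>.
\<close>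

lemma wheel_z_A:
  assumes f: "f \<in> lp (Xv (L + K))" "wheel_zero (L + K) f"
    and abc: "a \<in> {1..K}" "b \<in> {1..K}" "c \<in> {1..K}" and distinct: "distinct [a, b, c]"
  shows "wheel_at (q3 ^ m) q2 (0, a) (0, b) (0, c) (hnum L K f)"
proof -
  let ?g = "q3 ^ m" and ?u = "(0::nat, a)" and ?v = "(0::nat, b)" and ?w = "(0::nat, c)" and ?V = "YZ L K"
  have uvw: "?u \<in> ?V" "?v \<in> ?V" "?w \<in> ?V" and dist: "distinct [?u, ?v, ?w]"
    using abc distinct by (auto simp: Zv_iff)
  have g0: "?g \<noteq> 0"
    using qs_neq_0 by simp
  note g = generic_ratio[of ?g]
  have near: "k = (?w, q2, ?v) \<or> k = (?v, inverse q2, ?w)"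
    if "k \<in> Kset L K" "subst (wsub ?g q2 ?u ?v ?w) (lin k) = 0" for k
    using that abc dist g by (intro wsub_Kset_A) (auto simp: Zv_iff)
  obtain k0 where k0: "k0 \<in> Kset L K" "k0 = (?w, q2, ?v) \<or> k0 = (?v, inverse q2, ?w)"
    using Kset_A_z[OF abc(2,3), of L] distinct by auto
  let ?\<sigma> = "sub1 ?v (cst ?g * X ?u)"
  let ?s = "\<lambda>j e. cst (rco L j e) * case_prod ?\<sigma> (rvar L j e)"
  have \<sigma>_unit: "?\<sigma> j e \<in> lunit ?V" if "(j, e) \<in> ?V" for j e
    using that uvw g0 by (intro sub1_unit lunit_mult lunit_cst lunit_X) auto
  have \<sigma>v: "?\<sigma> 0 a = xvar 0 a" "?\<sigma> 0 b = cst ?g * xvar 0 a" "?\<sigma> 0 c = xvar 0 c"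
    using distinct by (auto simp: sub1_def)
  have s_z: "?s j (e + L) = cst (q3 ^ (j - 1)) * ?\<sigma> 0 e" if "e \<in> {1..K}" for j e
    using that by (intro sgs_z) simp
  have "subst ?s f / lin (?w, q2 * ?g, ?u) ^ card {1..m} \<in> lp ?V"
  proof (rule multiple_root_z[OF f(1) sgs_unit[OF \<sigma>_unit] YZ_col_le, where \<alpha> = "c + L"])
    show "lin_in ?V (?w, q2 * ?g, ?u)"
      using uvw distinct g0 qs_neq_0 by (auto simp: lin_in_def)
    show "?s i (c + L) = cst (q3 ^ (i - 1)) * X ?w" for i
      using s_z[OF abc(3)] \<sigma>v by simp
    fix i s assume i: "i \<in> {1..m}" and nz: "\<And>j e. (j, e) \<in> Xv (L + K) \<Longrightarrow> s j e \<noteq> 0"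
      and oth: "\<And>j e. (j, e) \<in> Xv (L + K) \<Longrightarrow> e \<noteq> c + L \<or> j \<notin> {1..m} \<Longrightarrow> s j e = ?s j e"
      and sc: "s i (c + L) = cst (q3 ^ (i - 1) * (q2 * ?g)) * X ?u"
    have s_b: "s j (b + L) = cst (q3 ^ (j - 1)) * (cst ?g * xvar 0 a)" if "j \<in> {1..m}" for j
      using oth[of j "b + L"] s_z[OF abc(2), of j] \<sigma>v distinct abc that by (simp add: Xv_iff)
    have s_a: "s j (a + L) = cst (q3 ^ (j - 1)) * xvar 0 a" if "j \<in> {1..m}" for j
      using oth[of j "a + L"] s_z[OF abc(1), of j] \<sigma>v distinct abc that by (simp add: Xv_iff)
    have pm: "prv m i \<in> {1..m}"
      using i nxt_prv by blast
    show "subst s f = 0"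
    proof (rule wheel_zeroA[OF f(2) i _ _ nz, where a = "if i = 1 then a + L else b + L" and b = "b + L" and c = "c + L"])
      show "s i (b + L) = cst q3 * s (prv m i) (if i = 1 then a + L else b + L)"
      proof (cases "i = 1")
        case True
        have "?g = q3 * q3 ^ (m - 1)"
          using m by (metis power_eq_if not_numeral_le_zero)
        thus ?thesis
          using s_b[OF i] s_a[of m] m True by (simp add: prv_def cst_mult mult.assoc)
      next
        case False
        hence "q3 ^ (i - 1) = q3 * q3 ^ (i - 1 - 1)"
        proof -
          have "i - 1 = Suc (i - 1 - 1)"
            using i False by auto
          thus ?thesis
            by (metis power_Suc)
        qed
        thus ?thesis
          using s_b[OF i] s_b[OF pm] False by (simp add: prv_def cst_mult mult.assoc)
      qed
      show "s i (c + L) = cst q2 * s i (b + L)"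
        using sc s_b[OF i] by (simp add: cst_mult mult_ac)
    qed (use abc distinct in auto)
  qed auto
  moreover have "Suc (mlt k0) = card {1..m}"
    using k0(2) mlt_z by auto
  ultimately have dvd: "subst ?\<sigma> (subst (sg L) f) / lin (?w, q2 * ?g, ?u) ^ Suc (mlt k0) \<in> lp ?V"
    using subst_sg_comp[OF f(1) lunit_neq_0[OF \<sigma>_unit]] by simp
  show ?thesis
  proof (rule wheel_multiple_A[OF f dist uvw g0 k0 dvd])
    fix k assume "k \<in> Kset L K" "k \<noteq> k0"
    thus "subst (wsub ?g q2 ?u ?v ?w) (lin k) \<noteq> 0"
      using near[of k] k0 Kset_order by blast
  qed
qed

text \<open>
  The mirror image of \<open>wheel_z_A\<close>, with the chain of \<open>z\<^sub>c\<close> continuing that of \<open>z\<^sub>b\<close>.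
\<close>

lemma wheel_z_B:
  assumes f: "f \<in> lp (Xv (L + K))" "wheel_zero (L + K) f"
    and abc: "a \<in> {1..K}" "b \<in> {1..K}" "c \<in> {1..K}" and distinct: "distinct [a, b, c]"
  shows "wheel_at q2 (q3 ^ m) (0, a) (0, b) (0, c) (hnum L K f)"
proof -
  let ?g = "q3 ^ m" and ?u = "(0::nat, a)" and ?v = "(0::nat, b)" and ?w = "(0::nat, c)" and ?V = "YZ L K"
  have uvw: "?u \<in> ?V" "?v \<in> ?V" "?w \<in> ?V" and dist: "distinct [?u, ?v, ?w]"
    using abc distinct by (auto simp: Zv_iff)
  have g0: "?g \<noteq> 0"
    using qs_neq_0 by simp
  note g = generic_ratio[of ?g]
  have near: "k = (?u, inverse q2, ?v) \<or> k = (?v, q2, ?u)"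
    if "k \<in> Kset L K" "subst (wsub q2 ?g ?u ?v ?w) (lin k) = 0" for k
    using that abc dist g by (intro wsub_Kset_B) (auto simp: Zv_iff)
  obtain k0 where k0: "k0 \<in> Kset L K" "k0 = (?u, inverse q2, ?v) \<or> k0 = (?v, q2, ?u)"
    using Kset_A_z[OF abc(1,2), of L] distinct by auto
  let ?\<sigma> = "sub1 ?w (cst ?g * X ?v)"
  let ?s = "\<lambda>j e. cst (rco L j e) * case_prod ?\<sigma> (rvar L j e)"
  have \<sigma>_unit: "?\<sigma> j e \<in> lunit ?V" if "(j, e) \<in> ?V" for j e
    using that uvw g0 by (intro sub1_unit lunit_mult lunit_cst lunit_X) auto
  have \<sigma>v: "?\<sigma> 0 a = xvar 0 a" "?\<sigma> 0 b = xvar 0 b" "?\<sigma> 0 c = cst ?g * xvar 0 b"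
    using distinct by (auto simp: sub1_def)
  have s_z: "?s j (e + L) = cst (q3 ^ (j - 1)) * ?\<sigma> 0 e" if "e \<in> {1..K}" for j e
    using that by (intro sgs_z) simp
  have "subst ?s f / lin (?u, inverse q2, ?v) ^ card {1..m} \<in> lp ?V"
  proof (rule multiple_root_z[OF f(1) sgs_unit[OF \<sigma>_unit] YZ_col_le, where \<alpha> = "a + L"])
    show "lin_in ?V (?u, inverse q2, ?v)"
      using uvw distinct qs_neq_0 by (auto simp: lin_in_def)
    show "?s i (a + L) = cst (q3 ^ (i - 1)) * X ?u" for i
      using s_z[OF abc(1)] \<sigma>v by simp
    fix i s assume i: "i \<in> {1..m}" and nz: "\<And>j e. (j, e) \<in> Xv (L + K) \<Longrightarrow> s j e \<noteq> 0"
      and oth: "\<And>j e. (j, e) \<in> Xv (L + K) \<Longrightarrow> e \<noteq> a + L \<or> j \<notin> {1..m} \<Longrightarrow> s j e = ?s j e"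
      and sa: "s i (a + L) = cst (q3 ^ (i - 1) * inverse q2) * X ?v"
    have s_b: "s j (b + L) = cst (q3 ^ (j - 1)) * xvar 0 b" if "j \<in> {1..m}" for j
      using oth[of j "b + L"] s_z[OF abc(2), of j] \<sigma>v distinct abc that by (simp add: Xv_iff)
    have s_c: "s j (c + L) = cst (q3 ^ (j - 1)) * (cst ?g * xvar 0 b)" if "j \<in> {1..m}" for j
      using oth[of j "c + L"] s_z[OF abc(3), of j] \<sigma>v distinct abc that by (simp add: Xv_iff)
    have nm: "nxt m i \<in> {1..m}"
      using i nxt_prv by blast
    show "subst s f = 0"
    proof (rule wheel_zeroB[OF f(2) i _ _ nz, where a = "a + L" and b = "b + L" and c = "if i = m then c + L else b + L"])
      show "s (nxt m i) (if i = m then c + L else b + L) = cst q3 * s i (b + L)"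
      proof (cases "i = m")
        case True
        have "?g = q3 * q3 ^ (m - 1)"
          using m by (metis power_eq_if not_numeral_le_zero)
        thus ?thesis
          using s_b[OF i] s_c[OF nm] True by (simp add: nxt_def cst_mult mult.assoc)
      next
        case False
        have "q3 ^ i = q3 * q3 ^ (i - 1)"
          using i by (simp add: power_eq_if[of q3 i])
        thus ?thesis
          using s_b[OF i] s_b[OF nm] False by (simp add: nxt_def cst_mult mult.assoc)
      qed
      have "cst q2 * s i (a + L) = (cst q2 * cst (inverse q2)) * (cst (q3 ^ (i - 1)) * xvar 0 b)"
        unfolding sa prod.case cst_mult by (simp only: mult_ac)
      thus "s i (b + L) = cst q2 * s i (a + L)"
        using s_b[OF i] qs_neq_0 by (simp add: cst_inverse)
    qed (use abc distinct in auto)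
  qed auto
  moreover have "Suc (mlt k0) = card {1..m}"
    using k0(2) mlt_z by auto
  ultimately have dvd: "subst ?\<sigma> (subst (sg L) f) / lin (?u, inverse q2, ?v) ^ Suc (mlt k0) \<in> lp ?V"
    using subst_sg_comp[OF f(1) lunit_neq_0[OF \<sigma>_unit]] by simp
  show ?thesis
  proof (rule wheel_multiple_B[OF f dist uvw g0 k0 dvd])
    fix k assume "k \<in> Kset L K" "k \<noteq> k0"
    thus "subst (wsub q2 ?g ?u ?v ?w) (lin k) \<noteq> 0"
      using near[of k] k0 Kset_order by blast
  qed
qed

end

section \<open>The image lies in the tensor product\<close>

lemma ppr_sq_subst:
  assumes "\<And>a b. a \<in> {1..n} \<Longrightarrow> b \<in> {1..n} \<Longrightarrow> a \<noteq> b \<Longrightarrow> s i a \<noteq> s i b"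
  shows "has_subst s (ppr {1..n} (\<lambda>a b. (xvar i a - xvar i b)^2)) (ppr {1..n} (\<lambda>a b. (s i a - s i b)^2))"
    "ppr {1..n} (\<lambda>a b. (s i a - s i b)^2) \<noteq> 0"
proof -
  show "has_subst s (ppr {1..n} (\<lambda>a b. (xvar i a - xvar i b)^2)) (ppr {1..n} (\<lambda>a b. (s i a - s i b)^2))"
    unfolding ppr_def case_prod_beta by (intro has_subst_prod has_subst_power has_subst_diff has_subst_xvar)
  show "ppr {1..n} (\<lambda>a b. (s i a - s i b)^2) \<noteq> 0"
    using assms finite_ordered_pairs[of "{1..n}"] unfolding ppr_def by (auto simp: prod_zero_iff)
qed

lemma ppr_sq_lp:
  assumes "\<And>a. a \<in> {1..n} \<Longrightarrow> (i, a) \<in> V"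
  shows "ppr {1..n} (\<lambda>a b. (xvar i a - xvar i b)^2) \<in> lp V"
  unfolding ppr_def using assms by (intro lp_prod) (auto intro!: lp_power lp_diff lp_xvar)

context shuffle_setup
begin

lemma Dy_subst:
  assumes "\<And>x y. x \<in> Yv L \<Longrightarrow> y \<in> Yv L \<Longrightarrow> x \<noteq> y \<Longrightarrow> case_prod s x \<noteq> case_prod s y"
  obtains D' where "has_subst s (Dy L) D'" "D' \<noteq> 0"
proof (cases "m - 1 = 1")
  case True
  have "s 1 a \<noteq> s 1 b" if "a \<in> {1..L}" "b \<in> {1..L}" "a \<noteq> b" for a b
    using assms[of "(1, a)" "(1, b)"] that m by (auto simp: Yv_iff)
  from ppr_sq_subst[of L s 1, OF this] show ?thesis
    using that unfolding Dy_def if_P[OF True] by blast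
next
  case False
  have eq: "Dy L = cyc_den (m - 1) L"
    unfolding Dy_def if_not_P[OF False] cyc_den_def by (rule refl)
  have "m - 1 \<ge> 2"
    using False m by auto
  from cyc_den_subst_neq_0[OF this, of L s] show ?thesis
    using that has_subst_cyc_den[of s "m - 1" L] assms unfolding eq Yv_def by blast
qed

lemma Dy_lp: "Dy L \<in> lp (Yv L)"
proof (cases "m - 1 = 1")
  case True
  show ?thesis
    unfolding Dy_def if_P[OF True] using m by (intro ppr_sq_lp) (auto simp: Yv_iff)
next
  case False
  have eq: "Dy L = cyc_den (m - 1) L"
    unfolding Dy_def if_not_P[OF False] cyc_den_def by (rule refl)
  show ?thesis
    unfolding eq Yv_def by (rule cyc_den_lp)
qed

lemma ren1_perm_Yv:
  assumes "\<sigma> permutes {1..L}" "i \<in> {1..m - 1}"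
  shows "j \<in> {1..m - 1} \<Longrightarrow> ren1 i \<sigma> j permutes {1..L}" "ren1 i \<sigma> 0 permutes {1..K}"
  using ren1_permutes[of \<sigma> "\<lambda>_. {1..L}" i j] ren1_permutes[of \<sigma> "\<lambda>j. if j = 0 then {1..K} else {1..L}" i 0] assms
  by auto

lemma left_factor_Sh:
  assumes p: "p \<in> lp (Yv L)"
    and sym: "\<And>i \<sigma>. i \<in> {1..m - 1} \<Longrightarrow> \<sigma> permutes {1..L} \<Longrightarrow> subst (ren (ren1 i \<sigma>)) p = p"
    and wheelA: "\<And>i a b c n. i \<in> {1..m - 1} \<Longrightarrow> {a, b, c} \<subseteq> {1..L} \<Longrightarrow> n = prv (m - 1) i \<Longrightarrow>
        distinct [(n, a), (i, b), (i, c)] \<Longrightarrow> wheel_at (mn (- 1) 1) q2 (n, a) (i, b) (i, c) p"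
    and wheelB: "\<And>i a b c n. i \<in> {1..m - 1} \<Longrightarrow> {a, b, c} \<subseteq> {1..L} \<Longrightarrow> n = nxt (m - 1) i \<Longrightarrow>
        distinct [(i, a), (i, b), (n, c)] \<Longrightarrow> wheel_at q2 (mn (- 1) 1) (i, a) (i, b) (n, c) p"
  shows "p / Dy L \<in> Sh (m - 1) (q', q1', q2, mn (- 1) 1) (\<lambda>_. L)"
proof -
  have sym_p: "sym_in (m - 1) (\<lambda>_. L) p"
    unfolding sym_in_ren1 using sym by blast
  have "poles (m - 1) (\<lambda>_. L) (p / Dy L)"
  proof (cases "m - 1 = 1")
    case True
    have "Dy L = (\<Prod>(a, b)\<in>{(a, b). a \<in> {1..L} \<and> b \<in> {1..L} \<and> a < b}. (xvar 1 a - xvar 1 b)^2)"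
      unfolding Dy_def if_P[OF True] ppr_def ..
    thus ?thesis
      unfolding poles_def if_P[OF True] using p sym_p by (auto simp: Yv_def lp_eq_laurent_polys)
  next
    case False
    have "Dy L = (\<Prod>i\<in>{1..m - 1}. \<Prod>a\<in>{1..L}. \<Prod>b\<in>{1..L}. (xvar i a - xvar (nxt (m - 1) i) b))"
      unfolding Dy_def if_not_P[OF False] ..
    thus ?thesis
      unfolding poles_def if_not_P[OF False] using p by (auto simp: Yv_def lp_eq_laurent_polys)
  qed
  moreover have "sym_in (m - 1) (\<lambda>_. L) (p / Dy L)"
  proof -
    have "subst (ren (ren1 i \<sigma>)) (Dy L) = Dy L" if "i \<in> {1..m - 1}" "\<sigma> permutes {1..L}" for i \<sigma>
      by (rule has_subst_imp_subst[OF Dy_sym]) (rule ren1_perm_Yv(1)[OF that(2,1)])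
    thus ?thesis
      using sym_in_divide[OF p Dy_lp Dy_neq_0, of "m - 1" "\<lambda>_. L"] sym_p by blast
  qed
  moreover have "wheel (m - 1) (q', q1', q2, mn (- 1) 1) (\<lambda>_. L) (p / Dy L)"
  proof -
    have step: "wheel_at qa qb u v w (p / Dy L)"
      if wh: "wheel_at qa qb u v w p" and dist: "distinct [u, v, w]"
        and qs: "qa = mn (- 1) 1 \<and> qb = q2 \<or> qa = q2 \<and> qb = mn (- 1) 1"
      for qa qb u v w
    proof -
      have q: "qa \<noteq> 0" "qb \<noteq> 0" "qa \<noteq> 1" "qb \<noteq> 1" "qb * qa \<noteq> 1"
        using qs qs_neq_0 q2_neq_1 generic_ratio[of "mn (- 1) 1"] by (auto simp: mult.commute)
      obtain D' where "has_subst (wsub qa qb u v w) (Dy L) D'" "D' \<noteq> 0"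
        using Dy_subst[of L "wsub qa qb u v w"] wsub_inj[OF dist q] by blast
      from wheel_at_divide[OF p this q(1,2)] show ?thesis
        using wh by simp
    qed
    show ?thesis
      unfolding wheel.simps
      by (intro conjI ballI impI step wheelA wheelB) auto
  qed
  ultimately show ?thesis
    by (simp add: Sh_def)
qed

text \<open>
  The second tensor factor has colour \<open>1\<close> as an element of \<open>Sh\<^sub>1\<close> and colour \<open>0\<close> inside the tensor product;
  \<open>z1\<close> and \<open>z0\<close> translate.
\<close>

definition z1 :: "nat \<Rightarrow> nat \<Rightarrow> ratfun" where "z1 = (\<lambda>i b. xvar 1 b)"

definition z0 :: "nat \<Rightarrow> nat \<Rightarrow> ratfun" where "z0 = (\<lambda>i b. xvar 0 b)"

lemma right_factor_Sh:
  assumes r: "r \<in> lp (Zv K)"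
    and sym: "\<And>\<sigma>. \<sigma> permutes {1..K} \<Longrightarrow> subst (ren (ren1 0 \<sigma>)) r = r"
    and wheelA: "\<And>a b c. {a, b, c} \<subseteq> {1..K} \<Longrightarrow> distinct [a, b, c] \<Longrightarrow>
        wheel_at (q3 ^ m) q2 (0, a) (0, b) (0, c) r"
    and wheelB: "\<And>a b c. {a, b, c} \<subseteq> {1..K} \<Longrightarrow> distinct [a, b, c] \<Longrightarrow>
        wheel_at q2 (q3 ^ m) (0, a) (0, b) (0, c) r"
  shows "\<exists>G\<in>Sh 1 (q', q1', q2, q3 ^ m) (\<lambda>_. K). subst z0 G = r / Dz K"
proof -
  let ?D = "ppr {1..K} (\<lambda>a b. (xvar 1 a - xvar 1 b)^2)" and ?V = "degree_vars 1 (\<lambda>_. K)"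
  let ?R = "subst z1 r"
  have V: "(1, a) \<in> ?V" if "a \<in> {1..K}" for a
    using that by (simp add: degree_vars_def)
  have R: "?R \<in> lp ?V"
    by (rule lp_subst[OF r]) (auto simp: z1_def Zv_iff degree_vars_def intro!: lunit_xvar)
  have D: "?D \<in> lp ?V" "?D \<noteq> 0"
    using ppr_sq_subst(2)[of K xvar 1] ppr_sq_lp[of K 1 ?V, OF V] by auto
  have comp1: "subst s ?R = subst (\<lambda>i b. s 1 b) r" if "\<And>b. s 1 b \<noteq> 0" for s
    using that by (intro lp_subst_comp(2)[OF r]) (auto simp: z1_def intro: has_subst_xvar)
  have comp0: "subst z1 (subst s r) = subst (\<lambda>i b. u 1 b) r"
    if "\<And>b. s 0 b \<noteq> 0" "\<And>b. u 1 b \<noteq> 0" "\<And>b. has_subst z1 (s 0 b) (u 1 b)" for s u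
    using that by (intro lp_subst_comp(2)[OF r]) (auto simp: Zv_iff)
  have sym_R: "sym_in 1 (\<lambda>_. K) ?R"
    unfolding sym_in_ren1
  proof (intro ballI allI impI)
    fix i \<sigma> assume "i \<in> {1..1::nat}" and \<sigma>: "\<sigma> permutes {1..K}"
    hence i: "i = 1" by simp
    have "subst z1 (subst (ren (ren1 0 \<sigma>)) r) = subst (\<lambda>i b. ren (ren1 1 \<sigma>) 1 b) r"
      using has_subst_xvar[of z1 0] by (intro comp0 ren_neq_0) (simp add: ren_def ren1_def z1_def)
    thus "subst (ren (ren1 i \<sigma>)) ?R = ?R"
      using comp1[of "ren (ren1 1 \<sigma>)"] ren_neq_0 sym[OF \<sigma>] i by simp
  qed
  have wheel_R: "wheel_at qa qb (1, a) (1, b) (1, c) ?R"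
    if "wheel_at qa qb (0, a) (0, b) (0, c) r" "qa \<noteq> 0" "qb \<noteq> 0" for qa qb a b c
  proof -
    have "subst z1 (subst (wsub qa qb (0, a) (0, b) (0, c)) r) =
        subst (\<lambda>i e. wsub qa qb (1, a) (1, b) (1, c) 1 e) r"
    proof (intro comp0 wsub_neq_0 that)
      fix e
      show "has_subst z1 (wsub qa qb (0, a) (0, b) (0, c) 0 e) (wsub qa qb (1, a) (1, b) (1, c) 1 e)"
        unfolding wsub_eq' wco_def wvar_def
        using has_subst_monom[of z1 _ "(0, _)"] has_subst_xvar[of z1 0] by (auto simp: z1_def)
    qed
    thus ?thesis
      using that comp1[of "wsub qa qb (1, a) (1, b) (1, c)"] wsub_neq_0[OF that(2,3)]
      by (simp add: wheel_at_wsub)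
  qed
  have "?R / ?D \<in> Sh 1 (q', q1', q2, q3 ^ m) (\<lambda>_. K)"
  proof -
    have "poles 1 (\<lambda>_. K) (?R / ?D)"
      unfolding poles_def using R sym_R by (auto simp: lp_eq_laurent_polys ppr_def)
    moreover have "sym_in 1 (\<lambda>_. K) (?R / ?D)"
    proof -
      have "subst (ren (ren1 i \<sigma>)) ?D = ?D" if "i \<in> {1..1}" "\<sigma> permutes {1..K}" for i \<sigma>
      proof -
        have i: "i = 1" using that by simp
        have perm: "ren1 1 \<sigma> 1 permutes {1..K}" using that by (simp add: ren1_def)
        show ?thesis
          unfolding i
          by (rule has_subst_imp_subst, rule ren_ppr[where i = 1 and r = "ren1 1 \<sigma>" and n = K])
             (use perm in \<open>auto simp: power2_commute intro!: has_subst_power has_subst_diff has_subst_ren\<close>)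
      qed
      thus ?thesis
        using sym_in_divide[OF R D, of 1 "\<lambda>_. K"] sym_R by blast
    qed
    moreover have "wheel 1 (q', q1', q2, q3 ^ m) (\<lambda>_. K) (?R / ?D)"
    proof -
      have step: "wheel_at qa qb (1, a) (1, b) (1, c) (?R / ?D)"
        if "wheel_at qa qb (0, a) (0, b) (0, c) r" "distinct [a, b, c]"
          "qa = q3 ^ m \<and> qb = q2 \<or> qa = q2 \<and> qb = q3 ^ m" for qa qb a b c
      proof -
        have q: "qa \<noteq> 0" "qb \<noteq> 0" "qa \<noteq> 1" "qb \<noteq> 1" "qb * qa \<noteq> 1"
          using that(3) qs_neq_0 q2_neq_1 generic_ratio[of "q3 ^ m"] by (auto simp: mult.commute)
        have dist: "distinct [(1::nat, a), (1, b), (1, c)]"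
          using that(2) by simp
        have inj: "wsub qa qb (1, a) (1, b) (1, c) 1 x \<noteq> wsub qa qb (1, a) (1, b) (1, c) 1 y" if "x \<noteq> y" for x y
          using wsub_inj[OF dist q, of "(1, x)" "(1, y)"] that by simp
        let ?w = "wsub qa qb (1, a) (1, b) (1, c)"
        have "has_subst ?w ?D (ppr {1..K} (\<lambda>x y. (?w 1 x - ?w 1 y)^2))" "ppr {1..K} (\<lambda>x y. (?w 1 x - ?w 1 y)^2) \<noteq> 0"
          using ppr_sq_subst[of K ?w 1] inj by blast+
        from wheel_at_divide[OF R this q(1,2)] show ?thesis
          using wheel_R[OF that(1) q(1,2)] by blast
      qed
      show ?thesis
        by (auto simp: prv_def nxt_def intro!: step[simplified] wheelA[simplified] wheelB[simplified])
    qed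
    ultimately show ?thesis
      by (simp add: Sh_def)
  qed
  moreover have "subst z0 (?R / ?D) = r / Dz K"
  proof -
    have "subst z0 ?R = subst (\<lambda>i b. xvar 0 b) r"
      using comp1[of z0] by (simp add: z0_def)
    also have "\<dots> = r"
      by (rule lp_subst_id[OF r]) (simp add: Zv_iff)
    finally have 1: "has_subst z0 ?R r"
      using lp_has_subst[OF R, of z0] by (simp add: z0_def)
    have "has_subst z0 ?D (Dz K)" "Dz K \<noteq> 0"
      using ppr_sq_subst[of K z0 1] by (auto simp: z0_def Dz_def)
    thus ?thesis
      by (intro has_subst_imp_subst has_subst_divide 1)
  qed
  ultimately show ?thesis
    by blast
qed

text \<open>
  The symmetry and wheel conditions hold for the Laurent polynomial \<open>hnum\<close> in all variables. Independence
  of the factors in a shortest representation passes them on to the factors.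
\<close>

theorem tildeF_in_tens_space:
  assumes F: "F \<in> Sh m (q, q1, q2, q3) (\<lambda>_. L + K)"
  shows "tildeF m (q, q1, q2, q3) l1 (L + K) L F \<in>
    tens_space (Sh (m - 1) (q', q1', q2, mn (- 1) 1) (\<lambda>_. L)) (Sh 1 (q'', q1'', q2, q3 ^ m) (\<lambda>_. K))"
proof -
  let ?A = "Sh (m - 1) (q', q1', q2, mn (- 1) 1) (\<lambda>_. L)" and ?B = "Sh 1 (q'', q1'', q2, q3 ^ m) (\<lambda>_. K)"
  obtain f where f: "f \<in> lp (Xv (L + K))" "F = f / cyc_den m (L + K)" "wheel_zero (L + K) f"
    "sym_in m (\<lambda>_. L + K) f"
    using Sh_numerator[OF F] by blast
  let ?h = "hnum L K f"
  have h: "?h \<in> lp (Yv L \<union> Zv K)"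
    by (rule hnum_lp[OF f(1,3)])
  obtain I p r where rep: "tensor_rep (Yv L) (Zv K) ?h I p r"
    and ind1: "\<And>a i. (\<And>i. i \<in> I \<Longrightarrow> a i \<in> lp (Zv K)) \<Longrightarrow> (\<Sum>i\<in>I. p i * a i) = 0 \<Longrightarrow> i \<in> I \<Longrightarrow> a i = 0"
    and ind2: "\<And>b i. (\<And>i. i \<in> I \<Longrightarrow> b i \<in> lp (Yv L)) \<Longrightarrow> (\<Sum>i\<in>I. b i * r i) = 0 \<Longrightarrow> i \<in> I \<Longrightarrow> b i = 0"
    using tensor_rep_independent[OF h Yv_Zv_disjoint] by blast
  have ind1': "\<And>b i. (\<And>i. i \<in> I \<Longrightarrow> b i \<in> lp (Zv K)) \<Longrightarrow> (\<Sum>i\<in>I. b i * p i) = 0 \<Longrightarrow> i \<in> I \<Longrightarrow> b i = 0"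
    using ind1 by (simp add: mult.commute)
  have rep': "tensor_rep (Zv K) (Yv L) ?h I r p"
    using rep by (simp add: tensor_rep_swap)
  have disj': "Zv K \<inter> Yv L = {}"
    using Yv_Zv_disjoint by blast
  have left: "p i / Dy L \<in> ?A" if i: "i \<in> I" for i
  proof -
    have cond: "subst s ?h = 0 \<Longrightarrow> subst s (p i) = 0" "subst s ?h = ?h \<Longrightarrow> subst s (p i) = p i"
      if "\<And>k a. (k, a) \<in> Yv L \<Longrightarrow> s k a \<in> lunit (Yv L)" "\<And>k a. (k, a) \<in> Zv K \<Longrightarrow> s k a = xvar k a" for s
      using tensor_rep_conditions[of "Yv L" "Zv K" ?h I p r s i] rep Yv_Zv_disjoint ind2 that i by blast+
    show ?thesis
    proof (rule left_factor_Sh)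
    show "p i \<in> lp (Yv L)"
      using rep i by (auto simp: tensor_rep_def)
    show "subst (ren (ren1 j \<sigma>)) (p i) = p i" if j: "j \<in> {1..m - 1}" "\<sigma> permutes {1..L}" for j \<sigma>
    proof (rule cond(2))
      show "subst (ren (ren1 j \<sigma>)) ?h = ?h"
        using ren1_perm_Yv[OF j(2,1)] by (intro hnum_sym f) auto
      show "ren (ren1 j \<sigma>) k a \<in> lunit (Yv L)" if "(k, a) \<in> Yv L" for k a
        using that permutes_in_image[OF j(2), of a] by (auto simp: ren_def ren1_def Yv_iff intro!: lunit_xvar)
      show "ren (ren1 j \<sigma>) k a = xvar k a" if "(k, a) \<in> Zv K" for k a
        using that j(1) by (auto simp: ren_def ren1_def Zv_iff)
    qed
    have wh: "wheel_at qa qb u v w (p i)"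
      if "wheel_at qa qb u v w ?h" "qa \<noteq> 0" "qb \<noteq> 0" "{u, v, w} \<subseteq> Yv L" for qa qb u v w
      unfolding wheel_at_wsub
    proof (rule cond(1))
      show "subst (wsub qa qb u v w) ?h = 0"
        using that(1) by (simp add: wheel_at_wsub)
      show "wsub qa qb u v w k a \<in> lunit (Yv L)" if "(k, a) \<in> Yv L" for k a
        using that \<open>{u, v, w} \<subseteq> Yv L\<close> \<open>qa \<noteq> 0\<close> \<open>qb \<noteq> 0\<close> by (intro wsub_unit) auto
      show "wsub qa qb u v w k a = xvar k a" if "(k, a) \<in> Zv K" for k a
        using that \<open>{u, v, w} \<subseteq> Yv L\<close> Yv_Zv_disjoint[of L K] by (auto simp: wsub_def)
    qed
    fix j a b c n
    assume j: "j \<in> {1..m - 1}" and abc: "{a, b, c} \<subseteq> {1..L}"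
    {
      assume n: "n = prv (m - 1) j" and d: "distinct [(n, a), (j, b), (j, c)]"
      have "n \<in> {1..m - 1}"
        using j m n by (auto simp: prv_def)
      thus "wheel_at (mn (- 1) 1) q2 (n, a) (j, b) (j, c) (p i)"
        using j abc qs_neq_0 mn_neq_0 m
        by (intro wh wheel_y_A[OF f(1,3) _ _ _ _ n d]) (auto simp: Yv_iff)
    next
      assume n: "n = nxt (m - 1) j" and d: "distinct [(j, a), (j, b), (n, c)]"
      have "n \<in> {1..m - 1}"
        using j m n by (auto simp: nxt_def)
      thus "wheel_at q2 (mn (- 1) 1) (j, a) (j, b) (n, c) (p i)"
        using j abc qs_neq_0 mn_neq_0 m
        by (intro wh wheel_y_B[OF f(1,3) _ _ _ _ n d]) (auto simp: Yv_iff)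
    }
    qed
  qed
  have right: "\<exists>G\<in>?B. subst z0 G = r i / Dz K" if i: "i \<in> I" for i
  proof -
    have cond: "subst s ?h = 0 \<Longrightarrow> subst s (r i) = 0" "subst s ?h = ?h \<Longrightarrow> subst s (r i) = r i"
      if "\<And>k a. (k, a) \<in> Zv K \<Longrightarrow> s k a \<in> lunit (Zv K)" "\<And>k a. (k, a) \<in> Yv L \<Longrightarrow> s k a = xvar k a" for s
      using tensor_rep_conditions[of "Zv K" "Yv L" ?h I r p s i] rep' disj' ind1' that i by blast+
    show ?thesis
    proof (rule right_factor_Sh)
    show "r i \<in> lp (Zv K)"
      using rep i by (auto simp: tensor_rep_def)
    show "subst (ren (ren1 0 \<sigma>)) (r i) = r i" if \<sigma>: "\<sigma> permutes {1..K}" for \<sigma>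
    proof (rule cond(2))
      show "subst (ren (ren1 0 \<sigma>)) ?h = ?h"
      proof (rule hnum_sym[OF f(1,4)])
        show "ren1 0 \<sigma> 0 permutes {1..K}"
          using \<sigma> by (simp add: ren1_def)
        show "ren1 0 \<sigma> j permutes {1..L}" if "j \<in> {1..m - 1}" for j
          using that permutes_id[of "{1..L}"] by (simp add: ren1_def id_def)
      qed
      show "ren (ren1 0 \<sigma>) k a \<in> lunit (Zv K)" if "(k, a) \<in> Zv K" for k a
        using that permutes_in_image[OF \<sigma>, of a] by (auto simp: ren_def ren1_def Zv_iff intro!: lunit_xvar)
      show "ren (ren1 0 \<sigma>) k a = xvar k a" if "(k, a) \<in> Yv L" for k a
        using that by (auto simp: ren_def ren1_def Yv_iff)
    qed
    have wh: "wheel_at qa qb u v w (r i)"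
      if "wheel_at qa qb u v w ?h" "qa \<noteq> 0" "qb \<noteq> 0" "{u, v, w} \<subseteq> Zv K" for qa qb u v w
      unfolding wheel_at_wsub
    proof (rule cond(1))
      show "subst (wsub qa qb u v w) ?h = 0"
        using that(1) by (simp add: wheel_at_wsub)
      show "wsub qa qb u v w k a \<in> lunit (Zv K)" if "(k, a) \<in> Zv K" for k a
        using that \<open>{u, v, w} \<subseteq> Zv K\<close> \<open>qa \<noteq> 0\<close> \<open>qb \<noteq> 0\<close> by (intro wsub_unit) auto
      show "wsub qa qb u v w k a = xvar k a" if "(k, a) \<in> Yv L" for k a
        using that \<open>{u, v, w} \<subseteq> Zv K\<close> Yv_Zv_disjoint[of L K] by (auto simp: wsub_def)
    qed
    fix a b c assume abc: "{a, b, c} \<subseteq> {1..K}" and d: "distinct [a, b, c]"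
    show "wheel_at (q3 ^ m) q2 (0, a) (0, b) (0, c) (r i)"
      using abc qs_neq_0 by (intro wh wheel_z_A[OF f(1,3) _ _ _ d]) (auto simp: Zv_iff)
    show "wheel_at q2 (q3 ^ m) (0, a) (0, b) (0, c) (r i)"
      using abc qs_neq_0 by (intro wh wheel_z_B[OF f(1,3) _ _ _ d]) (auto simp: Zv_iff)
    qed
  qed
  then obtain G where G: "\<And>i. i \<in> I \<Longrightarrow> G i \<in> ?B \<and> subst z0 (G i) = r i / Dz K"
    by metis
  have I: "finite I"
    using rep by (simp add: tensor_rep_def)
  then obtain xs where xs: "set xs = I" "distinct xs"
    using finite_distinct_list by blast
  have "tens_sum (map (\<lambda>i. (p i / Dy L, G i)) xs) = (\<Sum>i\<in>I. p i / Dy L * (r i / Dz K))"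
  proof -
    have "tens (p i / Dy L) (G i) = p i / Dy L * (r i / Dz K)" if "i \<in> I" for i
      using G[OF that] by (simp add: tens_def z0_def)
    hence "(\<Sum>i\<in>I. tens (p i / Dy L) (G i)) = (\<Sum>i\<in>I. p i / Dy L * (r i / Dz K))"
      by (rule sum.cong[OF refl])
    thus ?thesis
      using xs by (simp add: tens_sum_def o_def sum_list_distinct_conv_sum_set)
  qed
  also have "\<dots> = ?h / (Dy L * Dz K)"
    using rep by (simp add: tensor_rep_def sum_divide_distrib)
  also have "\<dots> = tildeF m (q, q1, q2, q3) l1 (L + K) L F"
    unfolding tildeF_eq(1)[OF f(1,2)] hnum_def using Dy_neq_0 Dz_neq_0 by simp
  finally have "tildeF m (q, q1, q2, q3) l1 (L + K) L F = tens_sum (map (\<lambda>i. (p i / Dy L, G i)) xs)" ..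
  moreover have "set (map (\<lambda>i. (p i / Dy L, G i)) xs) \<subseteq> ?A \<times> ?B"
    using left G xs by auto
  ultimately show ?thesis
    unfolding tens_space_def by blast
qed

end

section \<open>Multiplicativity\<close>

definition ww :: "complex \<Rightarrow> ratfun \<Rightarrow> ratfun \<Rightarrow> ratfun" where
  "ww p x y = (x - cst p * y) / (x - y)"

definition wprod :: "complex \<Rightarrow> nat set \<Rightarrow> nat set \<Rightarrow> (nat \<Rightarrow> ratfun) \<Rightarrow> (nat \<Rightarrow> ratfun) \<Rightarrow> ratfun" where
  "wprod p A B x y = (\<Prod>a\<in>A. \<Prod>b\<in>B. ww p (x a) (y b))"

text \<open>
  The scalar \<open>d\<close> of \<open>\<omega>\<^sub>i\<^sub>,\<^sub>i\<^sub>-\<^sub>1\<close> is absent for one and two colours.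
\<close>

definition eps :: "nat \<Rightarrow> complex \<Rightarrow> complex" where
  "eps n c = (if n \<le> 2 then 1 else c)"

lemma bij_nxt_gen: "n \<ge> 1 \<Longrightarrow> bij_betw (nxt n) {1..n} {1..n}"
  by (rule bij_betw_byWitness[where f' = "prv n"]) (auto simp: nxt_def prv_def)

lemma prod_prv_shift:
  assumes "n \<ge> 1"
  shows "(\<Prod>i\<in>{1..n}. g i (prv n i)) = (\<Prod>i\<in>{1..n}. g (nxt n i) i)"
proof -
  have "prv n (nxt n i) = i" if "i \<in> {1..n}" for i
    using that by (auto simp: nxt_def prv_def)
  hence "(\<Prod>i\<in>{1..n}. g (nxt n i) i) = (\<Prod>i\<in>{1..n}. g (nxt n i) (prv n (nxt n i)))"
    by (intro prod.cong refl) simp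
  also have "\<dots> = (\<Prod>i\<in>{1..n}. g i (prv n i))"
    by (rule prod.reindex_bij_betw[OF bij_nxt_gen[OF assms]])
  finally show ?thesis ..
qed

lemma omega_row:
  assumes n: "n \<ge> 1" and i: "i \<in> {1..n}"
  shows "(\<Prod>j\<in>{1..n}. \<Prod>a\<in>A. \<Prod>b\<in>J j. omega n (q, p1, p2, p3) i j (x a) (y j b)) =
    wprod p2 A (J i) x (y i) * wprod p1 A (J (nxt n i)) x (y (nxt n i)) *
    (\<Prod>a\<in>A. \<Prod>b\<in>J (prv n i). cst (eps n (q * p1)) * ww p3 (x a) (y (prv n i) b))"
proof -
  consider "n = 1" | "n = 2" | "n \<ge> 3" using n by linarith
  thus ?thesis
  proof cases
    case 1
    hence [simp]: "i = 1" using i by simp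
    have "omega 1 (q, p1, p2, p3) 1 1 u v = ww p2 u v * ww p1 u v * (cst (eps 1 (q * p1)) * ww p3 u v)" for u v
      by (simp add: ww_def eps_def power3_eq_cube)
    thus ?thesis
      using 1 by (simp add: wprod_def nxt_def prv_def prod.distrib)
  next
    case 2
    define j where "j = nxt n i"
    have j: "j \<noteq> i" "{1..n} = {i, j}" "prv n i = j"
      using 2 i by (auto simp: j_def nxt_def prv_def)
    have "omega n (q, p1, p2, p3) i i u v = ww p2 u v" for u v
      using 2 by (simp add: ww_def)
    moreover have "omega n (q, p1, p2, p3) i j u v = ww p1 u v * (cst (eps n (q * p1)) * ww p3 u v)" for u v
      using 2 j(1) by (simp add: ww_def eps_def power2_eq_square)
    ultimately show ?thesis
      using j unfolding j_def[symmetric] by (simp add: wprod_def prod.distrib del: omega.simps)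
  next
    case 3
    define j k where "j = nxt n i" and "k = prv n i"
    have jk: "j \<noteq> i" "k \<noteq> i" "j \<noteq> k" "{i, j, k} \<subseteq> {1..n}"
      using 3 i by (auto simp: j_def k_def nxt_def prv_def split: if_splits)
    have o: "omega n (q, p1, p2, p3) i i u v = ww p2 u v" 
      "omega n (q, p1, p2, p3) i j u v = ww p1 u v"
      "omega n (q, p1, p2, p3) i k u v = cst (eps n (q * p1)) * ww p3 u v" for u v
      using 3 jk by (simp_all add: ww_def eps_def j_def k_def)
    have "(\<Prod>l\<in>{1..n}. \<Prod>a\<in>A. \<Prod>b\<in>J l. omega n (q, p1, p2, p3) i l (x a) (y l b)) =
          (\<Prod>l\<in>{i, j, k}. \<Prod>a\<in>A. \<Prod>b\<in>J l. omega n (q, p1, p2, p3) i l (x a) (y l b))"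
    proof (rule prod.mono_neutral_right)
      show "\<forall>l\<in>{1..n} - {i, j, k}. (\<Prod>a\<in>A. \<Prod>b\<in>J l. omega n (q, p1, p2, p3) i l (x a) (y l b)) = 1"
        using 3 by (auto simp: j_def k_def)
    qed (use jk in auto)
    also have "\<dots> = (\<Prod>a\<in>A. \<Prod>b\<in>J i. omega n (q, p1, p2, p3) i i (x a) (y i b)) *
       (\<Prod>a\<in>A. \<Prod>b\<in>J j. omega n (q, p1, p2, p3) i j (x a) (y j b)) *
       (\<Prod>a\<in>A. \<Prod>b\<in>J k. omega n (q, p1, p2, p3) i k (x a) (y k b))"
      using jk by (simp add: mult.assoc del: omega.simps)
    finally show ?thesis
      unfolding o unfolding wprod_def j_def k_def .
  qed
qed

text \<open>
  For one and two colours the neighbours \<open>i - 1\<close>, \<open>i\<close>, \<open>i + 1\<close> coincide partly, and the factors of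
  \<open>\<omega>\<close> are multiplied. So up to the scalar \<open>d\<close> all cases are given by one formula.
\<close>

lemma omega_prod:
  assumes n: "n \<ge> 1"
  shows "(\<Prod>i\<in>{1..n}. \<Prod>j\<in>{1..n}. \<Prod>a\<in>I i. \<Prod>b\<in>J j. omega n (q, p1, p2, p3) i j (x i a) (x j b)) =
    (\<Prod>i\<in>{1..n}. wprod p2 (I i) (J i) (x i) (x i) * wprod p1 (I i) (J (nxt n i)) (x i) (x (nxt n i)) *
      (\<Prod>a\<in>I (nxt n i). \<Prod>b\<in>J i. cst (eps n (q * p1)) * ww p3 (x (nxt n i) a) (x i b)))"
proof -
  have "(\<Prod>i\<in>{1..n}. \<Prod>j\<in>{1..n}. \<Prod>a\<in>I i. \<Prod>b\<in>J j. omega n (q, p1, p2, p3) i j (x i a) (x j b)) =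
    (\<Prod>i\<in>{1..n}. wprod p2 (I i) (J i) (x i) (x i) * wprod p1 (I i) (J (nxt n i)) (x i) (x (nxt n i)) *
      (\<Prod>a\<in>I i. \<Prod>b\<in>J (prv n i). cst (eps n (q * p1)) * ww p3 (x i a) (x (prv n i) b)))"
    by (intro prod.cong refl omega_row[OF n])
  also have "\<dots> = (\<Prod>i\<in>{1..n}. wprod p2 (I i) (J i) (x i) (x i)) *
     (\<Prod>i\<in>{1..n}. wprod p1 (I i) (J (nxt n i)) (x i) (x (nxt n i))) *
     (\<Prod>i\<in>{1..n}. \<Prod>a\<in>I i. \<Prod>b\<in>J (prv n i). cst (eps n (q * p1)) * ww p3 (x i a) (x (prv n i) b))"
    by (simp only: prod.distrib)
  also have "(\<Prod>i\<in>{1..n}. \<Prod>a\<in>I i. \<Prod>b\<in>J (prv n i). cst (eps n (q * p1)) * ww p3 (x i a) (x (prv n i) b)) =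
     (\<Prod>i\<in>{1..n}. \<Prod>a\<in>I (nxt n i). \<Prod>b\<in>J i. cst (eps n (q * p1)) * ww p3 (x (nxt n i) a) (x i b))"
    by (rule prod_prv_shift[OF n, of "\<lambda>i j. \<Prod>a\<in>I i. \<Prod>b\<in>J j. cst (eps n (q * p1)) * ww p3 (x i a) (x j b)"])
  finally show ?thesis
    by (simp only: prod.distrib)
qed

lemma has_subst_ww:
  "has_subst s x x' \<Longrightarrow> has_subst s y y' \<Longrightarrow> x' \<noteq> y' \<Longrightarrow> has_subst s (ww p x y) (ww p x' y')"
  unfolding ww_def by (intro has_subst_divide has_subst_diff has_subst_mult has_subst_cst) simp_all

subsection \<open>Scaled linear forms\<close>

lemma ww_scale:
  assumes "\<alpha> \<noteq> 0"
  shows "ww p (cst \<alpha> * u) (cst \<beta> * v) = (u - cst (p * \<beta> / \<alpha>) * v) / (u - cst (\<beta> / \<alpha>) * v)"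
proof -
  have "cst \<alpha> * u - cst c * v = cst \<alpha> * (u - cst (c / \<alpha>) * v)" for c
    using assms by (simp add: right_diff_distrib mult.assoc[symmetric] flip: cst_mult)
  from this[of "p * \<beta>"] this[of \<beta>] show ?thesis
    using assms by (simp add: ww_def cst_mult mult.assoc)
qed

lemma ww_scale':
  assumes "\<alpha> \<noteq> 0" "p \<noteq> 0"
  shows "ww p (cst \<beta> * v) (cst \<alpha> * u) = cst p * ((u - cst (\<beta> / (p * \<alpha>)) * v) / (u - cst (\<beta> / \<alpha>) * v))"
proof -
  have "cst \<beta> * v - cst c * u = cst (- c) * (u - cst (\<beta> / c) * v)" if "c \<noteq> 0" for c
    using that by (simp add: cst_uminus right_diff_distrib mult.assoc[symmetric] flip: cst_mult)
  from this[of "p * \<alpha>"] this[of \<alpha>] show ?thesis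
    using assms by (simp add: ww_def cst_mult mult.assoc cst_uminus)
qed

lemma sorted_list_nth_bij:
  fixes S :: "nat set"
  assumes "finite S"
  shows "bij_betw (\<lambda>a. sorted_list_of_set S ! (a - 1)) {1..card S} S"
proof -
  have "bij_betw (\<lambda>i. sorted_list_of_set S ! i) {..<length (sorted_list_of_set S)} (set (sorted_list_of_set S))"
    by (rule bij_betw_nth) simp_all
  hence "bij_betw (\<lambda>i. sorted_list_of_set S ! i) {..<card S} S"
    using assms by simp
  moreover have "bij_betw (\<lambda>a. a - 1) {1..card S} {..<card S}"
    by (rule bij_betw_byWitness[where f' = Suc]) auto
  ultimately show ?thesis
    using bij_betw_trans[of "\<lambda>a. a - 1" "{1..card S}" "{..<card S}" "\<lambda>i. sorted_list_of_set S ! i" S]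
    by (simp add: o_def)
qed

text \<open>
  The labels of the \<open>z\<close> variables come after all labels of the \<open>y\<close> variables, so an increasing enumeration
  treats the two kinds one after the other.
\<close>

lemma sorted_list_union_shift:
  assumes A: "A \<subseteq> {1..L}" "finite B" "\<And>b. b \<in> B \<Longrightarrow> b \<ge> (1::nat)"
  shows "sorted_list_of_set (A \<union> (\<lambda>b. b + L) ` B) =
         sorted_list_of_set A @ map (\<lambda>b. b + L) (sorted_list_of_set B)"
proof (rule sorted_list_of_set_unique[THEN iffD1])
  have fin: "finite A"
    using A(1) finite_subset by blast
  show "finite (A \<union> (\<lambda>b. b + L) ` B)"
    using fin A(2) by simp
  have "A \<inter> (\<lambda>b. b + L) ` B = {}"
    using A by fastforce
  hence "length (sorted_list_of_set A @ map (\<lambda>b. b + L) (sorted_list_of_set B)) = card (A \<union> (\<lambda>b. b + L) ` B)"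
    using fin A(2) by (simp add: card_Un_disjoint card_image inj_on_def)
  moreover have "set (sorted_list_of_set A @ map (\<lambda>b. b + L) (sorted_list_of_set B)) = A \<union> (\<lambda>b. b + L) ` B"
    using fin A(2) by simp
  moreover have "sorted_wrt (<) (sorted_list_of_set A @ map (\<lambda>b. b + L) (sorted_list_of_set B))"
    using fin A by (fastforce simp: sorted_wrt_append sorted_wrt_map)
  ultimately show "sorted_wrt (<) (sorted_list_of_set A @ map (\<lambda>b. b + L) (sorted_list_of_set B)) \<and>
    set (sorted_list_of_set A @ map (\<lambda>b. b + L) (sorted_list_of_set B)) = A \<union> (\<lambda>b. b + L) ` B \<and>
    length (sorted_list_of_set A @ map (\<lambda>b. b + L) (sorted_list_of_set B)) = card (A \<union> (\<lambda>b. b + L) ` B)"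
    by blast
qed

definition PP :: "nat set \<Rightarrow> nat set \<Rightarrow> (nat \<Rightarrow> nat \<Rightarrow> ratfun) \<Rightarrow> ratfun" where
  "PP A B f = (\<Prod>a\<in>A. \<Prod>b\<in>B. f a b)"

lemma PP_mult: "PP A B f * PP A B g = PP A B (\<lambda>a b. f a b * g a b)"
  by (simp add: PP_def prod.distrib)

lemma PP_cong: "(\<And>a b. a \<in> A \<Longrightarrow> b \<in> B \<Longrightarrow> f a b = g a b) \<Longrightarrow> PP A B f = PP A B g"
  unfolding PP_def by (intro prod.cong refl) auto

lemma PP_swap: "PP A B f = PP B A (\<lambda>b a. f a b)"
  unfolding PP_def by (rule prod.swap)

lemma PP_const: "PP A B (\<lambda>_ _. c) = c ^ (card A * card B)"
  by (simp add: PP_def flip: power_mult) (simp add: mult.commute)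

lemma wprod_PP: "wprod p A B x y = PP A B (\<lambda>a b. ww p (x a) (y b))"
  by (simp add: wprod_def PP_def)

definition shift :: "nat \<Rightarrow> nat set \<Rightarrow> nat set" where "shift L B = (\<lambda>b. b + L) ` B"

lemma prod_shift: "(\<Prod>b\<in>shift L B. g b) = (\<Prod>b\<in>B. (g (b + L) :: ratfun))"
  by (simp add: shift_def prod.reindex inj_on_def)

lemma PP_union_shift:
  assumes "finite A" "finite A'" "finite B" "finite B'" "A \<inter> shift L A' = {}" "B \<inter> shift L B' = {}"
  shows "PP (A \<union> shift L A') (B \<union> shift L B') f =
    PP A B f * PP A B' (\<lambda>a b. f a (b + L)) * PP A' B (\<lambda>a b. f (a + L) b) * PP A' B' (\<lambda>a b. f (a + L) (b + L))"
proof -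
  have fin: "finite (shift L A')" "finite (shift L B')"
    using assms by (simp_all add: shift_def)
  show ?thesis
    unfolding PP_def
    using assms fin
    by (simp add: prod.union_disjoint prod_shift prod.distrib mult_ac)
qed

lemma ppr_union:
  assumes sym: "\<And>a b. g a b = g b a" and fin: "finite S" "finite T" and disj: "S \<inter> T = {}"
  shows "ppr (S \<union> T) g = ppr S g * ppr T g * PP S T g"
proof -
  let ?P = "\<lambda>S. {(a, b). a \<in> S \<and> b \<in> S \<and> a < (b::nat)}"
  let ?X = "{(a, b). a \<in> S \<and> b \<in> T \<and> a < b}" and ?Y = "{(a, b). a \<in> T \<and> b \<in> S \<and> a < b}"
  have finXY: "finite ?X" "finite ?Y"
    by (rule finite_subset[of _ "S \<times> T"], use fin in auto)
       (rule finite_subset[of _ "T \<times> S"], use fin in auto)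
  have "?P (S \<union> T) = (?P S \<union> ?P T) \<union> (?X \<union> ?Y)"
    by auto
  hence "ppr (S \<union> T) g = (\<Prod>(a, b)\<in>?P S \<union> ?P T. g a b) * (\<Prod>(a, b)\<in>?X \<union> ?Y. g a b)"
    unfolding ppr_def using disj fin finXY finite_ordered_pairs[OF fin(1)] finite_ordered_pairs[OF fin(2)]
    by (simp, intro prod.union_disjoint) auto
  also have "(\<Prod>(a, b)\<in>?P S \<union> ?P T. g a b) = ppr S g * ppr T g"
    unfolding ppr_def using disj finite_ordered_pairs[OF fin(1)] finite_ordered_pairs[OF fin(2)]
    by (intro prod.union_disjoint) auto
  also have "(\<Prod>(a, b)\<in>?X \<union> ?Y. g a b) = (\<Prod>(a, b)\<in>S \<times> T. g a b)"
    using disj sym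
    by (intro prod.reindex_bij_witness[of _ "\<lambda>(a, b). if a < b then (a, b) else (b, a)"
          "\<lambda>(a, b). if a \<in> S then (a, b) else (b, a)"]) (auto split: if_splits)
  also have "\<dots> = PP S T g"
    by (simp add: PP_def prod.cartesian_product)
  finally show ?thesis .
qed

context shuffle_setup
begin

lemma cancel3:
  fixes a b c e f g :: ratfun
  assumes "a \<noteq> 0" "b \<noteq> 0" "c \<noteq> 0"
  shows "e / a * (f / b) * (k * (a / c)) = k * (f * e) / (b * c)"
  using assms by simp

lemma lfz_neq_0: "i \<noteq> 0 \<Longrightarrow> xvar i a - cst c * xvar 0 b \<noteq> 0"
  by (intro lf_neq_0) simp

lemma de_mid:
  fixes a b :: nat
  assumes i: "i \<in> {2..m - 1}"
  defines "u \<equiv> xvar i a" and "v \<equiv> xvar 0 b"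
  shows "de i u v = cst d * ((u - cst (mn (2 * int m - 1 - int i) (int i)) * v) * (u - cst (mn (1 - int i) (int i - 2)) * v)) /
     ((u - cst (q3 ^ i / kap i) * v) * (u - cst (q3 ^ (i - 2) / kap i) * v))"
proof -
  have lf: "cst (kap i) * u - cst c * v = cst (kap i) * (u - cst (c / kap i) * v)" for c
    using kap_neq_0[of i] by (simp add: right_diff_distrib mult.assoc[symmetric] flip: cst_mult)
  have "i \<le> m" "2 \<le> i" "i \<noteq> 1" using i by auto
  hence c: "q1 * q3 ^ i / kap i = mn (2 * int m - 1 - int i) (int i)"
    "inverse q1 * q3 ^ (i - 2) / kap i = mn (1 - int i) (int i - 2)"
    by (simp_all add: mn_q1 mn_kap q3_pow mn_simps)
  have cancel: "D * ((k * x) * (k * y)) / ((k * z) * (k * w)) = D * (x * y) / (z * w)"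
    if "k \<noteq> 0" for D k x y z w :: ratfun
    using that by (simp add: mult_ac)
  show ?thesis
    unfolding de_def if_not_P[OF \<open>i \<noteq> 1\<close>] lf c by (rule cancel) (simp add: kap_neq_0)
qed

lemma eps_m: "m > 2 \<Longrightarrow> eps m d = d"
  by (simp add: eps_def)

text \<open>
  A variable \<open>y\<^sub>i\<close> meets the chain of \<open>z\<close> in the colours \<open>i - 1\<close>, \<open>i\<close>, \<open>i + 1\<close>. The three factors of \<open>\<omega>\<close> telescope
  and leave \<open>de i\<close>.
\<close>

lemma yz_mid:
  assumes i: "i \<in> {2..m - 1}"
  shows "ww q2 (cst (kap i) * xvar i a) (cst (q3 ^ (i - 1)) * xvar 0 b) *
     ww q1 (cst (kap i) * xvar i a) (cst (q3 ^ i) * xvar 0 b) *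
     (cst (eps m d) * ww q3 (cst (kap i) * xvar i a) (cst (q3 ^ (i - 2)) * xvar 0 b)) =
     de i (xvar i a) (xvar 0 b)"
proof -
  let ?u = "xvar i a" and ?v = "xvar 0 b"
  have i': "i \<le> m" "2 \<le> i" "i \<noteq> 0" "m > 2" using i by auto
  have c: "q2 * q3 ^ (i - 1) / kap i = mn (1 - int i) (int i - 2)"
    "q1 * q3 ^ i / kap i = mn (2 * int m - 1 - int i) (int i)"
    "q3 * q3 ^ (i - 2) / kap i = q3 ^ (i - 1) / kap i"
    using i' by (simp_all add: mn_q1 mn_q2 mn_q3 mn_kap q3_pow mn_simps of_nat_diff)
  show ?thesis
    unfolding ww_scale[OF kap_neq_0] c eps_m[OF i'(4)] de_mid[OF i]
    by (rule cancel3) (intro lfz_neq_0 i')+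
qed

lemma zy_mid:
  assumes i: "i \<in> {2..m - 1}"
  shows "ww q2 (cst (q3 ^ (i - 1)) * xvar 0 b) (cst (kap i) * xvar i a) *
     ww q1 (cst (q3 ^ (i - 2)) * xvar 0 b) (cst (kap i) * xvar i a) *
     (cst (eps m d) * ww q3 (cst (q3 ^ i) * xvar 0 b) (cst (kap i) * xvar i a)) =
     de i (xvar i a) (xvar 0 b)"
proof -
  let ?u = "xvar i a" and ?v = "xvar 0 b"
  have i': "i \<le> m" "2 \<le> i" "i \<noteq> 0" "m > 2" using i by auto
  have c: "q3 ^ (i - 1) / (q2 * kap i) = mn (2 * int m - 1 - int i) (int i)"
    "q3 ^ (i - 2) / (q1 * kap i) = mn (1 - int i) (int i - 2)"
    "q3 ^ i / (q3 * kap i) = q3 ^ (i - 1) / kap i"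
    using i' by (simp_all add: mn_q1 mn_q2 mn_q3 mn_kap q3_pow mn_simps of_nat_diff)
  have q: "cst q1 * (cst q2 * (cst q3 * x)) = x" for x
    using q1_q2_q3 by (simp add: mult.assoc[symmetric] flip: cst_mult)
  have cancel: "k2 * (e / a) * (k1 * (f / g)) * (k * (k3 * (a / h))) = k1 * (k2 * (k3 * (k * (e * f) / (h * g))))"
    if "a \<noteq> 0" for a e f g h k k1 k2 k3 :: ratfun
    using that by (simp add: mult_ac)
  show ?thesis
    unfolding ww_scale'[OF kap_neq_0 qs_neq_0(1)] ww_scale'[OF kap_neq_0 qs_neq_0(2)]
      ww_scale'[OF kap_neq_0 qs_neq_0(3)] c eps_m[OF i'(4)] de_mid[OF i]
    by (subst cancel[OF lfz_neq_0[OF i'(3)]]) (simp only: q)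
qed

text \<open>
  This identity fixes the normalisation of \<open>B\<close> and \<open>C\<close>.
\<close>

lemma nB_d: "nB * d ^ 2 = eps m d ^ 2" "nB * d ^ m = eps m d ^ m"
  using nz m by (auto simp: nB_def eps_def)

text \<open>
  The two copies of \<open>y\<^sub>1\<close> meet the chain of \<open>z\<close> at its two ends. Each copy alone leaves factors that cancel
  only against those of the other copy.
\<close>

lemma yz_ends:
  fixes a b :: nat
  defines "u \<equiv> xvar 1 a" and "z \<equiv> xvar 0 b"
  shows "(ww q2 (cst (kap 1) * u) z * ww q1 (cst (kap 1) * u) (cst q3 * z) *
          (cst (eps m d) * ww q3 (cst (kap 1) * u) (cst (q3 ^ (m - 1)) * z))) *
     (ww q2 u (cst (q3 ^ (m - 1)) * z) * ww q1 u z * (cst (eps m d) * ww q3 u (cst (q3 ^ (m - 2)) * z))) =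
     de 1 u z"
proof -
  have k1: "1 / kap 1 = q1" "c / kap 1 = c * q1" for c
    using qs_neq_0 by (simp_all only: kap_1) (simp_all add: field_simps)
  have q12: "q2 * q1 = inverse q3"
    using q1_q2_q3 qs_neq_0 by (simp add: field_simps)
  have c: "q2 * 1 / kap 1 = inverse q3" "q1 * q3 / kap 1 = q1^2 * q3" "q3 / kap 1 = q1 * q3"
    "q3 * q3 ^ (m - 1) / kap 1 = q1 * q3 ^ m" "q3 ^ (m - 1) / kap 1 = q1 * q3 ^ (m - 1)"
    unfolding k1 using q12 m power_Suc[of q3 "m - 1"]
    by (simp_all add: power2_eq_square mult_ac del: power_Suc)
  have c': "q2 * q3 ^ (m - 1) = inverse q1 * q3 ^ (m - 2)" "q3 * q3 ^ (m - 2) = q3 ^ (m - 1)"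
    using m by (simp_all add: mn_q1 mn_q2 mn_q3 q3_pow mn_simps of_nat_diff)
  have s1: "ww p (cst (kap 1) * u) z = (u - cst (p * 1 / kap 1) * z) / (u - cst (1 / kap 1) * z)" for p
    using ww_scale[OF kap_neq_0[of 1], of p u 1 z] by simp
  have sm: "ww p u (cst \<beta> * z) = (u - cst (p * \<beta>) * z) / (u - cst \<beta> * z)" for p \<beta>
    using ww_scale[of 1 p u \<beta> z] by simp
  have nl: "u - cst c * z \<noteq> 0" for c
    unfolding u_def z_def by (intro lf_neq_0) simp
  have nl1: "u - z \<noteq> 0"
    unfolding u_def z_def by (intro lf_neq_0) simp
  have w1: "ww q1 u z = (u - cst q1 * z) / (u - z)"
    by (simp add: ww_def)
  have cancel: "(e1 / x * (e2 / f2) * (k * (e3 / f3))) * (e4 / y * (x / f5) * (k * (y / f6))) =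
      k^2 * (e2 * e1 / (f2 * f5) * (e4 * e3 / (f6 * f3)))"
    if "x \<noteq> 0" "y \<noteq> 0" for x y e1 e2 e3 e4 f2 f3 f5 f6 k :: ratfun
    using that by (simp add: power2_eq_square mult_ac)
  have k: "cst nB * (cst (d^2) * A / B * (C / D)) = cst (eps m d)^2 * (A / B * (C / D))" for A B C D
    using nB_d(1) by (simp flip: cst_power cst_mult mult.assoc) 
  show ?thesis
    unfolding s1 ww_scale[OF kap_neq_0] sm w1 c c' k1(1) de_def if_P[OF refl] k
    by (rule cancel) (rule nl)+
qed

lemma zy_ends:
  fixes a b :: nat
  defines "u \<equiv> xvar 1 a" and "z \<equiv> xvar 0 b"
  shows "(ww q2 z (cst (kap 1) * u) * ww q1 (cst (q3 ^ (m - 1)) * z) (cst (kap 1) * u) *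
          (cst (eps m d) * ww q3 (cst q3 * z) (cst (kap 1) * u))) *
     (ww q2 (cst (q3 ^ (m - 1)) * z) u * ww q1 (cst (q3 ^ (m - 2)) * z) u * (cst (eps m d) * ww q3 z u)) =
     de 1 u z"
proof -
  have k1: "1 / kap 1 = q1" "c / (p * kap 1) = c * q1 / p" "c / kap 1 = c * q1" for c p
    using qs_neq_0 by (simp_all only: kap_1) (simp_all add: field_simps)
  have c: "1 / (q2 * kap 1) = q1^2 * q3" "q3 ^ (m - 1) / (q1 * kap 1) = q3 ^ (m - 1)"
    "q3 / (q3 * kap 1) = q1" "q3 / kap 1 = q1 * q3" "q3 ^ (m - 1) / kap 1 = q1 * q3 ^ (m - 1)"
    using qs_neq_0 m unfolding k1 by (simp_all add: mn_q1 mn_q2 mn_q3 mn_simps mult.commute)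
  have c': "q3 ^ (m - 1) / (q2 * 1) = q1 * q3 ^ m" "q3 ^ (m - 2) / (q1 * 1) = inverse q1 * q3 ^ (m - 2)"
    "1 / (q3 * 1) = inverse q3"
    using m by (simp_all add: mn_q1 mn_q2 mn_q3 q3_pow mn_simps of_nat_diff divide_inverse)
  have s1: "ww p z (cst (kap 1) * u) = cst p * ((u - cst (1 / (p * kap 1)) * z) / (u - cst (1 / kap 1) * z))"
    if "p \<noteq> 0" for p
    using ww_scale'[OF kap_neq_0[of 1] that, of 1 z u] by simp
  have sm: "ww p (cst \<beta> * z) u = cst p * ((u - cst (\<beta> / (p * 1)) * z) / (u - cst (\<beta> / 1) * z))" if "p \<noteq> 0" for p \<beta>
    using ww_scale'[of 1 p \<beta> z u] that by simp
  have sm1: "ww q3 z u = cst q3 * ((u - cst (1 / (q3 * 1)) * z) / (u - z))"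
    using ww_scale'[of 1 q3 1 z u] qs_neq_0 by simp
  have nl: "u - cst c * z \<noteq> 0" for c
    unfolding u_def z_def by (intro lf_neq_0) simp
  have cancel: "(k2 * (e1 / x) * (k1 * (y / f2)) * (k * (k3 * (x / f3)))) *
        (k2 * (e4 / y) * (k1 * (e5 / f5)) * (k * (k3 * (e6 / f6)))) =
      (k1 * k2 * k3)^2 * (k^2 * (e1 * e6 / (f3 * f6) * (e5 * e4 / (f5 * f2))))"
    if "x \<noteq> 0" "y \<noteq> 0" for x y e1 e4 e5 e6 f2 f3 f5 f6 k k1 k2 k3 :: ratfun
    using that by (simp add: power2_eq_square mult_ac)
  have q: "(cst q1 * cst q2 * cst q3)^2 * x = x" for x
    using q1_q2_q3 by (simp flip: cst_mult)
  have k: "cst nB * (cst (d^2) * A / B * (C / D)) = cst (eps m d)^2 * (A / B * (C / D))" for A B C D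
    using nB_d(1) by (simp flip: cst_power cst_mult mult.assoc)
  show ?thesis
    unfolding s1[OF qs_neq_0(2)] ww_scale'[OF kap_neq_0 qs_neq_0(1)] ww_scale'[OF kap_neq_0 qs_neq_0(3)]
      sm[OF qs_neq_0(2)] sm[OF qs_neq_0(1)] sm1 c c' k1(1) de_def if_P[OF refl] k div_by_1
    by (subst cancel[OF nl nl]) (simp only: q)
qed

text \<open>
  Two variables \<open>y\<^sub>1\<close> meet in colour \<open>m\<close> directly, and the copy in colour \<open>m\<close> of each of them meets the copy in
  colour \<open>1\<close> of the other one.
\<close>

lemma yy_top:
  assumes "a \<noteq> b"
  shows "ww q2 (xvar 1 a) (xvar 1 b) * ww q1 (xvar 1 a) (cst (kap 1) * xvar 1 b) *
      (cst (eps m d) * ww q3 (cst (kap 1) * xvar 1 a) (xvar 1 b)) =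
      cst (eps m d / (nA * d)) * al (xvar 1 a) (xvar 1 b)"
proof -
  let ?u = "xvar 1 a" and ?v = "xvar 1 b"
  have nl: "?u - cst c * ?v \<noteq> 0" for c
    using assms by (intro lf_neq_0) simp
  have nl1: "?u - ?v \<noteq> 0"
    using assms by (intro lf_neq_0) simp
  have w2: "ww q2 ?u ?v = (?u - cst q2 * ?v) / (?u - ?v)"
    by (simp add: ww_def)
  have w1: "ww q1 ?u (cst (kap 1) * ?v) = (?u - ?v) / (?u - cst (inverse q1) * ?v)"
    using ww_scale[of 1 q1 ?u "kap 1" ?v] qs_neq_0 kap_1 by simp
  have "1 / kap 1 = q1" "q3 / kap 1 = inverse q2"
    using q1_q2_q3 qs_neq_0 by (simp_all only: kap_1) (simp_all add: field_simps)
  hence w3: "ww q3 (cst (kap 1) * ?u) ?v = (?u - cst (inverse q2) * ?v) / (?u - cst q1 * ?v)"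
    using ww_scale[OF kap_neq_0[of 1], of q3 ?u 1 ?v] by simp
  have cancel: "e / x * (x / y) * (k * (f / g)) = k' * (n * (dd * (e * f) / (g * y)))"
    if "x \<noteq> 0" "k = k' * n * dd" for e x y k f g k' n dd :: ratfun
    using that by (simp add: mult_ac)
  have "cst (eps m d) = cst (eps m d / (nA * d)) * cst nA * cst d"
    using nA_neq_0 nz by (simp flip: cst_mult)
  thus ?thesis
    unfolding w2 w1 w3 al_def by (rule cancel[OF nl1])
qed

lemma yy_low1:
  assumes i: "i \<in> {1..m - 1}"
  shows "ww q1 (cst (kap i) * u) (cst (kap (i + 1)) * v) * (u - v) = ww (mn (int m) 0) u v * be u v * (u - v)"
proof -
  have c: "q1 * kap (i + 1) / kap i = mn (int m) 0" "kap (i + 1) / kap i = t"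
    using kap_Suc[OF i] by (simp_all add: mn_q1 mn_t mn_simps flip: times_divide_eq_right)
  show ?thesis
    unfolding ww_scale[OF kap_neq_0] c by (simp add: ww_def be_def)
qed

subsection \<open>The factors of the product for disjoint sets of labels\<close>

text \<open>
  The products of all \<open>\<omega>\<close> in the form of \<open>omega_prod\<close>: \<open>OmX\<close> for the specialised variables of the source, \<open>OmY\<close>
  and \<open>OmZ\<close> for the variables of the two target algebras.
\<close>

definition OmX :: "nat \<Rightarrow> (nat \<Rightarrow> nat set) \<Rightarrow> (nat \<Rightarrow> nat set) \<Rightarrow> ratfun" where
  "OmX L I J = (\<Prod>i\<in>{1..m}. PP (I i) (J i) (\<lambda>a b. ww q2 (sg L i a) (sg L i b)) *
     PP (I i) (J (nxt m i)) (\<lambda>a b. ww q1 (sg L i a) (sg L (nxt m i) b)) *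
     PP (I (nxt m i)) (J i) (\<lambda>a b. cst (eps m d) * ww q3 (sg L (nxt m i) a) (sg L i b)))"

definition OmY :: "(nat \<Rightarrow> nat set) \<Rightarrow> (nat \<Rightarrow> nat set) \<Rightarrow> ratfun" where
  "OmY I J = (\<Prod>i\<in>{1..m - 1}. PP (I i) (J i) (\<lambda>a b. ww q2 (xvar i a) (xvar i b)) *
     PP (I i) (J (col (i + 1))) (\<lambda>a b. ww (mn (int m) 0) (xvar i a) (xvar (col (i + 1)) b)) *
     PP (I (col (i + 1))) (J i) (\<lambda>a b. cst (eps (m - 1) (d * t)) * ww (mn (- 1) 1) (xvar (col (i + 1)) a) (xvar i b)))"

definition OmZ :: "nat set \<Rightarrow> nat set \<Rightarrow> ratfun" where
  "OmZ A B = PP A B (\<lambda>a b. ww q2 (xvar 0 a) (xvar 0 b) *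
     ww (mn (int m - 1) (1 - int m)) (xvar 0 a) (xvar 0 b) * ww (q3 ^ m) (xvar 0 a) (xvar 0 b))"

text \<open>
  The scalar by which neighbouring \<open>y\<close> colours differ from the target. It arises \<open>m - 1\<close> times, and the
  normalisation of \<open>A\<close> is chosen such that it cancels.
\<close>

definition cY :: complex where
  "cY = eps m d * t / eps (m - 1) (d * t)"

lemma eps_neq_0: "c \<noteq> 0 \<Longrightarrow> eps n c \<noteq> 0"
  by (simp add: eps_def)

lemma cY_power: "cY ^ (m - 1) * (eps m d / (nA * d)) = 1"
proof -
  consider "m = 2" | "m = 3" | "m > 3" using m by linarith
  thus ?thesis
  proof cases
    case 1
    have "t = q1"
      using t_power 1 by simp
    have "cY ^ (m - 1) * (eps m d / (nA * d)) = t ^ (m - 1) * q / d"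
      unfolding cY_def eps_def nA_def using 1 by (simp add: field_simps)
    also have "\<dots> = q * q1 / d"
      unfolding t_power by simp
    finally show ?thesis
      using q_q1 nz by simp
  next
    case 2
    thus ?thesis
      unfolding cY_def eps_def nA_def using nz qs_neq_0 by (simp add: power2_eq_square)
  next
    case 3
    thus ?thesis
      unfolding cY_def eps_def nA_def using nz qs_neq_0 by simp
  qed
qed

lemma yy_low:
  assumes i: "i \<in> {1..m - 1}" and uv: "u \<noteq> v"
  shows "ww q1 (cst (kap i) * u) (cst (kap (i + 1)) * v) = ww (mn (int m) 0) u v * be u v"
proof -
  have "u - v \<noteq> 0" using uv by simp
  thus ?thesis
    using yy_low1[OF i, of u v] by (rule mult_right_cancel[THEN iffD1])
qed

lemma yy_low3:
  assumes i: "i \<in> {1..m - 1}" and uv: "u \<noteq> v"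
  shows "cst (eps m d) * ww q3 (cst (kap (i + 1)) * u) (cst (kap i) * v) =
     cst cY * ((cst (eps (m - 1) (d * t)) * ww (mn (- 1) 1) u v) * be v u)"
proof -
  have c: "q3 * kap i / kap (i + 1) = mn (- 1) 1" "kap i / kap (i + 1) = inverse t"
    using kap_Suc[OF i] kap_neq_0[of i] kap_neq_0[of "i + 1"] qs_neq_0
    by (simp_all add: mn_q3 mn_t mn_simps field_simps)
  have "v - cst t * u = - (cst t * (u - cst (inverse t) * v))"
    using qs_neq_0 by (simp add: right_diff_distrib mult.assoc[symmetric] flip: cst_mult)
  hence be: "cst t * be v u = (u - v) / (u - cst (inverse t) * v)"
    using qs_neq_0 by (simp add: be_def minus_divide_left[symmetric] flip: minus_divide_right) (metis minus_diff_eq minus_divide_left)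
  have cY: "cst cY * cst (eps (m - 1) (d * t)) = cst (eps m d) * cst t"
    using nz qs_neq_0 eps_neq_0[of "d * t" "m - 1"] by (simp add: cY_def flip: cst_mult)
  have "cst cY * ((cst (eps (m - 1) (d * t)) * ww (mn (- 1) 1) u v) * be v u) =
     (cst cY * cst (eps (m - 1) (d * t))) * (ww (mn (- 1) 1) u v * be v u)"
    by (simp only: mult_ac)
  also have "\<dots> = cst (eps m d) * (ww (mn (- 1) 1) u v * (cst t * be v u))"
    unfolding cY by (simp only: mult_ac)
  also have "ww (mn (- 1) 1) u v * (cst t * be v u) = (u - cst (mn (- 1) 1) * v) / (u - cst (inverse t) * v)"
    unfolding be ww_def using uv by simp
  finally show ?thesis
    unfolding ww_scale[OF kap_neq_0] c by simp
qed

lemma col_nxt: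
  assumes "i \<in> {1..m - 1}"
  shows "nxt m i = i + 1" "col i = i" "nxt (m - 1) i = col (i + 1)"
  using assms m by (auto simp: nxt_def)

lemma prod_upto_m: "(\<Prod>i\<in>{1..m}. g i) = g m * (\<Prod>i\<in>{1..m - 1}. (g i :: ratfun))"
  unfolding upto_m using m by (subst prod.insert) auto

definition Yr :: "nat \<Rightarrow> nat \<Rightarrow> ratfun" where "Yr i a = cst (kap i) * xvar (col i) a"

definition Zr :: "nat \<Rightarrow> nat \<Rightarrow> ratfun" where "Zr i b = cst (q3 ^ (i - 1)) * xvar 0 b"

definition Xbe :: "(nat \<Rightarrow> nat set) \<Rightarrow> (nat \<Rightarrow> nat set) \<Rightarrow> nat \<Rightarrow> ratfun" where
  "Xbe I J i = PP (I i) (J (col (i + 1))) (\<lambda>a b. be (xvar i a) (xvar (col (i + 1)) b))"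

text \<open>
  Between neighbouring colours \<open>i, i + 1 \<le> m\<close> the ratio \<open>\<kappa>\<^sub>i\<^sub>+\<^sub>1 / \<kappa>\<^sub>i = t\<close> turns the parameters \<open>q\<^sub>1, q\<^sub>3\<close> into those of
  the target, at the cost of moving the pole; \<open>be\<close> moves it back. The step from colour \<open>m\<close> to colour \<open>1\<close> does
  not exist in the target and gives \<open>al\<close>.
\<close>

lemma omega_yy:
  assumes disj: "\<And>i. i \<in> {1..m - 1} \<Longrightarrow> I i \<inter> J i = {}"
    and cardI: "\<And>i. i \<in> {1..m - 1} \<Longrightarrow> card (I i) = M" and cardJ: "\<And>i. i \<in> {1..m - 1} \<Longrightarrow> card (J i) = N"
  shows "(\<Prod>i\<in>{1..m}. PP (I (col i)) (J (col i)) (\<lambda>a b. ww q2 (Yr i a) (Yr i b)) *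
     PP (I (col i)) (J (col (nxt m i))) (\<lambda>a b. ww q1 (Yr i a) (Yr (nxt m i) b)) *
     PP (I (col (nxt m i))) (J (col i)) (\<lambda>a b. cst (eps m d) * ww q3 (Yr (nxt m i) a) (Yr i b))) =
     OmY I J * (PP (I 1) (J 1) (\<lambda>a b. al (xvar 1 a) (xvar 1 b)) * (\<Prod>i\<in>{1..m - 1}. Xbe I J i * Xbe J I i))"
  (is "(\<Prod>i\<in>{1..m}. ?T i) = _")
proof -
  let ?e = "eps m d / (nA * d)"
  let ?O = "\<lambda>i. PP (I i) (J i) (\<lambda>a b. ww q2 (xvar i a) (xvar i b)) *
     PP (I i) (J (col (i + 1))) (\<lambda>a b. ww (mn (int m) 0) (xvar i a) (xvar (col (i + 1)) b)) *
     PP (I (col (i + 1))) (J i) (\<lambda>a b. cst (eps (m - 1) (d * t)) * ww (mn (- 1) 1) (xvar (col (i + 1)) a) (xvar i b))"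
  have one: "1 \<in> {1..m - 1}" "col 1 = 1" "col m = 1" "nxt m m = 1"
    using m by (auto simp: nxt_def)
  have neq: "xvar i a \<noteq> xvar j b" if "(i, a) \<noteq> (j, b)" for i j a b
    using lf_neq_0(3)[OF that] by simp
  have Ym: "Yr m a = xvar 1 a" "Yr 1 a = cst (kap 1) * xvar 1 a" for a
    unfolding Yr_def one by (simp_all add: kap_m)
  have "?T m = PP (I 1) (J 1) (\<lambda>a b. cst ?e * al (xvar 1 a) (xvar 1 b))"
    unfolding one PP_mult Ym
  proof (rule PP_cong)
    fix a b assume "a \<in> I 1" "b \<in> J 1"
    hence "a \<noteq> b" using disj[OF one(1)] by auto
    thus "ww q2 (xvar 1 a) (xvar 1 b) * ww q1 (xvar 1 a) (cst (kap 1) * xvar 1 b) *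
         (cst (eps m d) * ww q3 (cst (kap 1) * xvar 1 a) (xvar 1 b)) = cst ?e * al (xvar 1 a) (xvar 1 b)"
      by (rule yy_top)
  qed
  also have "\<dots> = cst ?e ^ (M * N) * PP (I 1) (J 1) (\<lambda>a b. al (xvar 1 a) (xvar 1 b))"
    unfolding PP_mult[symmetric] PP_const cardI[OF one(1)] cardJ[OF one(1)] ..
  finally have top: "?T m = \<dots>" .
  have low: "?T i = cst cY ^ (M * N) * (?O i * (Xbe I J i * Xbe J I i))" if i: "i \<in> {1..m - 1}" for i
  proof -
    let ?c = "col (i + 1)"
    have c: "?c \<in> {1..m - 1}" "(i, a) \<noteq> (?c, b)" if "i = ?c \<Longrightarrow> a \<noteq> b" for a b
      using that i m by auto
    have c': "?c \<in> {1..m - 1}"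
      using i m by auto
    have ne: "xvar i a \<noteq> xvar ?c b" if "a \<in> I i \<and> b \<in> J ?c \<or> a \<in> J i \<and> b \<in> I ?c" for a b
      by (rule neq) (use that disj[OF i] in auto)
    have Y: "Yr i a = cst (kap i) * xvar i a" "Yr (i + 1) a = cst (kap (i + 1)) * xvar ?c a" for a
      unfolding Yr_def using col_nxt(2)[OF i] by simp_all
    have 2: "PP (I i) (J i) (\<lambda>a b. ww q2 (cst (kap i) * xvar i a) (cst (kap i) * xvar i b)) =
        PP (I i) (J i) (\<lambda>a b. ww q2 (xvar i a) (xvar i b))"
      by (intro PP_cong) (simp add: ww_scale kap_neq_0, simp add: ww_def)
    have 1: "PP (I i) (J ?c) (\<lambda>a b. ww q1 (cst (kap i) * xvar i a) (cst (kap (i + 1)) * xvar ?c b)) =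
        PP (I i) (J ?c) (\<lambda>a b. ww (mn (int m) 0) (xvar i a) (xvar ?c b) * be (xvar i a) (xvar ?c b))"
      by (intro PP_cong yy_low i ne) blast
    have 3: "PP (I ?c) (J i) (\<lambda>a b. cst (eps m d) * ww q3 (cst (kap (i + 1)) * xvar ?c a) (cst (kap i) * xvar i b)) =
        PP (I ?c) (J i) (\<lambda>a b. cst cY * ((cst (eps (m - 1) (d * t)) * ww (mn (- 1) 1) (xvar ?c a) (xvar i b)) *
           be (xvar i b) (xvar ?c a)))"
      by (intro PP_cong yy_low3 i ne[symmetric]) blast
    have 4: "PP (I ?c) (J i) (\<lambda>a b. be (xvar i b) (xvar ?c a)) = Xbe J I i"
      unfolding Xbe_def by (rule PP_swap)
    have "card (I ?c) * card (J i) = M * N"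
      using cardI[OF c'] cardJ[OF i] by simp
    thus ?thesis
      unfolding col_nxt(1,2)[OF i] Y
      unfolding 1 2 3
      unfolding PP_mult[symmetric] PP_const 4
      unfolding Xbe_def[of I J] by (simp only: mult_ac)
  qed
  have "(\<Prod>i\<in>{1..m}. ?T i) = ?T m * (\<Prod>i\<in>{1..m - 1}. ?T i)"
    by (rule prod_upto_m)
  also have "(\<Prod>i\<in>{1..m - 1}. ?T i) = (\<Prod>i\<in>{1..m - 1}. cst cY ^ (M * N) * (?O i * (Xbe I J i * Xbe J I i)))"
    by (intro prod.cong refl low)
  also have "\<dots> = (cst cY ^ (M * N)) ^ (m - 1) * (OmY I J * (\<Prod>i\<in>{1..m - 1}. Xbe I J i * Xbe J I i))"
    unfolding OmY_def by (simp add: prod.distrib)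
  also have "?T m * \<dots> = (cst cY ^ (M * N)) ^ (m - 1) * cst ?e ^ (M * N) * (OmY I J *
     (PP (I 1) (J 1) (\<lambda>a b. al (xvar 1 a) (xvar 1 b)) * (\<Prod>i\<in>{1..m - 1}. Xbe I J i * Xbe J I i)))"
    unfolding top by (simp only: mult_ac)
  also have "(cst cY ^ (M * N)) ^ (m - 1) * cst ?e ^ (M * N) = cst (cY ^ (m - 1) * ?e) ^ (M * N)"
    unfolding cst_mult cst_power power_mult_distrib power_mult[symmetric] by (simp only: mult.commute)
  also have "\<dots> = 1"
    unfolding cY_power by simp
  finally show ?thesis by simp
qed

lemma zz_low:
  assumes i: "i \<in> {1..m - 1}" and uv: "u \<noteq> v"
  shows "ww q2 (cst (q3 ^ (i - 1)) * u) (cst (q3 ^ (i - 1)) * v) *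
     ww q1 (cst (q3 ^ (i - 1)) * u) (cst (q3 ^ i) * v) *
     (cst (eps m d) * ww q3 (cst (q3 ^ i) * u) (cst (q3 ^ (i - 1)) * v)) =
     cst (eps m d) * ((u - cst q2 * v) * (u - cst (inverse q2) * v)) /
       ((u - cst q3 * v) * (u - cst (inverse q3) * v))"
proof -
  have p: "q3 ^ n \<noteq> 0" for n
    using qs_neq_0 by simp
  have i': "i - 1 + 1 = i" "q3 ^ i = q3 * q3 ^ (i - 1)"
    using i power_Suc[of q3 "i - 1"] by auto
  have q13: "q1 * q3 = inverse q2"
    using q1_q2_q3 qs_neq_0 by (simp add: field_simps)
  have c: "q2 * q3 ^ (i - 1) / q3 ^ (i - 1) = q2" "q3 ^ (i - 1) / q3 ^ (i - 1) = 1"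
    "q1 * q3 ^ i / q3 ^ (i - 1) = inverse q2" "q3 ^ i / q3 ^ (i - 1) = q3"
    "q3 * q3 ^ (i - 1) / q3 ^ i = 1" "q3 ^ (i - 1) / q3 ^ i = inverse q3"
    unfolding i' using p[of "i - 1"] qs_neq_0 q13
    by (simp_all add: inverse_eq_divide flip: mult.assoc)
  show ?thesis
    unfolding ww_scale[OF p] c using uv by simp
qed

lemma zz_top:
  assumes uv: "u \<noteq> v"
  shows "ww q2 (cst (q3 ^ (m - 1)) * u) (cst (q3 ^ (m - 1)) * v) *
     ww q1 (cst (q3 ^ (m - 1)) * u) v *
     (cst (eps m d) * ww q3 u (cst (q3 ^ (m - 1)) * v)) =
     ww q2 u v * ww (mn (int m - 1) (1 - int m)) u v * ww (q3 ^ m) u v *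
      (cst (eps m d) * (u - v)^2 / ((u - cst (q3 ^ (m - 1)) * v) * (u - cst (inverse (q3 ^ (m - 1))) * v)))"
proof -
  let ?Q = "q3 ^ (m - 1)"
  have p: "?Q \<noteq> 0"
    using qs_neq_0 by simp
  have c3: "q1 * 1 / ?Q = mn (int m - 1) (1 - int m)"
    unfolding mn_q1 q3_pow using m by (simp add: mn_simps of_nat_diff)
  have c: "q2 * ?Q / ?Q = q2" "?Q / ?Q = 1" "1 / ?Q = inverse ?Q" "q3 * ?Q / 1 = q3 ^ m" "?Q / 1 = ?Q"
    using p m power_Suc[of q3 "m - 1"] by (simp_all add: divide_inverse del: power_Suc)
  have s: "ww q1 (cst ?Q * u) v = (u - cst (q1 * 1 / ?Q) * v) / (u - cst (1 / ?Q) * v)"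
    "ww q3 u (cst ?Q * v) = (u - cst (q3 * ?Q / 1) * v) / (u - cst (?Q / 1) * v)"
    using ww_scale[OF p, of q1 u 1 v] ww_scale[of 1 q3 u ?Q v] by simp_all
  have cancel: "a / w * (b / e) * (k * (f / g)) = a / w * (b / w) * (f / w) * (k * w^2 / (g * e))"
    if "w \<noteq> 0" for a b e f g k w :: ratfun
    using that by (simp add: power2_eq_square mult_ac)
  have uv': "u - v \<noteq> 0" using uv by simp
  show ?thesis
    unfolding s ww_scale[OF p] c3 c cst_1 mult_1_left
    unfolding ww_def by (rule cancel[OF uv'])
qed

text \<open>
  Two chains meet in \<open>m - 1\<close> equal links, which give the power in \<open>ga\<close>, and where the end of one chain meets
  the start of the other; this link carries the parameters of the target with one colour.
\<close>

lemma omega_zz: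
  assumes disj: "I \<inter> J = {}"
  shows "(\<Prod>i\<in>{1..m}. PP I J (\<lambda>a b. ww q2 (Zr i a) (Zr i b)) *
     PP I J (\<lambda>a b. ww q1 (Zr i a) (Zr (nxt m i) b)) *
     PP I J (\<lambda>a b. cst (eps m d) * ww q3 (Zr (nxt m i) a) (Zr i b))) =
     OmZ I J * PP I J (\<lambda>a b. ga (xvar 0 a) (xvar 0 b))"
  (is "(\<Prod>i\<in>{1..m}. ?T i) = _")
proof -
  let ?g = "\<lambda>u v. cst (eps m d) * ((u - cst q2 * v) * (u - cst (inverse q2) * v)) /
       ((u - cst q3 * v) * (u - cst (inverse q3) * v))"
  let ?h = "\<lambda>u v. ww q2 u v * ww (mn (int m - 1) (1 - int m)) u v * ww (q3 ^ m) u v *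
      (cst (eps m d) * (u - v)^2 / ((u - cst (q3 ^ (m - 1)) * v) * (u - cst (inverse (q3 ^ (m - 1))) * v)))"
  have ne: "xvar 0 a \<noteq> xvar 0 b" if "a \<in> I" "b \<in> J" for a b
    using that disj lf_neq_0(3)[of 0 a 0 b] by auto
  have n: "nxt m m = 1" "Zr 1 a = xvar 0 a" for a
    by (simp_all add: nxt_def Zr_def)
  have top: "?T m = PP I J (\<lambda>a b. ?h (xvar 0 a) (xvar 0 b))"
    unfolding PP_mult n Zr_def[of m] by (intro PP_cong zz_top ne)
  have low: "?T i = PP I J (\<lambda>a b. ?g (xvar 0 a) (xvar 0 b))" if i: "i \<in> {1..m - 1}" for i
  proof -
    have Z: "Zr (i + 1) a = cst (q3 ^ i) * xvar 0 a" for a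
      by (simp add: Zr_def)
    show ?thesis
      unfolding PP_mult col_nxt(1)[OF i] Z Zr_def[of i] by (intro PP_cong zz_low[OF i] ne)
  qed
  have c: "cst nB * (cst d ^ (m - 1) * cst d) = cst (eps m d) ^ (m - 1) * cst (eps m d)"
    using nB_d(2) m by (simp flip: cst_power cst_mult power_Suc2)
  have gh: "?h u v * ?g u v ^ (m - 1) =
     ww q2 u v * ww (mn (int m - 1) (1 - int m)) u v * ww (q3 ^ m) u v * ga u v" for u v
  proof -
    have alg: "W * (e * s / D) * (e * A / B) ^ n = W * (b * ((k * A / B) ^ n * (k * s / D)))"
      if "b * (k ^ n * k) = e ^ n * e" for W e s D A B b k :: ratfun and n
    proof -
      have "b * ((k * A / B) ^ n * (k * s / D)) = (b * (k ^ n * k)) * ((A / B) ^ n * (s / D))"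
        by (simp add: power_mult_distrib power_divide mult_ac)
      also have "\<dots> = (e * s / D) * (e * A / B) ^ n"
        unfolding that by (simp add: power_mult_distrib power_divide mult_ac)
      finally show ?thesis by (simp only: mult.assoc)
    qed
    show ?thesis
      unfolding ga_def by (rule alg[OF c])
  qed
  have "(\<Prod>i\<in>{1..m}. ?T i) = ?T m * (\<Prod>i\<in>{1..m - 1}. ?T i)"
    by (rule prod_upto_m)
  also have "(\<Prod>i\<in>{1..m - 1}. ?T i) = (\<Prod>i\<in>{1..m - 1}. PP I J (\<lambda>a b. ?g (xvar 0 a) (xvar 0 b)))"
    by (intro prod.cong refl low)
  also have "\<dots> = PP I J (\<lambda>a b. ?g (xvar 0 a) (xvar 0 b) ^ (m - 1))"
    unfolding PP_def by (simp only: prod_power_distrib prod_constant card_atLeastAtMost) simp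
  finally show ?thesis
    unfolding top
    unfolding OmZ_def PP_mult gh .
qed

lemma prv_cases:
  assumes "i \<in> {2..m - 1}"
  shows "prv m i = i - 1" "nxt m i = i + 1" "col i = i"
  using assms by (auto simp: prv_def nxt_def)

lemma prod_de:
  fixes T :: "nat \<Rightarrow> ratfun"
  assumes "T 1 * T m = D 1" "\<And>i. i \<in> {2..m - 1} \<Longrightarrow> T i = D i"
  shows "(\<Prod>i\<in>{1..m}. T i) = (\<Prod>i\<in>{1..m - 1}. D i)"
  unfolding split_upto_m upto_m1 using assms by simp

lemma ends: "prv m 1 = m" "nxt m 1 = 2" "col 1 = 1" "col m = 1" "prv m m = m - 1" "nxt m m = 1"
  using m by (auto simp: prv_def nxt_def)

lemma Zr_ends: "Zr 1 b = xvar 0 b" "Zr 2 b = cst q3 * xvar 0 b" "Zr (m - 1) b = cst (q3 ^ (m - 2)) * xvar 0 b"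
  using m by (simp_all add: Zr_def numeral_2_eq_2)

lemma omega_yz:
  "(\<Prod>i\<in>{1..m}. PP (I (col i)) J (\<lambda>a b. ww q2 (Yr i a) (Zr i b)) *
     PP (I (col i)) J (\<lambda>a b. ww q1 (Yr i a) (Zr (nxt m i) b)) *
     PP (I (col (nxt m i))) J (\<lambda>a b. cst (eps m d) * ww q3 (Yr (nxt m i) a) (Zr i b))) =
     (\<Prod>i\<in>{1..m - 1}. PP (I i) J (\<lambda>a b. de i (xvar i a) (xvar 0 b)))"
proof -
  let ?W = "\<lambda>i j. PP (I (col i)) J (\<lambda>a b. cst (eps m d) * ww q3 (Yr i a) (Zr j b))"
  let ?V = "\<lambda>i. PP (I (col i)) J (\<lambda>a b. ww q2 (Yr i a) (Zr i b)) *
     PP (I (col i)) J (\<lambda>a b. ww q1 (Yr i a) (Zr (nxt m i) b))"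
  have "(\<Prod>i\<in>{1..m}. ?V i * ?W (nxt m i) i) = (\<Prod>i\<in>{1..m}. ?V i * ?W i (prv m i))"
    unfolding prod.distrib using prod_nxt[of ?W] by simp
  also have "\<dots> = (\<Prod>i\<in>{1..m - 1}. PP (I i) J (\<lambda>a b. de i (xvar i a) (xvar 0 b)))"
  proof (rule prod_de)
    show "?V 1 * ?W 1 (prv m 1) * (?V m * ?W m (prv m m)) = PP (I 1) J (\<lambda>a b. de 1 (xvar 1 a) (xvar 0 b))"
      unfolding ends PP_mult Zr_ends unfolding Zr_def[of m] Yr_def ends kap_m
      by (intro PP_cong) (simp only: cst_1 mult_1_left yz_ends)
    show "?V i * ?W i (prv m i) = PP (I i) J (\<lambda>a b. de i (xvar i a) (xvar 0 b))" if i: "i \<in> {2..m - 1}" for i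
    proof -
      have "i - 1 - 1 = i - 2" by simp
      thus ?thesis
        unfolding prv_cases[OF i] PP_mult Yr_def Zr_def
        by (intro PP_cong) (simp only: prv_cases[OF i] yz_mid[OF i] add_diff_cancel_right')
    qed
  qed
  finally show ?thesis .
qed

lemma omega_zy:
  "(\<Prod>i\<in>{1..m}. PP I (J (col i)) (\<lambda>b a. ww q2 (Zr i b) (Yr i a)) *
     PP I (J (col (nxt m i))) (\<lambda>b a. ww q1 (Zr i b) (Yr (nxt m i) a)) *
     PP I (J (col i)) (\<lambda>b a. cst (eps m d) * ww q3 (Zr (nxt m i) b) (Yr i a))) =
     (\<Prod>i\<in>{1..m - 1}. PP (J i) I (\<lambda>a b. de i (xvar i a) (xvar 0 b)))"
proof -
  let ?W = "\<lambda>i j. PP I (J (col i)) (\<lambda>b a. ww q1 (Zr j b) (Yr i a))"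
  let ?V = "\<lambda>i. PP I (J (col i)) (\<lambda>b a. ww q2 (Zr i b) (Yr i a))"
  let ?U = "\<lambda>i. PP I (J (col i)) (\<lambda>b a. cst (eps m d) * ww q3 (Zr (nxt m i) b) (Yr i a))"
  have "(\<Prod>i\<in>{1..m}. ?V i * ?W (nxt m i) i * ?U i) = (\<Prod>i\<in>{1..m}. ?V i * ?W i (prv m i) * ?U i)"
    unfolding prod.distrib using prod_nxt[of ?W] by simp
  also have "\<dots> = (\<Prod>i\<in>{1..m - 1}. PP (J i) I (\<lambda>a b. de i (xvar i a) (xvar 0 b)))"
  proof (rule prod_de)
    show "?V 1 * ?W 1 (prv m 1) * ?U 1 * (?V m * ?W m (prv m m) * ?U m) =
        PP (J 1) I (\<lambda>a b. de 1 (xvar 1 a) (xvar 0 b))"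
      unfolding ends PP_mult Zr_ends PP_swap[of "J 1"] unfolding Zr_def[of m] Yr_def ends kap_m
      by (intro PP_cong) (simp only: cst_1 mult_1_left zy_ends)
    show "?V i * ?W i (prv m i) * ?U i = PP (J i) I (\<lambda>a b. de i (xvar i a) (xvar 0 b))"
      if i: "i \<in> {2..m - 1}" for i
    proof -
      have "i - 1 - 1 = i - 2" by simp
      thus ?thesis
        unfolding prv_cases[OF i] PP_mult Yr_def Zr_def PP_swap[of "J i"]
        by (intro PP_cong) (simp only: prv_cases[OF i] zy_mid[OF i] add_diff_cancel_right')
    qed
  qed
  finally show ?thesis .
qed

end

lemma has_subst_PP:
  assumes "\<And>a b. a \<in> A \<Longrightarrow> b \<in> B \<Longrightarrow> has_subst s (f a b) (g a b)"
  shows "has_subst s (PP A B f) (PP A B g)"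
  unfolding PP_def using assms by (intro has_subst_prod)

lemma prod_distrib4:
  "(\<Prod>i\<in>S. f i * g i * h i * k i) =
   (\<Prod>i\<in>S. f i) * (\<Prod>i\<in>S. g i) * (\<Prod>i\<in>S. h i) * (\<Prod>i\<in>S. (k i :: 'a :: comm_monoid_mult))"
  by (simp only: prod.distrib)

context shuffle_setup
begin

lemma yy_pairs_union:
  assumes i: "i \<in> {1..m - 1}"
    and fin: "\<And>i. i \<in> {1..m - 1} \<Longrightarrow> finite (I i) \<and> finite (J i)"
    and disj: "\<And>i. i \<in> {1..m - 1} \<Longrightarrow> I i \<inter> J i = {}"
  shows "(\<Prod>(a, b)\<in>yy_pairs (\<lambda>i. I i \<union> J i) i. be (xvar i a) (xvar (col (i + 1)) b)) =
    (\<Prod>(a, b)\<in>yy_pairs I i. be (xvar i a) (xvar (col (i + 1)) b)) *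
    (\<Prod>(a, b)\<in>yy_pairs J i. be (xvar i a) (xvar (col (i + 1)) b)) * (Xbe I J i * Xbe J I i)"
proof -
  define c where "c = col (i + 1)"
  have c: "c \<in> {1..m - 1}" "m = 2 \<Longrightarrow> c = i"
    using i m by (auto simp: c_def)
  let ?g = "\<lambda>(a, b). be (xvar i a) (xvar c b)"
  have eq: "yy_pairs (\<lambda>i. I i \<union> J i) i = (yy_pairs I i \<union> yy_pairs J i) \<union> (I i \<times> J c \<union> J i \<times> I c)"
    unfolding yy_pairs_def c_def[symmetric] using c(2) disj[OF i] disj[OF c(1)] by auto
  have f: "finite (yy_pairs I i)" "finite (yy_pairs J i)"
    unfolding yy_pairs_def c_def[symmetric] using fin[OF i] fin[OF c(1)]
    by (auto intro: finite_subset[of _ "I i \<times> I c"] finite_subset[of _ "J i \<times> J c"])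
  have f': "finite (I i \<times> J c)" "finite (J i \<times> I c)"
    using fin[OF i] fin[OF c(1)] by auto
  have d: "yy_pairs I i \<inter> yy_pairs J i = {}" "(I i \<times> J c) \<inter> (J i \<times> I c) = {}"
    "(yy_pairs I i \<union> yy_pairs J i) \<inter> (I i \<times> J c \<union> J i \<times> I c) = {}"
    using disj[OF i] disj[OF c(1)] unfolding yy_pairs_def c_def[symmetric] by auto
  have "(\<Prod>x\<in>yy_pairs (\<lambda>i. I i \<union> J i) i. ?g x) =
      (\<Prod>x\<in>yy_pairs I i. ?g x) * (\<Prod>x\<in>yy_pairs J i. ?g x) *
      ((\<Prod>x\<in>I i \<times> J c. ?g x) * (\<Prod>x\<in>J i \<times> I c. ?g x))"
    unfolding eq using f f' d by (simp add: prod.union_disjoint)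
  thus ?thesis
    unfolding Xbe_def PP_def c_def[symmetric] by (simp add: prod.cartesian_product)
qed

text \<open>
  The part of \<open>A B C\<close> for a union of two disjoint sets of labels that involves labels of both sets.
\<close>

definition DenX :: "(nat \<Rightarrow> nat set) \<Rightarrow> (nat \<Rightarrow> nat set) \<Rightarrow> nat set \<Rightarrow> nat set \<Rightarrow> ratfun" where
  "DenX I J A B = PP (I 1) (J 1) (\<lambda>a b. al (xvar 1 a) (xvar 1 b)) * (\<Prod>i\<in>{1..m - 1}. Xbe I J i * Xbe J I i) *
     PP A B (\<lambda>a b. ga (xvar 0 a) (xvar 0 b)) *
     (\<Prod>i\<in>{1..m - 1}. PP (I i) B (\<lambda>a b. de i (xvar i a) (xvar 0 b))) *
     (\<Prod>i\<in>{1..m - 1}. PP (J i) A (\<lambda>a b. de i (xvar i a) (xvar 0 b)))"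

lemma DenS_union:
  assumes fin: "\<And>i. i \<in> {1..m - 1} \<Longrightarrow> finite (I i) \<and> finite (J i)" "finite A" "finite B"
    and disj: "\<And>i. i \<in> {1..m - 1} \<Longrightarrow> I i \<inter> J i = {}" "A \<inter> B = {}"
  shows "DenS (\<lambda>i. I i \<union> J i) (A \<union> B) = DenS I A * DenS J B * DenX I J A B"
proof -
  have one: "1 \<in> {1..m - 1}"
    using m by auto
  let ?y = "\<lambda>I. \<Prod>i\<in>{1..m - 1}. \<Prod>(a, b)\<in>yy_pairs I i. be (xvar i a) (xvar (col (i + 1)) b)"
  have al: "ppr (I 1 \<union> J 1) (\<lambda>a b. al (xvar 1 a) (xvar 1 b)) = ppr (I 1) (\<lambda>a b. al (xvar 1 a) (xvar 1 b)) *
     ppr (J 1) (\<lambda>a b. al (xvar 1 a) (xvar 1 b)) * PP (I 1) (J 1) (\<lambda>a b. al (xvar 1 a) (xvar 1 b))"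
    using fin(1)[OF one] disj(1)[OF one] by (intro ppr_union al_sym) auto
  have ga: "ppr (A \<union> B) (\<lambda>a b. ga (xvar 0 a) (xvar 0 b)) = ppr A (\<lambda>a b. ga (xvar 0 a) (xvar 0 b)) *
     ppr B (\<lambda>a b. ga (xvar 0 a) (xvar 0 b)) * PP A B (\<lambda>a b. ga (xvar 0 a) (xvar 0 b))"
    using fin disj by (intro ppr_union ga_sym)
  have be: "?y (\<lambda>i. I i \<union> J i) = ?y I * ?y J * (\<Prod>i\<in>{1..m - 1}. Xbe I J i * Xbe J I i)"
    unfolding prod.distrib[symmetric]
    by (rule prod.cong[OF refl], rule yy_pairs_union[OF _ fin(1) disj(1)])
  have de: "(\<Prod>i\<in>{1..m - 1}. PP (I i \<union> J i) (A \<union> B) (\<lambda>a b. de i (xvar i a) (xvar 0 b))) =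
     (\<Prod>i\<in>{1..m - 1}. PP (I i) A (\<lambda>a b. de i (xvar i a) (xvar 0 b))) *
     (\<Prod>i\<in>{1..m - 1}. PP (J i) B (\<lambda>a b. de i (xvar i a) (xvar 0 b))) *
     ((\<Prod>i\<in>{1..m - 1}. PP (I i) B (\<lambda>a b. de i (xvar i a) (xvar 0 b))) *
     (\<Prod>i\<in>{1..m - 1}. PP (J i) A (\<lambda>a b. de i (xvar i a) (xvar 0 b))))"
    unfolding prod.distrib[symmetric]
  proof (intro prod.cong refl)
    fix i assume i: "i \<in> {1..m - 1}"
    show "PP (I i \<union> J i) (A \<union> B) (\<lambda>a b. de i (xvar i a) (xvar 0 b)) =
      PP (I i) A (\<lambda>a b. de i (xvar i a) (xvar 0 b)) * PP (J i) B (\<lambda>a b. de i (xvar i a) (xvar 0 b)) *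
      (PP (I i) B (\<lambda>a b. de i (xvar i a) (xvar 0 b)) * PP (J i) A (\<lambda>a b. de i (xvar i a) (xvar 0 b)))"
      unfolding PP_def using fin(1)[OF i] fin(2,3) disj(1)[OF i] disj(2)
      by (simp add: prod.union_disjoint prod.distrib mult_ac)
  qed
  show ?thesis
    unfolding DenS_def DenX_def PP_def[symmetric] al ga be de by (simp only: mult_ac)
qed

lemma PP_split:
  assumes A: "A \<subseteq> {1..L}" "B \<subseteq> {1..L}" and A': "A' \<subseteq> {1..K}" "B' \<subseteq> {1..K}"
  shows "PP (A \<union> shift L A') (B \<union> shift L B') (\<lambda>a b. h (sg L i a) (sg L j b)) =
     PP A B (\<lambda>a b. h (Yr i a) (Yr j b)) * PP A B' (\<lambda>a b. h (Yr i a) (Zr j b)) *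
     PP A' B (\<lambda>a b. h (Zr i a) (Yr j b)) * PP A' B' (\<lambda>a b. h (Zr i a) (Zr j b))"
proof -
  have fin: "finite A" "finite A'" "finite B" "finite B'"
    using A A' finite_subset by blast+
  have disj: "C \<inter> shift L C' = {}" if "C \<subseteq> {1..L}" "C' \<subseteq> {1..K}" for C C'
    using that by (force simp: shift_def)
  have Y: "sg L k a = Yr k a" if "a \<in> {1..L}" for k a
    using that by (simp add: sg_y Yr_def)
  have Z: "sg L k (b + L) = Zr k b" if "b \<in> {1..K}" for k b
    using that by (simp add: sg_z Zr_def)
  show ?thesis
    unfolding PP_union_shift[OF fin disj[OF A(1) A'(1)] disj[OF A(2) A'(2)]]
    using A A' by (intro arg_cong2[where f = "(*)"] PP_cong) (simp_all add: Y Z subset_iff)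
qed

text \<open>
  The heart of multiplicativity, for a single distribution of the variables.
\<close>

lemma OmX_DenX:
  assumes I: "\<And>i. i \<in> {1..m - 1} \<Longrightarrow> I i \<subseteq> {1..L} \<and> card (I i) = M"
    and J: "\<And>i. i \<in> {1..m - 1} \<Longrightarrow> J i \<subseteq> {1..L} \<and> card (J i) = N"
    and disj: "\<And>i. i \<in> {1..m - 1} \<Longrightarrow> I i \<inter> J i = {}"
    and AB: "A \<subseteq> {1..K}" "B \<subseteq> {1..K}" "A \<inter> B = {}"
  shows "OmX L (\<lambda>i. I (col i) \<union> shift L A) (\<lambda>i. J (col i) \<union> shift L B) = OmY I J * OmZ A B * DenX I J A B"
proof -
  have col: "col i \<in> {1..m - 1}" if "i \<in> {1..m}" for i
    using that m by auto
  have sub: "I (col i) \<subseteq> {1..L}" "J (col i) \<subseteq> {1..L}" if "i \<in> {1..m}" for i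
    using I[OF col[OF that]] J[OF col[OF that]] by auto
  have nx: "nxt m i \<in> {1..m}" if "i \<in> {1..m}" for i
    using nxt_range[OF that] .
  let ?YY = "\<lambda>i. PP (I (col i)) (J (col i)) (\<lambda>a b. ww q2 (Yr i a) (Yr i b)) *
     PP (I (col i)) (J (col (nxt m i))) (\<lambda>a b. ww q1 (Yr i a) (Yr (nxt m i) b)) *
     PP (I (col (nxt m i))) (J (col i)) (\<lambda>a b. cst (eps m d) * ww q3 (Yr (nxt m i) a) (Yr i b))"
  let ?YZ = "\<lambda>i. PP (I (col i)) B (\<lambda>a b. ww q2 (Yr i a) (Zr i b)) *
     PP (I (col i)) B (\<lambda>a b. ww q1 (Yr i a) (Zr (nxt m i) b)) *
     PP (I (col (nxt m i))) B (\<lambda>a b. cst (eps m d) * ww q3 (Yr (nxt m i) a) (Zr i b))"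
  let ?ZY = "\<lambda>i. PP A (J (col i)) (\<lambda>b a. ww q2 (Zr i b) (Yr i a)) *
     PP A (J (col (nxt m i))) (\<lambda>b a. ww q1 (Zr i b) (Yr (nxt m i) a)) *
     PP A (J (col i)) (\<lambda>b a. cst (eps m d) * ww q3 (Zr (nxt m i) b) (Yr i a))"
  let ?ZZ = "\<lambda>i. PP A B (\<lambda>a b. ww q2 (Zr i a) (Zr i b)) *
     PP A B (\<lambda>a b. ww q1 (Zr i a) (Zr (nxt m i) b)) *
     PP A B (\<lambda>a b. cst (eps m d) * ww q3 (Zr (nxt m i) a) (Zr i b))"
  have "OmX L (\<lambda>i. I (col i) \<union> shift L A) (\<lambda>i. J (col i) \<union> shift L B) =
     (\<Prod>i\<in>{1..m}. ?YY i * ?YZ i * ?ZY i * ?ZZ i)"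
    unfolding OmX_def
  proof (intro prod.cong refl)
    fix i assume i: "i \<in> {1..m}"
    note s = sub[OF i] sub[OF nx[OF i]]
    show "PP (I (col i) \<union> shift L A) (J (col i) \<union> shift L B) (\<lambda>a b. ww q2 (sg L i a) (sg L i b)) *
        PP (I (col i) \<union> shift L A) (J (col (nxt m i)) \<union> shift L B) (\<lambda>a b. ww q1 (sg L i a) (sg L (nxt m i) b)) *
        PP (I (col (nxt m i)) \<union> shift L A) (J (col i) \<union> shift L B)
          (\<lambda>a b. cst (eps m d) * ww q3 (sg L (nxt m i) a) (sg L i b)) = ?YY i * ?YZ i * ?ZY i * ?ZZ i"
      unfolding PP_split[OF s(1,2) AB(1,2), of "ww q2" i i] PP_split[OF s(1,4) AB(1,2), of "ww q1" i "nxt m i"]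
        PP_split[OF s(3,2) AB(1,2), of "\<lambda>x y. cst (eps m d) * ww q3 x y" "nxt m i" i]
      by (simp only: mult_ac)
  qed
  also have "\<dots> = (\<Prod>i\<in>{1..m}. ?YY i) * (\<Prod>i\<in>{1..m}. ?YZ i) * (\<Prod>i\<in>{1..m}. ?ZY i) * (\<Prod>i\<in>{1..m}. ?ZZ i)"
    by (rule prod_distrib4)
  also have "(\<Prod>i\<in>{1..m}. ?YY i) = OmY I J * (PP (I 1) (J 1) (\<lambda>a b. al (xvar 1 a) (xvar 1 b)) *
      (\<Prod>i\<in>{1..m - 1}. Xbe I J i * Xbe J I i))"
    by (rule omega_yy[where M = M and N = N]) (use I J disj in blast)+
  also note omega_yz
  also note omega_zy
  also note omega_zz[OF AB(3)]
  finally show ?thesis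
    unfolding DenX_def by (simp only: mult_ac)
qed

lemma DenS_neq_0:
  assumes fin: "\<And>i. i \<in> {1..m - 1} \<Longrightarrow> finite (I i)" "finite A"
  shows "DenS I A \<noteq> 0"
proof -
  have al: "al (xvar 1 a) (xvar 1 b) \<noteq> 0" if "a < b" for a b
    using that nA_neq_0 nz lf_neq_0(2)[of 1 a 1 b] by (simp add: al_def)
  have ga: "ga (xvar 0 a) (xvar 0 b) \<noteq> 0" if "a < b" for a b
    using that nB_neq_0 nz lf_neq_0(2,3)[of 0 a 0 b] by (simp add: ga_def)
  have de: "de i (xvar i a) (xvar 0 b) \<noteq> 0" if "i \<in> {1..m - 1}" for i a b
    using that nB_neq_0 nz kap_neq_0[of i] lf_neq_0(2,3)[of i a 0 b] lf_neq_0(1)[of "kap i" _ i a 0 b]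
    by (auto simp: de_def)
  have be: "be (xvar i a) (xvar (col (i + 1)) b) \<noteq> 0"
    if "i \<in> {1..m - 1}" "(a, b) \<in> yy_pairs I i" for i a b
  proof -
    have "(i, a) \<noteq> (col (i + 1), b)"
      using that m by (auto simp: yy_pairs_def split: if_splits)
    thus ?thesis
      using lf_neq_0(2,3)[of i a "col (i + 1)" b] by (simp only: be_def divide_eq_0_iff) blast
  qed
  have f: "finite (yy_pairs I i)" if i: "i \<in> {1..m - 1}" for i
  proof -
    have "col (i + 1) \<in> {1..m - 1}"
      using i m by auto
    thus ?thesis
      using fin(1)[OF i] fin(1)[of "col (i + 1)"]
      by (auto simp: yy_pairs_def intro: finite_subset[of _ "I i \<times> I (col (i + 1))"])
  qed
  have one: "1 \<in> {1..m - 1}"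
    using m by auto
  have "ppr (I 1) (\<lambda>a b. al (xvar 1 a) (xvar 1 b)) \<noteq> 0"
    using al finite_ordered_pairs[OF fin(1)[OF one]] by (auto simp: ppr_def prod_zero_iff)
  moreover have "ppr A (\<lambda>a b. ga (xvar 0 a) (xvar 0 b)) \<noteq> 0"
    using ga finite_ordered_pairs[OF fin(2)] by (auto simp: ppr_def prod_zero_iff)
  moreover have "(\<Prod>i\<in>{1..m - 1}. \<Prod>(a, b)\<in>yy_pairs I i. be (xvar i a) (xvar (col (i + 1)) b)) \<noteq> 0"
  proof -
    have "(\<Prod>x\<in>yy_pairs I i. case x of (a, b) \<Rightarrow> be (xvar i a) (xvar (col (i + 1)) b)) \<noteq> 0"
      if i: "i \<in> {1..m - 1}" for i
      unfolding prod_zero_iff[OF f[OF i]] using be[OF i] by fastforce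
    thus ?thesis
      unfolding prod_zero_iff[OF finite_atLeastAtMost] by blast
  qed
  moreover have "(\<Prod>i\<in>{1..m - 1}. \<Prod>a\<in>I i. \<Prod>b\<in>A. de i (xvar i a) (xvar 0 b)) \<noteq> 0"
    using de fin by (auto simp: prod_zero_iff simp del: One_nat_def)
  ultimately show ?thesis
    unfolding DenS_def by simp
qed

lemma sg_inj:
  assumes "(i, a) \<noteq> (j, b)" "i \<in> {1..m}" "j \<in> {1..m}" "a \<ge> 1" "b \<ge> 1"
  shows "sg L i a \<noteq> sg L j b"
proof
  assume "sg L i a = sg L j b"
  hence eq: "rvar L i a = rvar L j b" "rco L i a = rco L j b"
    unfolding sg_def using linear_form_eq_iff[of "rco L i a" "rco L j b"] rco_neq_0 by auto
  have rel: "a \<le> L \<longleftrightarrow> b \<le> L"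
    using eq(1) assms(2,3) m by (auto simp: rvar_def split: if_splits)
  hence ab: "a = b"
    using eq(1) assms(2,3) m by (auto simp: rvar_def split: if_splits)
  show False
  proof (cases "a \<le> L")
    case True
    hence "kap i = kap j"
      using eq(2) ab by (simp add: rco_def)
    thus False
      using assms ab by (simp add: mn_kap mn_simps)
  next
    case False
    hence "q3 ^ (i - 1) = q3 ^ (j - 1)"
      using eq(2) ab by (simp add: rco_def)
    thus False
      using assms ab by (auto simp: q3_pow mn_simps)
  qed
qed

lemma has_subst_OmX:
  assumes I: "\<And>i. i \<in> {1..m} \<Longrightarrow> I i \<subseteq> {1..N} \<and> J i \<subseteq> {1..N} \<and> I i \<inter> J i = {}"
  shows "has_subst (sg L)
     (\<Prod>i\<in>{1..m}. \<Prod>j\<in>{1..m}. \<Prod>a\<in>I i. \<Prod>b\<in>J j. omega m (q, q1, q2, q3) i j (xvar i a) (xvar j b)) (OmX L I J)"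
proof -
  have n: "m \<ge> 1" using m by simp
  have "q * q1 = d"
    using q_q1 .
  hence eq: "(\<Prod>i\<in>{1..m}. \<Prod>j\<in>{1..m}. \<Prod>a\<in>I i. \<Prod>b\<in>J j. omega m (q, q1, q2, q3) i j (xvar i a) (xvar j b)) =
     (\<Prod>i\<in>{1..m}. PP (I i) (J i) (\<lambda>a b. ww q2 (xvar i a) (xvar i b)) *
       PP (I i) (J (nxt m i)) (\<lambda>a b. ww q1 (xvar i a) (xvar (nxt m i) b)) *
       PP (I (nxt m i)) (J i) (\<lambda>a b. cst (eps m d) * ww q3 (xvar (nxt m i) a) (xvar i b)))"
    unfolding omega_prod[OF n, where x = xvar] wprod_PP by (simp only: PP_def)
  have ne: "sg L i a \<noteq> sg L j b" if "i \<in> {1..m}" "j \<in> {1..m}" "a \<in> I i" "b \<in> J j" "i = j \<or> j = nxt m i \<or> i = nxt m j"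
    for i j a b
  proof (rule sg_inj)
    show "(i, a) \<noteq> (j, b)"
      using that I[OF that(1)] by auto
  qed (use that I[OF that(1)] I[OF that(2)] in \<open>auto simp: subset_iff\<close>)
  show ?thesis
    unfolding eq OmX_def
    by (intro has_subst_prod has_subst_mult has_subst_PP has_subst_ww has_subst_xvar has_subst_cst ne)
       (blast intro: nxt_range)+
qed

lemma omega_target:
  "(\<Prod>i\<in>{1..m - 1}. \<Prod>j\<in>{1..m - 1}. \<Prod>a\<in>I i. \<Prod>b\<in>J j.
      omega (m - 1) (q, q1 * t, q2, mn (- 1) 1) i j (xvar i a) (xvar j b)) = OmY I J"
proof -
  have n: "m - 1 \<ge> 1" using m by simp
  have c: "q * (q1 * t) = d * t" "q1 * t = mn (int m) 0"
    using q_q1 by (simp flip: mult.assoc, simp add: mn_q1 mn_t mn_simps)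
  show ?thesis
    unfolding omega_prod[OF n, where x = xvar] wprod_PP OmY_def c(1)
    unfolding c(2)
    by (intro prod.cong refl) (simp only: col_nxt(3) PP_def)
qed

lemma has_subst_OmZ:
  assumes "A 1 \<inter> B 1 = {}"
  shows "has_subst z0 (\<Prod>i\<in>{1..1}. \<Prod>j\<in>{1..1}. \<Prod>a\<in>A i. \<Prod>b\<in>B j.
      omega 1 (q', mn (int m - 1) (1 - int m), q2, q3 ^ m) i j (xvar i a) (xvar j b)) (OmZ (A 1) (B 1))"
proof -
  let ?p = "mn (int m - 1) (1 - int m)"
  have o: "omega 1 (q', ?p, q2, q3 ^ m) 1 1 u v = ww q2 u v * ww ?p u v * ww (q3 ^ m) u v" for u v
    by (simp add: ww_def power3_eq_cube)
  have eq: "(\<Prod>i\<in>{1..1}. \<Prod>j\<in>{1..1}. \<Prod>a\<in>A i. \<Prod>b\<in>B j.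
      omega 1 (q', ?p, q2, q3 ^ m) i j (xvar i a) (xvar j b)) =
      PP (A 1) (B 1) (\<lambda>a b. ww q2 (xvar 1 a) (xvar 1 b) * ww ?p (xvar 1 a) (xvar 1 b) * ww (q3 ^ m) (xvar 1 a) (xvar 1 b))"
    unfolding o[symmetric] by (simp add: PP_def del: omega.simps)
  have x: "has_subst z0 (xvar 1 a) (xvar 0 a)" for a
    using has_subst_xvar[of z0 1 a] by (simp add: z0_def)
  show ?thesis
    unfolding eq OmZ_def
    by (intro has_subst_PP has_subst_mult has_subst_ww x) (use assms in auto)
qed

end

subsection \<open>Substitution in elements of a shuffle algebra\<close>

definition Sh_den :: "nat \<Rightarrow> nat \<Rightarrow> (nat \<Rightarrow> nat \<Rightarrow> ratfun) \<Rightarrow> ratfun" where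
  "Sh_den n N s = (if n = 1 then ppr {1..N} (\<lambda>a b. (s 1 a - s 1 b)^2)
     else (\<Prod>i\<in>{1..n}. \<Prod>a\<in>{1..N}. \<Prod>b\<in>{1..N}. (s i a - s (nxt n i) b)))"

lemma Sh_numerator_gen:
  assumes "F \<in> Sh n P (\<lambda>_. N)"
  obtains f where "f \<in> lp (degree_vars n (\<lambda>_. N))" "F = f / Sh_den n N xvar"
proof (cases "n = 1")
  case True
  thus ?thesis
    using assms that by (auto simp: Sh_def poles_def Sh_den_def ppr_def lp_eq_laurent_polys)
next
  case False
  thus ?thesis
    using assms that by (auto simp: Sh_def poles_def Sh_den_def lp_eq_laurent_polys)
qed

text \<open>
  Under these substitutions the denominators of the elements of a shuffle algebra stay nonzero.
\<close>

definition sep :: "nat \<Rightarrow> nat \<Rightarrow> (nat \<Rightarrow> nat \<Rightarrow> ratfun) \<Rightarrow> bool" where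
  "sep n N s \<longleftrightarrow> inj_on (case_prod s) (degree_vars n (\<lambda>_. N)) \<and> (\<forall>(i, a)\<in>degree_vars n (\<lambda>_. N). s i a \<noteq> 0)"

lemma sepI:
  assumes inj: "\<And>i a j b. (i, a) \<in> degree_vars n (\<lambda>_. N) \<Longrightarrow> (j, b) \<in> degree_vars n (\<lambda>_. N) \<Longrightarrow>
      s i a = s j b \<Longrightarrow> i = j \<and> a = b"
    and nz: "\<And>i a. (i, a) \<in> degree_vars n (\<lambda>_. N) \<Longrightarrow> s i a \<noteq> 0"
  shows "sep n N s"
  unfolding sep_def
proof (intro conjI inj_onI ballI)
  fix x y assume xy: "x \<in> degree_vars n (\<lambda>_. N)" "y \<in> degree_vars n (\<lambda>_. N)" "case_prod s x = case_prod s y"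
  obtain i a j b where e: "x = (i, a)" "y = (j, b)"
    by (cases x, cases y)
  show "x = y"
    using inj[of i a j b] xy unfolding e by simp
next
  fix x assume "x \<in> degree_vars n (\<lambda>_. N)"
  thus "case x of (i, a) \<Rightarrow> s i a \<noteq> 0"
    using nz by (cases x) simp
qed

lemma sep_neq:
  assumes "sep n N s" "(i, a) \<in> degree_vars n (\<lambda>_. N)" "(j, b) \<in> degree_vars n (\<lambda>_. N)" "(i, a) \<noteq> (j, b)"
  shows "s i a \<noteq> s j b"
  using assms inj_onD[of "case_prod s" "degree_vars n (\<lambda>_. N)" "(i, a)" "(j, b)"] by (auto simp: sep_def)

lemma Sh_den_neq_0:
  assumes n: "n \<ge> 1" and s: "sep n N s"
  shows "Sh_den n N s \<noteq> 0"
proof (cases "n = 1")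
  case True
  have "s 1 a \<noteq> s 1 b" if "a \<in> {1..N}" "b \<in> {1..N}" "a \<noteq> b" for a b
    using sep_neq[OF s, of 1 a 1 b] that True by (simp add: degree_vars_def)
  from ppr_sq_subst(2)[of N s 1, OF this] show ?thesis
    using True by (simp add: Sh_den_def)
next
  case False
  hence "n \<ge> 2" using n by simp
  from cyc_den_subst_neq_0[OF this, of N s] show ?thesis
    using False s unfolding sep_def inj_on_def Sh_den_def by (simp only: if_False) blast
qed

lemma has_subst_Sh_den:
  assumes "\<And>i a. (i, a) \<in> degree_vars n (\<lambda>_. N) \<Longrightarrow> has_subst s (t i a) (u i a)"
  shows "has_subst s (Sh_den n N t) (Sh_den n N u)"
proof (cases "n = 1")
  case True
  show ?thesis
    unfolding Sh_den_def if_P[OF True] ppr_def using True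
    by (intro has_subst_prod) (auto simp: degree_vars_def intro!: has_subst_power has_subst_diff assms)
next
  case False
  show ?thesis
    unfolding Sh_den_def if_not_P[OF False]
    by (intro has_subst_prod has_subst_diff assms) (auto simp: degree_vars_def nxt_def)
qed

lemma Sh_subst_eq:
  assumes n: "n \<ge> 1" and f: "f \<in> lp (degree_vars n (\<lambda>_. N))" "F = f / Sh_den n N xvar" and s: "sep n N s"
  shows "has_subst s F (subst s f / Sh_den n N s)"
  unfolding f(2)
proof (rule has_subst_divide)
  show "has_subst s f (subst s f)"
    using s by (intro lp_has_subst[OF f(1)]) (auto simp: sep_def)
  show "has_subst s (Sh_den n N xvar) (Sh_den n N s)"
    by (intro has_subst_Sh_den has_subst_xvar)
  show "Sh_den n N s \<noteq> 0"
    by (rule Sh_den_neq_0[OF n s])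
qed

lemma Sh_has_subst:
  assumes n: "n \<ge> 1" and F: "F \<in> Sh n P (\<lambda>_. N)" and s: "sep n N s"
  shows "has_subst s F (subst s F)"
  using Sh_numerator_gen[OF F] Sh_subst_eq[OF n _ _ s] has_subst_subst by metis

text \<open>
  The numerator is a Laurent polynomial, for which composition is unproblematic, so only the
  denominators have to be controlled.
\<close>

lemma Sh_subst_comp:
  assumes n: "n \<ge> 1" and F: "F \<in> Sh n P (\<lambda>_. N)" and t: "sep n N t" and u: "sep n N u"
    and s: "\<And>i a. (i, a) \<in> degree_vars n (\<lambda>_. N) \<Longrightarrow> has_subst s (t i a) (u i a)"
  shows "has_subst s (subst t F) (subst u F)"
proof -
  obtain f where f: "f \<in> lp (degree_vars n (\<lambda>_. N))" "F = f / Sh_den n N xvar"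
    using Sh_numerator_gen[OF F] .
  have eq: "subst t F = subst t f / Sh_den n N t" "subst u F = subst u f / Sh_den n N u"
    using Sh_subst_eq[OF n f] t u has_subst_imp_subst by blast+
  show ?thesis
    unfolding eq
  proof (rule has_subst_divide)
    show "has_subst s (subst t f) (subst u f)"
      using t u s by (intro lp_subst_comp(1)[OF f(1)]) (auto simp: sep_def)
    show "has_subst s (Sh_den n N t) (Sh_den n N u)"
      by (intro has_subst_Sh_den s)
    show "Sh_den n N u \<noteq> 0"
      by (rule Sh_den_neq_0[OF n u])
  qed
qed

lemma sep_cong:
  assumes "sep n N s" "\<And>i a. (i, a) \<in> degree_vars n (\<lambda>_. N) \<Longrightarrow> t i a = s i a"
  shows "sep n N t"
proof -
  have eq: "case_prod t x = case_prod s x" if "x \<in> degree_vars n (\<lambda>_. N)" for x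
    using assms(2)[of "fst x" "snd x"] that by (simp add: case_prod_beta)
  show ?thesis
    using assms inj_on_cong[OF eq, where A = "degree_vars n (\<lambda>_. N)"] by (auto simp: sep_def)
qed

lemma Sh_subst_cong:
  assumes n: "n \<ge> 1" and F: "F \<in> Sh n P (\<lambda>_. N)" and s: "sep n N s"
    and eq: "\<And>i a. (i, a) \<in> degree_vars n (\<lambda>_. N) \<Longrightarrow> t i a = s i a"
  shows "subst t F = subst s F"
proof -
  have t: "sep n N t"
    by (rule sep_cong[OF s eq])
  obtain f where f: "f \<in> lp (degree_vars n (\<lambda>_. N))" "F = f / Sh_den n N xvar"
    using Sh_numerator_gen[OF F] .
  have "has_subst t F (subst t f / Sh_den n N t)" "has_subst s F (subst s f / Sh_den n N s)"
    using Sh_subst_eq[OF n f] s t by blast+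
  moreover have "subst t f = subst s f"
    using t eq by (intro lp_subst_cong[OF f(1)]) (auto simp: sep_def)
  moreover have "Sh_den n N t = Sh_den n N s"
    using has_subst_Sh_den[of n N xvar t t] has_subst_Sh_den[of n N xvar t s] eq has_subst_xvar[of xvar]
      has_subst_unique[of xvar]
    by (metis (no_types, lifting) has_subst_Sh_den has_subst_unique has_subst_xvar)
  ultimately show ?thesis
    using has_subst_imp_subst by metis
qed

subsection \<open>Selecting labels\<close>

definition slt :: "(nat \<Rightarrow> nat set) \<Rightarrow> nat \<Rightarrow> nat \<Rightarrow> nat" where
  "slt I i a = sorted_list_of_set (I i) ! (a - 1)"

lemma select_eq: "select I F = subst (ren (slt I)) F"
  by (simp add: select_def ren_def[abs_def] slt_def)

lemma slt_bij:
  assumes "finite (I i)" "card (I i) = N"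
  shows "bij_betw (slt I i) {1..N} (I i)"
  using sorted_list_nth_bij[OF assms(1)] assms(2) by (simp add: slt_def[abs_def])

lemma sep_slt:
  assumes "\<And>i. i \<in> {1..n} \<Longrightarrow> finite (I i) \<and> card (I i) = N"
  shows "sep n N (ren (slt I))"
proof -
  have inj: "inj_on (slt I i) {1..N}" if "i \<in> {1..n}" for i
    using slt_bij[of I i N] assms[OF that] by (simp add: bij_betw_def)
  show ?thesis
  proof (rule sepI)
    fix i a j b
    assume "(i, a) \<in> degree_vars n (\<lambda>_. N)" "(j, b) \<in> degree_vars n (\<lambda>_. N)" "ren (slt I) i a = ren (slt I) j b"
    thus "i = j \<and> a = b"
      using inj_onD[OF inj[of i], of a b] by (auto simp: ren_def degree_vars_def)
  qed (simp add: ren_def)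
qed

text \<open>\<open>with0 A I\<close> gives colour \<open>0\<close>, the colour of the \<open>z\<close> variables, the labels \<open>A\<close>.\<close>

definition with0 :: "nat set \<Rightarrow> (nat \<Rightarrow> nat set) \<Rightarrow> nat \<Rightarrow> nat set" where
  "with0 A I = (\<lambda>i. if i = 0 then A else I i)"

context shuffle_setup
begin

lemma has_subst_tens:
  assumes F: "F \<in> Sh (m - 1) P (\<lambda>_. L)" and G: "G \<in> Sh 1 P' (\<lambda>_. K)"
    and I: "\<And>i. i \<in> {1..m - 1} \<Longrightarrow> finite (I i) \<and> card (I i) = L"
    and A: "finite (A 1)" "card (A 1) = K"
  obtains u where "has_subst (ren (slt (with0 (A 1) I))) (tens F G) (select I F * u)"
    "has_subst z0 (select A G) u"
proof -
  let ?r = "slt (with0 (A 1) I)" and ?u = "\<lambda>i b. xvar 0 (slt A 1 b)"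
  have m1: "m - 1 \<ge> 1" using m by simp
  have I': "finite (with0 (A 1) I i) \<and> card (with0 (A 1) I i) = L" if "i \<in> {1..m - 1}" for i
    using I[OF that] that by (simp add: with0_def)
  have "has_subst (ren ?r) F (subst (ren ?r) F)"
    by (rule Sh_has_subst[OF m1 F sep_slt[OF I']])
  moreover have "subst (ren ?r) F = select I F"
    unfolding select_eq
  proof (rule Sh_subst_cong[OF m1 F sep_slt[OF I]])
    fix i a assume "(i, a) \<in> degree_vars (m - 1) (\<lambda>_. L)"
    thus "ren ?r i a = ren (slt I) i a"
      by (auto simp: degree_vars_def ren_def with0_def slt_def)
  qed
  ultimately have 1: "has_subst (ren ?r) F (select I F)"
    by simp
  have inj: "inj_on (slt A 1) {1..K}"
    using slt_bij[of A 1 K] A by (simp add: bij_betw_def)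
  have sep: "sep 1 K z0" "sep 1 K ?u" "sep 1 K (ren (slt A))"
    by (intro sepI; use inj in \<open>auto simp: ren_def degree_vars_def z0_def dest: inj_onD\<close>)+
  have 2: "has_subst (ren ?r) (subst z0 G) (subst ?u G)"
  proof (rule Sh_subst_comp[OF order_refl G sep(1,2)])
    fix i a
    show "has_subst (ren ?r) (z0 i a) (xvar 0 (slt A 1 a))"
      using has_subst_ren[of ?r 0 a] by (simp add: z0_def slt_def with0_def)
  qed
  have 3: "has_subst z0 (select A G) (subst ?u G)"
    unfolding select_eq
  proof (rule Sh_subst_comp[OF order_refl G sep(3,2)])
    fix i a assume "(i, a) \<in> degree_vars 1 (\<lambda>_. K)"
    hence "i = 1" by (simp add: degree_vars_def)
    thus "has_subst z0 (ren (slt A) i a) (xvar 0 (slt A 1 a))"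
      using has_subst_xvar[of z0 1] by (simp add: ren_def z0_def)
  qed
  have "has_subst (ren ?r) (tens F G) (select I F * subst ?u G)"
    using has_subst_mult[OF 1 2] by (simp add: tens_def z0_def)
  thus ?thesis
    using that 3 by blast
qed

subsection \<open>The product of the target\<close>

abbreviation (input) pY :: params where "pY \<equiv> (q, q1 * t, q2, mn (- 1) 1)"

abbreviation (input) pZ :: params where "pZ \<equiv> (q, mn (int m - 1) (1 - int m), q2, q3 ^ m)"

text \<open>
  The index set of \<^const>\<open>sh_mult\<close> in degrees \<open>(M, \<dots>, M)\<close> out of \<open>(N, \<dots>, N)\<close>; \<open>cpl\<close> gives the labels of the second
  factor.
\<close>

definition lab :: "nat \<Rightarrow> nat \<Rightarrow> nat \<Rightarrow> (nat \<Rightarrow> nat set) set" where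
  "lab n N M = (\<Pi>\<^sub>E i\<in>{1..n}. {A. A \<subseteq> {1..N} \<and> card A = M})"

definition cpl :: "nat \<Rightarrow> (nat \<Rightarrow> nat set) \<Rightarrow> nat \<Rightarrow> nat set" where
  "cpl N I = (\<lambda>i. {1..N} - I i)"

text \<open>
  The product of the tensor product as a sum over pairs of distributions of the \<open>y\<close> and of the \<open>z\<close>. It
  depends only on the two functions and not on their presentations as sums of tensors, which is why
  \<^const>\<open>tens_mult\<close> is well defined.
\<close>

definition target_mult :: "nat \<Rightarrow> nat \<Rightarrow> nat \<Rightarrow> nat \<Rightarrow> ratfun \<Rightarrow> ratfun \<Rightarrow> ratfun" where
  "target_mult L K L' K' f g = (\<Sum>I\<in>lab (m - 1) (L + L') L. \<Sum>A\<in>lab 1 (K + K') K.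
     subst (ren (slt (with0 (A 1) I))) f * subst (ren (slt (with0 (cpl (K + K') A 1) (cpl (L + L') I)))) g *
     (OmY I (cpl (L + L') I) * OmZ (A 1) (cpl (K + K') A 1)))"

lemma lab_D:
  assumes "I \<in> lab n (L + L') L" "i \<in> {1..n}"
  shows "I i \<subseteq> {1..L + L'}" "finite (I i) \<and> card (I i) = L"
    "finite (cpl (L + L') I i) \<and> card (cpl (L + L') I i) = L'" "I i \<inter> cpl (L + L') I i = {}"
    "I i \<union> cpl (L + L') I i = {1..L + L'}" "cpl (L + L') I i \<subseteq> {1..L + L'}"
proof -
  show I: "I i \<subseteq> {1..L + L'}" "finite (I i) \<and> card (I i) = L"
    using PiE_mem[OF assms[unfolded lab_def]] finite_subset[of "I i" "{1..L + L'}"] by auto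
  thus "finite (cpl (L + L') I i) \<and> card (cpl (L + L') I i) = L'" "I i \<union> cpl (L + L') I i = {1..L + L'}"
    "I i \<inter> cpl (L + L') I i = {}" "cpl (L + L') I i \<subseteq> {1..L + L'}"
    unfolding cpl_def by (simp_all add: card_Diff_subset) blast+
qed

lemma finite_lab: "finite (lab n N M)"
  unfolding lab_def by (intro finite_PiE) auto

lemma sh_mult_lab:
  "sh_mult n P (\<lambda>_. L) (\<lambda>_. L') F G = (\<Sum>I\<in>lab n (L + L') L. select I F * select (cpl (L + L') I) G *
     (\<Prod>i\<in>{1..n}. \<Prod>j\<in>{1..n}. \<Prod>a\<in>I i. \<Prod>b\<in>cpl (L + L') I j. omega n P i j (xvar i a) (xvar j b)))"
  by (simp add: sh_mult_def lab_def cpl_def Let_def)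

lemma tens_sh_mult:
  assumes F: "F \<in> Sh (m - 1) pY (\<lambda>_. L)" and G: "G \<in> Sh 1 pZ (\<lambda>_. K)"
    and F': "F' \<in> Sh (m - 1) pY (\<lambda>_. L')" and G': "G' \<in> Sh 1 pZ (\<lambda>_. K')"
  shows "tens (sh_mult (m - 1) pY (\<lambda>_. L) (\<lambda>_. L') F F') (sh_mult 1 pZ (\<lambda>_. K) (\<lambda>_. K') G G') =
    target_mult L K L' K' (tens F G) (tens F' G')"
proof -
  define u where "u A = subst z0 (select A G)" for A
  define u' where "u' A = subst z0 (select (cpl (K + K') A) G')" for A
  have one: "1 \<in> {1..1::nat}" by simp
  have left: "subst (ren (slt (with0 (A 1) I))) (tens F G) = select I F * u A" "has_subst z0 (select A G) (u A)"
    if I: "I \<in> lab (m - 1) (L + L') L" and A: "A \<in> lab 1 (K + K') K" for I A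
  proof -
    have A': "finite (A 1)" "card (A 1) = K"
      using lab_D(2)[OF A one] by auto
    obtain v where "has_subst (ren (slt (with0 (A 1) I))) (tens F G) (select I F * v)" "has_subst z0 (select A G) v"
      using has_subst_tens[where I = I and A = A, OF F G lab_D(2)[OF I] A'] by blast
    thus "subst (ren (slt (with0 (A 1) I))) (tens F G) = select I F * u A" "has_subst z0 (select A G) (u A)"
      unfolding u_def using has_subst_imp_subst has_subst_subst by blast+
  qed
  have right: "subst (ren (slt (with0 (cpl (K + K') A 1) (cpl (L + L') I)))) (tens F' G') =
       select (cpl (L + L') I) F' * u' A" "has_subst z0 (select (cpl (K + K') A) G') (u' A)"
    if I: "I \<in> lab (m - 1) (L + L') L" and A: "A \<in> lab 1 (K + K') K" for I A
  proof -
    have A': "finite (cpl (K + K') A 1)" "card (cpl (K + K') A 1) = K'"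
      using lab_D(3)[OF A one] by auto
    obtain v where "has_subst (ren (slt (with0 (cpl (K + K') A 1) (cpl (L + L') I)))) (tens F' G')
        (select (cpl (L + L') I) F' * v)" "has_subst z0 (select (cpl (K + K') A) G') v"
      using has_subst_tens[where I = "cpl (L + L') I" and A = "cpl (K + K') A", OF F' G' lab_D(3)[OF I] A'] by blast
    thus "subst (ren (slt (with0 (cpl (K + K') A 1) (cpl (L + L') I)))) (tens F' G') =
       select (cpl (L + L') I) F' * u' A" "has_subst z0 (select (cpl (K + K') A) G') (u' A)"
      unfolding u'_def using has_subst_imp_subst has_subst_subst by blast+
  qed
  obtain I0 where I0: "I0 \<in> lab (m - 1) (L + L') L"
  proof
    show "restrict (\<lambda>_. {1..L}) {1..m - 1} \<in> lab (m - 1) (L + L') L"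
      by (auto simp: lab_def)
  qed
  have "has_subst z0 (sh_mult 1 pZ (\<lambda>_. K) (\<lambda>_. K') G G')
     (\<Sum>A\<in>lab 1 (K + K') K. u A * u' A * OmZ (A 1) (cpl (K + K') A 1))"
    unfolding sh_mult_lab
    by (intro has_subst_sum has_subst_mult left(2)[OF I0] right(2)[OF I0] has_subst_OmZ lab_D(4)[OF _ one])
  hence z: "subst z0 (sh_mult 1 pZ (\<lambda>_. K) (\<lambda>_. K') G G') =
     (\<Sum>A\<in>lab 1 (K + K') K. u A * u' A * OmZ (A 1) (cpl (K + K') A 1))"
    by (rule has_subst_imp_subst)
  have y: "sh_mult (m - 1) pY (\<lambda>_. L) (\<lambda>_. L') F F' =
     (\<Sum>I\<in>lab (m - 1) (L + L') L. select I F * select (cpl (L + L') I) F' * OmY I (cpl (L + L') I))"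
    unfolding sh_mult_lab omega_target ..
  have "tens (sh_mult (m - 1) pY (\<lambda>_. L) (\<lambda>_. L') F F') (sh_mult 1 pZ (\<lambda>_. K) (\<lambda>_. K') G G') =
    sh_mult (m - 1) pY (\<lambda>_. L) (\<lambda>_. L') F F' * subst z0 (sh_mult 1 pZ (\<lambda>_. K) (\<lambda>_. K') G G')"
    by (simp add: tens_def z0_def)
  also have "\<dots> = target_mult L K L' K' (tens F G) (tens F' G')"
    unfolding y z target_mult_def sum_product
  proof (intro sum.cong refl)
    fix I A assume "I \<in> lab (m - 1) (L + L') L" "A \<in> lab 1 (K + K') K"
    thus "select I F * select (cpl (L + L') I) F' * OmY I (cpl (L + L') I) *
         (u A * u' A * OmZ (A 1) (cpl (K + K') A 1)) =
       subst (ren (slt (with0 (A 1) I))) (tens F G) *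
       subst (ren (slt (with0 (cpl (K + K') A 1) (cpl (L + L') I)))) (tens F' G') *
       (OmY I (cpl (L + L') I) * OmZ (A 1) (cpl (K + K') A 1))"
      by (simp only: left(1) right(1) mult_ac)
  qed
  finally show ?thesis .
qed

end

lemma tens_sum_simps:
  "tens_sum [] = 0" "tens_sum ((F, G) # ps) = tens F G + tens_sum ps" "tens_sum (ps @ qs) = tens_sum ps + tens_sum qs"
  by (simp_all add: tens_sum_def)

lemma tens_sum_product:
  "tens_sum [(u F F', v G G'). (F, G) \<leftarrow> ps, (F', G') \<leftarrow> qs] =
   (\<Sum>(F, G)\<leftarrow>ps. \<Sum>(F', G')\<leftarrow>qs. tens (u F F') (v G G'))"
proof -
  have inner: "tens_sum [(u F F', v G G'). (F', G') \<leftarrow> qs] = (\<Sum>(F', G')\<leftarrow>qs. tens (u F F') (v G G'))" for F G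
    by (induction qs) (auto simp: tens_sum_simps)
  show ?thesis
    by (induction ps) (auto simp: tens_sum_simps inner)
qed

lemma sum_sum_list: "(\<Sum>i\<in>S. \<Sum>x\<leftarrow>xs. f i x) = (\<Sum>x\<leftarrow>xs. \<Sum>i\<in>S. (f i x :: 'a :: comm_monoid_add))"
  by (induction xs) (simp_all add: sum.distrib)

lemma sum_list_bilinear:
  "(\<Sum>x\<leftarrow>xs. u x) * (\<Sum>y\<leftarrow>ys. v y) * c = (\<Sum>x\<leftarrow>xs. \<Sum>y\<leftarrow>ys. u x * v y * (c :: 'a :: comm_semiring_0))"
  by (simp add: sum_list_const_mult sum_list_mult_const)

context shuffle_setup
begin

lemma has_subst_tens_sum:
  fixes A :: "nat \<Rightarrow> nat set"
  assumes ps: "set ps \<subseteq> Sh (m - 1) pY (\<lambda>_. L) \<times> Sh 1 pZ (\<lambda>_. K)"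
    and I: "\<And>i. i \<in> {1..m - 1} \<Longrightarrow> finite (I i) \<and> card (I i) = L"
    and A: "finite (A 1)" "card (A 1) = K"
  shows "has_subst (ren (slt (with0 (A 1) I))) (tens_sum ps)
     (\<Sum>x\<leftarrow>ps. subst (ren (slt (with0 (A 1) I))) (case_prod tens x))"
  using ps
proof (induction ps)
  case Nil
  show ?case
    by (simp add: tens_sum_simps has_subst_0)
next
  case (Cons x ps)
  obtain F G where x: "x = (F, G)" by (cases x)
  have FG: "F \<in> Sh (m - 1) pY (\<lambda>_. L)" "G \<in> Sh 1 pZ (\<lambda>_. K)"
    using Cons.prems x by auto
  obtain v where "has_subst (ren (slt (with0 (A 1) I))) (tens F G) (select I F * v)"
    using has_subst_tens[where A = A and I = I, OF FG I A] by blast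
  hence "has_subst (ren (slt (with0 (A 1) I))) (tens F G) (subst (ren (slt (with0 (A 1) I))) (tens F G))"
    by (rule has_subst_subst)
  from has_subst_add[OF this Cons.IH] show ?case
    using Cons.prems by (simp add: x tens_sum_simps)
qed

lemma target_mult_tens_sum:
  assumes ps: "set ps \<subseteq> Sh (m - 1) pY (\<lambda>_. L) \<times> Sh 1 pZ (\<lambda>_. K)"
    and qs: "set qs \<subseteq> Sh (m - 1) pY (\<lambda>_. L') \<times> Sh 1 pZ (\<lambda>_. K')"
  shows "target_mult L K L' K' (tens_sum ps) (tens_sum qs) =
     (\<Sum>x\<leftarrow>ps. \<Sum>y\<leftarrow>qs. target_mult L K L' K' (case_prod tens x) (case_prod tens y))"
proof -
  let ?s = "\<lambda>I A. ren (slt (with0 (A 1) I))"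
  let ?s' = "\<lambda>I A. ren (slt (with0 (cpl (K + K') A 1) (cpl (L + L') I)))"
  let ?c = "\<lambda>I A. OmY I (cpl (L + L') I) * OmZ (A 1) (cpl (K + K') A 1)"
  have one: "1 \<in> {1..1::nat}" by simp
  have "target_mult L K L' K' (tens_sum ps) (tens_sum qs) = (\<Sum>I\<in>lab (m - 1) (L + L') L. \<Sum>A\<in>lab 1 (K + K') K.
     (\<Sum>x\<leftarrow>ps. \<Sum>y\<leftarrow>qs. subst (?s I A) (case_prod tens x) * subst (?s' I A) (case_prod tens y) * ?c I A))"
    unfolding target_mult_def
  proof (intro sum.cong refl)
    fix I A assume I: "I \<in> lab (m - 1) (L + L') L" and A: "A \<in> lab 1 (K + K') K"
    have A1: "finite (A 1)" "card (A 1) = K" "finite (cpl (K + K') A 1)" "card (cpl (K + K') A 1) = K'"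
      using lab_D(2,3)[OF A one] by auto
    have "subst (?s I A) (tens_sum ps) = (\<Sum>x\<leftarrow>ps. subst (?s I A) (case_prod tens x))"
      by (rule has_subst_imp_subst, rule has_subst_tens_sum[where A = A and I = I, OF ps lab_D(2)[OF I] A1(1,2)])
    moreover have "subst (?s' I A) (tens_sum qs) = (\<Sum>y\<leftarrow>qs. subst (?s' I A) (case_prod tens y))"
      by (rule has_subst_imp_subst,
          rule has_subst_tens_sum[where A = "cpl (K + K') A" and I = "cpl (L + L') I", OF qs lab_D(3)[OF I] A1(3,4)])
    ultimately show "subst (?s I A) (tens_sum ps) * subst (?s' I A) (tens_sum qs) * ?c I A =
       (\<Sum>x\<leftarrow>ps. \<Sum>y\<leftarrow>qs. subst (?s I A) (case_prod tens x) * subst (?s' I A) (case_prod tens y) * ?c I A)"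
      by (simp only: sum_list_bilinear)
  qed
  also have "\<dots> = (\<Sum>x\<leftarrow>ps. \<Sum>y\<leftarrow>qs. target_mult L K L' K' (case_prod tens x) (case_prod tens y))"
    by (simp only: sum_sum_list target_mult_def)
  finally show ?thesis .
qed

lemma tens_mult_eq:
  assumes f: "f \<in> tens_space (Sh (m - 1) pY (\<lambda>_. L)) (Sh 1 pZ (\<lambda>_. K))"
    and g: "g \<in> tens_space (Sh (m - 1) pY (\<lambda>_. L')) (Sh 1 pZ (\<lambda>_. K'))"
  shows "tens_mult (m - 1) pY pZ L K L' K' f g = target_mult L K L' K' f g"
proof -
  have val: "tens_sum [(sh_mult (m - 1) pY (\<lambda>_. L) (\<lambda>_. L') F F', sh_mult 1 pZ (\<lambda>_. K) (\<lambda>_. K') G G').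
        (F, G) \<leftarrow> ps, (F', G') \<leftarrow> qs] = target_mult L K L' K' (tens_sum ps) (tens_sum qs)"
    if ps: "set ps \<subseteq> Sh (m - 1) pY (\<lambda>_. L) \<times> Sh 1 pZ (\<lambda>_. K)"
      and qs: "set qs \<subseteq> Sh (m - 1) pY (\<lambda>_. L') \<times> Sh 1 pZ (\<lambda>_. K')" for ps qs
    unfolding tens_sum_product target_mult_tens_sum[OF ps qs]
  proof (intro arg_cong[where f = sum_list] map_cong refl)
    fix x assume x: "x \<in> set ps"
    obtain F G where FG: "x = (F, G)" by (cases x)
    have in1: "F \<in> Sh (m - 1) pY (\<lambda>_. L)" "G \<in> Sh 1 pZ (\<lambda>_. K)"
      using ps x FG by auto
    have "tens (sh_mult (m - 1) pY (\<lambda>_. L) (\<lambda>_. L') F F') (sh_mult 1 pZ (\<lambda>_. K) (\<lambda>_. K') G G') =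
      target_mult L K L' K' (tens F G) (tens F' G')" if "(F', G') \<in> set qs" for F' G'
      using qs that by (intro tens_sh_mult in1) auto
    hence "(\<Sum>(F', G')\<leftarrow>qs. tens (sh_mult (m - 1) pY (\<lambda>_. L) (\<lambda>_. L') F F') (sh_mult 1 pZ (\<lambda>_. K) (\<lambda>_. K') G G')) =
      (\<Sum>y\<leftarrow>qs. target_mult L K L' K' (tens F G) (case_prod tens y))"
      by (intro arg_cong[where f = sum_list] map_cong refl) auto
    thus "(case x of (F, G) \<Rightarrow> \<Sum>(F', G')\<leftarrow>qs. tens (sh_mult (m - 1) pY (\<lambda>_. L) (\<lambda>_. L') F F')
            (sh_mult 1 pZ (\<lambda>_. K) (\<lambda>_. K') G G')) =
      (\<Sum>y\<leftarrow>qs. target_mult L K L' K' (case_prod tens x) (case_prod tens y))"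
      by (simp add: FG)
  qed
  obtain ps where ps: "set ps \<subseteq> Sh (m - 1) pY (\<lambda>_. L) \<times> Sh 1 pZ (\<lambda>_. K)" "f = tens_sum ps"
    using f unfolding tens_space_def by blast
  obtain qs where qs: "set qs \<subseteq> Sh (m - 1) pY (\<lambda>_. L') \<times> Sh 1 pZ (\<lambda>_. K')" "g = tens_sum qs"
    using g unfolding tens_space_def by blast
  show ?thesis
    unfolding tens_mult_def
  proof (rule the_equality, intro allI impI)
    fix ps qs
    assume "set ps \<subseteq> Sh (m - 1) pY (\<lambda>_. L) \<times> Sh 1 pZ (\<lambda>_. K)"
      "set qs \<subseteq> Sh (m - 1) pY (\<lambda>_. L') \<times> Sh 1 pZ (\<lambda>_. K')" "f = tens_sum ps" "g = tens_sum qs"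
    thus "target_mult L K L' K' f g = tens_sum [(sh_mult (m - 1) pY (\<lambda>_. L) (\<lambda>_. L') F F',
        sh_mult 1 pZ (\<lambda>_. K) (\<lambda>_. K') G G'). (F, G) \<leftarrow> ps, (F', G') \<leftarrow> qs]"
      using val[of ps qs] by simp
  next
    fix h
    assume "\<forall>ps qs. set ps \<subseteq> Sh (m - 1) pY (\<lambda>_. L) \<times> Sh 1 pZ (\<lambda>_. K) \<longrightarrow>
      set qs \<subseteq> Sh (m - 1) pY (\<lambda>_. L') \<times> Sh 1 pZ (\<lambda>_. K') \<longrightarrow> f = tens_sum ps \<longrightarrow> g = tens_sum qs \<longrightarrow>
      h = tens_sum [(sh_mult (m - 1) pY (\<lambda>_. L) (\<lambda>_. L') F F',
        sh_mult 1 pZ (\<lambda>_. K) (\<lambda>_. K') G G'). (F, G) \<leftarrow> ps, (F', G') \<leftarrow> qs]"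
    thus "h = target_mult L K L' K' f g"
      using ps qs val[OF ps(1) qs(1)] by blast
  qed
qed

subsection \<open>The specialisation of a product\<close>

lemma tildeF_rho: "tildeF m (q, q1, q2, q3) l1 (L + K) L F = subst (sg L) F / Den L K"
  unfolding tildeF_def Den_eq rho_eq ..

lemma slt_union_shift:
  assumes I: "I \<subseteq> {1..L}" "card I = M" and A: "A \<subseteq> {1..K}" "card A = N" and S: "S i = I \<union> shift L A"
  shows "a \<in> {1..M} \<Longrightarrow> slt S i a = sorted_list_of_set I ! (a - 1)"
    "b \<in> {1..N} \<Longrightarrow> slt S i (b + M) = sorted_list_of_set A ! (b - 1) + L"
proof -
  have fin: "finite I" "finite A"
    using I A finite_subset by auto
  have l: "sorted_list_of_set (S i) = sorted_list_of_set I @ map (\<lambda>b. b + L) (sorted_list_of_set A)"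
    unfolding S shift_def using A(1) by (intro sorted_list_union_shift[OF I(1) fin(2)]) auto
  have len: "length (sorted_list_of_set I) = M" "length (sorted_list_of_set A) = N"
    using I A fin by auto
  show "slt S i a = sorted_list_of_set I ! (a - 1)" if "a \<in> {1..M}"
  proof -
    have "a - 1 < length (sorted_list_of_set I)"
      unfolding len using that by auto
    thus ?thesis
      by (simp only: slt_def l nth_append if_True)
  qed
  show "slt S i (b + M) = sorted_list_of_set A ! (b - 1) + L" if b: "b \<in> {1..N}"
  proof -
    have "b + M - 1 = length (sorted_list_of_set I) + (b - 1)" "b - 1 < length (sorted_list_of_set A)"
      unfolding len using b by auto
    thus ?thesis
      by (simp only: slt_def l nth_append_length_plus nth_map)
  qed
qed

lemma sep_sg: "sep m N (sg L)"
proof (rule sepI)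
  fix i a j b assume "(i, a) \<in> degree_vars m (\<lambda>_. N)" "(j, b) \<in> degree_vars m (\<lambda>_. N)" "sg L i a = sg L j b"
  thus "i = j \<and> a = b"
    using sg_inj[of i a j b L] by (auto simp: Xv_iff)
qed (rule sg_neq_0)

lemma sep_sg_slt:
  assumes S: "\<And>i. i \<in> {1..m} \<Longrightarrow> finite (S i) \<and> card (S i) = N" "\<And>i a. i \<in> {1..m} \<Longrightarrow> a \<in> S i \<Longrightarrow> a \<ge> 1"
  shows "sep m N (\<lambda>i a. sg L i (slt S i a))"
proof (rule sepI)
  have bij: "bij_betw (slt S i) {1..N} (S i)" if "i \<in> {1..m}" for i
    using slt_bij[of S i N] S(1)[OF that] by blast
  fix i a j b
  assume ia: "(i, a) \<in> degree_vars m (\<lambda>_. N)" "(j, b) \<in> degree_vars m (\<lambda>_. N)"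
    "sg L i (slt S i a) = sg L j (slt S j b)"
  hence r: "i \<in> {1..m}" "j \<in> {1..m}" "a \<in> {1..N}" "b \<in> {1..N}"
    by (auto simp: Xv_iff)
  have pos: "slt S i a \<ge> 1" "slt S j b \<ge> 1"
    using S(2) bij_betwE[OF bij] r by blast+
  have "(i, slt S i a) = (j, slt S j b)"
    using sg_inj[OF _ r(1,2) pos, of L] ia(3) by blast
  thus "i = j \<and> a = b"
    using bij_betw_imp_inj_on[OF bij[OF r(1)]] r by (auto dest: inj_onD)
qed (rule sg_neq_0)

text \<open>
  Selecting labels and then specialising amounts to specialising and then renaming, because the \<open>y\<close>
  labels precede the \<open>z\<close> labels.
\<close>

lemma subst_selected:
  assumes F: "F \<in> Sh m (q, q1, q2, q3) (\<lambda>_. M + N)"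
    and I: "\<And>i. i \<in> {1..m - 1} \<Longrightarrow> I i \<subseteq> {1..L} \<and> card (I i) = M"
    and A: "A \<subseteq> {1..K}" "card A = N"
    and S: "\<And>i. i \<in> {1..m} \<Longrightarrow> S i = I (col i) \<union> shift L A"
  shows "subst (\<lambda>i a. sg L i (slt S i a)) F =
     subst (ren (slt (with0 A I))) (tildeF m (q, q1, q2, q3) l1 (M + N) M F) * DenS I A"
proof -
  let ?r = "slt (with0 A I)" and ?u = "\<lambda>i a. sg L i (slt S i a)"
  have m1: "m \<ge> 1" using m by simp
  have col: "col i \<in> {1..m - 1}" if "i \<in> {1..m}" for i
    using that m by auto
  have finA: "finite A" and finI: "finite (I i)" if "i \<in> {1..m - 1}" for i
    using A I[OF that] finite_subset by blast+
  have finA': "finite A"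
    using A finite_subset by blast
  have disj: "I (col i) \<inter> shift L A = {}" if "i \<in> {1..m}" for i
    using I[OF col[OF that]] A by (force simp: shift_def)
  have S': "finite (S i) \<and> card (S i) = M + N" if i: "i \<in> {1..m}" for i
    unfolding S[OF i] using I[OF col[OF i]] finI[OF col[OF i]] A finA' disj[OF i]
    by (auto simp: card_Un_disjoint shift_def card_image inj_on_def)
  have pos: "a \<ge> 1" if "i \<in> {1..m}" "a \<in> S i" for i a
    using that(2) I[OF col[OF that(1)]] A unfolding S[OF that(1)] by (auto simp: shift_def subset_iff)
  have 1: "has_subst (ren ?r) (subst (sg M) F) (subst ?u F)"
  proof (rule Sh_subst_comp[OF m1 F sep_sg sep_sg_slt[OF S' pos]])
    fix i a assume "(i, a) \<in> degree_vars m (\<lambda>_. M + N)"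
    hence ia: "i \<in> {1..m}" "a \<in> {1..M + N}"
      by (auto simp: Xv_iff)
    note IA = I[OF col[OF ia(1)], THEN conjunct1] I[OF col[OF ia(1)], THEN conjunct2] A S[OF ia(1)]
    show "has_subst (ren ?r) (sg M i a) (?u i a)"
    proof (cases "a \<le> M")
      case True
      hence a: "a \<in> {1..M}" using ia by simp
      have s: "slt S i a = ?r (col i) a"
        using slt_union_shift(1)[where S = S and i = i, OF IA a] col[OF ia(1)] by (simp add: slt_def with0_def)
      have "?r (col i) a \<in> I (col i)"
        using bij_betwE[OF slt_bij[of I "col i" M]] I[OF col[OF ia(1)]] finI[OF col[OF ia(1)]] a col[OF ia(1)]
        by (auto simp: slt_def with0_def)
      hence "?r (col i) a \<le> L"
        using IA(1) by auto
      hence "?u i a = cst (kap i) * xvar (col i) (?r (col i) a)"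
        unfolding s by (rule sg_y)
      thus ?thesis
        unfolding sg_y[OF True] using has_subst_mult[OF has_subst_cst has_subst_ren] by simp
    next
      case False
      define b where "b = a - M"
      have b: "a = b + M" "b \<in> {1..N}"
        using ia False by (auto simp: b_def)
      have s: "slt S i a = ?r 0 b + L"
        using slt_union_shift(2)[where S = S and i = i, OF IA b(2)] b by (simp add: slt_def with0_def)
      have "?r 0 b \<in> A"
        using bij_betwE[OF slt_bij[of "with0 A I" 0 N]] A finA' b by (simp add: with0_def)
      hence r0: "?r 0 b \<ge> 1"
        using A by auto
      have b1: "b \<ge> 1" using b by simp
      show ?thesis
        unfolding s sg_z[OF r0] unfolding b(1) sg_z[OF b1] by (intro has_subst_mult has_subst_cst has_subst_ren)
    qed
  qed
  have rI: "bij_betw (?r i) {1..M} (I i)" if "i \<in> {1..m - 1}" for i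
  proof -
    have "?r i = slt I i"
      using that by (simp add: slt_def[abs_def] with0_def)
    thus ?thesis
      using slt_bij[of I i M] I[OF that] finI[OF that] by simp
  qed
  have rA: "bij_betw (?r 0) {1..N} A"
    using slt_bij[of "with0 A I" 0 N] A finA' by (simp add: with0_def)
  have "has_subst (ren ?r) (Den M N) (DenS (\<lambda>i. ?r i ` {1..M}) (?r 0 ` {1..N}))"
    using rI rA m by (intro has_subst_Den) (auto simp: bij_betw_def)
  also have "?r 0 ` {1..N} = A"
    using rA by (simp add: bij_betw_def)
  also have "DenS (\<lambda>i. ?r i ` {1..M}) A = DenS I A"
    using rI by (intro DenS_cong) (simp add: bij_betw_def)
  finally have 2: "has_subst (ren ?r) (Den M N) (DenS I A)" .
  have nz: "DenS I A \<noteq> 0"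
    by (rule DenS_neq_0[OF finI finA'])
  have "subst (ren ?r) (tildeF m (q, q1, q2, q3) l1 (M + N) M F) = subst ?u F / DenS I A"
    unfolding tildeF_rho by (rule has_subst_imp_subst, rule has_subst_divide[OF 1 2 nz])
  thus ?thesis
    using nz by simp
qed

subsection \<open>The terms that survive the specialisation\<close>

text \<open>
  A distribution is compatible with the specialisation if the two copies of each \<open>y\<^sub>1\<^sub>,\<^sub>a\<close>, and all variables
  in the chain of each \<open>z\<^sub>b\<close>, are on the same side.
\<close>

definition aligned :: "nat \<Rightarrow> (nat \<Rightarrow> nat set) \<Rightarrow> bool" where
  "aligned L S \<longleftrightarrow> S m \<inter> {..L} = S 1 \<inter> {..L} \<and> (\<forall>i\<in>{1..m}. S i \<inter> {L<..} = S 1 \<inter> {L<..})"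

lemma PP_nonzeroD: "PP A B f \<noteq> 0 \<Longrightarrow> finite A \<Longrightarrow> finite B \<Longrightarrow> a \<in> A \<Longrightarrow> b \<in> B \<Longrightarrow> f a b \<noteq> 0"
  unfolding PP_def by (auto simp: prod_zero_iff)

text \<open>
  The zeros of \<open>\<omega>\<close> only show that the sets of \<open>z\<close> labels decrease with the colour, and that the \<open>y\<close> labels in
  colour \<open>m\<close> are among those in colour \<open>1\<close>. Since each colour contributes equally many labels, equality
  follows.
\<close>

lemma OmX_not_aligned:
  assumes S: "S \<in> lab m (M + M') M" and nonzero: "OmX L S (cpl (M + M') S) \<noteq> 0"
  shows "aligned L S"
proof -
  let ?J = "cpl (M + M') S"
  have fac: "PP (S i) (?J (nxt m i)) (\<lambda>a b. ww q1 (sg L i a) (sg L (nxt m i) b)) \<noteq> 0"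
    "PP (S (nxt m i)) (?J i) (\<lambda>a b. cst (eps m d) * ww q3 (sg L (nxt m i) a) (sg L i b)) \<noteq> 0"
    if "i \<in> {1..m}" for i
    using nonzero that unfolding OmX_def prod_zero_iff[OF finite_atLeastAtMost] mult_eq_0_iff by blast+
  have rng: "m \<in> {1..m}" "1 \<in> {1..m}"
    using m by auto
  have fin: "finite (S i)" "finite (?J i)" "card (S i) = M" "S i \<subseteq> {1..M + M'}" if "i \<in> {1..m}" for i
    using lab_D(1-3)[OF S that] by blast+
  have J: "a \<in> ?J i \<longleftrightarrow> a \<notin> S i" if "i \<in> {1..m}" "a \<in> {1..M + M'}" for i a
    using lab_D[OF S that(1)] that(2) by blast
  let ?Z = "\<lambda>i. S i \<inter> {L<..}" and ?Y = "\<lambda>i. S i \<inter> {..L}"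
  \<comment> \<open>If \<open>z\<^sub>b\<close> were in the first factor in colour \<open>i + 1\<close> and in the second one in colour \<open>i\<close>, then
      \<open>\<omega>\<^sub>i\<^sub>+\<^sub>1\<^sub>,\<^sub>i\<close> would be evaluated at its zero.\<close>
  have step: "?Z (i + 1) \<subseteq> ?Z i" if i: "i \<in> {1..m - 1}" for i
  proof
    fix b assume b: "b \<in> ?Z (i + 1)"
    have i': "i \<in> {1..m}" "i + 1 \<in> {1..m}" "nxt m i = i + 1"
      using i col_nxt(1)[OF i] by auto
    show "b \<in> ?Z i"
    proof (rule ccontr)
      assume "b \<notin> ?Z i"
      hence "b \<in> ?J i"
        using b J[OF i'(1), of b] fin(4)[OF i'(2)] by auto
      with fac(2)[OF i'(1)] b have "ww q3 (sg L (i + 1) b) (sg L i b) \<noteq> 0"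
        unfolding i'(3) using PP_nonzeroD[OF _ fin(1)[OF i'(2)] fin(2)[OF i'(1)]] by fastforce
      moreover have "sg L (i + 1) b = cst q3 * sg L i b"
      proof -
        have "b > L" using b by simp
        moreover have "q3 ^ i = q3 * q3 ^ (i - 1)"
          using i power_Suc[of q3 "i - 1"] by simp
        ultimately show ?thesis
          by (simp add: sg_def rco_def rvar_def cst_mult mult.assoc)
      qed
      ultimately show False
        by (simp add: ww_def)
    qed
  qed
  have Z: "?Z j \<subseteq> ?Z i" if "i \<le> j" "1 \<le> i" "j \<le> m" for i j
    using that
  proof (induction j rule: dec_induct)
    case (step n)
    have "?Z (n + 1) \<subseteq> ?Z n"
      using step by (intro \<open>\<And>i. i \<in> {1..m - 1} \<Longrightarrow> ?Z (i + 1) \<subseteq> ?Z i\<close>) auto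
    thus ?case
      using step by auto
  qed simp
  \<comment> \<open>The same with \<open>\<omega>\<^sub>m\<^sub>,\<^sub>1\<close> and the two copies of \<open>y\<^sub>1\<^sub>,\<^sub>a\<close>.\<close>
  have Y: "?Y m \<subseteq> ?Y 1"
  proof
    fix a assume a: "a \<in> ?Y m"
    have n: "nxt m m = 1"
      by (simp add: nxt_def)
    show "a \<in> ?Y 1"
    proof (rule ccontr)
      assume "a \<notin> ?Y 1"
      hence "a \<in> ?J 1"
        using a J[OF rng(2), of a] fin(4)[OF rng(1)] by auto
      with fac(1)[OF rng(1)] a have "ww q1 (sg L m a) (sg L 1 a) \<noteq> 0"
        unfolding n using PP_nonzeroD[OF _ fin(1)[OF rng(1)] fin(2)[OF rng(2)]] by blast
      moreover have "sg L m a = cst q1 * sg L 1 a"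
      proof -
        have "q1 * kap 1 = 1"
          unfolding kap_1 using qs_neq_0 by simp
        hence "cst q1 * (cst (kap 1) * xvar 1 a) = xvar 1 a"
          by (simp only: mult.assoc[symmetric] cst_mult[symmetric]) simp
        thus ?thesis
          using a m by (simp add: sg_y kap_m)
      qed
      ultimately show False
        by (simp add: ww_def)
    qed
  qed
  have card: "card (?Y i) + card (?Z i) = M" if "i \<in> {1..m}" for i
  proof -
    have "?Y i \<union> ?Z i = S i" "?Y i \<inter> ?Z i = {}"
      by auto
    thus ?thesis
      using card_Un_disjoint[of "?Y i" "?Z i"] fin[OF that] by auto
  qed
  have f1: "finite (?Y 1)" "finite (?Z 1)"
    using fin(1)[OF rng(2)] by auto
  have Zm: "?Z m \<subseteq> ?Z 1"
    using m by (intro Z) auto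
  have "card (?Y m) \<le> card (?Y 1)" "card (?Z m) \<le> card (?Z 1)"
    using Y Zm f1 by (auto intro: card_mono)
  hence "card (?Y m) = card (?Y 1)" "card (?Z m) = card (?Z 1)"
    using card[OF rng(1)] card[OF rng(2)] by auto
  hence eq: "?Y m = ?Y 1" "?Z m = ?Z 1"
    using card_subset_eq[OF f1(1) Y] card_subset_eq[OF f1(2) Zm] by blast+
  have "?Z i = ?Z 1" if "i \<in> {1..m}" for i
    using Z[of i m] Z[of 1 i] that eq(2) by auto
  thus ?thesis
    using eq(1) unfolding aligned_def by blast
qed

text \<open>
  \<open>join\<close> and \<open>split\<close> are the bijection between the compatible distributions and the pairs of a distribution
  of the \<open>y\<close> and one of the \<open>z\<close>.
\<close>

definition join :: "nat \<Rightarrow> (nat \<Rightarrow> nat set) \<Rightarrow> (nat \<Rightarrow> nat set) \<Rightarrow> nat \<Rightarrow> nat set" where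
  "join L I A = restrict (\<lambda>i. I (col i) \<union> shift L (A 1)) {1..m}"

lemma col_range: "i \<in> {1..m} \<Longrightarrow> col i \<in> {1..m - 1}"
  using m by auto

lemma join_parts:
  assumes I: "I \<in> lab (m - 1) L L'" and A: "A \<in> lab 1 K K'" and i: "i \<in> {1..m}"
  shows "join L I A i = I (col i) \<union> shift L (A 1)" "I (col i) \<subseteq> {1..L}" "card (I (col i)) = L'"
    "A 1 \<subseteq> {1..K}" "card (A 1) = K'"
    "join L I A i \<inter> {..L} = I (col i)" "join L I A i \<inter> {L<..} = shift L (A 1)"
proof -
  show j: "join L I A i = I (col i) \<union> shift L (A 1)"
    using i by (simp add: join_def)
  show IA: "I (col i) \<subseteq> {1..L}" "card (I (col i)) = L'" "A 1 \<subseteq> {1..K}" "card (A 1) = K'"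
    using PiE_mem[OF I[unfolded lab_def] col_range[OF i]] PiE_mem[OF A[unfolded lab_def], of 1] by auto
  have "shift L (A 1) \<subseteq> {L<..}"
    using IA(3) by (auto simp: shift_def)
  thus "join L I A i \<inter> {..L} = I (col i)" "join L I A i \<inter> {L<..} = shift L (A 1)"
    unfolding j using IA(1) by (auto simp: subset_iff)
qed

lemma join_in_lab:
  assumes I: "I \<in> lab (m - 1) L L'" and A: "A \<in> lab 1 K K'"
  shows "join L I A \<in> lab m (L + K) (L' + K')" "aligned L (join L I A)"
proof -
  have "join L I A i \<subseteq> {1..L + K} \<and> card (join L I A i) = L' + K'" if i: "i \<in> {1..m}" for i
  proof -
    note p = join_parts[OF I A i]
    have "I (col i) \<inter> shift L (A 1) = {}"
      using p(2,4) by (force simp: shift_def)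
    moreover have "finite (I (col i))" "finite (shift L (A 1))" "card (shift L (A 1)) = K'"
      using p(5) finite_subset[OF p(2)] finite_subset[OF p(4)] by (simp_all add: shift_def card_image inj_on_def)
    moreover have "shift L (A 1) \<subseteq> {1..L + K}"
      using p(4) by (auto simp: shift_def)
    moreover have "I (col i) \<subseteq> {1..L + K}"
      using p(2) by auto
    ultimately show ?thesis
      unfolding p(1) using p(3) by (simp add: card_Un_disjoint del: One_nat_def)
  qed
  thus "join L I A \<in> lab m (L + K) (L' + K')"
    unfolding lab_def by (auto simp: join_def PiE_iff)
  have rng: "m \<in> {1..m}" "1 \<in> {1..m}"
    using m by auto
  have "col m = col 1"
    using m by simp
  thus "aligned L (join L I A)"
    unfolding aligned_def using join_parts(6,7)[OF I A] rng by auto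
qed

definition split :: "nat \<Rightarrow> (nat \<Rightarrow> nat set) \<Rightarrow> (nat \<Rightarrow> nat set) \<times> (nat \<Rightarrow> nat set)" where
  "split L S = (restrict (\<lambda>i. S i \<inter> {..L}) {1..m - 1}, restrict (\<lambda>_. (\<lambda>b. b - L) ` (S 1 \<inter> {L<..})) {1..1})"

lemma split_join:
  assumes I: "I \<in> lab (m - 1) L L'" and A: "A \<in> lab 1 K K'"
  shows "split L (join L I A) = (I, A)" "card (join L I A 1 \<inter> {..L}) = L'" "card (join L I A 1 \<inter> {L<..}) = K'"
proof -
  have one: "1 \<in> {1..m}" "col 1 = 1"
    using m by auto
  note p = join_parts[OF I A]
  show "card (join L I A 1 \<inter> {..L}) = L'"
    unfolding p(6)[OF one(1)] by (rule p(3)[OF one(1)])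
  show "card (join L I A 1 \<inter> {L<..}) = K'"
    unfolding p(7)[OF one(1)] using p(5)[OF one(1)] by (simp add: shift_def card_image inj_on_def)
  have "join L I A i \<inter> {..L} = I i" if i: "i \<in> {1..m - 1}" for i
  proof -
    have "i \<in> {1..m}" "col i = i"
      using i col_nxt(2)[OF i] by auto
    thus ?thesis
      using p(6)[of i] by simp
  qed
  moreover have "(\<lambda>b. b - L) ` (join L I A 1 \<inter> {L<..}) = A 1"
    unfolding p(7)[OF one(1)] by (simp add: shift_def image_image)
  moreover have "restrict I {1..m - 1} = I" "restrict A {1..1} = A"
    using I A PiE_restrict unfolding lab_def by blast+
  ultimately show "split L (join L I A) = (I, A)"
    unfolding split_def by (metis (no_types, lifting) restrict_ext singletonD atLeastAtMost_singleton)
qed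

lemma join_split:
  assumes S: "S \<in> lab m (L + K) M" and al: "aligned L S"
  defines "L' \<equiv> card (S 1 \<inter> {..L})" and "K' \<equiv> card (S 1 \<inter> {L<..})"
  shows "fst (split L S) \<in> lab (m - 1) L L'" "snd (split L S) \<in> lab 1 K K'"
    "join L (fst (split L S)) (snd (split L S)) = S" "L' + K' = M" "L' \<le> L" "K' \<le> K"
proof -
  let ?I = "fst (split L S)" and ?A = "snd (split L S)"
  have one: "1 \<in> {1..m}" "1 \<in> {1..m - 1}"
    using m by auto
  have Si: "S i \<subseteq> {1..L + K}" "card (S i) = M" "finite (S i)" if "i \<in> {1..m}" for i
    using PiE_mem[OF S[unfolded lab_def] that] finite_subset[of "S i"] by auto
  have card: "card (S i \<inter> {..L}) + card (S i \<inter> {L<..}) = M" if "i \<in> {1..m}" for i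
  proof -
    have "(S i \<inter> {..L}) \<union> (S i \<inter> {L<..}) = S i" "(S i \<inter> {..L}) \<inter> (S i \<inter> {L<..}) = {}"
      by auto
    thus ?thesis
      using card_Un_disjoint[of "S i \<inter> {..L}" "S i \<inter> {L<..}"] Si[OF that] by auto
  qed
  have Z: "S i \<inter> {L<..} = S 1 \<inter> {L<..}" if "i \<in> {1..m}" for i
    using al that unfolding aligned_def by blast
  have cardY: "card (S i \<inter> {..L}) = L'" if "i \<in> {1..m}" for i
    using card[OF that] card[OF one(1)] unfolding Z[OF that] L'_def by simp
  show sum: "L' + K' = M"
    unfolding L'_def K'_def by (rule card[OF one(1)])
  have Y1: "S i \<inter> {..L} \<subseteq> {1..L}" if "i \<in> {1..m}" for i
    using Si(1)[OF that] by auto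
  have Z1: "S 1 \<inter> {L<..} \<subseteq> {L + 1..L + K}"
    using Si(1)[OF one(1)] by auto
  have "i \<in> {1..m}" if "i \<in> {1..m - 1}" for i
    using that by auto
  hence I: "?I i = S i \<inter> {..L}" "?I i \<in> {A. A \<subseteq> {1..L} \<and> card A = L'}" if "i \<in> {1..m - 1}" for i
    using that Y1 cardY by (auto simp: split_def)
  thus "?I \<in> lab (m - 1) L L'"
    unfolding lab_def by (intro PiE_I) (auto simp: split_def)
  have A: "?A 1 = (\<lambda>b. b - L) ` (S 1 \<inter> {L<..})"
    by (simp add: split_def)
  have A': "card (?A 1) = K'" "?A 1 \<subseteq> {1..K}"
  proof -
    have "inj_on (\<lambda>b. b - L) (S 1 \<inter> {L<..})"
      by (rule inj_onI) auto
    thus "card (?A 1) = K'"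
      unfolding A K'_def by (rule card_image)
    show "?A 1 \<subseteq> {1..K}"
    proof
      fix x assume "x \<in> ?A 1"
      then obtain b where "x = b - L" "b \<in> {L + 1..L + K}"
        unfolding A using Z1 by blast
      thus "x \<in> {1..K}" by auto
    qed
  qed
  show "?A \<in> lab 1 K K'"
    unfolding lab_def
  proof (rule PiE_I)
    fix i :: nat assume "i \<in> {1..1}"
    hence i: "i = 1" by simp
    show "?A i \<in> {A. A \<subseteq> {1..K} \<and> card A = K'}"
      unfolding i using A' by blast
  qed (auto simp: split_def)
  have sh: "shift L (?A 1) = S 1 \<inter> {L<..}"
    unfolding A shift_def image_image by force
  show "join L ?I ?A = S"
  proof
    fix i
    show "join L ?I ?A i = S i"
    proof (cases "i \<in> {1..m}")
      case True
      have "?I (col i) = S (col i) \<inter> {..L}"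
        by (rule I(1)[OF col_range[OF True]])
      also have "\<dots> = S i \<inter> {..L}"
        using al by (auto simp: aligned_def)
      finally have "join L ?I ?A i = (S i \<inter> {..L}) \<union> (S i \<inter> {L<..})"
        using True sh Z[OF True] by (simp add: join_def)
      also have "\<dots> = S i" by auto
      finally show ?thesis .
    next
      case False
      thus ?thesis
        using PiE_arb[OF S[unfolded lab_def] False] by (simp only: join_def restrict_apply if_False)
    qed
  qed
  show "L' \<le> L"
    unfolding L'_def using card_mono[OF _ Y1[OF one(1)]] by simp
  show "K' \<le> K"
    unfolding K'_def using card_mono[OF _ Z1] by simp
qed

text \<open>
  The degrees of the first factor are summed over as well, since one degree \<open>M\<close> in the source corresponds
  to all bidegrees \<open>(L', K')\<close> with \<open>L' + K' = M\<close>.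
\<close>

lemma sum_aligned:
  fixes h :: "nat \<Rightarrow> (nat \<Rightarrow> nat set) \<Rightarrow> ratfun"
  assumes zero: "\<And>M S. M \<le> L + K \<Longrightarrow> S \<in> lab m (L + K) M \<Longrightarrow> \<not> aligned L S \<Longrightarrow> h M S = 0"
  shows "(\<Sum>M\<le>L + K. \<Sum>S\<in>lab m (L + K) M. h M S) =
     (\<Sum>L'\<le>L. \<Sum>K'\<le>K. \<Sum>I\<in>lab (m - 1) L L'. \<Sum>A\<in>lab 1 K K'. h (L' + K') (join L I A))"
proof -
  let ?T = "SIGMA M:{..L + K}. {S \<in> lab m (L + K) M. aligned L S}"
  let ?U = "SIGMA x:{..L} \<times> {..K}. lab (m - 1) L (fst x) \<times> lab 1 K (snd x)"
  let ?e = "\<lambda>((L', K'), (I, A)). (L' + K', join L I A)"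
  let ?d = "\<lambda>(M, S). ((card (S 1 \<inter> {..L}), card (S 1 \<inter> {L<..})), split L S)"
  have "(\<Sum>M\<le>L + K. \<Sum>S\<in>lab m (L + K) M. h M S) = (\<Sum>(M, S)\<in>(SIGMA M:{..L + K}. lab m (L + K) M). h M S)"
    by (intro sum.Sigma ballI finite_lab) simp
  also have "\<dots> = (\<Sum>(M, S)\<in>?T. h M S)"
    using zero by (intro sum.mono_neutral_right finite_SigmaI finite_lab) auto
  also have "\<dots> = (\<Sum>x\<in>?U. case ?e x of (M, S) \<Rightarrow> h M S)"
  proof (rule sum.reindex_bij_betw[symmetric], rule bij_betw_byWitness[where f' = ?d])
    show "\<forall>x\<in>?U. ?d (?e x) = x"
      using split_join by auto
    show "\<forall>y\<in>?T. ?e (?d y) = y"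
    proof
      fix y assume "y \<in> ?T"
      then obtain M S where y: "y = (M, S)" "S \<in> lab m (L + K) M" "aligned L S"
        by auto
      thus "?e (?d y) = y"
        using join_split[OF y(2,3)] by (simp add: case_prod_beta)
    qed
    show "?e ` ?U \<subseteq> ?T"
      using join_in_lab by (auto intro: add_mono)
    show "?d ` ?T \<subseteq> ?U"
    proof
      fix x assume "x \<in> ?d ` ?T"
      then obtain M S where y: "x = ?d (M, S)" "S \<in> lab m (L + K) M" "aligned L S"
        by auto
      thus "x \<in> ?U"
        using join_split[OF y(2,3)] by (simp add: mem_Times_iff)
    qed
  qed
  also have "\<dots> = (\<Sum>x\<in>{..L} \<times> {..K}. \<Sum>y\<in>lab (m - 1) L (fst x) \<times> lab 1 K (snd x). case ?e (x, y) of (M, S) \<Rightarrow> h M S)"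
    by (subst sum.Sigma) (auto intro: finite_lab sum.cong)
  also have "\<dots> = (\<Sum>L'\<le>L. \<Sum>K'\<le>K. \<Sum>I\<in>lab (m - 1) L L'. \<Sum>A\<in>lab 1 K K'. h (L' + K') (join L I A))"
    by (simp add: sum.cartesian_product[symmetric] case_prod_beta sum.cartesian_product')
  finally show ?thesis .
qed

lemma OmX_cong:
  assumes "\<And>i. i \<in> {1..m} \<Longrightarrow> I i = I' i" "\<And>i. i \<in> {1..m} \<Longrightarrow> J i = J' i"
  shows "OmX L I J = OmX L I' J'"
  unfolding OmX_def
proof (intro prod.cong refl)
  fix i assume i: "i \<in> {1..m}"
  show "PP (I i) (J i) (\<lambda>a b. ww q2 (sg L i a) (sg L i b)) *
        PP (I i) (J (nxt m i)) (\<lambda>a b. ww q1 (sg L i a) (sg L (nxt m i) b)) *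
        PP (I (nxt m i)) (J i) (\<lambda>a b. cst (eps m d) * ww q3 (sg L (nxt m i) a) (sg L i b)) =
      PP (I' i) (J' i) (\<lambda>a b. ww q2 (sg L i a) (sg L i b)) *
        PP (I' i) (J' (nxt m i)) (\<lambda>a b. ww q1 (sg L i a) (sg L (nxt m i) b)) *
        PP (I' (nxt m i)) (J' i) (\<lambda>a b. cst (eps m d) * ww q3 (sg L (nxt m i) a) (sg L i b))"
    unfolding assms[OF i] assms[OF nxt_range[OF i]] ..
qed

lemma specialised_term:
  assumes F: "F \<in> Sh m (q, q1, q2, q3) (\<lambda>_. L1 + K1)" and G: "G \<in> Sh m (q, q1, q2, q3) (\<lambda>_. L2 + K2)"
    and I: "I \<in> lab (m - 1) (L1 + L2) L1" and A: "A \<in> lab 1 (K1 + K2) K1"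
  defines "S \<equiv> join (L1 + L2) I A"
  defines "S' \<equiv> cpl (L1 + L2 + (K1 + K2)) S" and "I' \<equiv> cpl (L1 + L2) I" and "A' \<equiv> cpl (K1 + K2) A 1"
  shows "subst (\<lambda>i a. sg (L1 + L2) i (slt S i a)) F * subst (\<lambda>i a. sg (L1 + L2) i (slt S' i a)) G *
       OmX (L1 + L2) S S' / Den (L1 + L2) (K1 + K2) =
     subst (ren (slt (with0 (A 1) I))) (tildeF m (q, q1, q2, q3) l1 (L1 + K1) L1 F) *
     subst (ren (slt (with0 A' I'))) (tildeF m (q, q1, q2, q3) l1 (L2 + K2) L2 G) * (OmY I I' * OmZ (A 1) A')"
proof -
  let ?L = "L1 + L2" and ?K = "K1 + K2"
  have one: "1 \<in> {1..1::nat}" by simp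
  note lI = lab_D[OF I] and lA = lab_D[OF A one]
  have Ii: "I i \<subseteq> {1..?L} \<and> card (I i) = L1" "I' i \<subseteq> {1..?L} \<and> card (I' i) = L2" "I i \<inter> I' i = {}"
    "finite (I i) \<and> finite (I' i)" "I i \<union> I' i = {1..?L}" if "i \<in> {1..m - 1}" for i
    using lI[OF that] by (auto simp: I'_def)
  have Ai: "A 1 \<subseteq> {1..?K}" "card (A 1) = K1" "A' \<subseteq> {1..?K}" "card A' = K2" "A 1 \<inter> A' = {}"
    "finite (A 1)" "finite A'" "A 1 \<union> A' = {1..?K}"
    using lA by (auto simp: A'_def)
  have S: "S i = I (col i) \<union> shift ?L (A 1)" if "i \<in> {1..m}" for i
    unfolding S_def using join_parts(1)[OF I A that] .
  have S': "S' i = I' (col i) \<union> shift ?L A'" if i: "i \<in> {1..m}" for i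
  proof -
    have "{1..?L + ?K} = {1..?L} \<union> shift ?L {1..?K}"
      unfolding shift_def using image_add_atLeastAtMost[of ?L 1 ?K] by (auto simp: add.commute)
    moreover have "shift ?L (A 1) \<inter> {1..?L} = {}" "I (col i) \<inter> shift ?L {1..?K} = {}"
      using Ii(1)[OF col_range[OF i]] Ai(1) by (force simp: shift_def)+
    moreover have "shift ?L {1..?K} - shift ?L (A 1) = shift ?L ({1..?K} - A 1)"
      unfolding shift_def by (rule image_set_diff[symmetric]) (simp add: inj_def)
    ultimately show ?thesis
      unfolding S'_def cpl_def S[OF i] I'_def A'_def by blast
  qed
  have 1: "subst (\<lambda>i a. sg ?L i (slt S i a)) F =
     subst (ren (slt (with0 (A 1) I))) (tildeF m (q, q1, q2, q3) l1 (L1 + K1) L1 F) * DenS I (A 1)"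
    by (rule subst_selected[where I = I and S = S, OF F Ii(1) Ai(1,2) S])
  have 2: "subst (\<lambda>i a. sg ?L i (slt S' i a)) G =
     subst (ren (slt (with0 A' I'))) (tildeF m (q, q1, q2, q3) l1 (L2 + K2) L2 G) * DenS I' A'"
    by (rule subst_selected[where I = I' and S = S', OF G Ii(2) Ai(3,4) S'])
  have 3: "OmX ?L S S' = OmY I I' * OmZ (A 1) A' * DenX I I' (A 1) A'"
    using OmX_cong[of S "\<lambda>i. I (col i) \<union> shift ?L (A 1)" S' "\<lambda>i. I' (col i) \<union> shift ?L A'" ?L, OF S S']
      OmX_DenX[OF Ii(1,2,3) Ai(1,3,5)] by simp
  have "Den ?L ?K = DenS (\<lambda>i. I i \<union> I' i) (A 1 \<union> A')"
    unfolding Den_def Ai(8) using Ii(5) by (intro DenS_cong) simp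
  also have "\<dots> = DenS I (A 1) * DenS I' A' * DenX I I' (A 1) A'"
    by (rule DenS_union[OF Ii(4) Ai(6,7) Ii(3) Ai(5)])
  finally have den: "Den ?L ?K = DenS I (A 1) * DenS I' A' * DenX I I' (A 1) A'" .
  hence nz: "DenS I (A 1) \<noteq> 0" "DenS I' A' \<noteq> 0" "DenX I I' (A 1) A' \<noteq> 0"
    using rD_Den_neq_0(2)[of ?L ?K] by auto
  have cancel: "f * x * (g * y) * (o1 * o2 * z) / (x * y * z) = f * g * (o1 * o2)"
    if "x \<noteq> 0" "y \<noteq> 0" "z \<noteq> 0" for f g x y z o1 o2 :: ratfun
    using that by simp
  show ?thesis
    unfolding 1 2 3 den by (rule cancel[OF nz])
qed

lemma has_subst_sh_mult:
  assumes F: "F \<in> Sh m (q, q1, q2, q3) (\<lambda>_. M)" and G: "G \<in> Sh m (q, q1, q2, q3) (\<lambda>_. M')"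
  shows "has_subst (sg L) (sh_mult m (q, q1, q2, q3) (\<lambda>_. M) (\<lambda>_. M') F G)
     (\<Sum>S\<in>lab m (M + M') M. subst (\<lambda>i a. sg L i (slt S i a)) F *
        subst (\<lambda>i a. sg L i (slt (cpl (M + M') S) i a)) G * OmX L S (cpl (M + M') S))"
proof -
  have m1: "m \<ge> 1" using m by simp
  have sel: "has_subst (sg L) (select S H) (subst (\<lambda>i a. sg L i (slt S i a)) H)"
    if H: "H \<in> Sh m (q, q1, q2, q3) (\<lambda>_. N)" and S: "\<And>i. i \<in> {1..m} \<Longrightarrow> finite (S i) \<and> card (S i) = N"
      and pos: "\<And>i a. i \<in> {1..m} \<Longrightarrow> a \<in> S i \<Longrightarrow> a \<ge> 1" for S H N
    unfolding select_eq
  proof (rule Sh_subst_comp[OF m1 H sep_slt[OF S] sep_sg_slt[OF S pos]])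
    fix i a
    show "has_subst (sg L) (ren (slt S) i a) (sg L i (slt S i a))"
      unfolding ren_def by (rule has_subst_xvar)
  qed
  show ?thesis
    unfolding sh_mult_lab
  proof (intro has_subst_sum has_subst_mult)
    fix S assume S: "S \<in> lab m (M + M') M"
    note l = lab_D[OF S]
    show "has_subst (sg L) (select S F) (subst (\<lambda>i a. sg L i (slt S i a)) F)"
      by (intro sel[OF F l(2)]) (use l(1) in fastforce)+
    show "has_subst (sg L) (select (cpl (M + M') S) G) (subst (\<lambda>i a. sg L i (slt (cpl (M + M') S) i a)) G)"
      by (intro sel[OF G l(3)]) (use l(6) in fastforce)+
    show "has_subst (sg L) (\<Prod>i\<in>{1..m}. \<Prod>j\<in>{1..m}. \<Prod>a\<in>S i. \<Prod>b\<in>cpl (M + M') S j.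
        omega m (q, q1, q2, q3) i j (xvar i a) (xvar j b)) (OmX L S (cpl (M + M') S))"
      using l by (intro has_subst_OmX[where N = "M + M'"] conjI)
  qed
qed

text \<open>
  Only compatible distributions contribute, and their summands agree one by one.
\<close>

theorem tildeF_product:
  assumes F: "\<And>M. F M \<in> Sh m (q, q1, q2, q3) (\<lambda>_. M)" and G: "\<And>M. G M \<in> Sh m (q, q1, q2, q3) (\<lambda>_. M)"
  shows "tildeF m (q, q1, q2, q3) l1 (L + K) L
      (\<Sum>M\<le>L + K. sh_mult m (q, q1, q2, q3) (\<lambda>_. M) (\<lambda>_. L + K - M) (F M) (G (L + K - M))) =
     (\<Sum>L'\<le>L. \<Sum>K'\<le>K. target_mult L' K' (L - L') (K - K')
        (tildeF m (q, q1, q2, q3) l1 (L' + K') L' (F (L' + K')))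
        (tildeF m (q, q1, q2, q3) l1 (L - L' + (K - K')) (L - L') (G (L - L' + (K - K')))))"
proof -
  define h where "h M S = subst (\<lambda>i a. sg L i (slt S i a)) (F M) *
    subst (\<lambda>i a. sg L i (slt (cpl (L + K) S) i a)) (G (L + K - M)) * OmX L S (cpl (L + K) S) / Den L K" for M S
  have "has_subst (sg L) (\<Sum>M\<le>L + K. sh_mult m (q, q1, q2, q3) (\<lambda>_. M) (\<lambda>_. L + K - M) (F M) (G (L + K - M)))
     (\<Sum>M\<le>L + K. \<Sum>S\<in>lab m (L + K) M. subst (\<lambda>i a. sg L i (slt S i a)) (F M) *
        subst (\<lambda>i a. sg L i (slt (cpl (L + K) S) i a)) (G (L + K - M)) * OmX L S (cpl (L + K) S))"
  proof (rule has_subst_sum)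
    fix M assume "M \<in> {..L + K}"
    hence "M + (L + K - M) = L + K"
      by simp
    with has_subst_sh_mult[OF F[of M] G[of "L + K - M"], of L]
    show "has_subst (sg L) (sh_mult m (q, q1, q2, q3) (\<lambda>_. M) (\<lambda>_. L + K - M) (F M) (G (L + K - M)))
       (\<Sum>S\<in>lab m (L + K) M. subst (\<lambda>i a. sg L i (slt S i a)) (F M) *
        subst (\<lambda>i a. sg L i (slt (cpl (L + K) S) i a)) (G (L + K - M)) * OmX L S (cpl (L + K) S))"
      by (simp only:)
  qed
  hence "tildeF m (q, q1, q2, q3) l1 (L + K) L
      (\<Sum>M\<le>L + K. sh_mult m (q, q1, q2, q3) (\<lambda>_. M) (\<lambda>_. L + K - M) (F M) (G (L + K - M))) =
     (\<Sum>M\<le>L + K. \<Sum>S\<in>lab m (L + K) M. h M S)"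
    unfolding tildeF_rho h_def sum_divide_distrib[symmetric] by (simp only: has_subst_imp_subst)
  also have "\<dots> = (\<Sum>L'\<le>L. \<Sum>K'\<le>K. \<Sum>I\<in>lab (m - 1) L L'. \<Sum>A\<in>lab 1 K K'. h (L' + K') (join L I A))"
  proof (rule sum_aligned)
    fix M S assume "M \<le> L + K" "S \<in> lab m (L + K) M" "\<not> aligned L S"
    thus "h M S = 0"
      using OmX_not_aligned[of S M "L + K - M" L] by (auto simp: h_def)
  qed
  also have "\<dots> = (\<Sum>L'\<le>L. \<Sum>K'\<le>K. target_mult L' K' (L - L') (K - K')
        (tildeF m (q, q1, q2, q3) l1 (L' + K') L' (F (L' + K')))
        (tildeF m (q, q1, q2, q3) l1 (L - L' + (K - K')) (L - L') (G (L - L' + (K - K')))))"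
  proof (intro sum.cong refl)
    fix L' K' assume "L' \<in> {..L}" "K' \<in> {..K}"
    then obtain L2 K2 where e: "L = L' + L2" "K = K' + K2"
      using le_Suc_ex by (metis atMost_iff)
    have d: "L - L' = L2" "K - K' = K2" "L + K - (L' + K') = L2 + K2"
      unfolding e by simp_all
    show "(\<Sum>I\<in>lab (m - 1) L L'. \<Sum>A\<in>lab 1 K K'. h (L' + K') (join L I A)) =
       target_mult L' K' (L - L') (K - K') (tildeF m (q, q1, q2, q3) l1 (L' + K') L' (F (L' + K')))
        (tildeF m (q, q1, q2, q3) l1 (L - L' + (K - K')) (L - L') (G (L - L' + (K - K'))))"
      unfolding d h_def target_mult_def unfolding e
      by (intro sum.cong refl specialised_term F G)
  qed
  finally show ?thesis .
qed

subsection \<open>The homomorphism\<close>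

lemma tildeF_additive:
  assumes "F \<in> Sh m (q, q1, q2, q3) (\<lambda>_. L + K)" "G \<in> Sh m (q, q1, q2, q3) (\<lambda>_. L + K)"
  shows "tildeF m (q, q1, q2, q3) l1 (L + K) L (F + G) =
     tildeF m (q, q1, q2, q3) l1 (L + K) L F + tildeF m (q, q1, q2, q3) l1 (L + K) L G"
    "tildeF m (q, q1, q2, q3) l1 (L + K) L (cst c * F) = cst c * tildeF m (q, q1, q2, q3) l1 (L + K) L F"
proof -
  have m1: "m \<ge> 1" using m by simp
  note s = Sh_has_subst[OF m1 assms(1) sep_sg[of _ L]] Sh_has_subst[OF m1 assms(2) sep_sg[of _ L]]
  have "subst (sg L) (F + G) = subst (sg L) F + subst (sg L) G" "subst (sg L) (cst c * F) = cst c * subst (sg L) F"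
    by (rule has_subst_imp_subst[OF has_subst_add[OF s]],
        rule has_subst_imp_subst[OF has_subst_mult[OF has_subst_cst s(1)]])
  thus "tildeF m (q, q1, q2, q3) l1 (L + K) L (F + G) =
     tildeF m (q, q1, q2, q3) l1 (L + K) L F + tildeF m (q, q1, q2, q3) l1 (L + K) L G"
    "tildeF m (q, q1, q2, q3) l1 (L + K) L (cst c * F) = cst c * tildeF m (q, q1, q2, q3) l1 (L + K) L F"
    unfolding tildeF_rho by (simp_all add: add_divide_distrib)
qed

lemma tildeF_0: "tildeF m (q, q1, q2, q3) l1 (L + K) L 0 = 0"
  unfolding tildeF_rho by simp

lemma tildeF_1: "tildeF m (q, q1, q2, q3) l1 0 0 1 = 1"
proof -
  have "Den 0 0 = 1"
    by (simp add: Den_def DenS_def ppr_def yy_pairs_def)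
  thus ?thesis
    using tildeF_rho[of 0 0 1] by simp
qed

text \<open>
  What remains are finiteness of supports, linearity, the unit and the grading, which are read off from the
  components.
\<close>

lemma pi_map_hom:
  "graded_algebra_hom (Sh0 m (q, q1, q2, q3)) (\<lambda>N. N) (Sh0_tensor_Sh1 (m - 1) pY pZ) (\<lambda>(L, K). L + K)
     (pi_map m (q, q1, q2, q3) l1)"
proof -
  let ?A = "Sh0 m (q, q1, q2, q3)" and ?B = "Sh0_tensor_Sh1 (m - 1) pY pZ" and ?\<pi> = "pi_map m (q, q1, q2, q3) l1"
  have pi: "?\<pi> F (L, K) = tildeF m (q, q1, q2, q3) l1 (L + K) L (F (L + K))" for F L K
    by (simp add: pi_map_def)
  have comp: "F N \<in> Sh m (q, q1, q2, q3) (\<lambda>_. N)" if "F \<in> carrier ?A" for F N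
    using that by (simp add: Sh0_def)
  have fin: "finite {N. F N \<noteq> 0}" if "F \<in> carrier ?A" for F
    using that by (simp add: Sh0_def)
  have tens: "?\<pi> F (L, K) \<in> tens_space (Sh (m - 1) pY (\<lambda>_. L)) (Sh 1 pZ (\<lambda>_. K))" if "F \<in> carrier ?A" for F L K
    unfolding pi by (rule tildeF_in_tens_space[OF comp[OF that]])
  have supp: "F (L + K) \<noteq> 0" if "?\<pi> F (L, K) \<noteq> 0" for F L K
  proof
    assume "F (L + K) = 0"
    thus False using that tildeF_0 by (simp add: pi)
  qed
  have closed: "?\<pi> F \<in> carrier ?B" if F: "F \<in> carrier ?A" for F
  proof -
    have "{k. ?\<pi> F k \<noteq> 0} \<subseteq> (\<lambda>(N, L). (L, N - L)) ` (SIGMA N:{N. F N \<noteq> 0}. {..N})"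
    proof
      fix k assume "k \<in> {k. ?\<pi> F k \<noteq> 0}"
      moreover obtain L K where k: "k = (L, K)" by (cases k)
      ultimately have "F (L + K) \<noteq> 0"
        using supp by simp
      thus "k \<in> (\<lambda>(N, L). (L, N - L)) ` (SIGMA N:{N. F N \<noteq> 0}. {..N})"
        unfolding k by (intro image_eqI[where x = "(L + K, L)"]) auto
    qed
    moreover have "finite ((\<lambda>(N, L). (L, N - L)) ` (SIGMA N:{N. F N \<noteq> 0}. {..N}))"
      using fin[OF F] by (intro finite_imageI finite_SigmaI) auto
    ultimately have "finite {k. ?\<pi> F k \<noteq> 0}"
      by (rule finite_subset)
    thus ?thesis
      using tens[OF F] by (simp add: Sh0_tensor_Sh1_def)
  qed
  have mult: "?\<pi> (F \<otimes>\<^bsub>?A\<^esub> G) = ?\<pi> F \<otimes>\<^bsub>?B\<^esub> ?\<pi> G" if F: "F \<in> carrier ?A" and G: "G \<in> carrier ?A" for F G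
  proof
    fix k :: "nat \<times> nat"
    obtain L K where k: "k = (L, K)" by (cases k)
    have "?\<pi> (F \<otimes>\<^bsub>?A\<^esub> G) (L, K) = tildeF m (q, q1, q2, q3) l1 (L + K) L
      (\<Sum>M\<le>L + K. sh_mult m (q, q1, q2, q3) (\<lambda>_. M) (\<lambda>_. L + K - M) (F M) (G (L + K - M)))"
      by (simp add: pi Sh0_def)
    also have "\<dots> = (\<Sum>L'\<le>L. \<Sum>K'\<le>K. target_mult L' K' (L - L') (K - K') (?\<pi> F (L', K')) (?\<pi> G (L - L', K - K')))"
      unfolding pi by (rule tildeF_product[where F = F and G = G, OF comp[OF F] comp[OF G]])
    also have "\<dots> = (\<Sum>L'\<le>L. \<Sum>K'\<le>K. tens_mult (m - 1) pY pZ L' K' (L - L') (K - K')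
        (?\<pi> F (L', K')) (?\<pi> G (L - L', K - K')))"
      by (intro sum.cong refl tens_mult_eq[symmetric] tens F G)
    also have "\<dots> = (?\<pi> F \<otimes>\<^bsub>?B\<^esub> ?\<pi> G) (L, K)"
      by (simp add: Sh0_tensor_Sh1_def)
    finally show "?\<pi> (F \<otimes>\<^bsub>?A\<^esub> G) k = (?\<pi> F \<otimes>\<^bsub>?B\<^esub> ?\<pi> G) k"
      unfolding k .
  qed
  have add: "?\<pi> (F \<oplus>\<^bsub>?A\<^esub> G) = ?\<pi> F \<oplus>\<^bsub>?B\<^esub> ?\<pi> G" if F: "F \<in> carrier ?A" and G: "G \<in> carrier ?A" for F G
  proof
    fix k :: "nat \<times> nat"
    obtain L K where k: "k = (L, K)" by (cases k)
    have "?\<pi> (\<lambda>N. F N + G N) (L, K) = ?\<pi> F (L, K) + ?\<pi> G (L, K)"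
      unfolding pi by (rule tildeF_additive(1)[OF comp[OF F] comp[OF G]])
    thus "?\<pi> (F \<oplus>\<^bsub>?A\<^esub> G) k = (?\<pi> F \<oplus>\<^bsub>?B\<^esub> ?\<pi> G) k"
      unfolding k by (simp add: Sh0_def Sh0_tensor_Sh1_def)
  qed
  have one: "?\<pi> \<one>\<^bsub>?A\<^esub> = \<one>\<^bsub>?B\<^esub>"
  proof
    fix k :: "nat \<times> nat"
    obtain L K where k: "k = (L, K)" by (cases k)
    show "?\<pi> \<one>\<^bsub>?A\<^esub> k = \<one>\<^bsub>?B\<^esub> k"
    proof (cases "L + K = 0")
      case True
      thus ?thesis
        unfolding k pi using tildeF_1 by (simp add: Sh0_def Sh0_tensor_Sh1_def)
    next
      case False
      thus ?thesis
        unfolding k pi using tildeF_0[of L K] by (auto simp: Sh0_def Sh0_tensor_Sh1_def)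
    qed
  qed
  have scale: "?\<pi> (\<lambda>g. cst c * F g) = (\<lambda>h. cst c * ?\<pi> F h)" if F: "F \<in> carrier ?A" for c F
  proof
    fix k :: "nat \<times> nat"
    obtain L K where k: "k = (L, K)" by (cases k)
    show "?\<pi> (\<lambda>g. cst c * F g) k = cst c * ?\<pi> F k"
      unfolding k pi by (rule tildeF_additive(2)[OF comp[OF F] comp[OF F]])
  qed
  show ?thesis
    unfolding graded_algebra_hom_def
  proof (intro conjI allI ballI impI)
    show "?\<pi> \<in> ring_hom ?A ?B"
      unfolding ring_hom_def using closed mult add one by simp
  next
    fix N F h assume "F \<in> carrier ?A" "\<forall>g. F g \<noteq> 0 \<longrightarrow> g = N" "?\<pi> F h \<noteq> 0"
    thus "(case h of (L, K) \<Rightarrow> L + K) = N"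
      using supp by (cases h) auto
  qed (rule scale)
qed

end

theorem proposition3p4:
  fixes q d q1 q2 q3 l1 q1t q3t :: complex and m :: nat
  assumes "q \<noteq> 0" and "d \<noteq> 0"
    and "q1 = inverse q * d" and "q2 = q^2" and "q3 = inverse q * inverse d"
    and generic: "\<And>n1 n2 n3 :: int.
      q1 powi n1 * q2 powi n2 * q3 powi n3 = 1 \<Longrightarrow> n1 = n2 \<and> n2 = n3"
    and "exp l1 = q1"
    and "m \<ge> 2"
    and "q1t = q1 * frac_pow l1 (1 / of_nat (m - 1))"
    and "q3t = q3 * frac_pow l1 (- (1 / of_nat (m - 1)))"
  shows "graded_algebra_hom
           (Sh0 m (q, q1, q2, q3)) (\<lambda>N. N)
           (Sh0_tensor_Sh1 (m - 1) (q, q1t, q2, q3t) (q, q1 * q3 powi (1 - int m), q2, q3 ^ m))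
             (\<lambda>(L, K). L + K)
           (pi_map m (q, q1, q2, q3) l1)"
proof -
  define t where "t = frac_pow l1 (1 / of_nat (m - 1))"
  define mn where "mn a b = t powi a * q3 powi b" for a b :: int
  interpret shuffle_setup q d q1 q2 q3 l1 t m mn
    using assms by unfold_locales (simp_all add: t_def mn_def)
  have "q1t = q1 * t" "q3t = mn (- 1) 1"
    using assms(9,10) by (simp_all add: t_def mn_def frac_pow_minus)
  moreover have "q1 * q3 powi (1 - int m) = mn (int m - 1) (1 - int m)"
    by (simp add: mn_q1) (simp add: mn_def)
  ultimately show ?thesis
    using pi_map_hom by simp
qed

end
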